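(* Let $d\ge 1$ and let $X_1,X_2,\dots$ be i.i.d. random vectors in $\mathbb{R}^d$ with density $f\in\mathcal{P}_{C,4}$ for some $C<\infty$. Suppose the kernel $K:\mathbb{R}^d\to\mathbb{R}$ has the form $K(t)=\Phi(\|t\|^2)$ for some real function $\Phi$ with uniformly bounded second order derivative and with support contained in $[0,T]$, $T<\infty$, and that $K$ is non-negative and integrates to $1$. Let $c>0$ be a constant, let $p:\mathbb{R}\to\mathbb{R}$ be a nondecreasing clipping function, that is, $p(s)\ge 1$ for all $s$ and $p(s)=s$ for all $s\ge t_0$ for some $1\le t_0<\infty$, with five bounded and uniformly continuous derivatives, and set $\alpha(s)=c\,p^{1/2}(s/c^2)$. Let $h_{2,n}=c_2n^{-1/(8+d)}$ for some constant $c_2>0$, and let $h_{1,n}$ be a bandwidth sequence such that $U(h_{1,n})=o(h_{2,n}^2)$ as $n\to\infty$, where $U(h_{1,n})=\sqrt{\frac{\log h_{1,n}^{-1}}{nh_{1,n}^d}}+h_{1,n}^2$. Let $$\hat f(t;h_{1,n},h_{2,n})=\frac{1}{nh_{2,n}^d}\sum_{i=1}^{n}K\left(\frac{t-X_i}{h_{2,n}}\alpha(\hat f(X_i;h_{1,n}))\right)\alpha^d(\hat f(X_i;h_{1,n})),\qquad \hat f(t;h_{1,n})=\frac{1}{nh_{1,n}^d}\sum_{i=1}^nK\left(\frac{t-X_i}{h_{1,n}}\right).$$ Then for every $r>0$ and every $t\in\mathcal{D}_r$, as $n\to\infty$, $$\sqrt{nh_{2,n}^d}\,\bigl[\hat f(t;h_{1,n},h_{2,n})-\mathbb{E}\hat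 f(t;h_{1,n},h_{2,n})\bigr]\xrightarrow{D}N(0,\sigma_t^2)$$ and $$\sqrt{nh_{2,n}^d}\,\bigl[\hat f(t;h_{1,n},h_{2,n})-f(t)\bigr]\xrightarrow{D}N\left(c_2^{(d+8)/2}\sum_{|v|=4}\frac{\tau_v D_v(1/f)(t)}{v!},\ \sigma_t^2\right),$$ where $$\sigma_t^2=\alpha^d(f(t))f(t)\mu_0+f^3(t)\frac{[(\alpha^d)'(f(t))]^2}{d^2\alpha^d(f(t))}\int_{\mathbb{R}^d}L^2(z)\,dz+f^2(t)(\alpha^d)'(f(t))\mu_0,$$ $\mu_0=\int_{\mathbb{R}^d}K^2(u)\,du$ and $L(x)=dK(x)+\sum_{i=1}^d x_i\,\partial_iK(x)$.
   Context: $\mathcal{P}_{C,k}$ is the set of probability densities on $\mathbb{R}^d$ which, together with all their partial derivatives of order $k$ or lower, are bounded by $C<\infty$ and are uniformly continuous. $\mathcal{D}_r=\{t\in\mathbb{R}^d: f(t)>r>t_0c^2,\ \|t\|<1/r\}$ (so $\mathcal{D}_r$ is empty unless $r>t_0c^2$). $\alpha^d(s)$ means $(\alpha(s))^d$, and $(\alpha^d)'$ is the derivative of the one-variable function $s\mapsto(\alpha(s))^d$. For a multi-index $v=(v_1,\dots,v_d)\in(\mathbb{N}\cup\{0\})^d$: $|v|=\sum_i v_i$, $v!=v_1!\cdots v_d!$, $u^v=u_1^{v_1}\cdots u_d^{v_d}$, $D_v$ is the partial derivative of order $v_i$ in the $i$-th coordinate for each $i$, and $\tau_v=\int_{\mathbb{R}^d}u^vK(u)\,du$.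 $\Phi$ is regarded as a function on $[0,\infty)$. Bandwidth sequences are positive, with $h_{1,n}\to0$ and $nh_{1,n}^d\to\infty$. $\xrightarrow{D}$ denotes convergence in distribution. *)

theory Defs
  imports "HOL-Probability.Probability" "HOL-Library.Landau_Symbols"
begin

subsection \<open>Partial derivatives and multi-indices\<close>

definition partial_deriv :: "'n::finite \<Rightarrow> (real ^ 'n \<Rightarrow> real) \<Rightarrow> real ^ 'n \<Rightarrow> real" where
  "partial_deriv i g x = deriv (\<lambda>s. g (x + s *\<^sub>R axis i 1)) 0"

definition partially_differentiable :: "'n::finite \<Rightarrow> (real ^ 'n \<Rightarrow> real) \<Rightarrow> bool" where
  "partially_differentiable i g \<longleftrightarrow>
     (\<forall>x. (\<lambda>s. g (x + s *\<^sub>R axis i 1)) differentiable (at (0::real)))"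

definition partial_derivs :: "'n::finite list \<Rightarrow> (real ^ 'n \<Rightarrow> real) \<Rightarrow> real ^ 'n \<Rightarrow> real" where
  "partial_derivs is g = foldr partial_deriv is g"

text \<open>Multi-indices are functions from the coordinates to \<open>nat\<close>. The order in which the
  partial derivatives of \<open>multi_deriv v g\<close> are taken is some unspecified one: it does not matter
  at a point around which \<open>g\<close> is \<open>\<bar>v\<bar>\<close> times continuously differentiable.\<close>

definition multi_deriv :: "('n::finite \<Rightarrow> nat) \<Rightarrow> (real ^ 'n \<Rightarrow> real) \<Rightarrow> real ^ 'n \<Rightarrow> real" where
  "multi_deriv v g = partial_derivs (SOME is. \<forall>i. count_list is i = v i) g"

definition multi_abs :: "('n::finite \<Rightarrow> nat) \<Rightarrow> nat" where
  "multi_abs v = (\<Sum>i\<in>UNIV. v i)"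

definition multi_fact :: "('n::finite \<Rightarrow> nat) \<Rightarrow> real" where
  "multi_fact v = (\<Prod>i\<in>UNIV. fact (v i))"

definition multi_power :: "real ^ 'n \<Rightarrow> ('n::finite \<Rightarrow> nat) \<Rightarrow> real" where
  "multi_power u v = (\<Prod>i\<in>UNIV. (u $ i) ^ v i)"


subsection \<open>Densities, kernels and clipping functions\<close>

definition smooth_densities :: "real \<Rightarrow> nat \<Rightarrow> (real ^ 'n::finite \<Rightarrow> real) set" where
  "smooth_densities C k = {f.
     (\<forall>x. 0 \<le> f x) \<and> has_bochner_integral lborel f 1 \<and>
     (\<forall>is i. length is < k \<longrightarrow> partially_differentiable i (partial_derivs is f)) \<and>
     (\<forall>is. length is \<le> k \<longrightarrow>
        (\<forall>x. \<bar>partial_derivs is f x\<bar> \<le> C) \<and>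
        uniformly_continuous_on UNIV (partial_derivs is f))}"

definition bounded_second_derivative_on :: "real set \<Rightarrow> (real \<Rightarrow> real) \<Rightarrow> bool" where
  "bounded_second_derivative_on S \<Phi> \<longleftrightarrow>
     (\<exists>\<Phi>1 \<Phi>2. (\<forall>s\<in>S. (\<Phi> has_real_derivative \<Phi>1 s) (at s within S)) \<and>
              (\<forall>s\<in>S. (\<Phi>1 has_real_derivative \<Phi>2 s) (at s within S)) \<and>
              bounded (\<Phi>2 ` S))"

text \<open>\<open>\<Phi>\<close> is a function on \<open>[0, \<infinity>)\<close>: its derivatives at \<open>0\<close> are one-sided, and its values at
  negative arguments are irrelevant.\<close>

definition radial_kernel :: "(real \<Rightarrow> real) \<Rightarrow> real \<Rightarrow> (real ^ 'n::finite \<Rightarrow> real) \<Rightarrow> bool" where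
  "radial_kernel \<Phi> T K \<longleftrightarrow>
     bounded_second_derivative_on {0..} \<Phi> \<and>
     closure {s. 0 \<le> s \<and> \<Phi> s \<noteq> 0} \<subseteq> {0..T} \<and>
     (\<forall>x. K x = \<Phi> ((norm x)\<^sup>2)) \<and>
     (\<forall>x. 0 \<le> K x) \<and> has_bochner_integral lborel K 1"

definition clipping_function :: "real \<Rightarrow> (real \<Rightarrow> real) \<Rightarrow> bool" where
  "clipping_function t0 p \<longleftrightarrow>
     1 \<le> t0 \<and> mono p \<and> (\<forall>s. 1 \<le> p s) \<and> (\<forall>s\<ge>t0. p s = s) \<and>
     (\<forall>k<5. \<forall>s. (deriv ^^ k) p differentiable (at s)) \<and>
     (\<forall>k\<in>{1..5}. bounded (range ((deriv ^^ k) p)) \<and>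
                  uniformly_continuous_on UNIV ((deriv ^^ k) p))"

definition clip_scale :: "real \<Rightarrow> (real \<Rightarrow> real) \<Rightarrow> real \<Rightarrow> real" where
  "clip_scale c p s = c * sqrt (p (s / c\<^sup>2))"

definition good_region :: "(real ^ 'n::finite \<Rightarrow> real) \<Rightarrow> real \<Rightarrow> real \<Rightarrow> real \<Rightarrow> (real ^ 'n) set" where
  "good_region f c t0 r = {t. f t > r \<and> r > t0 * c\<^sup>2 \<and> norm t < 1 / r}"


subsection \<open>The estimators, at a sample \<open>x 0, \<dots>, x (n - 1)\<close>\<close>

definition kde :: "(real ^ 'n::finite \<Rightarrow> real) \<Rightarrow> nat \<Rightarrow> real \<Rightarrow> (nat \<Rightarrow> real ^ 'n) \<Rightarrow> real ^ 'n \<Rightarrow> real" where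
  "kde K n h x t =
     1 / (real n * h ^ CARD('n)) * (\<Sum>i<n. K ((1 / h) *\<^sub>R (t - x i)))"

definition adaptive_kde :: "(real ^ 'n::finite \<Rightarrow> real) \<Rightarrow> (real \<Rightarrow> real) \<Rightarrow> nat \<Rightarrow> real \<Rightarrow> real
    \<Rightarrow> (nat \<Rightarrow> real ^ 'n) \<Rightarrow> real ^ 'n \<Rightarrow> real" where
  "adaptive_kde K \<alpha> n h1 h2 x t =
     1 / (real n * h2 ^ CARD('n)) *
       (\<Sum>i<n. K ((\<alpha> (kde K n h1 x (x i)) / h2) *\<^sub>R (t - x i)) * \<alpha> (kde K n h1 x (x i)) ^ CARD('n))"


subsection \<open>Rates and limit parameters\<close>

definition U_rate :: "nat \<Rightarrow> nat \<Rightarrow> real \<Rightarrow> real" where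
  "U_rate d n h = sqrt (ln (1 / h) / (real n * h ^ d)) + h\<^sup>2"

definition kernel_moment :: "(real ^ 'n::finite \<Rightarrow> real) \<Rightarrow> ('n \<Rightarrow> nat) \<Rightarrow> real" where
  "kernel_moment K v = (LINT u|lborel. multi_power u v * K u)"

definition kernel_L :: "(real ^ 'n::finite \<Rightarrow> real) \<Rightarrow> real ^ 'n \<Rightarrow> real" where
  "kernel_L K x = real CARD('n) * K x + (\<Sum>i\<in>UNIV. x $ i * partial_deriv i K x)"

definition kernel_mu0 :: "(real ^ 'n::finite \<Rightarrow> real) \<Rightarrow> real" where
  "kernel_mu0 K = (LINT u|lborel. (K u)\<^sup>2)"

definition asymptotic_variance ::
  "(real ^ 'n::finite \<Rightarrow> real) \<Rightarrow> (real \<Rightarrow> real) \<Rightarrow> (real ^ 'n \<Rightarrow> real) \<Rightarrow> real ^ 'n \<Rightarrow> real" where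
  "asymptotic_variance K \<alpha> f t =
     (let d = CARD('n); \<alpha>d = (\<lambda>s. \<alpha> s ^ d); y = f t in
        \<alpha>d y * y * kernel_mu0 K
        + y ^ 3 * (deriv \<alpha>d y)\<^sup>2 / ((real d)\<^sup>2 * \<alpha>d y) * (LINT z|lborel. (kernel_L K z)\<^sup>2)
        + y\<^sup>2 * deriv \<alpha>d y * kernel_mu0 K)"

definition asymptotic_bias ::
  "(real ^ 'n::finite \<Rightarrow> real) \<Rightarrow> real \<Rightarrow> (real ^ 'n \<Rightarrow> real) \<Rightarrow> real ^ 'n \<Rightarrow> real" where
  "asymptotic_bias K c2 f t =
     c2 powr ((real CARD('n) + 8) / 2) *
       (\<Sum>v | multi_abs v = 4.
          kernel_moment K v * multi_deriv v (\<lambda>x. 1 / f x) t / multi_fact v)"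

text \<open>\<open>normal_density\<close> is parametrised by the standard deviation; \<open>s2\<close> is the variance, and it
  has to be positive for this to be a probability measure.\<close>

definition normal_law :: "real \<Rightarrow> real \<Rightarrow> real measure" where
  "normal_law m s2 = density lborel (\<lambda>x. ennreal (normal_density m (sqrt s2) x))"

end

theory Submission
  imports Defs "HOL-Combinatorics.Multiset_Permutations" "HOL-Real_Asymp.Real_Asymp"
begin

text \<open>Write \<open>G h x s\<close> for the summand \<open>K ((\<alpha> s / h) *\<^sub>R (t - x)) * \<alpha> s ^ d / h ^ d\<close> of the estimator, where
  \<open>s\<close> is the pilot estimate at the sample point \<open>x\<close>, and expand it to first order in \<open>s\<close> around
  \<open>f x\<close>. As \<open>t\<close> is fixed, no uniform bound on the pilot is needed: conditionally on \<open>x\<close>, the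
  remainder has mean of order \<open>1 / (n h1^d) + h1^4\<close>, which is \<open>o(h2^4)\<close> by the rate condition. The
  first-order term is, apart from its diagonal, a U-statistic. Its degenerate part is negligible, and
  its Hoeffding projection has the same order as \<open>G h x (f x)\<close>, which produces the terms of the
  variance that involve \<open>L\<close> and the derivative of \<open>\<alpha> ^ d\<close>. What remains is the central limit theorem
  for a triangular array of bounded independent variables.

  Near \<open>t\<close> one has \<open>\<alpha> (f x) = sqrt (f x)\<close>. Substituting \<open>w = sqrt (f (t + h *\<^sub>R u)) *\<^sub>R u\<close> in the mean of
  \<open>G h x (f x)\<close> gives \<open>\<integral> K w * q w h dw\<close>; in the expansion of \<open>q w\<close> in powers of \<open>h\<close> the coefficients
  of \<open>h\<close> and \<open>h^3\<close> are odd in \<open>w\<close>, that of \<open>h^2\<close> vanishes, and that of \<open>h^4\<close> is the fourth-order Taylor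
  term of \<open>1 / f\<close>. Since \<open>\<integral> L = 0\<close>, the bias of the pilot changes the mean by \<open>O(h1^2 h2^2)\<close> only.\<close>

text \<open>A Lagrange inversion singles out the square root in \<open>clip_scale\<close>. With
  \<open>\<gamma> = 1 / f\<close>, the substituted integrand along a ray is
  \<open>\<gamma>^(-3/2) dx/dz\<close> for \<open>z = x / sqrt (\<gamma> x)\<close>. Its coefficient
  of order m in z is therefore the m-th Taylor coefficient of \<open>\<gamma>^((m-2)/2)\<close>: for
  m = 2 that of a constant, for m = 4 that of \<open>\<gamma>\<close> itself. The proof confirms
  these coefficients by explicit expansion. The first claim centres at the exact expectation, so the
  remainder has to vanish in mean and not merely in probability; every error is therefore bounded in
  mean over the product measure. That a sample point lies near \<open>t\<close> has probability of
  order \<open>h2^d\<close>, which pays for the \<open>1 / h2^d\<close> of the kernel. The norming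
  factor \<open>sqrt (n h2^d)\<close> is a constant times \<open>h2^(-4)\<close>, so exactly the
  errors of order \<open>o(h2^4)\<close> disappear. This is also why the linear term needs a
  cancellation in its mean: the plain bound by \<open>h1^2\<close> is only
  \<open>o(h2^2)\<close>.\<close>

section \<open>Integration over finite product spaces and second moments of U-statistics\<close>

lemma PiM_integral_remove:
  fixes F :: "('i \<Rightarrow> 'a) \<Rightarrow> real"
  assumes "prob_space Q" "finite J" "i \<in> J" "integrable (PiM J (\<lambda>_. Q)) F"
  shows "(LINT x|PiM J (\<lambda>_. Q). F x) = (LINT x|PiM (J - {i}) (\<lambda>_. Q). (LINT y|Q. F (x(i := y))))"
proof -
  interpret Q: prob_space Q by fact
  interpret product_sigma_finite "\<lambda>_::'i. Q" ..
  have "insert i (J - {i}) = J" using assms by auto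
  then show ?thesis
    using product_integral_insert[of "J - {i}" i F] assms by simp
qed

text \<open>The removed coordinate is integrated last, so that the inner integral is a conditional
  mean given one sample point. The form for non-negative integrands makes the exchange available as
  a computation of the mean itself.\<close>

lemma PiM_integral_remove_rev:
  fixes F :: "('i \<Rightarrow> 'a) \<Rightarrow> real"
  assumes "prob_space Q" "finite J" "i \<in> J" "F \<in> borel_measurable (PiM J (\<lambda>_. Q))" "\<And>x. 0 \<le> F x"
  shows "(\<integral>\<^sup>+x. ennreal (F x) \<partial>PiM J (\<lambda>_. Q)) = (\<integral>\<^sup>+y. (\<integral>\<^sup>+x. ennreal (F (x(i := y))) \<partial>PiM (J - {i}) (\<lambda>_. Q)) \<partial>Q)"
proof -
  interpret Q: prob_space Q by fact
  interpret product_sigma_finite "\<lambda>_::'i. Q" ..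
  have "insert i (J - {i}) = J" using assms by auto
  then show ?thesis
    using product_nn_integral_insert_rev[of "J - {i}" i "\<lambda>x. ennreal (F x)"] assms by simp
qed

lemma integrable_bounded:
  fixes F :: "'a \<Rightarrow> real"
  assumes "prob_space Q" "F \<in> borel_measurable Q" "\<And>x. x \<in> space Q \<Longrightarrow> \<bar>F x\<bar> \<le> B"
  shows "integrable Q F"
proof -
  interpret Q: prob_space Q by fact
  show ?thesis using assms by (intro Q.integrable_const_bound[of _ B]) auto
qed

lemma square_integral_le:
  fixes F :: "'a \<Rightarrow> real"
  assumes "prob_space Q" "F \<in> borel_measurable Q" "\<And>x. x \<in> space Q \<Longrightarrow> \<bar>F x\<bar> \<le> B"
  shows "(LINT x|Q. F x)\<^sup>2 \<le> (LINT x|Q. (F x)\<^sup>2)"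
proof -
  interpret Q: prob_space Q by fact
  have "\<bar>(F x)\<^sup>2\<bar> \<le> B\<^sup>2" if "x \<in> space Q" for x
    using power_mono[OF assms(3)[OF that], of 2] by simp
  then have "integrable Q F" "integrable Q (\<lambda>x. (F x)\<^sup>2)"
    using assms by (auto intro!: integrable_bounded[OF assms(1)])
  then show ?thesis
    using Q.variance_eq[of F] Q.variance_positive[of F] by simp
qed

lemma PiM_integral_component:
  fixes \<psi> :: "'a \<Rightarrow> real"
  assumes "prob_space Q" "finite J" "i \<in> J" "\<psi> \<in> borel_measurable Q"
    "\<And>x. x \<in> space Q \<Longrightarrow> \<bar>\<psi> x\<bar> \<le> B"
  shows "(LINT x|PiM J (\<lambda>_. Q). \<psi> (x i)) = (LINT y|Q. \<psi> y)"
proof -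
  interpret P: prob_space "PiM J (\<lambda>_. Q)" using assms(1) by (rule prob_space_PiM)
  interpret P': prob_space "PiM (J - {i}) (\<lambda>_. Q)" using assms(1) by (rule prob_space_PiM)
  have *: "(\<lambda>x. x i) \<in> measurable (PiM J (\<lambda>_. Q)) Q"
    using assms(3) by measurable
  have "integrable (PiM J (\<lambda>_. Q)) (\<lambda>x. \<psi> (x i))"
    using assms(3-5) measurable_space[OF *]
    by (intro integrable_bounded[of _ _ B]) (auto intro: P.prob_space_axioms measurable_compose[OF *])
  then show ?thesis
    by (subst PiM_integral_remove[OF assms(1-3)]) (auto simp: P'.prob_space)
qed

text \<open>After expanding the square, a mixed term dies as soon as one of its two coordinates is
  integrated out, because this already produces the mean of \<open>\<psi>\<close>.\<close>

lemma PiM_sum_second_moment: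
  fixes \<psi> :: "'a \<Rightarrow> real"
  assumes Q: "prob_space Q" and J: "finite J" and m[measurable]: "\<psi> \<in> borel_measurable Q"
    and B: "\<And>x. x \<in> space Q \<Longrightarrow> \<bar>\<psi> x\<bar> \<le> B" and z: "(LINT y|Q. \<psi> y) = 0"
  shows "(LINT x|PiM J (\<lambda>_. Q). (\<Sum>j\<in>J. \<psi> (x j))\<^sup>2) = real (card J) * (LINT y|Q. (\<psi> y)\<^sup>2)"
proof -
  let ?P = "PiM J (\<lambda>_. Q)"
  interpret Q: prob_space Q by fact
  interpret P: prob_space ?P using Q by (rule prob_space_PiM)
  have sp: "x j \<in> space Q" if "x \<in> space ?P" "j \<in> J" for x j
    using that by (auto simp: space_PiM)
  have mj[measurable]: "(\<lambda>x. \<psi> (x j)) \<in> borel_measurable ?P" if "j \<in> J" for j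
    using that by measurable
  have B0: "0 \<le> B" using Q.not_empty B by force
  have b2: "\<bar>\<psi> a * \<psi> b\<bar> \<le> B * B" if "a \<in> space Q" "b \<in> space Q" for a b
    using B that B0 by (simp add: abs_mult mult_mono)
  have int: "integrable ?P (\<lambda>x. \<psi> (x j) * \<psi> (x k))" if "j \<in> J" "k \<in> J" for j k
    using that by (intro integrable_bounded[OF P.prob_space_axioms, of _ "B*B"]) (auto intro!: b2 sp)
  have *: "(LINT x|?P. \<psi> (x j) * \<psi> (x k)) = (if j = k then (LINT y|Q. (\<psi> y)\<^sup>2) else 0)"
    if "j \<in> J" "k \<in> J" for j k
  proof (cases "j = k")
    case True
    have "(LINT x|?P. (\<lambda>y. (\<psi> y)\<^sup>2) (x j)) = (LINT y|Q. (\<psi> y)\<^sup>2)"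
      by (rule PiM_integral_component[OF Q J that(1), where B="B*B"]) (measurable, metis b2 power2_eq_square)
    then show ?thesis using True by (simp add: power2_eq_square)
  next
    case False
    then show ?thesis
      using that by (simp add: PiM_integral_remove[OF Q J that(1) int] z)
  qed
  have "(LINT x|?P. (\<Sum>j\<in>J. \<psi> (x j))\<^sup>2) = (LINT x|?P. (\<Sum>j\<in>J. \<Sum>k\<in>J. \<psi> (x j) * \<psi> (x k)))"
    by (simp add: power2_eq_square sum_product)
  also have "\<dots> = (\<Sum>j\<in>J. \<Sum>k\<in>J. LINT x|?P. \<psi> (x j) * \<psi> (x k))"
    using int by (subst Bochner_Integration.integral_sum; (intro sum.cong refl Bochner_Integration.integral_sum)?) auto
  also have "\<dots> = (\<Sum>j\<in>J. \<Sum>k\<in>J. if j = k then (LINT y|Q. (\<psi> y)\<^sup>2) else 0)"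
    using * by (intro sum.cong) auto
  also have "\<dots> = real (card J) * (LINT y|Q. (\<psi> y)\<^sup>2)"
    using J by simp
  finally show ?thesis .
qed

text \<open>Two ordered pairs of indices can correlate only if they are equal or reversed: otherwise
  some index occurs in just one place, and degeneracy integrates that variable to zero. Each pair
  thus has at most two partners, hence the factor 2.\<close>

lemma degenerate_U_second_moment:
  fixes h :: "'a \<Rightarrow> 'a \<Rightarrow> real"
  assumes Q: "prob_space Q" and J: "finite J"
    and m[measurable]: "case_prod h \<in> borel_measurable (Q \<Otimes>\<^sub>M Q)"
    and B: "\<And>x y. x \<in> space Q \<Longrightarrow> y \<in> space Q \<Longrightarrow> \<bar>h x y\<bar> \<le> B"
    and z1: "\<And>x. x \<in> space Q \<Longrightarrow> (LINT y|Q. h x y) = 0"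
    and z2: "\<And>y. y \<in> space Q \<Longrightarrow> (LINT x|Q. h x y) = 0"
  shows "(LINT x|PiM J (\<lambda>_. Q). (\<Sum>i\<in>J. \<Sum>j\<in>J - {i}. h (x i) (x j))\<^sup>2)
     \<le> 2 * (real (card J))\<^sup>2 * (LINT x|Q. LINT y|Q. (h x y)\<^sup>2)"
proof -
  let ?P = "PiM J (\<lambda>_. Q)"
  interpret Q: prob_space Q by fact
  interpret P: prob_space ?P using Q by (rule prob_space_PiM)
  interpret QQ: pair_prob_space Q Q ..
  define V where "V = (LINT x|Q. LINT y|Q. (h x y)\<^sup>2)"
  define E where "E = (SIGMA i:J. J - {i})"
  have finE: "finite E" using J by (auto simp: E_def)
  have sp: "x j \<in> space Q" if "x \<in> space ?P" "j \<in> J" for x j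
    using that by (auto simp: space_PiM)
  have mh[measurable]: "(\<lambda>x. h (x i) (x j)) \<in> borel_measurable ?P" if "i \<in> J" "j \<in> J" for i j
    using measurable_compose[OF measurable_Pair[of "\<lambda>x. x i" ?P Q "\<lambda>x. x j" Q] m] that by simp
  have B0: "0 \<le> B" using Q.not_empty B by force
  have b2: "\<bar>h a b * h a' b'\<bar> \<le> B * B" if "a \<in> space Q" "b \<in> space Q" "a' \<in> space Q" "b' \<in> space Q" for a b a' b'
    using B that B0 by (simp add: abs_mult mult_mono)
  have int: "integrable ?P (\<lambda>x. h (x i) (x j) * h (x k) (x l))" if "i \<in> J" "j \<in> J" "k \<in> J" "l \<in> J" for i j k l
    using that by (intro integrable_bounded[OF P.prob_space_axioms, of _ "B*B"]) (auto intro!: b2 sp)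
  have V0: "0 \<le> V" unfolding V_def by (intro Bochner_Integration.integral_nonneg) auto
  have intsq: "integrable (Q \<Otimes>\<^sub>M Q) (\<lambda>(x,y). (h x y)\<^sup>2)"
    by (intro integrable_bounded[OF QQ.prob_space_axioms, of _ "B*B"])
      (auto simp: space_pair_measure power2_eq_square intro: b2)
  have sq: "(LINT x|?P. (h (x i) (x j))\<^sup>2) = V" if "i \<in> J" "j \<in> J" "i \<noteq> j" for i j
  proof -
    have "(LINT x|?P. (h (x i) (x j))\<^sup>2) = (LINT x|PiM (J - {i}) (\<lambda>_. Q). (LINT y|Q. (h y (x j))\<^sup>2))"
      using int[of i j i j] that by (subst PiM_integral_remove[OF Q J that(1)]) (auto simp: power2_eq_square)
    also have "\<dots> = (LINT z|Q. LINT y|Q. (h y z)\<^sup>2)"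
    proof (rule PiM_integral_component[OF Q, of _ _ "\<lambda>z. LINT y|Q. (h y z)\<^sup>2" "B*B"])
      fix z assume "z \<in> space Q"
      then have b: "\<bar>(h y z)\<^sup>2\<bar> \<le> B * B" if "y \<in> space Q" for y
        using b2[of y z y z] that by (simp add: power2_eq_square)
      have "\<bar>LINT y|Q. (h y z)\<^sup>2\<bar> \<le> (LINT y|Q. \<bar>(h y z)\<^sup>2\<bar>)" by (rule integral_abs_bound)
      also have "\<dots> \<le> (LINT y|Q. B * B)"
        using b \<open>z \<in> space Q\<close> by (intro integral_mono integrable_abs integrable_bounded[OF Q, of _ "B*B"]) auto
      finally have "\<bar>LINT y|Q. (h y z)\<^sup>2\<bar> \<le> (LINT y|Q. B * B)" .
      then show "\<bar>LINT y|Q. (h y z)\<^sup>2\<bar> \<le> B * B" by (simp add: Q.prob_space)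
    qed (use J that in simp_all)
    also have "\<dots> = V"
      unfolding V_def using QQ.Fubini_integral[of "\<lambda>x y. (h x y)\<^sup>2"] intsq by simp
    finally show ?thesis .
  qed
  have zero: "(LINT x|?P. h (x i) (x j) * h (x k) (x l)) = 0"
    if J4: "i \<in> J" "j \<in> J" "k \<in> J" "l \<in> J" "i \<noteq> j" "k \<noteq> l" and ne: "\<not> (i \<in> {k,l} \<and> j \<in> {k,l})" for i j k l
  proof -
    consider "i \<notin> {k,l}" | "j \<notin> {k,l}" using ne by blast
    then show ?thesis
    proof cases
      case 1
      have "(LINT y|Q. h ((x(i := y)) i) ((x(i := y)) j) * h ((x(i := y)) k) ((x(i := y)) l)) = 0"
        if x: "x \<in> space (PiM (J - {i}) (\<lambda>_. Q))" for x
      proof -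
        have "x j \<in> space Q" using x J4 by (auto simp: space_PiM PiE_iff)
        moreover have "(x(i := y)) k = x k" "(x(i := y)) l = x l" "(x(i := y)) j = x j" for y
          using 1 J4 by auto
        ultimately show ?thesis by (simp add: z2)
      qed
      then show ?thesis
        unfolding PiM_integral_remove[OF Q J J4(1) int[OF J4(1-4)]]
        by (simp cong: Bochner_Integration.integral_cong)
    next
      case 2
      have "(LINT y|Q. h ((x(j := y)) i) ((x(j := y)) j) * h ((x(j := y)) k) ((x(j := y)) l)) = 0"
        if x: "x \<in> space (PiM (J - {j}) (\<lambda>_. Q))" for x
      proof -
        have "x i \<in> space Q" using x J4 by (auto simp: space_PiM PiE_iff)
        moreover have "(x(j := y)) k = x k" "(x(j := y)) l = x l" "(x(j := y)) i = x i" for y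
          using 2 J4 by auto
        ultimately show ?thesis by (simp add: z1)
      qed
      then show ?thesis
        unfolding PiM_integral_remove[OF Q J J4(2) int[OF J4(1-4)]]
        by (simp cong: Bochner_Integration.integral_cong)
    qed
  qed
  \<comment> \<open>\<open>h\<close> need not be symmetric, so the product of a pair with its
    reversal is not a square; the inequality between the arithmetic and the geometric mean bounds
    it.\<close>
  have le: "(LINT x|?P. h (x i) (x j) * h (x j) (x i)) \<le> V" if "i \<in> J" "j \<in> J" "i \<noteq> j" for i j
  proof -
    have "(LINT x|?P. h (x i) (x j) * h (x j) (x i)) \<le> (LINT x|?P. ((h (x i) (x j))\<^sup>2 + (h (x j) (x i))\<^sup>2) / 2)"
    proof (intro integral_mono int that)
      show "integrable ?P (\<lambda>x. ((h (x i) (x j))\<^sup>2 + (h (x j) (x i))\<^sup>2) / 2)"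
        using int[of i j i j] int[of j i j i] that by (auto simp: power2_eq_square)
      show "h (x i) (x j) * h (x j) (x i) \<le> ((h (x i) (x j))\<^sup>2 + (h (x j) (x i))\<^sup>2) / 2" for x
        using sum_squares_bound[of "h (x i) (x j)" "h (x j) (x i)"] by simp
    qed
    also have "\<dots> = (V + V) / 2"
      using int[of i j i j] int[of j i j i] that sq
      by (subst integral_divide_zero, subst Bochner_Integration.integral_add) (auto simp: power2_eq_square)
    finally show ?thesis by simp
  qed
  have "(LINT x|?P. (\<Sum>i\<in>J. \<Sum>j\<in>J - {i}. h (x i) (x j))\<^sup>2)
     = (LINT x|?P. (\<Sum>e\<in>E. h (x (fst e)) (x (snd e)))\<^sup>2)"
    unfolding E_def using J by (simp add: sum.Sigma split_def)
  also have "\<dots> = (LINT x|?P. (\<Sum>e\<in>E. \<Sum>e'\<in>E. h (x (fst e)) (x (snd e)) * h (x (fst e')) (x (snd e'))))"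
    by (simp add: power2_eq_square sum_product)
  also have "\<dots> = (\<Sum>e\<in>E. \<Sum>e'\<in>E. LINT x|?P. h (x (fst e)) (x (snd e)) * h (x (fst e')) (x (snd e')))"
    using int by (subst Bochner_Integration.integral_sum; (intro sum.cong refl Bochner_Integration.integral_sum)?) (auto simp: E_def)
  also have "\<dots> \<le> (\<Sum>e\<in>E. \<Sum>e'\<in>E. if e' \<in> {e, (snd e, fst e)} then V else 0)"
  proof (intro sum_mono)
    fix e e' assume "e \<in> E" "e' \<in> E"
    obtain i j k l where e: "e = (i, j)" "e' = (k, l)" by (cases e, cases e') blast
    have m: "i \<in> J" "j \<in> J" "i \<noteq> j" "k \<in> J" "l \<in> J" "k \<noteq> l"
      using \<open>e \<in> E\<close> \<open>e' \<in> E\<close> unfolding e E_def by auto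
    have "(k = i \<and> l = j) \<or> (k = j \<and> l = i) \<or> \<not> (i \<in> {k,l} \<and> j \<in> {k,l})"
      using m(3) by auto
    then consider "k = i" "l = j" | "k = j" "l = i" | "\<not> (i \<in> {k,l} \<and> j \<in> {k,l})" by metis
    then show "(LINT x|?P. h (x (fst e)) (x (snd e)) * h (x (fst e')) (x (snd e')))
      \<le> (if e' \<in> {e, (snd e, fst e)} then V else 0)"
    proof cases
      case 1
      then show ?thesis using sq[OF m(1-3)] by (simp add: e power2_eq_square)
    next
      case 2
      then show ?thesis using le[OF m(1-3)] by (simp add: e)
    next
      case 3
      then show ?thesis using zero[OF m(1,2,4,5,3,6) 3] V0 by (simp add: e)
    qed
  qed
  also have "\<dots> = (\<Sum>e\<in>E. real (card (E \<inter> {e, (snd e, fst e)})) * V)"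
    by (simp only: sum.If_cases[OF finE] Collect_mem_eq) (simp)
  also have "\<dots> \<le> (\<Sum>e\<in>E. 2 * V)"
  proof (intro sum_mono mult_right_mono V0)
    fix e :: "'b \<times> 'b"
    have "card (E \<inter> {e, (snd e, fst e)}) \<le> card {e, (snd e, fst e)}" by (intro card_mono) auto
    also have "\<dots> \<le> 2" by (simp add: card_insert_if)
    finally show "real (card (E \<inter> {e, (snd e, fst e)})) \<le> 2" by simp
  qed
  also have "\<dots> = 2 * real (card E) * V" by simp
  also have "\<dots> \<le> 2 * (real (card J))\<^sup>2 * V"
  proof -
    have "card E \<le> card (J \<times> J)" using J by (intro card_mono) (auto simp: E_def)
    then have "real (card E) \<le> real (card J * card J)"
      unfolding card_cartesian_product by (rule of_nat_mono)
    then have "real (card E) \<le> (real (card J))\<^sup>2"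
      by (simp add: power2_eq_square)
    then show ?thesis using V0 by (intro mult_right_mono) auto
  qed
  finally show ?thesis unfolding V_def .
qed

section \<open>Characteristic functions and the limit theorem for bounded triangular arrays\<close>

lemma iexp_add: "iexp (a + b) = iexp a * iexp b"
  by (simp add: distrib_left exp_add)

text \<open>Boundedness turns the third-moment term of the Taylor bound into \<open>B\<close> times
  a second moment. The condition that \<open>B\<close> tends to zero later stands in for Lindeberg's
  condition.\<close>

lemma char_array_summand:
  fixes \<psi> :: "'a \<Rightarrow> real"
  assumes Q: "prob_space Q" and m[measurable]: "\<psi> \<in> borel_measurable Q"
    and B: "\<And>x. x \<in> space Q \<Longrightarrow> \<bar>\<psi> x\<bar> \<le> B" and z: "(LINT y|Q. \<psi> y) = 0"
  shows "cmod ((CLINT x|Q. iexp (s * \<psi> x)) - (1 - s\<^sup>2 * (LINT y|Q. (\<psi> y)\<^sup>2) / 2))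
     \<le> \<bar>s\<bar> ^ 3 * B * (LINT y|Q. (\<psi> y)\<^sup>2) / 6"
proof -
  interpret Q: prob_space Q by fact
  have b2: "(\<psi> x)\<^sup>2 \<le> B\<^sup>2" if "x \<in> space Q" for x
    using power_mono[OF B[OF that], of 2] by simp
  have i1: "integrable Q \<psi>" by (rule integrable_bounded[OF Q m B])
  have i2: "integrable Q (\<lambda>x. (\<psi> x)\<^sup>2)" by (rule integrable_bounded[OF Q, of _ "B\<^sup>2"]) (auto intro: b2)
  have "cmod (char (distr Q borel \<psi>) s - (1 - s\<^sup>2 * (LINT y|Q. (\<psi> y)\<^sup>2) / 2))
     \<le> s\<^sup>2 / 6 * (LINT x|Q. min (6 * (\<psi> x)\<^sup>2) (\<bar>s\<bar> * \<bar>\<psi> x\<bar> ^ 3))"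
    by (rule Q.char_approx3'[OF m i1 i2 z _ refl]) (simp add: z)
  also have "\<dots> \<le> s\<^sup>2 / 6 * (LINT x|Q. \<bar>s\<bar> * B * (\<psi> x)\<^sup>2)"
  proof (intro mult_left_mono integral_mono)
    have "\<bar>s\<bar> * \<bar>\<psi> x\<bar> ^ 3 \<le> \<bar>s\<bar> * B * (\<psi> x)\<^sup>2" if "x \<in> space Q" for x
    proof -
      have "\<bar>\<psi> x\<bar> ^ 3 = \<bar>\<psi> x\<bar> * (\<psi> x)\<^sup>2" by (simp add: power3_eq_cube power2_eq_square)
      also have "\<dots> \<le> B * (\<psi> x)\<^sup>2" using B[OF that] by (intro mult_right_mono) auto
      finally show ?thesis by (simp add: mult_left_mono mult.assoc)
    qed
    then show "min (6 * (\<psi> x)\<^sup>2) (\<bar>s\<bar> * \<bar>\<psi> x\<bar> ^ 3) \<le> \<bar>s\<bar> * B * (\<psi> x)\<^sup>2" if "x \<in> space Q" for x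
      using that by (simp add: min.coboundedI2)
    show "integrable Q (\<lambda>x. min (6 * (\<psi> x)\<^sup>2) (\<bar>s\<bar> * \<bar>\<psi> x\<bar> ^ 3))"
      using b2 by (intro integrable_bounded[OF Q, of _ "6 * B\<^sup>2"]) (auto simp: min_le_iff_disj)
  qed (use i2 in auto)
  also have "\<dots> = \<bar>s\<bar> ^ 3 * B * (LINT y|Q. (\<psi> y)\<^sup>2) / 6"
    by (simp add: power3_eq_cube power2_eq_square)
  finally show ?thesis by (simp add: char_def integral_distr)
qed

text \<open>The characteristic function of the row sum is an \<open>n\<close>-th power, which is
  compared with the \<open>n\<close>-th power of \<open>1 - s^2 v / (2n)\<close>. For numbers in the
  unit disc, \<open>n\<close>-th powers differ by at most \<open>n\<close> times the difference of
  the bases.\<close>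

lemma triangular_array_char:
  fixes \<psi> :: "nat \<Rightarrow> 'a \<Rightarrow> real"
  assumes Q: "prob_space Q" and m: "\<And>n. \<psi> n \<in> borel_measurable Q"
    and B: "\<And>n x. x \<in> space Q \<Longrightarrow> \<bar>\<psi> n x\<bar> \<le> B n" and z: "\<And>n. (LINT y|Q. \<psi> n y) = 0"
    and v: "(\<lambda>n. real n * (LINT y|Q. (\<psi> n y)\<^sup>2)) \<longlonglongrightarrow> v" and B0: "B \<longlonglongrightarrow> 0"
  shows "(\<lambda>n. CLINT x|PiM {..<n} (\<lambda>_. Q). iexp (s * (\<Sum>i<n. \<psi> n (x i)))) \<longlonglongrightarrow> exp (- (s\<^sup>2 * v / 2))"
proof -
  interpret Q: prob_space Q by fact
  interpret product_sigma_finite "\<lambda>_::nat. Q" ..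
  note m[measurable]
  define a where "a n = (LINT y|Q. (\<psi> n y)\<^sup>2)" for n
  define \<phi> where "\<phi> n = (CLINT x|Q. iexp (s * \<psi> n x))" for n
  have a0: "0 \<le> a n" for n unfolding a_def by (intro Bochner_Integration.integral_nonneg) auto
  have \<phi>1: "cmod (\<phi> n) \<le> 1" for n
  proof -
    have "cmod (\<phi> n) \<le> (LINT x|Q. cmod (iexp (s * \<psi> n x)))"
      unfolding \<phi>_def by (intro integral_norm_bound)
    also have "\<dots> = 1" by (simp add: Q.prob_space del: of_real_mult)
    finally show ?thesis .
  qed
  have eq: "(CLINT x|PiM {..<n} (\<lambda>_. Q). iexp (s * (\<Sum>i<n. \<psi> n (x i)))) = \<phi> n ^ n" for n
  proof -
    have "(CLINT x|PiM {..<n} (\<lambda>_. Q). iexp (s * (\<Sum>i<n. \<psi> n (x i))))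
       = (CLINT x|PiM {..<n} (\<lambda>_. Q). (\<Prod>i<n. iexp (s * \<psi> n (x i))))"
      by (simp add: exp_sum[symmetric] sum_distrib_left)
    also have "\<dots> = (\<Prod>i<n. \<phi> n)"
      unfolding \<phi>_def by (intro product_integral_prod[where f="\<lambda>_ x. iexp (s * \<psi> n x)"] Q.integrable_iexp) auto
    finally show ?thesis by simp
  qed
  let ?w = "\<lambda>n. complex_of_real (1 + (- (s\<^sup>2 * v / 2)) / real n)"
  \<comment> \<open>The comparison base is in the unit disc only once \<open>n\<close> is large, so
    the estimate holds eventually rather than always.\<close>
  have w1: "\<forall>\<^sub>F n in sequentially. cmod (?w n) \<le> 1"
  proof -
    have "0 \<le> v"
      using v a0 unfolding a_def by (intro LIMSEQ_le_const[OF v]) auto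
    moreover have "(\<lambda>n. s\<^sup>2 * v / 2 / real n) \<longlonglongrightarrow> 0" by (rule lim_const_over_n)
    then have "\<forall>\<^sub>F n in sequentially. s\<^sup>2 * v / 2 / real n < 1" by (rule order_tendstoD) auto
    then show ?thesis
    proof eventually_elim
      case (elim n)
      have "0 \<le> s\<^sup>2 * v / 2 / real n" using \<open>0 \<le> v\<close> by simp
      then have "\<bar>1 + (- (s\<^sup>2 * v / 2)) / real n\<bar> \<le> 1" using elim unfolding minus_divide_left[symmetric] by linarith
      then show ?case unfolding norm_of_real .
    qed
  qed
  have tri: "cmod (a - c) \<le> cmod (a - b) + cmod (b - c)" for a b c :: complex
    using dist_triangle[of a c b] by (simp add: dist_norm)
  have bd: "\<forall>\<^sub>F n in sequentially. cmod (\<phi> n ^ n - ?w n ^ n)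
     \<le> \<bar>s\<bar> ^ 3 * B n * (real n * a n) / 6 + s\<^sup>2 * \<bar>real n * a n - v\<bar> / 2"
    using w1 eventually_gt_at_top[of 0]
  proof eventually_elim
    case (elim n)
    have eqn: "complex_of_real (1 - s\<^sup>2 * a n / 2) - ?w n = complex_of_real (s\<^sup>2 / 2 * (v / real n - a n))"
      unfolding of_real_diff[symmetric] by (simp add: field_simps)
    have "cmod (\<phi> n - ?w n) \<le> cmod (\<phi> n - complex_of_real (1 - s\<^sup>2 * a n / 2)) + cmod (complex_of_real (1 - s\<^sup>2 * a n / 2) - ?w n)"
      by (rule tri)
    also have "\<dots> \<le> \<bar>s\<bar> ^ 3 * B n * a n / 6 + cmod (complex_of_real (1 - s\<^sup>2 * a n / 2) - ?w n)"
      using char_array_summand[OF Q m[of n] B[of _ n] z[of n], of s] by (simp add: \<phi>_def a_def)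
    also have "cmod (complex_of_real (1 - s\<^sup>2 * a n / 2) - ?w n) = s\<^sup>2 / 2 * \<bar>v / real n - a n\<bar>"
      unfolding eqn norm_of_real by (simp add: abs_mult)
    finally have "real n * cmod (\<phi> n - ?w n) \<le> real n * (\<bar>s\<bar> ^ 3 * B n * a n / 6 + s\<^sup>2 / 2 * \<bar>v / real n - a n\<bar>)"
      by (rule mult_left_mono) simp
    then have "cmod (\<phi> n ^ n - ?w n ^ n) \<le> real n * (\<bar>s\<bar> ^ 3 * B n * a n / 6 + s\<^sup>2 / 2 * \<bar>v / real n - a n\<bar>)"
      using elim \<phi>1 by (intro order_trans[OF norm_power_diff]) auto
    also have "\<dots> = \<bar>s\<bar> ^ 3 * B n * (real n * a n) / 6 + s\<^sup>2 / 2 * (real n * \<bar>v / real n - a n\<bar>)"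
      by (simp add: algebra_simps)
    also have "real n * \<bar>v / real n - a n\<bar> = \<bar>real n * (v / real n - a n)\<bar>"
      by (simp add: abs_mult)
    also have "\<dots> = \<bar>real n * a n - v\<bar>" using elim by (simp add: algebra_simps abs_minus_commute)
    finally show ?case by simp
  qed
  have "(\<lambda>n. \<bar>s\<bar> ^ 3 * B n * (real n * a n) / 6 + s\<^sup>2 * \<bar>real n * a n - v\<bar> / 2)
     \<longlonglongrightarrow> \<bar>s\<bar> ^ 3 * 0 * v / 6 + s\<^sup>2 * \<bar>v - v\<bar> / 2"
    using v unfolding a_def by (intro tendsto_intros B0) auto
  then have "(\<lambda>n. \<phi> n ^ n - ?w n ^ n) \<longlonglongrightarrow> 0"
    by (intro Lim_null_comparison[OF bd]) simp
  note d = this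
  have w: "(\<lambda>n. ?w n ^ n) \<longlonglongrightarrow> complex_of_real (exp (- (s\<^sup>2 * v / 2)))"
    unfolding of_real_power[symmetric]
    by (rule isCont_tendsto_compose[OF _ tendsto_exp_limit_sequentially]) auto
  have "(\<lambda>n. \<phi> n ^ n) \<longlonglongrightarrow> complex_of_real (exp (- (s\<^sup>2 * v / 2)))"
    by (rule Lim_transform[OF w d])
  then show ?thesis unfolding eq .
qed

lemma prob_space_normal_law: "0 < v \<Longrightarrow> prob_space (normal_law \<mu> v)"
  unfolding normal_law_def by (rule prob_space_normal_density) simp

lemma real_distribution_normal_law: "0 < v \<Longrightarrow> real_distribution (normal_law \<mu> v)"
  using prob_space_normal_law unfolding real_distribution_def real_distribution_axioms_def
  by (auto simp: normal_law_def)

text \<open>Everything reduces to the standard normal law through the affine map with slope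
  \<open>sqrt v\<close> and intercept \<open>\<mu>\<close>.\<close>

lemma char_normal_law:
  assumes v: "0 < v"
  shows "char (normal_law \<mu> v) s = iexp (s * \<mu>) * exp (- (s\<^sup>2 * v / 2))"
proof -
  interpret S: prob_space std_normal_distribution
    by (rule prob_space_normal_density) simp
  have "distributed std_normal_distribution lborel (\<lambda>x. x) (\<lambda>x. ennreal (std_normal_density x))"
    unfolding distributed_def by (simp add: distr_id2)
  then have "distributed std_normal_distribution lborel (\<lambda>x. \<mu> + sqrt v * x) (\<lambda>x. ennreal (normal_density (\<mu> + sqrt v * 0) (\<bar>sqrt v\<bar> * 1) x))"
    using v by (intro S.normal_density_affine) auto
  then have "normal_law \<mu> v = distr std_normal_distribution borel (\<lambda>x. \<mu> + sqrt v * x)"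
    unfolding distributed_def normal_law_def using v by (simp cong: distr_cong)
  then have "char (normal_law \<mu> v) s = (CLINT x|std_normal_distribution. iexp (s * (\<mu> + sqrt v * x)))"
    by (simp add: char_def integral_distr)
  also have "\<dots> = (CLINT x|std_normal_distribution. iexp (s * \<mu>) * iexp ((s * sqrt v) * x))"
    unfolding iexp_add[symmetric] by (simp add: distrib_left mult.assoc)
  also have "\<dots> = iexp (s * \<mu>) * char std_normal_distribution (s * sqrt v)"
    unfolding char_def by (rule integral_mult_right_zero)
  also have "char std_normal_distribution (s * sqrt v) = exp (- (s\<^sup>2 * v / 2))"
    unfolding char_std_normal_distribution using v by (simp add: power_mult_distrib exp_of_real)
  finally show ?thesis by simp
qed

lemma norm_iexp_diff_le: "cmod (iexp a - iexp b) \<le> \<bar>a - b\<bar>"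
proof -
  have "iexp a = iexp b * iexp (a - b)"
    unfolding iexp_add[symmetric] by simp
  then have "iexp a - iexp b = iexp b * (iexp (a - b) - 1)"
    by (simp add: right_diff_distrib)
  then have "cmod (iexp a - iexp b) = cmod (iexp (a - b) - 1)"
    by (simp add: norm_mult)
  also have "\<dots> \<le> \<bar>a - b\<bar>" using iexp_approx1[of "a - b" 0] by simp
  finally show ?thesis .
qed

text \<open>The form needed later: a row sum, a remainder that is small in mean and a convergent
  deterministic shift. As \<open>iexp\<close> is Lipschitz with constant 1, the last two change the
  characteristic function by at most \<open>\<bar>s\<bar>\<close> times their mean size, and Levy's
  continuity theorem finishes.\<close>

lemma triangular_array_clt:
  fixes \<psi> :: "nat \<Rightarrow> 'a \<Rightarrow> real"
  assumes Q: "prob_space Q" and m: "\<And>n. \<psi> n \<in> borel_measurable Q"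
    and B: "\<And>n x. x \<in> space Q \<Longrightarrow> \<bar>\<psi> n x\<bar> \<le> B n" and z: "\<And>n. (LINT y|Q. \<psi> n y) = 0"
    and v: "(\<lambda>n. real n * (LINT y|Q. (\<psi> n y)\<^sup>2)) \<longlonglongrightarrow> v" and B0: "B \<longlonglongrightarrow> 0" and v0: "0 < v"
    and \<rho>: "\<And>n. integrable (PiM {..<n} (\<lambda>_. Q)) (\<rho> n)"
    and \<rho>0: "(\<lambda>n. LINT x|PiM {..<n} (\<lambda>_. Q). \<bar>\<rho> n x\<bar>) \<longlonglongrightarrow> 0"
    and \<mu>: "\<mu>' \<longlonglongrightarrow> \<mu>"
  shows "weak_conv_m (\<lambda>n. distr (PiM {..<n} (\<lambda>_. Q)) borel (\<lambda>x. (\<Sum>i<n. \<psi> n (x i)) + \<rho> n x + \<mu>' n))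
    (normal_law \<mu> v)"
proof (rule levy_continuity)
  let ?P = "\<lambda>n. PiM {..<n} (\<lambda>_. Q)"
  interpret Q: prob_space Q by fact
  have P: "prob_space (?P n)" for n using Q by (rule prob_space_PiM)
  note m[measurable]
  have [measurable]: "\<rho> n \<in> borel_measurable (?P n)" for n using \<rho> by auto
  show "real_distribution (normal_law \<mu> v)" using v0 by (rule real_distribution_normal_law)
  show "real_distribution (distr (?P n) borel (\<lambda>x. (\<Sum>i<n. \<psi> n (x i)) + \<rho> n x + \<mu>' n))" for n
    by (intro prob_space.real_distribution_distr[OF P]) measurable
  fix s :: real
  let ?c = "\<lambda>n. char (distr (?P n) borel (\<lambda>x. (\<Sum>i<n. \<psi> n (x i)) + \<rho> n x + \<mu>' n)) s"
  let ?e = "\<lambda>n. (CLINT x|?P n. iexp (s * (\<Sum>i<n. \<psi> n (x i))))"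
  have ce: "cmod (?c n - iexp (s * \<mu>) * ?e n) \<le> \<bar>s\<bar> * ((LINT x|?P n. \<bar>\<rho> n x\<bar>) + \<bar>\<mu>' n - \<mu>\<bar>)" for n
  proof -
    interpret P: prob_space "?P n" by (rule P)
    have i1: "integrable (?P n) (\<lambda>x. iexp (s * ((\<Sum>i<n. \<psi> n (x i)) + \<rho> n x + \<mu>' n)))"
      by (intro P.integrable_iexp) auto
    have i2: "integrable (?P n) (\<lambda>x. iexp (s * \<mu>) * iexp (s * (\<Sum>i<n. \<psi> n (x i))))"
      by (intro integrable_mult_right P.integrable_iexp) auto
    have "?c n = (CLINT x|?P n. iexp (s * ((\<Sum>i<n. \<psi> n (x i)) + \<rho> n x + \<mu>' n)))"
      unfolding char_def by (rule integral_distr) auto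
    moreover have "iexp (s * \<mu>) * ?e n = (CLINT x|?P n. iexp (s * \<mu>) * iexp (s * (\<Sum>i<n. \<psi> n (x i))))"
      by (rule integral_mult_right_zero[symmetric])
    ultimately have "?c n - iexp (s * \<mu>) * ?e n = (CLINT x|?P n. iexp (s * ((\<Sum>i<n. \<psi> n (x i)) + \<rho> n x + \<mu>' n)) - iexp (s * \<mu>) * iexp (s * (\<Sum>i<n. \<psi> n (x i))))"
      by (simp only: Bochner_Integration.integral_diff[OF i1 i2])
    then have "cmod (?c n - iexp (s * \<mu>) * ?e n) = cmod (CLINT x|?P n. iexp (s * ((\<Sum>i<n. \<psi> n (x i)) + \<rho> n x + \<mu>' n)) - iexp (s * \<mu>) * iexp (s * (\<Sum>i<n. \<psi> n (x i))))"
      by (rule arg_cong)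
    also have "\<dots> \<le> (LINT x|?P n. cmod (iexp (s * ((\<Sum>i<n. \<psi> n (x i)) + \<rho> n x + \<mu>' n)) - iexp (s * \<mu>) * iexp (s * (\<Sum>i<n. \<psi> n (x i)))))"
      by (rule integral_norm_bound)
    also have "\<dots> \<le> (LINT x|?P n. \<bar>s\<bar> * (\<bar>\<rho> n x\<bar> + \<bar>\<mu>' n - \<mu>\<bar>))"
    proof (rule integral_mono)
      fix x
      have "s * ((\<Sum>i<n. \<psi> n (x i)) + \<rho> n x + \<mu>' n) - s * ((\<Sum>i<n. \<psi> n (x i)) + \<mu>) = s * (\<rho> n x + (\<mu>' n - \<mu>))"
        by (simp add: algebra_simps)
      then have eqd: "\<bar>s * ((\<Sum>i<n. \<psi> n (x i)) + \<rho> n x + \<mu>' n) - s * ((\<Sum>i<n. \<psi> n (x i)) + \<mu>)\<bar> \<le> \<bar>s\<bar> * (\<bar>\<rho> n x\<bar> + \<bar>\<mu>' n - \<mu>\<bar>)"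
        by (simp only: abs_mult mult_left_mono[OF abs_triangle_ineq abs_ge_zero])
      have "iexp (s * \<mu>) * iexp (s * (\<Sum>i<n. \<psi> n (x i))) = iexp (s * ((\<Sum>i<n. \<psi> n (x i)) + \<mu>))"
        unfolding iexp_add[symmetric] by (simp add: algebra_simps)
      then show "cmod (iexp (s * ((\<Sum>i<n. \<psi> n (x i)) + \<rho> n x + \<mu>' n)) - iexp (s * \<mu>) * iexp (s * (\<Sum>i<n. \<psi> n (x i))))
         \<le> \<bar>s\<bar> * (\<bar>\<rho> n x\<bar> + \<bar>\<mu>' n - \<mu>\<bar>)"
        using order_trans[OF norm_iexp_diff_le eqd]
        by (simp only:)
    next
      show "integrable (?P n) (\<lambda>x. cmod (iexp (s * ((\<Sum>i<n. \<psi> n (x i)) + \<rho> n x + \<mu>' n)) - iexp (s * \<mu>) * iexp (s * (\<Sum>i<n. \<psi> n (x i)))))"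
        by (intro integrable_norm Bochner_Integration.integrable_diff i1 i2)
      show "integrable (?P n) (\<lambda>x. \<bar>s\<bar> * (\<bar>\<rho> n x\<bar> + \<bar>\<mu>' n - \<mu>\<bar>))"
        using \<rho>[of n] by auto
    qed
    also have "\<dots> = \<bar>s\<bar> * ((LINT x|?P n. \<bar>\<rho> n x\<bar>) + \<bar>\<mu>' n - \<mu>\<bar>)"
      using \<rho>[of n] by (simp add: P.prob_space)
    finally show ?thesis .
  qed
  have "(\<lambda>n. \<bar>s\<bar> * ((LINT x|?P n. \<bar>\<rho> n x\<bar>) + \<bar>\<mu>' n - \<mu>\<bar>)) \<longlonglongrightarrow> \<bar>s\<bar> * (0 + \<bar>\<mu> - \<mu>\<bar>)"
    by (intro tendsto_intros \<rho>0 \<mu>)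
  then have d: "(\<lambda>n. ?c n - iexp (s * \<mu>) * ?e n) \<longlonglongrightarrow> 0"
    by (intro Lim_null_comparison[OF always_eventually[OF allI[OF ce]]]) simp
  have "(\<lambda>n. iexp (s * \<mu>) * ?e n) \<longlonglongrightarrow> iexp (s * \<mu>) * exp (- (s\<^sup>2 * v / 2))"
    by (intro tendsto_mult tendsto_const triangular_array_char[OF Q m B z v B0])
  then show "?c \<longlonglongrightarrow> char (normal_law \<mu> v) s"
    unfolding char_normal_law[OF v0] by (rule Lim_transform[OF _ d])
qed

section \<open>Continuous differentiability through iterated partial derivatives\<close>

text \<open>Regularity is phrased with the very \<open>partial_deriv\<close> that occurs in
  \<open>smooth_densities\<close> and \<open>multi_deriv\<close>; total differentiability is derived
  from it in \<open>C1_has_derivative\<close>. Recursion on the derivative functions makes the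
  closure properties inductions on the order with the function generalised.\<close>

primrec C_on :: "nat \<Rightarrow> (real ^ 'n::finite) set \<Rightarrow> (real ^ 'n \<Rightarrow> real) \<Rightarrow> bool" where
  "C_on 0 V g \<longleftrightarrow> continuous_on V g"
| "C_on (Suc k) V g \<longleftrightarrow> continuous_on V g \<and>
     (\<forall>i. (\<forall>x\<in>V. (\<lambda>s. g (x + s *\<^sub>R axis i 1)) differentiable (at (0::real))) \<and> C_on k V (partial_deriv i g))"

lemma C_on_continuous: "C_on k V g \<Longrightarrow> continuous_on V g"
  by (cases k) auto

lemma C_on_partial: "C_on (Suc k) V g \<Longrightarrow> C_on k V (partial_deriv i g)"
  by auto

lemma C_on_Suc_D: "C_on (Suc k) V g \<Longrightarrow> C_on k V g"
proof (induction k arbitrary: g)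
  case (Suc k)
  have "C_on k V (partial_deriv i g)" for i
    using Suc.IH[of "partial_deriv i g"] Suc.prems by (metis C_on.simps(2))
  then show ?case using Suc.prems unfolding C_on.simps(2)[of k] by (metis C_on.simps(2))
qed auto

lemma C_on_mono: "j \<le> k \<Longrightarrow> C_on k V g \<Longrightarrow> C_on j V g"
  by (induction k rule: dec_induct) (auto dest: C_on_Suc_D simp del: C_on.simps)

lemma partial_deriv_I:
  "((\<lambda>s. g (x + s *\<^sub>R axis i 1)) has_real_derivative D) (at 0) \<Longrightarrow> partial_deriv i g x = D"
  unfolding partial_deriv_def by (rule DERIV_imp_deriv)

lemma partial_deriv_D:
  assumes "C_on (Suc k) V g" "x \<in> V"
  shows "((\<lambda>s. g (x + s *\<^sub>R axis i 1)) has_real_derivative partial_deriv i g x) (at 0)"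
  using assms unfolding partial_deriv_def DERIV_deriv_iff_real_differentiable by auto

lemma eventually_line_in_open:
  fixes x u :: "'a::real_normed_vector"
  assumes "open V" "x + y *\<^sub>R u \<in> V"
  shows "\<forall>\<^sub>F s in nhds y. x + s *\<^sub>R u \<in> V"
proof -
  have "((\<lambda>s. x + s *\<^sub>R u) \<longlongrightarrow> x + y *\<^sub>R u) (nhds y)"
    by (intro tendsto_intros) (simp add: filterlim_ident)
  then show ?thesis using assms by (rule topological_tendstoD)
qed

lemma partial_deriv_cong:
  assumes "open V" "x \<in> V" "\<And>y. y \<in> V \<Longrightarrow> g y = h y"
  shows "partial_deriv i g x = partial_deriv i h x"
proof -
  have "\<forall>\<^sub>F s in nhds 0. x + s *\<^sub>R axis i 1 \<in> V"
    using assms by (intro eventually_line_in_open) auto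
  then show ?thesis
    unfolding partial_deriv_def using assms(3) by (intro deriv_cong_ev) (auto elim: eventually_mono)
qed

lemma C_on_cong:
  assumes "open V" "\<And>y. y \<in> V \<Longrightarrow> g y = h y" "C_on k V g"
  shows "C_on k V h"
  using assms(2,3)
proof (induction k arbitrary: g h)
  case 0
  then show ?case using continuous_on_cong by force
next
  case (Suc k)
  have "(\<lambda>s. h (x + s *\<^sub>R axis i 1)) differentiable (at (0::real))" if "x \<in> V" for i x
  proof -
    have "\<forall>\<^sub>F s in nhds 0. x + s *\<^sub>R axis i 1 \<in> V"
      using assms(1) that by (intro eventually_line_in_open) auto
    then have "\<forall>\<^sub>F s in nhds 0. g (x + s *\<^sub>R axis i 1) = h (x + s *\<^sub>R axis i 1)"
      using Suc.prems(1) by (auto elim: eventually_mono)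
    then have "((\<lambda>s. h (x + s *\<^sub>R axis i 1)) has_real_derivative partial_deriv i g x) (at 0)"
      using partial_deriv_D[OF Suc.prems(2) that, of i] DERIV_cong_ev[of 0 0 "\<lambda>s. g (x + s *\<^sub>R axis i 1)" "\<lambda>s. h (x + s *\<^sub>R axis i 1)"]
      by simp
    then show ?thesis using real_differentiable_def by blast
  qed
  moreover have "C_on k V (partial_deriv i h)" for i
    using Suc.prems by (intro Suc.IH[of "partial_deriv i g" "partial_deriv i h"] partial_deriv_cong[OF assms(1)]) auto
  moreover have "continuous_on V h"
    using Suc.prems continuous_on_cong by force
  ultimately show ?case by simp
qed

text \<open>Derivatives are usually computed only on \<open>V\<close>, while
  \<open>partial_deriv\<close> is defined everywhere. Candidates \<open>D\<close> that are right on
  the open set suffice, by \<open>C_on_cong\<close>.\<close>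

lemma C_on_I:
  assumes "open V" "continuous_on V g"
    and "\<And>i x. x \<in> V \<Longrightarrow> ((\<lambda>s. g (x + s *\<^sub>R axis i 1)) has_real_derivative D i x) (at 0)"
    and "\<And>i. C_on k V (D i)"
  shows "C_on (Suc k) V g"
proof -
  have "C_on k V (partial_deriv i g)" for i
    by (rule C_on_cong[OF assms(1) _ assms(4)]) (rule partial_deriv_I[OF assms(3), symmetric])
  then show ?thesis using assms(2,3) unfolding C_on.simps real_differentiable_def by blast
qed

lemma C_on_const: "open V \<Longrightarrow> C_on k V (\<lambda>x. c)"
proof (induction k arbitrary: c)
  case (Suc k)
  show ?case by (rule C_on_I[where D="\<lambda>_ _. 0"]) (use Suc in auto)
qed auto

lemma C_on_add: "open V \<Longrightarrow> C_on k V g \<Longrightarrow> C_on k V h \<Longrightarrow> C_on k V (\<lambda>x. g x + h x)"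
proof (induction k arbitrary: g h)
  case (Suc k)
  show ?case
    by (rule C_on_I[where D="\<lambda>i x. partial_deriv i g x + partial_deriv i h x", OF Suc.prems(1)])
      (use Suc.IH[OF Suc.prems(1) C_on_partial C_on_partial] Suc.prems in
        \<open>auto intro!: continuous_on_add DERIV_add partial_deriv_D[OF Suc.prems(2)] partial_deriv_D[OF Suc.prems(3)]\<close>)
qed (auto intro: continuous_on_add)

lemma C_on_mult: "open V \<Longrightarrow> C_on k V g \<Longrightarrow> C_on k V h \<Longrightarrow> C_on k V (\<lambda>x. g x * h x)"
proof (induction k arbitrary: g h)
  case (Suc k)
  have "C_on k V (\<lambda>x. partial_deriv i g x * h x + partial_deriv i h x * g x)" for i
    by (intro C_on_add Suc.prems(1) Suc.IH C_on_partial[OF Suc.prems(2)] C_on_partial[OF Suc.prems(3)]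
        C_on_Suc_D[OF Suc.prems(2)] C_on_Suc_D[OF Suc.prems(3)])
  moreover have "((\<lambda>s. g (x + s *\<^sub>R axis i 1) * h (x + s *\<^sub>R axis i 1)) has_real_derivative
      partial_deriv i g x * h x + partial_deriv i h x * g x) (at 0)" if "x \<in> V" for i x
    using DERIV_mult'[OF partial_deriv_D[OF Suc.prems(3) that, of i] partial_deriv_D[OF Suc.prems(2) that, of i]]
    by (simp add: mult.commute)
  moreover have "continuous_on V (\<lambda>x. g x * h x)"
    by (intro continuous_on_mult C_on_continuous[OF Suc.prems(2)] C_on_continuous[OF Suc.prems(3)])
  ultimately show ?case
    by (intro C_on_I[where D="\<lambda>i x. partial_deriv i g x * h x + partial_deriv i h x * g x", OF Suc.prems(1)])
qed (auto intro: continuous_on_mult)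

text \<open>The derivative of a reciprocal contains only a derivative of \<open>g\<close> and two
  copies of the reciprocal itself, so the induction hypothesis covers it.\<close>

lemma C_on_inverse: "open V \<Longrightarrow> (\<And>x. x \<in> V \<Longrightarrow> g x \<noteq> 0) \<Longrightarrow> C_on k V g \<Longrightarrow> C_on k V (\<lambda>x. 1 / g x)"
proof (induction k)
  case 0
  then show ?case by (auto intro!: continuous_on_divide continuous_on_const)
next
  case (Suc k)
  let ?D = "\<lambda>i x. (-1) * (partial_deriv i g x * ((1 / g x) * (1 / g x)))"
  have ih: "C_on k V (\<lambda>x. 1 / g x)" 
    by (rule Suc.IH[OF Suc.prems(1,2) C_on_Suc_D[OF Suc.prems(3)]])
  have "C_on k V (?D i)" for i
    by (intro C_on_mult Suc.prems(1) C_on_const C_on_partial[OF Suc.prems(3)] ih)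
  moreover have "((\<lambda>s. 1 / g (x + s *\<^sub>R axis i 1)) has_real_derivative ?D i x) (at 0)" if "x \<in> V" for i x
    using DERIV_inverse_fun[OF partial_deriv_D[OF Suc.prems(3) that, of i]] Suc.prems(2)[OF that]
    by (simp add: inverse_eq_divide power2_eq_square divide_simps)
  moreover have "continuous_on V (\<lambda>x. 1 / g x)" by (rule C_on_continuous[OF ih])
  ultimately show ?case
    by (intro C_on_I[where D="?D", OF Suc.prems(1)])
qed

lemma C_on_partial_derivs: "C_on (k + length is) V g \<Longrightarrow> C_on k V (partial_derivs is g)"
proof (induction "is" arbitrary: k)
  case (Cons i "is")
  have "C_on (Suc k) V (partial_derivs is g)" using Cons.prems by (intro Cons.IH) simp
  then show ?case by (simp add: partial_derivs_def)
qed (simp add: partial_derivs_def)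

text \<open>In the induction, the list of derivatives already taken grows by one while the order
  still available shrinks by one.\<close>

lemma smooth_densities_C_on:
  assumes "f \<in> smooth_densities C k"
  shows "C_on k UNIV f"
proof -
  have "length is + j \<le> k \<Longrightarrow> C_on j UNIV (partial_derivs is f)" for "is" j
  proof (induction j arbitrary: "is")
    case 0
    then show ?case using assms
      by (auto simp: smooth_densities_def intro!: uniformly_continuous_imp_continuous)
  next
    case (Suc j)
    have "C_on j UNIV (partial_deriv i (partial_derivs is f))" for i
      using Suc.IH[of "i # is"] Suc.prems by (simp add: partial_derivs_def)
    moreover have "continuous_on UNIV (partial_derivs is f)"
      using assms Suc.prems by (auto simp: smooth_densities_def intro!: uniformly_continuous_imp_continuous)
    moreover have "partially_differentiable i (partial_derivs is f)" for i
      using assms Suc.prems by (auto simp: smooth_densities_def)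
    ultimately show ?case by (auto simp: partially_differentiable_def)
  qed
  from this[of "[]" k] show ?thesis by (simp add: partial_derivs_def)
qed

subsection \<open>Derivatives along lines\<close>

text \<open>The \<open>m\<close>-th derivative of \<open>g\<close> at \<open>x\<close> in direction
  \<open>u\<close>. Summing over ordered index lists instead of multi-indices avoids multinomial
  coefficients: differentiating along a line simply prepends an index. The passage to multi-indices
  is made once, in \<open>dirsum_multi_index\<close>.\<close>

definition dirsum :: "real ^ 'n::finite \<Rightarrow> nat \<Rightarrow> (real ^ 'n \<Rightarrow> real) \<Rightarrow> real ^ 'n \<Rightarrow> real" where
  "dirsum u m g x = (\<Sum>is | length is = m. (\<Prod>i\<leftarrow>is. u $ i) * partial_derivs is g x)"

lemma finite_lists_length [simp]: "finite {is :: 'n::finite list. length is = m}"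
  using finite_lists_length_eq[of "UNIV :: 'n set" m] by simp

lemma dirsum_0: "dirsum u 0 g x = g x"
proof -
  have "{is :: 'n list. length is = 0} = {[]}" by auto
  then show ?thesis by (simp add: dirsum_def partial_derivs_def)
qed

lemma sum_lists_Suc:
  "(\<Sum>is | length is = Suc m. F is) = (\<Sum>is | length is = m. \<Sum>i\<in>UNIV. F ((i::'n::finite) # is))"
proof -
  have "{is :: 'n list. length is = Suc m} = (\<lambda>(is, i). i # is) ` ({is. length is = m} \<times> UNIV)"
    by (auto simp: length_Suc_conv image_iff)
  then have "(\<Sum>is | length is = Suc m. F is) = (\<Sum>(is, i)\<in>{is. length is = m} \<times> UNIV. F (i # is))"
    by (simp add: sum.reindex inj_on_def split_def)
  then show ?thesis by (simp add: sum.cartesian_product)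
qed

lemma norm_proj_le:
  fixes h :: "real ^ 'n::finite"
  shows "norm (\<Sum>i\<in>S. (h $ i) *\<^sub>R axis i (1::real)) \<le> norm h"
proof (rule norm_le_componentwise_cart)
  fix i
  have "(\<Sum>k\<in>S. (h $ k) *\<^sub>R axis k (1::real)) $ i = (if i \<in> S then h $ i else 0)"
    by (simp add: axis_def if_distrib cong: if_cong)
  then show "norm ((\<Sum>k\<in>S. (h $ k) *\<^sub>R axis k (1::real)) $ i) \<le> norm (h $ i)" by simp
qed

lemma partial_deriv_line:
  assumes "C_on (Suc k) V g" "z + s *\<^sub>R axis i 1 \<in> V"
  shows "((\<lambda>s. g (z + s *\<^sub>R axis i 1)) has_real_derivative partial_deriv i g (z + s *\<^sub>R axis i 1)) (at s)"
  using partial_deriv_D[OF assms, of i] DERIV_shift[of "\<lambda>s. g (z + s *\<^sub>R axis i 1)" _ 0 s]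
  by (simp add: algebra_simps)

text \<open>The increment is built up one coordinate at a time. Each new coordinate is handled by
  the mean value inequality on an axis-parallel segment together with continuity of that partial
  derivative, at the price of one more \<open>e * norm h\<close>.\<close>

lemma C1_frechet_aux:
  fixes g :: "real ^ 'n::finite \<Rightarrow> real"
  assumes V: "open V" and g: "C_on (Suc 0) V g" and x: "x \<in> V" and e: "0 < e"
  shows "\<exists>\<delta>>0. \<forall>h. norm h < \<delta> \<longrightarrow>
     \<bar>g (x + (\<Sum>i\<in>S. (h $ i) *\<^sub>R axis i 1)) - g x - (\<Sum>i\<in>S. h $ i * partial_deriv i g x)\<bar> \<le> real (card S) * e * norm h"
proof (induction S rule: infinite_finite_induct)
  case (insert j S)
  let ?p = "\<lambda>S h. (\<Sum>i\<in>S. (h $ i) *\<^sub>R axis i (1::real)) :: real ^ 'n"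
  obtain \<delta>1 where \<delta>1: "\<delta>1 > 0" "\<And>h. norm h < \<delta>1 \<Longrightarrow>
     \<bar>g (x + ?p S h) - g x - (\<Sum>i\<in>S. h $ i * partial_deriv i g x)\<bar> \<le> real (card S) * e * norm h"
    using insert.IH by blast
  have "continuous_on V (partial_deriv j g)" using g by simp
  then have "\<forall>\<^sub>F y in at x. dist (partial_deriv j g y) (partial_deriv j g x) < e"
    using V x e by (intro tendstoD) (auto simp: continuous_on_eq_continuous_at continuous_within)
  moreover have "\<forall>\<^sub>F y in at x. y \<in> V" using V x by (rule eventually_at_in_open')
  ultimately have "\<forall>\<^sub>F y in at x. dist (partial_deriv j g y) (partial_deriv j g x) < e \<and> y \<in> V"
    by eventually_elim auto
  then obtain \<delta>2 where \<delta>2: "\<delta>2 > 0" "\<And>y. dist y x < \<delta>2 \<Longrightarrow> \<bar>partial_deriv j g y - partial_deriv j g x\<bar> < e \<and> y \<in> V"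
    unfolding eventually_at using e x by (metis abs_zero diff_self dist_real_def UNIV_I)
  \<comment> \<open>Half of \<open>\<delta>2\<close> suffices because the partial increment and the
    new segment are each no longer than \<open>norm h\<close>.\<close>
  have "\<bar>g (x + ?p (insert j S) h) - g x - (\<Sum>i\<in>insert j S. h $ i * partial_deriv i g x)\<bar> \<le> real (card (insert j S)) * e * norm h"
    if h: "norm h < min \<delta>1 (\<delta>2 / 2)" for h
  proof -
    let ?z = "x + ?p S h"
    have near: "dist (?z + s *\<^sub>R axis j 1) x < \<delta>2" if "s \<in> closed_segment 0 (h $ j)" for s
    proof -
      have "\<bar>s\<bar> \<le> \<bar>h $ j\<bar>" using that by (auto simp: closed_segment_eq_real_ivl split: if_splits)
      also have "\<dots> \<le> norm h" by (rule component_le_norm_cart)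
      finally have "norm (?p S h + s *\<^sub>R axis j (1::real)) \<le> norm h + norm h"
        by (intro order_trans[OF norm_triangle_ineq] add_mono norm_proj_le) (simp add: norm_axis_1)
      then show ?thesis using h by (simp add: dist_norm add.assoc)
    qed
    let ?\<phi> = "\<lambda>s. g (?z + s *\<^sub>R axis j 1) - s * partial_deriv j g x"
    have "norm (?\<phi> (h $ j) - ?\<phi> 0) \<le> e * norm (h $ j - 0)"
    proof (rule field_differentiable_bound[where S="closed_segment 0 (h $ j)" and f'="\<lambda>s. partial_deriv j g (?z + s *\<^sub>R axis j 1) - partial_deriv j g x"])
      fix s assume s: "s \<in> closed_segment 0 (h $ j)"
      show "(?\<phi> has_field_derivative partial_deriv j g (?z + s *\<^sub>R axis j 1) - partial_deriv j g x) (at s within closed_segment 0 (h $ j))"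
        using \<delta>2(2)[OF near[OF s]]
        by (intro DERIV_diff has_field_derivative_at_within[OF partial_deriv_line[OF g]])
          (auto intro!: derivative_eq_intros)
      show "norm (partial_deriv j g (?z + s *\<^sub>R axis j 1) - partial_deriv j g x) \<le> e"
        using \<delta>2(2)[OF near[OF s]] by simp
    qed auto
    also have "\<dots> \<le> e * norm h"
      using e component_le_norm_cart[of h j] by simp
    finally have 1: "\<bar>g (?z + (h $ j) *\<^sub>R axis j 1) - g ?z - h $ j * partial_deriv j g x\<bar> \<le> e * norm h"
      by simp
    have eq: "x + ?p (insert j S) h = ?z + (h $ j) *\<^sub>R axis j 1"
      using insert.hyps by (simp add: algebra_simps)
    have "\<bar>g (x + ?p (insert j S) h) - g x - (\<Sum>i\<in>insert j S. h $ i * partial_deriv i g x)\<bar>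
       \<le> \<bar>g (?z + (h $ j) *\<^sub>R axis j 1) - g ?z - h $ j * partial_deriv j g x\<bar>
         + \<bar>g (x + ?p S h) - g x - (\<Sum>i\<in>S. h $ i * partial_deriv i g x)\<bar>"
      unfolding eq using insert.hyps by simp
    also have "\<dots> \<le> e * norm h + real (card S) * e * norm h"
      using \<delta>1(2)[of h] h 1 by (intro add_mono) auto
    also have "\<dots> = real (card (insert j S)) * e * norm h"
      using insert.hyps by (simp add: algebra_simps)
    finally show ?thesis .
  qed
  then show ?case using \<delta>1(1) \<delta>2(1) by (intro exI[of _ "min \<delta>1 (\<delta>2 / 2)"]) auto
qed (auto intro: exI[of _ 1])

text \<open>Needed for the chain rule along lines that are not parallel to an axis.\<close>

lemma C1_has_derivative:
  fixes g :: "real ^ 'n::finite \<Rightarrow> real"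
  assumes V: "open V" and g: "C_on (Suc 0) V g" and x: "x \<in> V"
  shows "(g has_derivative (\<lambda>h. \<Sum>i\<in>UNIV. h $ i * partial_deriv i g x)) (at x)"
  unfolding has_derivative_at_alt
proof (intro conjI allI impI)
  show "bounded_linear (\<lambda>h. \<Sum>i\<in>UNIV. h $ i * partial_deriv i g x)"
    by (intro bounded_linear_sum bounded_linear_mult_left bounded_linear_compose[OF bounded_linear_mult_left] bounded_linear_vec_nth)
  fix e :: real assume e: "0 < e"
  define e' where "e' = e / real CARD('n)"
  have e': "0 < e'" "real CARD('n) * e' = e" using e by (auto simp: e'_def)
  have ex: "(\<Sum>i\<in>UNIV. (h $ i) *\<^sub>R axis i 1) = h" for h :: "real ^ 'n"
    by (simp add: vec_eq_iff axis_def if_distrib cong: if_cong)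
  show "\<exists>d>0. \<forall>y. norm (y - x) < d \<longrightarrow>
     norm (g y - g x - (\<Sum>i\<in>UNIV. (y - x) $ i * partial_deriv i g x)) \<le> e * norm (y - x)"
  proof -
    obtain d where d: "d > 0" "\<And>h. norm h < d \<Longrightarrow> \<bar>g (x + h) - g x - (\<Sum>i\<in>UNIV. h $ i * partial_deriv i g x)\<bar> \<le> e * norm h"
      using C1_frechet_aux[OF V g x e'(1), of UNIV] unfolding ex e'(2) by blast
    show ?thesis
    proof (intro exI conjI allI impI)
      show "0 < d" by fact
      fix y assume "norm (y - x) < d"
      from d(2)[OF this] show "norm (g y - g x - (\<Sum>i\<in>UNIV. (y - x) $ i * partial_deriv i g x)) \<le> e * norm (y - x)"
        by simp
    qed
  qed
qed

lemma C1_line_derivative: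
  fixes g :: "real ^ 'n::finite \<Rightarrow> real"
  assumes V: "open V" and g: "C_on (Suc 0) V g" and x: "t + y *\<^sub>R u \<in> V"
  shows "((\<lambda>s. g (t + s *\<^sub>R u)) has_real_derivative (\<Sum>i\<in>UNIV. u $ i * partial_deriv i g (t + y *\<^sub>R u))) (at y)"
proof -
  have "((\<lambda>s. t + s *\<^sub>R u) has_derivative (\<lambda>s. s *\<^sub>R u)) (at y)"
    by (auto intro!: derivative_eq_intros)
  from diff_chain_at[OF this C1_has_derivative[OF V g x]]
  show ?thesis
    unfolding o_def by (rule has_derivative_imp_has_field_derivative) (simp add: sum_distrib_left mult_ac)
qed

lemma dirsum_derivative:
  fixes g :: "real ^ 'n::finite \<Rightarrow> real"
  assumes V: "open V" and g: "C_on (Suc m) V g" and x: "t + y *\<^sub>R u \<in> V"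
  shows "((\<lambda>s. dirsum u m g (t + s *\<^sub>R u)) has_real_derivative dirsum u (Suc m) g (t + y *\<^sub>R u)) (at y)"
proof -
  have "((\<lambda>s. dirsum u m g (t + s *\<^sub>R u)) has_real_derivative
     (\<Sum>is | length is = m. (\<Prod>i\<leftarrow>is. u $ i) * (\<Sum>i\<in>UNIV. u $ i * partial_deriv i (partial_derivs is g) (t + y *\<^sub>R u)))) (at y)"
    unfolding dirsum_def
  proof (intro DERIV_sum DERIV_cmult C1_line_derivative[OF V _ x])
    fix "is" :: "'n list" assume "is \<in> {is. length is = m}"
    then show "C_on (Suc 0) V (partial_derivs is g)" using g by (intro C_on_partial_derivs) simp
  qed
  also have "(\<Sum>is | length is = m. (\<Prod>i\<leftarrow>is. u $ i) * (\<Sum>i\<in>UNIV. u $ i * partial_deriv i (partial_derivs is g) (t + y *\<^sub>R u)))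
     = dirsum u (Suc m) g (t + y *\<^sub>R u)"
    unfolding dirsum_def sum_lists_Suc by (simp add: sum_distrib_left mult_ac partial_derivs_def)
  finally show ?thesis .
qed

text \<open>Starting from the \<open>j\<close>-th directional derivative lets the same lemma expand
  \<open>g\<close> (\<open>j = 0\<close>) and its derivatives along the line
  (\<open>j > 0\<close>).\<close>

lemma taylor_line:
  fixes g :: "real ^ 'n::finite \<Rightarrow> real"
  assumes V: "open V" and g: "C_on (j + m) V g" and m: "0 < m" and y: "0 < y"
    and x: "\<And>s. 0 \<le> s \<Longrightarrow> s \<le> y \<Longrightarrow> t + s *\<^sub>R u \<in> V"
  shows "\<exists>\<theta>. 0 < \<theta> \<and> \<theta> < y \<and>
    dirsum u j g (t + y *\<^sub>R u) = (\<Sum>k<m. dirsum u (j + k) g t / fact k * y ^ k)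
      + dirsum u (j + m) g (t + \<theta> *\<^sub>R u) / fact m * y ^ m"
proof -
  have "\<forall>k s. k < m \<and> 0 \<le> s \<and> s \<le> y \<longrightarrow>
     ((\<lambda>s. dirsum u (j + k) g (t + s *\<^sub>R u)) has_real_derivative dirsum u (j + Suc k) g (t + s *\<^sub>R u)) (at s)"
    using g by (auto intro!: dirsum_derivative[OF V] x intro: C_on_mono[of "Suc _" "j + m"] simp del: C_on.simps)
  from Maclaurin[of y m "\<lambda>k s. dirsum u (j + k) g (t + s *\<^sub>R u)" "\<lambda>s. dirsum u j g (t + s *\<^sub>R u)", OF y m _ this]
  show ?thesis by auto
qed

lemma dirsum_1: "dirsum u (Suc 0) g x = (\<Sum>i\<in>UNIV. u $ i * partial_deriv i g x)"
proof -
  have "{is :: 'a list. length is = 0} = {[]}" by auto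
  then show ?thesis unfolding dirsum_def sum_lists_Suc by (simp add: partial_derivs_def)
qed

text \<open>\<open>CARD('n) ^ m\<close> counts the index lists. The coefficients stay abstract so
  that second differences of derivatives can be bounded by the same lemma.\<close>

lemma coeff_sum_bound:
  fixes u :: "real ^ 'n::finite"
  assumes "\<And>is. length is = m \<Longrightarrow> \<bar>a is\<bar> \<le> B"
  shows "\<bar>\<Sum>is | length is = m. (\<Prod>i\<leftarrow>is. u $ i) * a is\<bar> \<le> real CARD('n) ^ m * B * norm u ^ m"
proof -
  have p: "\<bar>\<Prod>i\<leftarrow>is. u $ i\<bar> \<le> norm u ^ length is" for "is" :: "'n list"
    by (induction "is") (auto simp: abs_mult intro!: mult_mono component_le_norm_cart)
  have "\<bar>\<Sum>is | length is = m. (\<Prod>i\<leftarrow>is. u $ i) * a is\<bar> \<le> (\<Sum>is | length is = m. \<bar>(\<Prod>i\<leftarrow>is. u $ i) * a is\<bar>)"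
    by (rule sum_abs)
  also have "\<dots> \<le> (\<Sum>is :: 'n list | length is = m. norm u ^ m * B)"
    unfolding abs_mult using p assms by (intro sum_mono mult_mono) force+
  also have "\<dots> = real (card {is :: 'n list. length is = m}) * (norm u ^ m * B)" by simp
  also have "card {is :: 'n list. length is = m} = CARD('n) ^ m"
    using card_lists_length_eq[of "UNIV :: 'n set" m] by simp
  finally show ?thesis by (simp add: mult_ac)
qed

lemma dirsum_bound:
  fixes g :: "real ^ 'n::finite \<Rightarrow> real"
  assumes "\<And>is. length is = m \<Longrightarrow> \<bar>partial_derivs is g x\<bar> \<le> B"
  shows "\<bar>dirsum u m g x\<bar> \<le> real CARD('n) ^ m * B * norm u ^ m"
  unfolding dirsum_def using assms by (rule coeff_sum_bound)

lemma continuous_on_dirsum: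
  fixes g :: "real ^ 'a::finite \<Rightarrow> real"
  assumes "C_on m V g"
  shows "continuous_on (UNIV \<times> V) (\<lambda>(u, x). dirsum u m g x)"
proof -
  have "continuous_on (UNIV \<times> V) (\<lambda>p. (\<Prod>i\<leftarrow>is. fst p $ i) * partial_derivs is g (snd p))" if "length is = m" for "is"
  proof (intro continuous_on_mult)
    show "continuous_on (UNIV \<times> V) (\<lambda>p :: (real ^ 'a) \<times> (real ^ 'a). \<Prod>i\<leftarrow>is. fst p $ i)"
    proof (induction "is")
      case (Cons a "is")
      have "continuous_on (UNIV \<times> V) (\<lambda>p :: (real ^ 'a) \<times> (real ^ 'a). fst p $ a)" by (intro continuous_intros)
      then show ?case using continuous_on_mult[OF _ Cons.IH] by simp
    qed simp
    have "continuous_on V (partial_derivs is g)"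
      using C_on_partial_derivs[of 0 "is" V g] assms that by simp
    then show "continuous_on (UNIV \<times> V) (\<lambda>p. partial_derivs is g (snd p))"
      by (rule continuous_on_compose2) (auto intro!: continuous_intros)
  qed
  then show ?thesis unfolding dirsum_def split_def by (intro continuous_on_sum) auto
qed

lemma dirsum_scale: "dirsum (c *\<^sub>R u) m g x = c ^ m * dirsum u m g x"
proof -
  have "(\<Prod>i\<leftarrow>is. (c *\<^sub>R u) $ i) = c ^ length is * (\<Prod>i\<leftarrow>is. u $ i)" for "is"
    by (induction "is") (auto simp: mult_ac)
  then show ?thesis unfolding dirsum_def sum_distrib_left
    by (intro sum.cong refl) (simp only: mem_Collect_eq mult.assoc)
qed

subsection \<open>Symmetry of partial derivatives\<close>

text \<open>The mean value theorem is applied along axis \<open>i\<close> and then along axis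
  \<open>j\<close>. The second difference is symmetric in the two axes, so exchanging them evaluates
  the same number through the other mixed derivative.\<close>

lemma second_difference:
  fixes g :: "real ^ 'n::finite \<Rightarrow> real"
  assumes V: "open V" and g: "C_on (Suc (Suc 0)) V g" and s: "0 < s"
    and x: "\<And>a b. 0 \<le> a \<Longrightarrow> a \<le> s \<Longrightarrow> 0 \<le> b \<Longrightarrow> b \<le> s \<Longrightarrow> x + a *\<^sub>R axis i 1 + b *\<^sub>R axis j 1 \<in> V"
  shows "\<exists>a b. 0 \<le> a \<and> a \<le> s \<and> 0 \<le> b \<and> b \<le> s \<and>
    g (x + s *\<^sub>R axis i 1 + s *\<^sub>R axis j 1) - g (x + s *\<^sub>R axis i 1) - g (x + s *\<^sub>R axis j 1) + g x
    = s\<^sup>2 * partial_deriv j (partial_deriv i g) (x + a *\<^sub>R axis i 1 + b *\<^sub>R axis j 1)"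
proof -
  let ?ei = "axis i (1::real) :: real ^ 'n" and ?ej = "axis j (1::real) :: real ^ 'n"
  have g1: "C_on (Suc 0) V g" using g by (rule C_on_Suc_D)
  have "\<exists>a>0. a < s \<and> (g (x + s *\<^sub>R ?ej + s *\<^sub>R ?ei) - g (x + s *\<^sub>R ?ei)) - (g (x + s *\<^sub>R ?ej + 0 *\<^sub>R ?ei) - g (x + 0 *\<^sub>R ?ei))
    = (s - 0) * (partial_deriv i g (x + s *\<^sub>R ?ej + a *\<^sub>R ?ei) - partial_deriv i g (x + a *\<^sub>R ?ei))"
    using x[of _ s] x[of _ 0] s
    by (intro MVT2[OF s] DERIV_diff partial_deriv_line[OF g1]) (auto simp: add_ac)
  then obtain a where a: "0 < a" "a < s" "g (x + s *\<^sub>R ?ej + s *\<^sub>R ?ei) - g (x + s *\<^sub>R ?ei) - g (x + s *\<^sub>R ?ej) + g x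
    = s * (partial_deriv i g (x + s *\<^sub>R ?ej + a *\<^sub>R ?ei) - partial_deriv i g (x + a *\<^sub>R ?ei))"
    by (auto simp: algebra_simps)
  have "\<exists>b>0. b < s \<and> partial_deriv i g ((x + a *\<^sub>R ?ei) + s *\<^sub>R ?ej) - partial_deriv i g ((x + a *\<^sub>R ?ei) + 0 *\<^sub>R ?ej)
    = (s - 0) * partial_deriv j (partial_deriv i g) ((x + a *\<^sub>R ?ei) + b *\<^sub>R ?ej)"
    using x[of a] a by (intro MVT2[OF s] partial_deriv_line[OF C_on_partial[OF g]]) auto
  then obtain b where b: "0 < b" "b < s" "partial_deriv i g (x + s *\<^sub>R ?ej + a *\<^sub>R ?ei) - partial_deriv i g (x + a *\<^sub>R ?ei)
    = s * partial_deriv j (partial_deriv i g) (x + a *\<^sub>R ?ei + b *\<^sub>R ?ej)"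
    by (auto simp: algebra_simps)
  show ?thesis
    using a b by (intro exI[of _ a] exI[of _ b]) (auto simp: power2_eq_square add_ac)
qed

lemma partial_deriv_commute:
  fixes g :: "real ^ 'n::finite \<Rightarrow> real"
  assumes V: "open V" and g: "C_on (Suc (Suc 0)) V g" and x: "x \<in> V"
  shows "partial_deriv i (partial_deriv j g) x = partial_deriv j (partial_deriv i g) x"
proof (rule ccontr)
  let ?A = "partial_deriv i (partial_deriv j g)" and ?B = "partial_deriv j (partial_deriv i g)"
  let ?ei = "axis i (1::real) :: real ^ 'n" and ?ej = "axis j (1::real) :: real ^ 'n"
  assume ne: "?A x \<noteq> ?B x"
  \<comment> \<open>Two values that lie within half the gap of \<open>?A x\<close> and of
    \<open>?B x\<close> respectively cannot coincide.\<close>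
  define e where "e = \<bar>?A x - ?B x\<bar> / 2"
  have e: "0 < e" using ne by (simp add: e_def)
  have c: "continuous_on V ?A" "continuous_on V ?B" using g by auto
  have "\<forall>\<^sub>F y in nhds x. dist (?A y) (?A x) < e \<and> dist (?B y) (?B x) < e \<and> y \<in> V"
    using V x e c continuous_on_eq_continuous_at[OF V]
    by (intro eventually_conj eventually_nhds_in_open tendstoD) (auto simp: continuous_at_imp_continuous_on isCont_def tendsto_at_iff_tendsto_nhds)
  then obtain \<delta> where \<delta>: "\<delta> > 0" "\<And>y. dist y x < \<delta> \<Longrightarrow> dist (?A y) (?A x) < e \<and> dist (?B y) (?B x) < e \<and> y \<in> V"
    unfolding eventually_nhds_metric by auto
  \<comment> \<open>Points of the square with side \<open>s\<close> are at distance at most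
    \<open>2 * s\<close> from \<open>x\<close>, hence inside the ball of radius
    \<open>\<delta>\<close>.\<close>
  define s where "s = \<delta> / 3"
  have s: "0 < s" using \<delta> by (simp add: s_def)
  have near: "dist (x + a *\<^sub>R axis k 1 + b *\<^sub>R axis l 1) x < \<delta>" if "0 \<le> a" "a \<le> s" "0 \<le> b" "b \<le> s" for a b k l
  proof -
    have "norm (a *\<^sub>R axis k 1 + b *\<^sub>R axis l (1::real) :: real ^ 'n) \<le> a + b"
      using that by (intro order_trans[OF norm_triangle_ineq]) (simp add: norm_axis_1)
    then show ?thesis using that s by (simp add: dist_norm add.assoc s_def)
  qed
  obtain a b where ab: "0 \<le> a" "a \<le> s" "0 \<le> b" "b \<le> s" "g (x + s *\<^sub>R ?ei + s *\<^sub>R ?ej) - g (x + s *\<^sub>R ?ei) - g (x + s *\<^sub>R ?ej) + g x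
    = s\<^sup>2 * ?B (x + a *\<^sub>R ?ei + b *\<^sub>R ?ej)"
    using second_difference[OF V g s, of x i j] near \<delta>(2) by blast
  obtain a' b' where ab': "0 \<le> a'" "a' \<le> s" "0 \<le> b'" "b' \<le> s" "g (x + s *\<^sub>R ?ej + s *\<^sub>R ?ei) - g (x + s *\<^sub>R ?ej) - g (x + s *\<^sub>R ?ei) + g x
    = s\<^sup>2 * ?A (x + a' *\<^sub>R ?ej + b' *\<^sub>R ?ei)"
    using second_difference[OF V g s, of x j i] near \<delta>(2) by blast
  have eq: "x + s *\<^sub>R ?ej + s *\<^sub>R ?ei = x + s *\<^sub>R ?ei + s *\<^sub>R ?ej" by simp
  have "s\<^sup>2 * ?A (x + a' *\<^sub>R ?ej + b' *\<^sub>R ?ei) = s\<^sup>2 * ?B (x + a *\<^sub>R ?ei + b *\<^sub>R ?ej)"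
    using ab(5) ab'(5) unfolding eq by linarith
  then have "?A (x + a' *\<^sub>R ?ej + b' *\<^sub>R ?ei) = ?B (x + a *\<^sub>R ?ei + b *\<^sub>R ?ej)"
    using s by simp
  moreover have "dist (?A (x + a' *\<^sub>R ?ej + b' *\<^sub>R ?ei)) (?A x) < e" "dist (?B (x + a *\<^sub>R ?ei + b *\<^sub>R ?ej)) (?B x) < e"
    using \<delta>(2)[OF near] ab ab' by auto
  ultimately show False unfolding e_def dist_real_def by (simp add: abs_if split: if_splits)
qed

text \<open>The index \<open>i\<close> travels to the front by adjacent transpositions, each
  justified by \<open>partial_deriv_commute\<close>.\<close>

lemma partial_derivs_move_front:
  fixes g :: "real ^ 'n::finite \<Rightarrow> real"
  assumes V: "open V" and g: "C_on (Suc (length ys)) V g" and x: "x \<in> V"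
  shows "partial_derivs (ys @ [i]) g x = partial_derivs (i # ys) g x"
  using g x
proof (induction ys arbitrary: x)
  case (Cons y ys)
  have g': "C_on (Suc (length ys)) V g" using C_on_Suc_D[OF Cons.prems(1)] by simp
  have "partial_derivs ((y # ys) @ [i]) g x = partial_deriv y (partial_derivs (ys @ [i]) g) x"
    by (simp add: partial_derivs_def)
  also have "\<dots> = partial_deriv y (partial_deriv i (partial_derivs ys g)) x"
    using Cons.IH[OF g'] by (intro partial_deriv_cong[OF V Cons.prems(2)]) (simp add: partial_derivs_def)
  also have "\<dots> = partial_deriv i (partial_deriv y (partial_derivs ys g)) x"
    using Cons.prems by (intro partial_deriv_commute[OF V] C_on_partial_derivs) auto
  finally show ?case by (simp add: partial_derivs_def)
qed (simp add: partial_derivs_def)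

lemma partial_derivs_append: "partial_derivs (xs @ ys) g = partial_derivs xs (partial_derivs ys g)"
  by (simp add: partial_derivs_def)

lemma partial_derivs_perm:
  fixes g :: "real ^ 'n::finite \<Rightarrow> real"
  assumes V: "open V" and g: "C_on (length is) V g" and p: "mset is = mset js" and x: "x \<in> V"
  shows "partial_derivs is g x = partial_derivs js g x"
  using g p x
proof (induction "is" arbitrary: js x)
  case (Cons i "is")
  have "i \<in> set js" using Cons.prems(2) by (metis list.set_intros(1) mset_eq_setD)
  then obtain ys zs where js: "js = ys @ i # zs" by (auto dest: split_list)
  have m: "mset is = mset (ys @ zs)" using Cons.prems(2) js by simp
  then have len: "length is = length ys + length zs" by (metis length_append size_mset)
  have "partial_derivs js g x = partial_derivs (ys @ [i]) (partial_derivs zs g) x"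
    unfolding js by (simp add: partial_derivs_append[symmetric])
  also have "\<dots> = partial_derivs (i # ys) (partial_derivs zs g) x"
    using Cons.prems(1) len by (intro partial_derivs_move_front[OF V _ Cons.prems(3)] C_on_partial_derivs) simp
  also have "\<dots> = partial_deriv i (partial_derivs (ys @ zs) g) x"
    by (simp add: partial_derivs_def)
  also have "\<dots> = partial_deriv i (partial_derivs is g) x"
    using Cons.IH[OF C_on_Suc_D m] Cons.prems(1) by (intro partial_deriv_cong[OF V Cons.prems(3)]) simp
  finally show ?case by (simp add: partial_derivs_def)
qed simp

text \<open>Index lists are grouped by their counts. All lists with counts \<open>v\<close> give the
  same derivative by symmetry, and there are \<open>fact m / multi_fact v\<close> of them, the
  number of arrangements of a multiset.\<close>

lemma dirsum_multi_index:
  fixes g :: "real ^ 'n::finite \<Rightarrow> real"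
  assumes V: "open V" and g: "C_on m V g" and x: "x \<in> V"
  shows "dirsum u m g x = fact m * (\<Sum>v | multi_abs v = m. multi_power u v * multi_deriv v g x / multi_fact v)"
proof -
  let ?L = "{is :: 'n list. length is = m}" and ?V = "{v :: 'n \<Rightarrow> nat. multi_abs v = m}"
  have fin: "finite ?V"
  proof (rule finite_subset)
    show "?V \<subseteq> (UNIV :: 'n set) \<rightarrow>\<^sub>E {..m}"
      by (auto simp: multi_abs_def member_le_sum)
    show "finite ((UNIV :: 'n set) \<rightarrow>\<^sub>E {..m})" by (intro finite_PiE) auto
  qed
  have len: "length is = (\<Sum>i\<in>UNIV. count_list is i)" for "is" :: "'n list"
    by (simp add: sum_count_set[of "is" UNIV])
  have "dirsum u m g x = (\<Sum>v\<in>?V. \<Sum>is | is \<in> ?L \<and> count_list is = v. (\<Prod>i\<leftarrow>is. u $ i) * partial_derivs is g x)"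
    unfolding dirsum_def by (rule sum.group[symmetric]) (use fin in \<open>auto simp: multi_abs_def len[symmetric]\<close>)
  also have "\<dots> = (\<Sum>v\<in>?V. fact m * (multi_power u v * multi_deriv v g x / multi_fact v))"
  proof (rule sum.cong[OF refl])
    fix v assume v: "v \<in> ?V"
    define A where "A = Abs_multiset v"
    have A: "count A i = v i" for i unfolding A_def by (subst Abs_multiset_inverse) auto
    have eq: "{is. is \<in> ?L \<and> count_list is = v} = permutations_of_multiset A"
      using v by (auto simp: permutations_of_multiset_def multiset_eq_iff A len multi_abs_def count_mset fun_eq_iff)
    have sz: "size A = m" using v A unfolding size_multiset_overloaded_eq multi_abs_def
      by (auto intro!: sum.mono_neutral_cong_left simp: not_in_iff)
    have "multi_fact v = real (\<Prod>i\<in>set_mset A. fact (count A i))"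
      unfolding multi_fact_def A of_nat_prod by (intro prod.mono_neutral_cong_right) (auto simp: not_in_iff A)
    then have cd: "multi_fact v * real (card (permutations_of_multiset A)) = fact m"
      using arg_cong[OF card_permutations_of_multiset_aux[of A], of real] sz by (simp del: of_nat_prod add: mult.commute)
    have f0: "multi_fact v \<noteq> 0" by (simp add: multi_fact_def)
    have summand: "(\<Prod>i\<leftarrow>is. u $ i) * partial_derivs is g x = multi_power u v * multi_deriv v g x"
      if "is \<in> permutations_of_multiset A" for "is"
    proof -
      have c: "count_list is i = v i" for i using that A by (simp add: permutations_of_multiset_def flip: count_mset)
      have "(\<Prod>i\<leftarrow>is. u $ i) = multi_power u v"
        unfolding multi_power_def c[symmetric]
      proof (induction "is")
        case (Cons a "is")
        have "(\<Prod>i\<in>UNIV. (u $ i) ^ count_list (a # is) i) = (\<Prod>i\<in>UNIV. (u $ i) ^ count_list is i * (if i = a then u $ i else 1))"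
          by (intro prod.cong) auto
        then show ?case using Cons by (simp add: prod.distrib)
      qed simp
      \<comment> \<open>The unspecified list chosen in \<open>multi_deriv\<close> has the same
        counts and hence is a permutation of \<open>is\<close>.\<close>
      moreover have "\<forall>i. count_list (SOME is. \<forall>i. count_list is i = v i) i = v i"
        by (rule someI[of "\<lambda>is. \<forall>i. count_list is i = v i" "is"]) (use c in auto)
      then have "mset is = mset (SOME is. \<forall>i. count_list is i = v i)"
        by (simp add: multiset_eq_iff count_mset c)
      then have "partial_derivs is g x = multi_deriv v g x"
        unfolding multi_deriv_def using g eq that by (intro partial_derivs_perm[OF V _ _ x]) auto
      ultimately show ?thesis by simp
    qed
    have "(\<Sum>is | is \<in> ?L \<and> count_list is = v. (\<Prod>i\<leftarrow>is. u $ i) * partial_derivs is g x)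
      = real (card (permutations_of_multiset A)) * (multi_power u v * multi_deriv v g x)"
      unfolding eq by (simp add: summand)
    also have "\<dots> = fact m * (multi_power u v * multi_deriv v g x / multi_fact v)"
      using cd f0 by (simp add: field_simps)
    finally show "(\<Sum>is | is \<in> ?L \<and> count_list is = v. (\<Prod>i\<leftarrow>is. u $ i) * partial_derivs is g x)
      = fact m * (multi_power u v * multi_deriv v g x / multi_fact v)" .
  qed
  finally show ?thesis by (simp add: sum_distrib_left)
qed

subsection \<open>Scaling and polar integration\<close>

lemma nn_integral_lborel_scale:
  fixes f :: "real ^ 'n::finite \<Rightarrow> ennreal"
  assumes [measurable]: "f \<in> borel_measurable borel" and c: "c \<noteq> 0"
  shows "(\<integral>\<^sup>+x. f x \<partial>lborel) = ennreal (\<bar>c\<bar> ^ CARD('n)) * (\<integral>\<^sup>+x. f (t + c *\<^sub>R x) \<partial>lborel)"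
  by (subst lborel_affine[OF c, of t])
     (simp add: nn_integral_density nn_integral_distr nn_integral_cmult)

lemma lborel_integrable_scale:
  fixes f :: "real ^ 'n::finite \<Rightarrow> real"
  assumes f: "integrable lborel f" and c: "c \<noteq> 0"
  shows "integrable lborel (\<lambda>x. f (t + c *\<^sub>R x))"
  using f f[THEN borel_measurable_integrable] c unfolding integrable_iff_bounded
  by (subst (asm) nn_integral_lborel_scale[where c=c and t=t]) (auto simp: ennreal_mult_less_top)

lemma lborel_integral_scale:
  fixes f :: "real ^ 'n::finite \<Rightarrow> real"
  assumes [measurable]: "f \<in> borel_measurable borel" and c: "c \<noteq> 0"
  shows "(LINT x|lborel. f x) = \<bar>c\<bar> ^ CARD('n) * (LINT x|lborel. f (t + c *\<^sub>R x))"
  by (subst lborel_affine[OF c, of t])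
     (simp add: integral_density integral_distr)

lemma lborel_integral_odd:
  fixes f :: "real ^ 'n::finite \<Rightarrow> real"
  assumes "f \<in> borel_measurable borel" "\<And>x. f (- x) = - f x"
  shows "(LINT x|lborel. f x) = 0"
  using lborel_integral_scale[OF assms(1), of "-1" 0] assms(2) by simp

lemma integrable_bounded_support:
  fixes f :: "real ^ 'n::finite \<Rightarrow> real"
  assumes [measurable]: "f \<in> borel_measurable borel"
    and "\<And>x. norm x \<le> R \<Longrightarrow> \<bar>f x\<bar> \<le> B" "\<And>x. norm x > R \<Longrightarrow> f x = 0"
  shows "integrable lborel f"
proof (rule Bochner_Integration.integrable_bound)
  have "emeasure lborel (cball (0::real ^ 'n) R) < \<infinity>"
    by (rule emeasure_bounded_finite) simp
  then show "integrable lborel (\<lambda>x. B * indicator (cball (0::real ^ 'n) R) x)"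
    by (intro integrable_mult_right) simp
  show "AE x in lborel. norm (f x) \<le> norm (B * indicator (cball 0 R) x)"
    using assms(2,3) by (intro AE_I2) (force simp: indicator_def dist_norm)
qed simp

text \<open>Each ray meets the shell \<open>1 \<le> norm v \<le> exp 1\<close> in a set of logarithmic length 1, so that the
  shell can replace the unit sphere and no surface measure is needed.\<close>

lemma nn_integral_polar:
  fixes F :: "real ^ 'n::finite \<Rightarrow> real"
  assumes [measurable]: "F \<in> borel_measurable borel" and F0: "\<And>x. 0 \<le> F x"
  shows "(\<integral>\<^sup>+u. ennreal (F u) \<partial>lborel) =
    (\<integral>\<^sup>+v. indicator {v. 1 \<le> norm v \<and> norm v \<le> exp 1} v *
      (\<integral>\<^sup>+l. ennreal (if 0 < l then l ^ (CARD('n) - 1) * F (l *\<^sub>R v) else 0) \<partial>lborel) \<partial>(lborel :: (real ^ 'n) measure))"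
proof -
  \<comment> \<open>Substituting \<open>u = l *\<^sub>R v\<close> turns the condition on
    \<open>l\<close> into \<open>v \<in> A\<close>, and the weight \<open>1 / l\<close> reduces the
    volume factor \<open>l ^ CARD('n)\<close> to \<open>l ^ (CARD('n) - 1)\<close>.\<close>
  define S where "S u l = (if norm u / exp 1 \<le> l \<and> l \<le> norm u then F u / l else 0)" for u :: "real ^ 'n" and l :: real
  define A where "A = {v :: real ^ 'n. 1 \<le> norm v \<and> norm v \<le> exp 1}"
  have [measurable]: "A \<in> sets borel" unfolding A_def by measurable
  have [measurable]: "case_prod (\<lambda>u l. ennreal (S u l)) \<in> borel_measurable (lborel \<Otimes>\<^sub>M lborel)"
    unfolding S_def by measurable
  have 1: "(\<integral>\<^sup>+l. ennreal (S u l) \<partial>lborel) = ennreal (F u)" if u: "u \<noteq> 0" for u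
  proof -
    have n: "0 < norm u / exp 1" using u by simp
    have le: "norm u / exp 1 \<le> norm u"
      using u by (simp add: divide_le_eq)
    have "(\<integral>\<^sup>+l. ennreal (S u l) \<partial>lborel) = (\<integral>\<^sup>+l. ennreal (F u / l) * indicator {norm u / exp 1 .. norm u} l \<partial>lborel)"
      by (intro nn_integral_cong) (auto simp: S_def indicator_def)
    also have "\<dots> = F u * ln (norm u) - F u * ln (norm u / exp 1)"
    proof (rule nn_integral_FTC_Icc[OF _ _ _ le])
      fix l assume "l \<in> {norm u / exp 1 .. norm u}"
      then have "0 < l" using n by (simp add: less_le_trans)
      then show "((\<lambda>l. F u * ln l) has_real_derivative F u / l) (at l)" "0 \<le> F u / l"
        using F0 by (auto intro!: derivative_eq_intros simp: field_simps)
    qed measurable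
    also have "F u * ln (norm u) - F u * ln (norm u / exp 1) = F u"
      using u by (simp add: ln_div algebra_simps)
    finally show ?thesis .
  qed
  have "(\<integral>\<^sup>+u. ennreal (F u) \<partial>lborel) = (\<integral>\<^sup>+u. \<integral>\<^sup>+l. ennreal (S u l) \<partial>lborel \<partial>lborel)"
    using AE_lborel_singleton[of "0 :: real ^ 'n"] by (intro nn_integral_cong_AE) (auto simp: 1 elim: eventually_mono)
  also have "\<dots> = (\<integral>\<^sup>+l. \<integral>\<^sup>+u. ennreal (S u l) \<partial>lborel \<partial>lborel)"
    by (rule lborel_pair.Fubini'[symmetric]) measurable
  also have "\<dots> = (\<integral>\<^sup>+l. \<integral>\<^sup>+v. ennreal (if 0 < l \<and> v \<in> A then l ^ (CARD('n) - 1) * F (l *\<^sub>R v) else 0) \<partial>lborel \<partial>lborel)"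
  proof (rule nn_integral_cong)
    fix l :: real
    show "(\<integral>\<^sup>+u. ennreal (S u l) \<partial>lborel) = (\<integral>\<^sup>+v. ennreal (if 0 < l \<and> v \<in> A then l ^ (CARD('n) - 1) * F (l *\<^sub>R v) else 0) \<partial>lborel)"
    proof (cases "0 < l")
      case True
      have "(\<integral>\<^sup>+u. ennreal (S u l) \<partial>lborel) = ennreal (\<bar>l\<bar> ^ CARD('n)) * (\<integral>\<^sup>+v. ennreal (S (0 + l *\<^sub>R v) l) \<partial>lborel)"
        by (rule nn_integral_lborel_scale) (use True in \<open>auto simp: S_def\<close>)
      also have "\<dots> = (\<integral>\<^sup>+v. ennreal (\<bar>l\<bar> ^ CARD('n)) * ennreal (S (0 + l *\<^sub>R v) l) \<partial>lborel)"
        by (rule nn_integral_cmult[symmetric]) (simp add: S_def)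
      also have "\<dots> = (\<integral>\<^sup>+v. ennreal (if 0 < l \<and> v \<in> A then l ^ (CARD('n) - 1) * F (l *\<^sub>R v) else 0) \<partial>lborel)"
      proof (rule nn_integral_cong)
        fix v :: "real ^ 'n"
        have "l ^ CARD('n) = l ^ (CARD('n) - 1) * l" by (simp flip: power_Suc2)
        moreover have "norm (l *\<^sub>R v) / exp 1 \<le> l \<and> l \<le> norm (l *\<^sub>R v) \<longleftrightarrow> v \<in> A"
          using True by (auto simp: A_def divide_le_eq)
        ultimately have "\<bar>l\<bar> ^ CARD('n) * S (0 + l *\<^sub>R v) l = (if 0 < l \<and> v \<in> A then l ^ (CARD('n) - 1) * F (l *\<^sub>R v) else 0)"
          using True by (simp add: S_def)
        then show "ennreal (\<bar>l\<bar> ^ CARD('n)) * ennreal (S (0 + l *\<^sub>R v) l) = ennreal (if 0 < l \<and> v \<in> A then l ^ (CARD('n) - 1) * F (l *\<^sub>R v) else 0)"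
          by (simp add: ennreal_mult'[symmetric])
      qed
      finally show ?thesis .
    next
      case False
      have "S u l = 0" for u
      proof (cases "norm u / exp 1 \<le> l \<and> l \<le> norm u")
        case True
        moreover have "0 \<le> norm u / exp 1" by simp
        ultimately have "l = 0" using False by linarith
        then show ?thesis by (simp add: S_def)
      qed (auto simp: S_def)
      then show ?thesis using False by simp
    qed
  qed
  also have "\<dots> = (\<integral>\<^sup>+v. \<integral>\<^sup>+l. ennreal (if 0 < l \<and> v \<in> A then l ^ (CARD('n) - 1) * F (l *\<^sub>R v) else 0) \<partial>lborel \<partial>lborel)"
    by (rule lborel_pair.Fubini') measurable
  also have "\<dots> = (\<integral>\<^sup>+v. indicator A v * (\<integral>\<^sup>+l. ennreal (if 0 < l then l ^ (CARD('n) - 1) * F (l *\<^sub>R v) else 0) \<partial>lborel) \<partial>lborel)"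
    by (intro nn_integral_cong) (auto simp: indicator_def)
  finally show ?thesis unfolding A_def .
qed

text \<open>The Jacobian of \<open>u \<mapsto> \<beta> u *\<^sub>R u\<close> is \<open>\<beta> u ^ (d - 1) * J u\<close>, with \<open>J\<close> the derivative
  of \<open>l \<mapsto> l * \<beta> (l *\<^sub>R v)\<close>; along each ray this is a one-dimensional substitution.\<close>

lemma nn_integral_radial_substitution:
  fixes g \<beta> J :: "real ^ 'n::finite \<Rightarrow> real"
  assumes [measurable]: "g \<in> borel_measurable borel" "\<beta> \<in> borel_measurable borel" "J \<in> borel_measurable borel"
    and g0: "\<And>x. 0 \<le> g x" and gs: "\<And>x. norm x > c * \<rho> \<Longrightarrow> g x = 0"
    and \<rho>: "0 < \<rho>" and c: "0 < c" and \<beta>: "\<And>u. norm u \<le> \<rho> \<Longrightarrow> c \<le> \<beta> u"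
    and der: "\<And>v l. 0 \<le> l \<Longrightarrow> norm (l *\<^sub>R v) \<le> \<rho> \<Longrightarrow> ((\<lambda>l. l * \<beta> (l *\<^sub>R v)) has_real_derivative J (l *\<^sub>R v)) (at l)"
    and J: "continuous_on (cball 0 \<rho>) J" "\<And>u. norm u \<le> \<rho> \<Longrightarrow> 0 \<le> J u"
  shows "(\<integral>\<^sup>+u. ennreal (if norm u \<le> \<rho> then g (\<beta> u *\<^sub>R u) * (\<beta> u ^ (CARD('n) - 1) * J u) else 0) \<partial>lborel)
    = (\<integral>\<^sup>+w. ennreal (g w) \<partial>lborel)"
proof -
  let ?F = "\<lambda>u. if norm u \<le> \<rho> then g (\<beta> u *\<^sub>R u) * (\<beta> u ^ (CARD('n) - 1) * J u) else 0"
  let ?I = "\<lambda>F (v :: real ^ 'n). (\<integral>\<^sup>+l. ennreal (if 0 < l then l ^ (CARD('n) - 1) * F (l *\<^sub>R v) else 0) \<partial>lborel)"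
  have F0: "0 \<le> ?F u" for u using \<beta>[of u] c J(2)[of u] g0 by auto
  have inner: "?I ?F v = ?I g v" if v: "1 \<le> norm v" for v :: "real ^ 'n"
  proof -
    define \<Lambda> where "\<Lambda> = \<rho> / norm v"
    define s where "s l = l * \<beta> (l *\<^sub>R v)" for l
    define k where "k t = t ^ (CARD('n) - 1) * g (t *\<^sub>R v)" for t
    have nv: "0 < norm v" using v by linarith
    have \<Lambda>: "0 < \<Lambda>" using \<rho> nv by (simp add: \<Lambda>_def)
    have in\<Lambda>: "norm (l *\<^sub>R v) \<le> \<rho> \<longleftrightarrow> l \<le> \<Lambda>" if "0 \<le> l" for l
      using that nv by (simp add: \<Lambda>_def field_simps)
    have sL: "g (t *\<^sub>R v) = 0" if "t > s \<Lambda>" for t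
    proof (rule gs)
      have "c * \<rho> = \<Lambda> * c * norm v" using nv by (simp add: \<Lambda>_def)
      also have "\<dots> \<le> s \<Lambda> * norm v"
        using \<beta>[of "\<Lambda> *\<^sub>R v"] in\<Lambda>[of \<Lambda>] \<Lambda> by (intro mult_right_mono) (auto simp: s_def mult_left_mono)
      also have "\<dots> < t * norm v" using that nv by simp
      also have "\<dots> \<le> norm (t *\<^sub>R v)" by (simp add: mult_right_mono)
      finally show "c * \<rho> < norm (t *\<^sub>R v)" .
    qed
    have "?I ?F v = (\<integral>\<^sup>+l. ennreal (k (s l) * J (l *\<^sub>R v) * indicator {0..\<Lambda>} l) \<partial>lborel)"
      using AE_lborel_singleton[of "0 :: real"]
    proof (intro nn_integral_cong_AE, eventually_elim)
      case (elim l)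
      have "(if 0 < l then l ^ (CARD('n) - 1) * ?F (l *\<^sub>R v) else 0) = k (s l) * J (l *\<^sub>R v) * indicator {0..\<Lambda>} l"
      proof (cases "0 < l \<and> l \<le> \<Lambda>")
        case True
        then have "?F (l *\<^sub>R v) = g (s l *\<^sub>R v) * (\<beta> (l *\<^sub>R v) ^ (CARD('n) - 1) * J (l *\<^sub>R v))"
          using in\<Lambda>[of l] by (simp add: s_def mult.commute)
        then show ?thesis using True
          by (simp add: k_def s_def power_mult_distrib mult_ac del: norm_scaleR)
      next
        case False
        then show ?thesis using elim in\<Lambda>[of l] by (auto simp del: norm_scaleR)
      qed
      then show ?case by (rule arg_cong)
    qed
    also have "\<dots> = (\<integral>\<^sup>+t. ennreal (k t * indicator {s 0..s \<Lambda>} t) \<partial>lborel)"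
    proof (rule nn_integral_substitution[symmetric])
      show "set_borel_measurable borel {s 0..s \<Lambda>} k"
        unfolding set_borel_measurable_def k_def by measurable
      show "(s has_real_derivative J (l *\<^sub>R v)) (at l)" if "l \<in> {0..\<Lambda>}" for l
        unfolding s_def using that in\<Lambda>[of l] by (intro der) auto
      show "continuous_on {0..\<Lambda>} (\<lambda>l. J (l *\<^sub>R v))"
        using in\<Lambda> by (intro continuous_on_compose2[OF J(1)] continuous_intros) auto
      show "0 \<le> J (l *\<^sub>R v)" if "l \<in> {0..\<Lambda>}" for l
        using that in\<Lambda>[of l] by (intro J(2)) auto
    qed (use \<Lambda> in simp)
    also have "\<dots> = ?I g v"
      using AE_lborel_singleton[of "0 :: real"]
    proof (intro nn_integral_cong_AE, eventually_elim)
      case (elim t)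
      have "0 \<le> s \<Lambda>" "s 0 = 0" using \<Lambda> \<beta>[of "\<Lambda> *\<^sub>R v"] c in\<Lambda>[of \<Lambda>] by (auto simp: s_def)
      then have "k t * indicator {s 0..s \<Lambda>} t = (if 0 < t then t ^ (CARD('n) - 1) * g (t *\<^sub>R v) else 0)"
        using elim sL[of t] by (auto simp: k_def indicator_def)
      then show ?case by (rule arg_cong)
    qed
    finally show ?thesis .
  qed
  have [measurable]: "?F \<in> borel_measurable borel" by measurable
  show ?thesis
    unfolding nn_integral_polar[of ?F, OF \<open>?F \<in> borel_measurable borel\<close> F0] nn_integral_polar[of g, OF assms(1) g0]
    using inner by (intro nn_integral_cong) (simp add: indicator_def)
qed

lemma integrable_pos_part:
  fixes g :: "'a \<Rightarrow> real"
  assumes "integrable M g" shows "integrable M (\<lambda>w. max 0 (g w))"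
  by (rule Bochner_Integration.integrable_bound[OF assms]) (use assms in auto)

text \<open>The later integrands change sign (\<open>kernel_L K\<close>, or \<open>K\<close> times
  an odd polynomial), so the non-negative case is applied to positive and negative parts.\<close>

lemma has_bochner_integral_radial_substitution:
  fixes g \<beta> J :: "real ^ 'n::finite \<Rightarrow> real"
  assumes m[measurable]: "g \<in> borel_measurable borel" "\<beta> \<in> borel_measurable borel" "J \<in> borel_measurable borel"
    and g: "integrable lborel g" and gs: "\<And>x. norm x > c * \<rho> \<Longrightarrow> g x = 0"
    and \<rho>: "0 < \<rho>" and c: "0 < c" and \<beta>: "\<And>u. norm u \<le> \<rho> \<Longrightarrow> c \<le> \<beta> u"
    and der: "\<And>v l. 0 \<le> l \<Longrightarrow> norm (l *\<^sub>R v) \<le> \<rho> \<Longrightarrow> ((\<lambda>l. l * \<beta> (l *\<^sub>R v)) has_real_derivative J (l *\<^sub>R v)) (at l)"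
    and J: "continuous_on (cball 0 \<rho>) J" "\<And>u. norm u \<le> \<rho> \<Longrightarrow> 0 \<le> J u"
  shows "has_bochner_integral lborel (\<lambda>u. if norm u \<le> \<rho> then g (\<beta> u *\<^sub>R u) * (\<beta> u ^ (CARD('n) - 1) * J u) else 0)
    (LINT w|lborel. g w)"
proof -
  have nn: "has_bochner_integral lborel (\<lambda>u. if norm u \<le> \<rho> then k (\<beta> u *\<^sub>R u) * (\<beta> u ^ (CARD('n) - 1) * J u) else 0)
    (LINT w|lborel. k w)" if [measurable]: "k \<in> borel_measurable borel" and k: "integrable lborel k" "\<And>x. 0 \<le> k x" "\<And>x. norm x > c * \<rho> \<Longrightarrow> k x = 0" for k
  proof (rule has_bochner_integral_nn_integral)
    show "AE u in lborel. 0 \<le> (if norm u \<le> \<rho> then k (\<beta> u *\<^sub>R u) * (\<beta> u ^ (CARD('n) - 1) * J u) else 0)"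
    proof (rule AE_I2)
      fix u show "0 \<le> (if norm u \<le> \<rho> then k (\<beta> u *\<^sub>R u) * (\<beta> u ^ (CARD('n) - 1) * J u) else 0)"
        using \<beta>[of u] c J(2)[of u] k(2) by auto
    qed
    show "(\<integral>\<^sup>+u. ennreal (if norm u \<le> \<rho> then k (\<beta> u *\<^sub>R u) * (\<beta> u ^ (CARD('n) - 1) * J u) else 0) \<partial>lborel)
       = ennreal (LINT w|lborel. k w)"
      using nn_integral_radial_substitution[of k \<beta> J c \<rho>] that m(2,3) \<rho> c \<beta> der J
      by (simp add: nn_integral_eq_integral)
  qed (use k(2) in \<open>auto intro: Bochner_Integration.integral_nonneg\<close>)
  have "has_bochner_integral lborel (\<lambda>u. (if norm u \<le> \<rho> then max 0 (g (\<beta> u *\<^sub>R u)) * (\<beta> u ^ (CARD('n) - 1) * J u) else 0)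
     - (if norm u \<le> \<rho> then max 0 (- g (\<beta> u *\<^sub>R u)) * (\<beta> u ^ (CARD('n) - 1) * J u) else 0))
    ((LINT w|lborel. max 0 (g w)) - (LINT w|lborel. max 0 (- g w)))"
    using g gs by (intro has_bochner_integral_diff nn[of "\<lambda>w. max 0 (g w)"] nn[of "\<lambda>w. max 0 (- g w)"] integrable_pos_part integrable_minus) auto
  also have "(\<lambda>u. (if norm u \<le> \<rho> then max 0 (g (\<beta> u *\<^sub>R u)) * (\<beta> u ^ (CARD('n) - 1) * J u) else 0)
     - (if norm u \<le> \<rho> then max 0 (- g (\<beta> u *\<^sub>R u)) * (\<beta> u ^ (CARD('n) - 1) * J u) else 0))
     = (\<lambda>u. if norm u \<le> \<rho> then g (\<beta> u *\<^sub>R u) * (\<beta> u ^ (CARD('n) - 1) * J u) else 0)"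
    by (auto simp: max_def fun_eq_iff)
  also have "(LINT w|lborel. max 0 (g w)) - (LINT w|lborel. max 0 (- g w)) = (LINT w|lborel. g w)"
    unfolding Bochner_Integration.integral_diff[OF integrable_pos_part[OF g] integrable_pos_part[OF integrable_minus[OF g]], symmetric]
    by (intro Bochner_Integration.integral_cong) (auto simp: max_def)
  finally show ?thesis .
qed

lemma continuous_on_radial:
  fixes \<psi> :: "real \<Rightarrow> real"
  assumes "continuous_on {0..} \<psi>"
  shows "continuous_on UNIV (\<lambda>x :: real ^ 'n::finite. \<psi> ((norm x)\<^sup>2))"
  by (rule continuous_on_compose2[OF assms]) (auto intro!: continuous_intros)

lemma integrable_radial:
  fixes \<psi> :: "real \<Rightarrow> real"
  assumes c: "continuous_on {0..} \<psi>" and s: "\<And>s. s > T \<Longrightarrow> \<psi> s = 0" and T: "0 < T"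
  shows "integrable lborel (\<lambda>x :: real ^ 'n::finite. \<psi> ((norm x)\<^sup>2))"
proof -
  have "compact (\<psi> ` {0..T})"
    by (intro compact_continuous_image continuous_on_subset[OF c]) auto
  then obtain B where B: "\<And>s. s \<in> {0..T} \<Longrightarrow> \<bar>\<psi> s\<bar> \<le> B"
    using compact_imp_bounded bounded_iff by (metis imageI real_norm_def)
  show ?thesis
  proof (rule integrable_bounded_support[where R="sqrt T" and B=B])
    show "(\<lambda>x :: real ^ 'n. \<psi> ((norm x)\<^sup>2)) \<in> borel_measurable borel"
      by (intro borel_measurable_continuous_onI continuous_on_radial c)
    show "\<bar>\<psi> ((norm x)\<^sup>2)\<bar> \<le> B" if "norm x \<le> sqrt T" for x :: "real ^ 'n"
      using that T power_mono[of "norm x" "sqrt T" 2] by (intro B) auto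
    show "\<psi> ((norm x)\<^sup>2) = 0" if "sqrt T < norm x" for x :: "real ^ 'n"
      using that T by (intro s) (metis abs_norm_cancel real_sqrt_abs real_sqrt_less_iff)
  qed
qed

lemma derivative_zero_beyond:
  fixes \<psi> :: "real \<Rightarrow> real"
  assumes d: "(\<psi> has_real_derivative D) (at s within {0..})"
    and z: "\<And>s. s > T \<Longrightarrow> \<psi> s = 0" and T: "0 < T" "T < s"
  shows "D = 0"
proof -
  have s: "at s within {0..} = at s" using T by (intro at_within_interior) auto
  have "\<forall>\<^sub>F x in nhds s. x \<in> {T<..}" using T by (intro eventually_nhds_in_open) auto
  then have "\<forall>\<^sub>F x in nhds s. \<psi> x = 0" by eventually_elim (auto simp: z)
  then have "(\<psi> has_real_derivative D) (at s) \<longleftrightarrow> ((\<lambda>_. 0) has_real_derivative D) (at s)"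
    by (intro DERIV_cong_ev) auto
  then have "((\<lambda>_. 0 :: real) has_real_derivative D) (at s)" using d s by simp
  then show ?thesis using DERIV_unique DERIV_const by blast
qed

text \<open>The integrand is the divergence of the vector field
  \<open>\<psi> ((norm x)^2) x\<close>. Its integral vanishes by scaling: the integral of
  \<open>\<psi> ((l * norm x)^2)\<close> is a constant over \<open>l ^ CARD('n)\<close>, and
  differentiating both sides at \<open>l = 1\<close> under the integral yields the claim.\<close>

lemma integral_radial_divergence:
  fixes \<psi> \<psi>' :: "real \<Rightarrow> real"
  assumes d: "\<And>s. 0 \<le> s \<Longrightarrow> (\<psi> has_real_derivative \<psi>' s) (at s within {0..})"
    and c: "continuous_on {0..} \<psi>'" and z: "\<And>s. s > T \<Longrightarrow> \<psi> s = 0" and T: "0 < T"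
  shows "(LINT x|lborel. real CARD('n) * \<psi> ((norm (x :: real ^ 'n::finite))\<^sup>2) + 2 * (norm x)\<^sup>2 * \<psi>' ((norm x)\<^sup>2)) = 0"
proof -
  have c0: "continuous_on {0..} \<psi>"
    using d by (intro DERIV_continuous_on) auto
  have z': "\<psi>' s = 0" if "s > T" for s
    using derivative_zero_beyond[OF d z T that] that T by simp
  have i0: "integrable lborel (\<lambda>x :: real ^ 'n. \<psi> ((norm x)\<^sup>2))"
    by (rule integrable_radial[OF c0 z T])
  have i1: "integrable lborel (\<lambda>x :: real ^ 'n. 2 * (norm x)\<^sup>2 * \<psi>' ((norm x)\<^sup>2))"
    by (rule integrable_radial[where \<psi>="\<lambda>s. 2 * s * \<psi>' s", OF _ _ T]) (auto intro!: continuous_intros c simp: z')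
  define I where "I = (LINT x|lborel. \<psi> ((norm (x :: real ^ 'n))\<^sup>2))"
  \<comment> \<open>Since \<open>l\<close> is at least \<open>1/2\<close> on \<open>U\<close>, the
    radius \<open>2 * sqrt T\<close> keeps the supports of all dilated functions inside one box,
    over which the Leibniz rule applies.\<close>
  define R where "R = 2 * sqrt T"
  define U where "U = {1/2..2 :: real}"
  let ?B = "cbox (\<chi> i. - R) (\<chi> i. R) :: (real ^ 'n) set"
  have out: "T < (l * norm x)\<^sup>2" if x: "x \<notin> ?B" and l: "l \<in> U" for x :: "real ^ 'n" and l
  proof -
    obtain i where "\<not> (- R \<le> x $ i \<and> x $ i \<le> R)"
      using x unfolding mem_box_cart by auto
    then have "R < \<bar>x $ i\<bar>" by auto
    also have "\<dots> \<le> norm x" by (rule component_le_norm_cart)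
    finally have "sqrt T < 1/2 * norm x" by (simp add: R_def)
    also have "\<dots> \<le> l * norm x" using l by (intro mult_right_mono) (auto simp: U_def)
    finally show ?thesis using T by (metis real_sqrt_less_iff real_sqrt_abs abs_ge_self less_le_trans)
  qed
  have hi: "((\<lambda>x. g x) has_integral (LINT x|lborel. g x)) ?B" if "integrable lborel g" "\<And>x. x \<notin> ?B \<Longrightarrow> g x = 0" for g :: "real ^ 'n \<Rightarrow> real"
  proof -
    have "(\<lambda>x. if x \<in> ?B then g x else 0) = g" using that(2) by auto
    then show ?thesis
      using has_integral_integral_lborel[OF that(1)] has_integral_restrict_UNIV[of ?B g] by simp
  qed
  have sc: "integrable lborel (\<lambda>x :: real ^ 'n. \<psi> ((l * norm x)\<^sup>2))" "(LINT x|lborel. \<psi> ((l * norm (x :: real ^ 'n))\<^sup>2)) = I / l ^ CARD('n)"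
    if "l \<in> U" for l
    using lborel_integrable_scale[OF i0, of l 0] lborel_integral_scale[of "\<lambda>x :: real ^ 'n. \<psi> ((norm x)\<^sup>2)" l 0] i0 that
    by (auto simp: I_def U_def power_mult_distrib)
  have "((\<lambda>l. integral ?B (\<lambda>x. \<psi> ((l * norm x)\<^sup>2))) has_field_derivative integral ?B (\<lambda>x. 2 * 1 * (norm x)\<^sup>2 * \<psi>' ((1 * norm x)\<^sup>2))) (at 1 within U)"
  proof (rule leibniz_rule_field_derivative)
    fix l :: real and x :: "real ^ 'n" assume l: "l \<in> U"
    show "((\<lambda>l. \<psi> ((l * norm x)\<^sup>2)) has_field_derivative 2 * l * (norm x)\<^sup>2 * \<psi>' ((l * norm x)\<^sup>2)) (at l within U)"
    proof -
      have "((\<lambda>l. (l * norm x)\<^sup>2) has_real_derivative 2 * l * (norm x)\<^sup>2) (at l within U)"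
        by (auto intro!: derivative_eq_intros simp: power2_eq_square)
      moreover have "(\<psi> has_real_derivative \<psi>' ((l * norm x)\<^sup>2)) (at ((l * norm x)\<^sup>2) within (\<lambda>l. (l * norm x)\<^sup>2) ` U)"
        by (rule has_field_derivative_subset[OF d]) auto
      ultimately have "(\<psi> \<circ> (\<lambda>l. (l * norm x)\<^sup>2) has_real_derivative \<psi>' ((l * norm x)\<^sup>2) * (2 * l * (norm x)\<^sup>2)) (at l within U)"
        by (intro DERIV_image_chain)
      then show ?thesis unfolding o_def by (simp only: mult.commute)
    qed
    show "(\<lambda>x. \<psi> ((l * norm x)\<^sup>2)) integrable_on ?B"
      using hi[OF sc(1)[OF l]] out[OF _ l] z by blast
  next
    show "continuous_on (U \<times> ?B) (\<lambda>(l, x). 2 * l * (norm x)\<^sup>2 * \<psi>' ((l * norm x)\<^sup>2))"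
      unfolding split_def by (intro continuous_intros continuous_on_compose2[OF c]) auto
  qed (auto simp: U_def)
  note D = this
  have eq1: "integral ?B (\<lambda>x. \<psi> ((l * norm x)\<^sup>2)) = I / l ^ CARD('n)" if "l \<in> U" for l
    using hi[OF sc(1)[OF that]] out[OF _ that] z sc(2)[OF that] by (intro integral_unique) auto
  have eq2: "integral ?B (\<lambda>x. 2 * 1 * (norm x)\<^sup>2 * \<psi>' ((1 * norm x)\<^sup>2)) = (LINT x|lborel. 2 * (norm (x :: real ^ 'n))\<^sup>2 * \<psi>' ((norm x)\<^sup>2))"
    using hi[OF i1] out[of _ 1] z' by (intro integral_unique) (auto simp: U_def)
  have "((\<lambda>l. I / l ^ CARD('n)) has_real_derivative (LINT x|lborel. 2 * (norm (x :: real ^ 'n))\<^sup>2 * \<psi>' ((norm x)\<^sup>2))) (at 1 within U)"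
    by (rule has_field_derivative_transform_within[OF D[unfolded eq2] zero_less_one]) (auto simp: eq1, simp add: U_def)
  moreover have "at 1 within U = at (1 :: real)" by (intro at_within_interior) (auto simp: U_def)
  ultimately have "((\<lambda>l. I / l ^ CARD('n)) has_real_derivative (LINT x|lborel. 2 * (norm (x :: real ^ 'n))\<^sup>2 * \<psi>' ((norm x)\<^sup>2))) (at 1)"
    by simp
  moreover have "((\<lambda>l. I / l ^ CARD('n)) has_real_derivative - (real CARD('n) * I)) (at 1)"
    by (auto intro!: derivative_eq_intros simp: power2_eq_square)
  ultimately have "(LINT x|lborel. 2 * (norm (x :: real ^ 'n))\<^sup>2 * \<psi>' ((norm x)\<^sup>2)) = - (real CARD('n) * I)"
    by (rule DERIV_unique)
  then show ?thesis using i0 i1 by (simp add: I_def)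
qed

subsection \<open>Radial kernels\<close>

text \<open>The derivatives that \<open>radial_kernel\<close> only asserts to exist are fixed here
  as \<open>\<Phi>1\<close> and \<open>\<Phi>2\<close>, with one common bound
  \<open>\<kappa>\<close> for the function and both derivatives.\<close>

locale smooth_kernel =
  fixes \<Phi> \<Phi>1 \<Phi>2 :: "real \<Rightarrow> real" and T \<kappa> :: real and d :: nat and K :: "real ^ 'n::finite \<Rightarrow> real"
  assumes d_eq: "d = CARD('n)" and T_pos: "0 < T" and \<kappa>_pos: "0 < \<kappa>"
    and \<Phi>_deriv: "\<And>s. 0 \<le> s \<Longrightarrow> (\<Phi> has_real_derivative \<Phi>1 s) (at s within {0..})"
    and \<Phi>1_deriv: "\<And>s. 0 \<le> s \<Longrightarrow> (\<Phi>1 has_real_derivative \<Phi>2 s) (at s within {0..})"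
    and \<Phi>_le: "\<And>s. 0 \<le> s \<Longrightarrow> \<bar>\<Phi> s\<bar> \<le> \<kappa>" and \<Phi>1_le: "\<And>s. 0 \<le> s \<Longrightarrow> \<bar>\<Phi>1 s\<bar> \<le> \<kappa>"
    and \<Phi>2_le: "\<And>s. 0 \<le> s \<Longrightarrow> \<bar>\<Phi>2 s\<bar> \<le> \<kappa>"
    and \<Phi>_zero: "\<And>s. T < s \<Longrightarrow> \<Phi> s = 0"
    and K_eq: "\<And>x. K x = \<Phi> ((norm x)\<^sup>2)" and K_nonneg: "\<And>x. 0 \<le> K x"
    and K_int: "has_bochner_integral lborel K 1"

lemma radial_kernel_imp_smooth_kernel:
  fixes K :: "real ^ 'n::finite \<Rightarrow> real"
  assumes "radial_kernel \<Phi> T K"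
  obtains \<Phi>1 \<Phi>2 T' \<kappa> where "smooth_kernel \<Phi> \<Phi>1 \<Phi>2 T' \<kappa> CARD('n) K"
proof -
  obtain \<Phi>1 \<Phi>2 where d: "\<And>s. 0 \<le> s \<Longrightarrow> (\<Phi> has_real_derivative \<Phi>1 s) (at s within {0..})"
      "\<And>s. 0 \<le> s \<Longrightarrow> (\<Phi>1 has_real_derivative \<Phi>2 s) (at s within {0..})" and b: "bounded (\<Phi>2 ` {0..})"
    using assms unfolding radial_kernel_def bounded_second_derivative_on_def by (meson atLeast_iff)
  \<comment> \<open>Enlarging the support bound is harmless and makes it positive.\<close>
  define T' where "T' = max T 1"
  have T': "0 < T'" by (simp add: T'_def)
  have z: "\<Phi> s = 0" if "T' < s" for s
  proof (rule ccontr)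
    assume "\<Phi> s \<noteq> 0"
    then have "s \<in> closure {s. 0 \<le> s \<and> \<Phi> s \<noteq> 0}"
      using that T' by (intro subsetD[OF closure_subset]) auto
    then have "s \<in> {0..T}" using assms unfolding radial_kernel_def by blast
    then show False using that by (simp add: T'_def)
  qed
  have z1: "\<Phi>1 s = 0" if "T' < s" for s
    using derivative_zero_beyond[OF d(1) z T' that] that T' by simp
  have bd: "\<exists>B. \<forall>s\<ge>0. \<bar>g s\<bar> \<le> B" if "continuous_on {0..} g" "\<And>s. T' < s \<Longrightarrow> g s = 0" for g :: "real \<Rightarrow> real"
  proof -
    have "compact (g ` {0..T'})"
      by (intro compact_continuous_image continuous_on_subset[OF that(1)]) auto
    then obtain B where B: "\<And>s. s \<in> {0..T'} \<Longrightarrow> \<bar>g s\<bar> \<le> B"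
      using compact_imp_bounded bounded_iff by (metis imageI real_norm_def)
    have "\<bar>g s\<bar> \<le> B" if "0 \<le> s" for s
      using B[of s] B[of 0] \<open>\<And>s. T' < s \<Longrightarrow> g s = 0\<close>[of s] that T' by (cases "s \<le> T'") auto
    then show ?thesis by blast
  qed
  obtain B0 where B0: "\<And>s. 0 \<le> s \<Longrightarrow> \<bar>\<Phi> s\<bar> \<le> B0"
    using bd[OF DERIV_continuous_on[OF d(1)] z] by auto
  obtain B1 where B1: "\<And>s. 0 \<le> s \<Longrightarrow> \<bar>\<Phi>1 s\<bar> \<le> B1"
    using bd[OF DERIV_continuous_on[OF d(2)] z1] by auto
  obtain B2 where B2: "\<And>s. 0 \<le> s \<Longrightarrow> \<bar>\<Phi>2 s\<bar> \<le> B2"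
    using b unfolding bounded_iff by auto
  define \<kappa> where "\<kappa> = max 1 (max B0 (max B1 B2))"
  have "smooth_kernel \<Phi> \<Phi>1 \<Phi>2 T' \<kappa> CARD('n) K"
    using assms d z T' B0 B1 B2 unfolding radial_kernel_def
    by unfold_locales (auto simp: \<kappa>_def le_max_iff_disj)
  then show ?thesis by (rule that)
qed

context smooth_kernel
begin

text \<open>The radial profile of \<open>kernel_L K\<close>: on functions of
  \<open>s = (norm x)^2\<close>, the sum of \<open>x $ i\<close> times the \<open>i\<close>-th
  partial derivative becomes \<open>2 * s\<close> times the derivative in \<open>s\<close>.\<close>

definition l :: "real \<Rightarrow> real" where "l s = real d * \<Phi> s + 2 * s * \<Phi>1 s"

lemma \<Phi>1_zero: "T < s \<Longrightarrow> \<Phi>1 s = 0"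
  using derivative_zero_beyond[OF \<Phi>_deriv \<Phi>_zero T_pos] T_pos by force

lemma \<Phi>2_zero: "T < s \<Longrightarrow> \<Phi>2 s = 0"
  using derivative_zero_beyond[OF \<Phi>1_deriv \<Phi>1_zero T_pos] T_pos by force

lemma l_zero: "T < s \<Longrightarrow> l s = 0"
  by (simp add: l_def \<Phi>_zero \<Phi>1_zero)

lemma \<Phi>_cont: "continuous_on {0..} \<Phi>" and \<Phi>1_cont: "continuous_on {0..} \<Phi>1"
  using \<Phi>_deriv \<Phi>1_deriv by (auto intro!: DERIV_continuous_on)

lemma l_cont: "continuous_on {0..} l"
  unfolding l_def by (intro continuous_intros \<Phi>_cont \<Phi>1_cont)

lemma l_deriv: "0 \<le> s \<Longrightarrow> (l has_real_derivative (real d + 2) * \<Phi>1 s + 2 * s * \<Phi>2 s) (at s within {0..})"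
  unfolding l_def by (auto intro!: derivative_eq_intros \<Phi>_deriv \<Phi>1_deriv simp: algebra_simps)

lemma K_le: "K x \<le> \<kappa>"
  using \<Phi>_le[of "(norm x)\<^sup>2"] by (simp add: K_eq)

lemma K_cont: "continuous_on UNIV K"
  unfolding K_eq[abs_def] by (rule continuous_on_radial[OF \<Phi>_cont])

lemma K_measurable [measurable]: "K \<in> borel_measurable borel"
  by (intro borel_measurable_continuous_onI K_cont)

lemma K_zero: "T < (norm x)\<^sup>2 \<Longrightarrow> K x = 0"
  by (simp add: K_eq \<Phi>_zero)

lemma K_minus: "K (- x) = K x"
  by (simp add: K_eq)

lemma K_integrable: "integrable lborel K" and K_integral: "(LINT x|lborel. K x) = 1"
  using K_int by (auto simp: has_bochner_integral_iff)

text \<open>At the origin \<open>\<Phi>\<close> has only a one-sided derivative. The chain rule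
  still applies because squared norms stay in \<open>{0..}\<close>, so that the derivative is needed
  only within the image.\<close>

lemma partial_deriv_K: "partial_deriv i K x = \<Phi>1 ((norm x)\<^sup>2) * (2 * x $ i)"
proof (rule partial_deriv_I)
  let ?N = "\<lambda>s. (norm (x + s *\<^sub>R axis i 1))\<^sup>2"
  have N: "?N s = (norm x)\<^sup>2 + 2 * s * x $ i + s\<^sup>2" for s
    unfolding power2_norm_eq_inner
    by (simp add: inner_add_left inner_add_right inner_axis inner_axis' power2_eq_square algebra_simps)
  have "(?N has_real_derivative 2 * x $ i) (at 0)"
    unfolding N by (auto intro!: derivative_eq_intros)
  moreover have "(\<Phi> has_real_derivative \<Phi>1 ((norm x)\<^sup>2)) (at (?N 0) within ?N ` UNIV)"
    using has_field_derivative_subset[OF \<Phi>_deriv[of "(norm x)\<^sup>2"], of "range ?N"] by (simp add: image_subset_iff)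
  ultimately show "((\<lambda>s. K (x + s *\<^sub>R axis i 1)) has_real_derivative \<Phi>1 ((norm x)\<^sup>2) * (2 * x $ i)) (at 0)"
    unfolding K_eq using DERIV_image_chain[of \<Phi> "\<Phi>1 ((norm x)\<^sup>2)" ?N 0 UNIV] by (simp add: o_def)
qed

lemma kernel_L_eq: "kernel_L K x = l ((norm x)\<^sup>2)"
proof -
  have "(\<Sum>i\<in>UNIV. x $ i * (\<Phi>1 ((norm x)\<^sup>2) * (2 * x $ i))) = 2 * \<Phi>1 ((norm x)\<^sup>2) * (\<Sum>i\<in>UNIV. x $ i * x $ i)"
    unfolding sum_distrib_left by (intro sum.cong) auto
  also have "(\<Sum>i\<in>UNIV. x $ i * x $ i) = (norm x)\<^sup>2"
    unfolding power2_norm_eq_inner inner_vec_def by simp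
  finally show ?thesis by (simp add: kernel_L_def partial_deriv_K l_def K_eq flip: d_eq)
qed

lemma kernel_L_cont: "continuous_on UNIV (kernel_L K)"
  unfolding kernel_L_eq[abs_def] by (rule continuous_on_radial[OF l_cont])

lemma kernel_L_measurable [measurable]: "kernel_L K \<in> borel_measurable borel"
  by (intro borel_measurable_continuous_onI kernel_L_cont)

lemma kernel_L_integrable: "integrable lborel (kernel_L K)"
  unfolding kernel_L_eq[abs_def] by (rule integrable_radial[OF l_cont l_zero T_pos])

lemma kernel_L_integral: "(LINT x|lborel. kernel_L K x) = 0"
  using integral_radial_divergence[OF \<Phi>_deriv \<Phi>1_cont \<Phi>_zero T_pos, where 'n='n]
  by (simp add: kernel_L_eq l_def flip: d_eq)

text \<open>Twice \<open>K * L\<close> is \<open>d * K^2\<close> plus the divergence of the field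
  \<open>K^2 x\<close>, and that divergence integrates to zero. The identity turns the cross term of
  the variance into a multiple of \<open>kernel_mu0 K\<close>.\<close>

lemma K_kernel_L_integral: "(LINT x|lborel. K x * kernel_L K x) = real d / 2 * kernel_mu0 K"
proof -
  let ?g = "\<lambda>s. real d * (\<Phi> s)\<^sup>2 + 2 * s * (2 * \<Phi> s * \<Phi>1 s)"
  have "(LINT x|lborel. real d * (\<Phi> ((norm x)\<^sup>2))\<^sup>2 + 2 * (norm (x :: real ^ 'n))\<^sup>2 * (2 * \<Phi> ((norm x)\<^sup>2) * \<Phi>1 ((norm x)\<^sup>2))) = 0"
    unfolding d_eq
  proof (rule integral_radial_divergence[where T=T])
    show "((\<lambda>s. (\<Phi> s)\<^sup>2) has_real_derivative 2 * \<Phi> s * \<Phi>1 s) (at s within {0..})" if "0 \<le> s" for s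
      using that by (auto intro!: derivative_eq_intros \<Phi>_deriv)
  qed (auto intro!: continuous_intros \<Phi>_cont \<Phi>1_cont simp: \<Phi>_zero T_pos)
  moreover have "(\<lambda>x. real d * (\<Phi> ((norm x)\<^sup>2))\<^sup>2 + 2 * (norm (x :: real ^ 'n))\<^sup>2 * (2 * \<Phi> ((norm x)\<^sup>2) * \<Phi>1 ((norm x)\<^sup>2)))
     = (\<lambda>x. 2 * (K x * kernel_L K x) - real d * (K x)\<^sup>2)"
    by (auto simp: fun_eq_iff K_eq kernel_L_eq l_def power2_eq_square algebra_simps)
  moreover have "integrable lborel (\<lambda>x :: real ^ 'n. K x * kernel_L K x)"
    unfolding K_eq kernel_L_eq by (rule integrable_radial[OF _ _ T_pos]) (auto intro!: continuous_intros \<Phi>_cont l_cont simp: \<Phi>_zero)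
  moreover have "integrable lborel (\<lambda>x :: real ^ 'n. (K x)\<^sup>2)"
    unfolding K_eq by (rule integrable_radial[OF _ _ T_pos]) (auto intro!: continuous_intros \<Phi>_cont simp: \<Phi>_zero)
  ultimately show ?thesis unfolding kernel_mu0_def by simp
qed

text \<open>Makes the limit variance positive, without which \<open>normal_law\<close> would not be
  a probability measure.\<close>

lemma kernel_mu0_pos: "0 < kernel_mu0 K"
proof -
  have i: "integrable lborel (\<lambda>x :: real ^ 'n. (K x)\<^sup>2)"
    unfolding K_eq by (rule integrable_radial[OF _ _ T_pos]) (auto intro!: continuous_intros \<Phi>_cont simp: \<Phi>_zero)
  have "0 \<le> kernel_mu0 K" unfolding kernel_mu0_def by (intro Bochner_Integration.integral_nonneg) auto
  moreover have "kernel_mu0 K \<noteq> 0"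
  proof
    assume "kernel_mu0 K = 0"
    then have "AE x in lborel. (K x)\<^sup>2 = 0"
      unfolding kernel_mu0_def using i by (subst (asm) integral_nonneg_eq_0_iff_AE) auto
    then have "(LINT x|lborel. K x) = (LINT x|(lborel :: (real ^ 'n) measure). 0)"
      by (intro integral_cong_AE) auto
    then show False by (simp add: K_integral)
  qed
  ultimately show ?thesis by simp
qed

end

subsection \<open>A Lagrange inversion to fourth order\<close>

text \<open>A calculus of error orders in a small quantity \<open>e\<close> along a filter. The
  filter used later is a product with a principal filter, so that every order is uniform over a ball
  of directions.\<close>

locale small_param =
  fixes F :: "'a filter" and e :: "'a \<Rightarrow> real"
  assumes e_tendsto: "(e \<longlongrightarrow> 0) F"
begin

definition BO :: "nat \<Rightarrow> ('a \<Rightarrow> real) \<Rightarrow> bool" where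
  "BO k g \<longleftrightarrow> g \<in> O[F](\<lambda>x. e x ^ k)"

lemma BO_add: "BO k g \<Longrightarrow> BO k h \<Longrightarrow> BO k (\<lambda>x. g x + h x)"
  and BO_diff: "BO k g \<Longrightarrow> BO k h \<Longrightarrow> BO k (\<lambda>x. g x - h x)"
  unfolding BO_def by (rule sum_in_bigo; assumption)+

lemma BO_mult: "BO j g \<Longrightarrow> BO k h \<Longrightarrow> BO (j + k) (\<lambda>x. g x * h x)"
  unfolding BO_def by (simp add: power_add landau_o.big.mult)

lemma BO_mult0: "BO 0 g \<Longrightarrow> BO 0 h \<Longrightarrow> BO 0 (\<lambda>x. g x * h x)"
  using BO_mult[of 0 g 0 h] by simp

lemma BO_const: "BO 0 (\<lambda>x. c)"
  unfolding BO_def by simp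

lemma BO_power0: "BO 0 g \<Longrightarrow> BO 0 (\<lambda>x. g x ^ n)"
  by (induction n) (auto simp: BO_const BO_mult0)

lemma BO_e_power: "BO k (\<lambda>x. e x ^ k)"
  unfolding BO_def by simp

lemma BO_Suc_D: "BO (Suc k) g \<Longrightarrow> BO k g"
proof -
  assume a: "BO (Suc k) g"
  have "(\<lambda>x. e x ^ k * e x) \<in> O[F](\<lambda>x. e x ^ k * 1)"
    by (intro landau_o.big.mult landau_o.big_refl landau_o.small_imp_big) (use e_tendsto in \<open>simp add: smalloI_tendsto\<close>)
  then show ?thesis using a unfolding BO_def by (auto simp: mult.commute intro: landau_o.big_trans)
qed

lemma BO_mono: "j \<le> k \<Longrightarrow> BO k g \<Longrightarrow> BO j g"
  by (induction k rule: dec_induct) (auto dest: BO_Suc_D)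

lemma BO_e: "BO 0 e"
  using BO_mono[of 0 1 e] BO_e_power[of 1] by simp

lemma BO_smallo: "BO (Suc k) g \<Longrightarrow> g \<in> o[F](\<lambda>x. e x ^ k)"
proof -
  assume a: "BO (Suc k) g"
  have "(\<lambda>x. e x ^ k * e x) \<in> o[F](\<lambda>x. e x ^ k * 1)"
    by (intro landau_o.big_small_mult landau_o.big_refl) (use e_tendsto in \<open>simp add: smalloI_tendsto\<close>)
  then show ?thesis using a unfolding BO_def by (auto simp: mult.commute intro: landau_o.big_small_trans)
qed

lemma smallo_BO: "g \<in> o[F](\<lambda>x. e x ^ k) \<Longrightarrow> BO k g"
  unfolding BO_def by (rule landau_o.small_imp_big)

lemmas BO_0_intros = BO_add BO_diff BO_mult0 BO_const BO_power0 BO_e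

lemma BO_e_times: "BO 0 g \<Longrightarrow> BO k (\<lambda>x. e x ^ k * g x)"
  using BO_mult[OF BO_e_power[of k], of 0 g] by simp

lemma BO_eq: "BO k g \<Longrightarrow> (\<And>x. h x = g x) \<Longrightarrow> BO k h"
  unfolding BO_def by (rule landau_o.big.in_cong[THEN iffD1, rotated]) auto

lemma BO_cube_diff:
  assumes x: "BO 1 (\<lambda>p. x p)" and y: "BO 2 (\<lambda>p. x p - y p)"
  shows "BO 2 (\<lambda>p. (1 + x p) ^ 3 - (1 + 3 * y p))"
proof -
  have "BO 2 (\<lambda>p. x p * x p)" using BO_mult[OF x x] by (simp add: numeral_2_eq_2)
  moreover have "BO 2 (\<lambda>p. (x p * x p) * (3 + x p))"
    using BO_mult[OF calculation, of 0 "\<lambda>p. 3 + x p"] BO_mono[OF _ x, of 0] by (simp add: BO_0_intros)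
  ultimately have "BO 2 (\<lambda>p. (x p - y p) * 3 + (x p * x p) * (3 + x p))"
    using BO_mult[OF y BO_const[of 3]] by (intro BO_add) auto
  then show ?thesis by (rule BO_eq) (simp add: power3_eq_cube algebra_simps)
qed

text \<open>\<open>\<gamma>\<close> models a positive function along a ray, normalised to 1 at the
  base point; \<open>\<delta>\<close> is \<open>\<gamma>\<close> minus half of \<open>e\<close>
  times its derivative; \<open>\<omega> = \<gamma>^(-1/2)\<close> relates the old variable
  \<open>e\<close> to the new one \<open>e * \<omega>\<close>. By Lagrange inversion, the
  coefficients of \<open>1 / \<delta>\<close> in the new variable at orders 1 to 4 are the Taylor
  coefficients of \<open>\<gamma>^(-1/2)\<close>, \<open>\<gamma>^0\<close>,
  \<open>\<gamma>^(1/2)\<close> and \<open>\<gamma>\<close>. The proof confirms them by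
  substitution.\<close>

lemma inverse_expansion:
  assumes a: "BO 0 a1" "BO 0 a2" "BO 0 a3" "BO 0 a4"
    and \<gamma>: "BO 4 (\<lambda>p. \<gamma> p - (1 + a1 p * e p + a2 p * e p ^ 2 + a3 p * e p ^ 3))"
    and \<delta>: "(\<lambda>p. \<delta> p - (1 + a1 p / 2 * e p - a3 p / 2 * e p ^ 3 - a4 p * e p ^ 4)) \<in> o[F](\<lambda>p. e p ^ 4)"
    and \<omega>: "\<And>p. 0 \<le> \<omega> p" "\<forall>\<^sub>F p in F. (\<omega> p)\<^sup>2 * \<gamma> p = 1"
    and b1: "\<And>p. b1 p = - a1 p / 2"
    and b3: "\<And>p. b3 p = a1 p ^ 3 / 16 - a1 p * a2 p / 4 + a3 p / 2"
  shows "(\<lambda>p. 1 / \<delta> p - (1 + b1 p * (e p * \<omega> p) + b3 p * (e p * \<omega> p) ^ 3 + a4 p * (e p * \<omega> p) ^ 4)) \<in> o[F](\<lambda>p. e p ^ 4)"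
proof -
  \<comment> \<open>Taylor coefficients of \<open>(1 + a1 e + a2 e^2 + a3 e^3)^(-1/2)\<close>, so
    that \<open>P\<close> approximates \<open>\<omega>\<close>.\<close>
  define p1 where "p1 p = - a1 p / 2" for p
  define p2 where "p2 p = 3 / 8 * a1 p ^ 2 - a2 p / 2" for p
  define p3 where "p3 p = - a3 p / 2 + 3 / 4 * (a1 p * a2 p) - 5 / 16 * a1 p ^ 3" for p
  define P where "P p = 1 + p1 p * e p + p2 p * e p ^ 2 + p3 p * e p ^ 3" for p
  have div: "BO 0 (\<lambda>p. g p / c)" if "BO 0 g" for g and c :: real
    using BO_mult0[OF that BO_const[of "1/c"]] by simp
  have neg: "BO 0 (\<lambda>p. - g p)" if "BO 0 g" for g
    using BO_diff[OF BO_const[of 0] that] by simp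
  note BI = BO_0_intros div neg a
  have bp: "BO 0 p1" "BO 0 p2" "BO 0 p3" "BO 0 b1" "BO 0 b3"
    unfolding p1_def[abs_def] p2_def[abs_def] p3_def[abs_def] b1[abs_def] b3[abs_def] by (intro BI)+
  have bP: "BO 0 P" unfolding P_def by (intro BI bp)
  have one: "(g \<longlongrightarrow> c) F" if "BO 1 (\<lambda>p. g p - c)" for g c
  proof -
    have "(\<lambda>p. g p - c) \<in> o[F](\<lambda>p. e p ^ 0)" using that by (intro BO_smallo) simp
    then have "((\<lambda>p. g p - c) \<longlongrightarrow> 0) F" using smalloD_tendsto[of "\<lambda>p. g p - c" F "\<lambda>_. 1"] by simp
    then show ?thesis by (simp add: LIM_zero_iff)
  qed
  have P1: "BO 1 (\<lambda>p. P p - 1)"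
    by (rule BO_eq[OF BO_e_times[of "\<lambda>p. p1 p + p2 p * e p + p3 p * e p ^ 2" 1]])
      (auto simp: P_def algebra_simps power2_eq_square power3_eq_cube intro!: BI bp)
  have \<gamma>1: "BO 1 (\<lambda>p. \<gamma> p - 1)"
  proof -
    have "BO 1 (\<lambda>p. e p ^ 1 * (a1 p + a2 p * e p + a3 p * e p ^ 2))" by (intro BO_e_times BI)
    then have "BO 1 (\<lambda>p. (\<gamma> p - (1 + a1 p * e p + a2 p * e p ^ 2 + a3 p * e p ^ 3)) + e p ^ 1 * (a1 p + a2 p * e p + a3 p * e p ^ 2))"
      by (intro BO_add BO_mono[OF _ \<gamma>]) auto
    then show ?thesis
      by (rule BO_eq) (auto simp: algebra_simps power2_eq_square power3_eq_cube)
  qed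
  have \<gamma>P: "BO 4 (\<lambda>p. \<gamma> p * (P p)\<^sup>2 - 1)"
  proof -
    define q1 where "q1 p = 2 * p1 p" for p
    define q2 where "q2 p = 2 * p2 p + p1 p ^ 2" for p
    define q3 where "q3 p = 2 * p3 p + 2 * (p1 p * p2 p)" for p
    define A where "A p = 1 + a1 p * e p + a2 p * e p ^ 2 + a3 p * e p ^ 3" for p
    have bq: "BO 0 q1" "BO 0 q2" "BO 0 q3"
      unfolding q1_def[abs_def] q2_def[abs_def] q3_def[abs_def] by (intro BI bp)+
    have bA: "BO 0 A" unfolding A_def[abs_def] by (intro BI)
    have z: "a1 p + q1 p = 0" "a2 p + a1 p * q1 p + q2 p = 0" "a3 p + a2 p * q1 p + a1 p * q2 p + q3 p = 0" for p
      unfolding q1_def q2_def q3_def p1_def p2_def p3_def by (simp_all add: power2_eq_square power3_eq_cube field_simps)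
    have P2: "(P p)\<^sup>2 = (1 + q1 p * e p + q2 p * e p ^ 2 + q3 p * e p ^ 3)
      + e p ^ 4 * (p2 p ^ 2 + 2 * (p1 p * p3 p) + 2 * (p2 p * p3 p * e p) + p3 p ^ 2 * e p ^ 2)" for p
      unfolding P_def q1_def q2_def q3_def by algebra
    have AQ: "A p * (1 + q1 p * e p + q2 p * e p ^ 2 + q3 p * e p ^ 3) - 1
      = e p ^ 4 * (a1 p * q3 p + a2 p * q2 p + a3 p * q1 p + e p * (a2 p * q3 p + a3 p * q2 p) + e p ^ 2 * (a3 p * q3 p))" for p
      using z[of p] unfolding A_def by algebra
    have "BO 4 (\<lambda>p. (\<gamma> p - A p) * (P p)\<^sup>2)"
      using BO_mult[OF \<gamma>[folded A_def] BO_power0[OF bP, of 2]] by simp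
    moreover have "BO 4 (\<lambda>p. e p ^ 4 * (A p * (p2 p ^ 2 + 2 * (p1 p * p3 p) + 2 * (p2 p * p3 p * e p) + p3 p ^ 2 * e p ^ 2)))"
      by (intro BO_e_times BI bp bA)
    moreover have "BO 4 (\<lambda>p. e p ^ 4 * (a1 p * q3 p + a2 p * q2 p + a3 p * q1 p + e p * (a2 p * q3 p + a3 p * q2 p) + e p ^ 2 * (a3 p * q3 p)))"
      by (intro BO_e_times BI bq)
    ultimately have "BO 4 (\<lambda>p. (\<gamma> p - A p) * (P p)\<^sup>2 + e p ^ 4 * (A p * (p2 p ^ 2 + 2 * (p1 p * p3 p) + 2 * (p2 p * p3 p * e p) + p3 p ^ 2 * e p ^ 2))
      + e p ^ 4 * (a1 p * q3 p + a2 p * q2 p + a3 p * q1 p + e p * (a2 p * q3 p + a3 p * q2 p) + e p ^ 2 * (a3 p * q3 p)))"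
      by (intro BO_add)
    then show ?thesis
      by (rule BO_eq) (use AQ P2 in \<open>simp add: algebra_simps\<close>)
  qed
  \<comment> \<open>Since \<open>\<omega>^2 \<gamma> = 1\<close>, the difference
    \<open>1 - \<gamma> P^2\<close> factors as
    \<open>\<gamma> (\<omega> + P) (\<omega> - P)\<close>, and the first two factors stay away from
    zero. An error of order 4 in the square is therefore one in \<open>\<omega>\<close>.\<close>
  have \<omega>P: "BO 4 (\<lambda>p. \<omega> p - P p)"
  proof -
    have "\<forall>\<^sub>F p in F. \<gamma> p > 1/2" using one[OF \<gamma>1] by (rule order_tendstoD) simp
    moreover have "\<forall>\<^sub>F p in F. P p > 1/2" using one[OF P1] by (rule order_tendstoD) simp
    ultimately have "\<forall>\<^sub>F p in F. norm (\<omega> p - P p) \<le> 4 * norm (\<gamma> p * (P p)\<^sup>2 - 1)"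
      using \<omega>(2)
    proof eventually_elim
      case (elim p)
      have "1/2 * (1/2) \<le> (\<omega> p + P p) * \<gamma> p" using elim \<omega>(1)[of p] by (intro mult_mono) auto
      then have "1/4 * \<bar>\<omega> p - P p\<bar> \<le> ((\<omega> p + P p) * \<gamma> p) * \<bar>\<omega> p - P p\<bar>" by (intro mult_right_mono) auto
      also have "\<dots> = \<bar>((\<omega> p + P p) * \<gamma> p) * (\<omega> p - P p)\<bar>"
        using elim \<omega>(1)[of p] by (simp add: abs_mult)
      also have "((\<omega> p + P p) * \<gamma> p) * (\<omega> p - P p) = 1 - \<gamma> p * (P p)\<^sup>2"
        using elim by (simp add: algebra_simps power2_eq_square)
      finally show ?case by (simp add: abs_minus_commute)
    qed
    then have "(\<lambda>p. \<omega> p - P p) \<in> O[F](\<lambda>p. \<gamma> p * (P p)\<^sup>2 - 1)" by (rule bigoI)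
    then show ?thesis using \<gamma>P unfolding BO_def by (rule landau_o.big_trans)
  qed
  define x where "x p = \<omega> p - 1" for p
  have x1: "BO 1 x" using BO_add[OF BO_mono[OF _ \<omega>P, of 1] P1] by (simp add: x_def[abs_def])
  have "BO 2 (\<lambda>p. (\<omega> p - P p) + e p ^ 2 * (p2 p + p3 p * e p))"
    by (intro BO_add BO_mono[OF _ \<omega>P] BO_e_times BI bp) simp
  then have x2: "BO 2 (\<lambda>p. x p - p1 p * e p)"
    by (rule BO_eq) (simp add: x_def P_def algebra_simps power2_eq_square power3_eq_cube)
  define W where "W p = 1 + b1 p * (e p * \<omega> p) + b3 p * (e p * \<omega> p) ^ 3 + a4 p * (e p * \<omega> p) ^ 4" for p
  \<comment> \<open>Coefficients of \<open>W\<close> in powers of \<open>e\<close> once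
    \<open>\<omega>\<close> is replaced by its expansion; terms beyond order four are
    discarded.\<close>
  define w2 where "w2 p = b1 p * p1 p" for p
  define w3 where "w3 p = b1 p * p2 p + b3 p" for p
  define w4 where "w4 p = b1 p * p3 p + 3 * (b3 p * p1 p) + a4 p" for p
  define Wp where "Wp p = 1 + b1 p * e p + w2 p * e p ^ 2 + w3 p * e p ^ 3 + w4 p * e p ^ 4" for p
  define \<delta>p where "\<delta>p p = 1 + a1 p / 2 * e p - a3 p / 2 * e p ^ 3 - a4 p * e p ^ 4" for p
  have bw: "BO 0 w2" "BO 0 w3" "BO 0 w4"
    unfolding w2_def[abs_def] w3_def[abs_def] w4_def[abs_def] by (intro BI bp)+
  have bWp: "BO 0 Wp" and b\<delta>p: "BO 0 \<delta>p" unfolding Wp_def[abs_def] \<delta>p_def[abs_def] by (intro BI bp bw)+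
  have WWp: "BO 5 (\<lambda>p. W p - Wp p)"
  proof -
    have 1: "BO 5 (\<lambda>p. e p ^ 1 * b1 p * (\<omega> p - P p))"
      using BO_mult[OF BO_e_times[OF bp(4), of 1] \<omega>P] by simp
    have 3: "BO 5 (\<lambda>p. e p ^ 3 * b3 p * ((1 + x p) ^ 3 - (1 + 3 * (p1 p * e p))))"
      using BO_mult[OF BO_e_times[OF bp(5), of 3] BO_cube_diff[OF x1 x2]] by simp
    have "BO 1 (\<lambda>p. x p * (4 + 6 * x p + 4 * x p ^ 2 + x p ^ 3))"
      using BO_mult[OF x1, of 0 "\<lambda>p. 4 + 6 * x p + 4 * x p ^ 2 + x p ^ 3"] BO_mono[OF _ x1, of 0] by (simp add: BI)
    then have 4: "BO 5 (\<lambda>p. e p ^ 4 * a4 p * (x p * (4 + 6 * x p + 4 * x p ^ 2 + x p ^ 3)))"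
      using BO_mult[OF BO_e_times[OF a(4), of 4], of 1] by simp
    have "W p - Wp p = e p ^ 1 * b1 p * (\<omega> p - P p) + e p ^ 3 * b3 p * ((1 + x p) ^ 3 - (1 + 3 * (p1 p * e p)))
      + e p ^ 4 * a4 p * (x p * (4 + 6 * x p + 4 * x p ^ 2 + x p ^ 3))" for p
    proof -
      have "\<omega> p = 1 + x p" by (simp add: x_def)
      then show ?thesis unfolding W_def Wp_def w2_def w3_def w4_def P_def by algebra
    qed
    then show ?thesis by (intro BO_eq[OF BO_add[OF BO_add[OF 1 3] 4]])
  qed
  have prod: "BO 5 (\<lambda>p. 1 - \<delta>p p * Wp p)"
  proof -
    define d1 where "d1 p = a1 p / 2" for p
    define d3 where "d3 p = - a3 p / 2" for p
    define d4 where "d4 p = - a4 p" for p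
    have bd: "BO 0 d1" "BO 0 d3" "BO 0 d4"
      unfolding d1_def[abs_def] d3_def[abs_def] d4_def[abs_def] by (intro BI)+
    \<comment> \<open>The cancellations at orders 1 to 4. The second identity closes without a
      square term in \<open>W\<close>: this is the vanishing quadratic coefficient.\<close>
    have z: "d1 p + b1 p = 0" "d1 p * b1 p + w2 p = 0" "d3 p + d1 p * w2 p + w3 p = 0" "d4 p + d3 p * b1 p + d1 p * w3 p + w4 p = 0" for p
      unfolding w2_def w3_def w4_def d1_def d3_def d4_def p1_def p2_def p3_def b1 b3
      by (simp_all add: eval_nat_numeral field_simps)
    have "1 - \<delta>p p * Wp p = e p ^ 5 * (- (d1 p * w4 p + d3 p * w2 p + d4 p * b1 p + e p * (d3 p * w3 p + d4 p * w2 p)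
       + e p ^ 2 * (d3 p * w4 p + d4 p * w3 p) + e p ^ 3 * (d4 p * w4 p)))" for p
    proof -
      have "\<delta>p p = 1 + d1 p * e p + d3 p * e p ^ 3 + d4 p * e p ^ 4" by (simp add: \<delta>p_def d1_def d3_def d4_def)
      then show ?thesis using z[of p] unfolding Wp_def by algebra
    qed
    moreover have "BO 5 (\<lambda>p. e p ^ 5 * (- (d1 p * w4 p + d3 p * w2 p + d4 p * b1 p + e p * (d3 p * w3 p + d4 p * w2 p)
       + e p ^ 2 * (d3 p * w4 p + d4 p * w3 p) + e p ^ 3 * (d4 p * w4 p))))"
      by (intro BO_e_times BI bd bw bp)
    ultimately show ?thesis by (rule BO_eq[rotated])
  qed
  have bW: "BO 0 W" using BO_add[OF BO_mono[OF _ WWp, of 0] bWp] by simp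
  have \<delta>1: "(\<delta> \<longlongrightarrow> 1) F"
  proof (rule one)
    have "BO 1 (\<lambda>p. (\<delta> p - \<delta>p p) + e p ^ 1 * (a1 p / 2 - a3 p / 2 * e p ^ 2 - a4 p * e p ^ 3))"
      by (intro BO_add BO_mono[OF _ smallo_BO[OF \<delta>[folded \<delta>p_def]]] BO_e_times BI) simp
    then show "BO 1 (\<lambda>p. \<delta> p - 1)"
      by (rule BO_eq) (simp add: \<delta>p_def algebra_simps eval_nat_numeral)
  qed
  have "(\<lambda>p. (1 - \<delta>p p * Wp p) - \<delta>p p * (W p - Wp p) - (\<delta> p - \<delta>p p) * W p) \<in> o[F](\<lambda>p. e p ^ 4)"
  proof (rule sum_in_smallo(2)[OF sum_in_smallo(2)])
    show "(\<lambda>p. 1 - \<delta>p p * Wp p) \<in> o[F](\<lambda>p. e p ^ 4)" using prod by (intro BO_smallo) simp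
    have "BO 5 (\<lambda>p. \<delta>p p * (W p - Wp p))" using BO_mult[OF b\<delta>p WWp] by simp
    then show "(\<lambda>p. \<delta>p p * (W p - Wp p)) \<in> o[F](\<lambda>p. e p ^ 4)" by (intro BO_smallo) simp
    show "(\<lambda>p. (\<delta> p - \<delta>p p) * W p) \<in> o[F](\<lambda>p. e p ^ 4)"
      using landau_o.small_big_mult[OF \<delta>[folded \<delta>p_def] bW[unfolded BO_def]] by simp
  qed
  then have "(\<lambda>p. 1 - \<delta> p * W p) \<in> o[F](\<lambda>p. e p ^ 4)"
    by (rule landau_o.small.in_cong[THEN iffD1, rotated]) (simp add: algebra_simps)
  moreover have "(\<lambda>p. 1 / \<delta> p - W p) \<in> O[F](\<lambda>p. 1 - \<delta> p * W p)"
  proof (rule bigoI[where c=2])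
    have "\<forall>\<^sub>F p in F. \<delta> p > 1/2" using \<delta>1 by (rule order_tendstoD) simp
    then show "\<forall>\<^sub>F p in F. norm (1 / \<delta> p - W p) \<le> 2 * norm (1 - \<delta> p * W p)"
    proof eventually_elim
      case (elim p)
      have "\<bar>1 / \<delta> p - W p\<bar> = \<bar>1 - \<delta> p * W p\<bar> / \<delta> p"
        using elim by (simp add: field_simps abs_if split: if_splits)
      also have "\<dots> \<le> \<bar>1 - \<delta> p * W p\<bar> / (1/2)"
        using elim by (intro divide_left_mono) auto
      finally show ?case by simp
    qed
  qed
  ultimately show ?thesis unfolding W_def by (metis (no_types, lifting) landau_o.big_small_trans)
qed

end

subsection \<open>Uniform Taylor expansions\<close>

text \<open>A product with a principal filter encodes uniformity in the second component, which
  turns the Landau symbols into uniform estimates.\<close>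

lemma eventually_prod_principal_iff:
  "(\<forall>\<^sub>F p in A \<times>\<^sub>F principal B. P p) \<longleftrightarrow> (\<forall>\<^sub>F x in A. \<forall>y\<in>B. P (x, y))"
  unfolding eventually_prod_filter eventually_principal
proof
  assume "\<exists>Pf Pg. eventually Pf A \<and> (\<forall>x\<in>B. Pg x) \<and> (\<forall>x y. Pf x \<longrightarrow> Pg y \<longrightarrow> P (x, y))"
  then obtain Pf Pg where "eventually Pf A" "\<forall>x\<in>B. Pg x" "\<forall>x y. Pf x \<longrightarrow> Pg y \<longrightarrow> P (x, y)" by blast
  then show "\<forall>\<^sub>F x in A. \<forall>y\<in>B. P (x, y)" by (auto elim!: eventually_mono)
next
  assume "\<forall>\<^sub>F x in A. \<forall>y\<in>B. P (x, y)"
  then show "\<exists>Pf Pg. eventually Pf A \<and> (\<forall>x\<in>B. Pg x) \<and> (\<forall>x y. Pf x \<longrightarrow> Pg y \<longrightarrow> P (x, y))"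
    by (intro exI[of _ "\<lambda>x. \<forall>y\<in>B. P (x, y)"] exI[of _ "\<lambda>y. y \<in> B"]) auto
qed

lemma small_param_fst: "small_param (at_right 0 \<times>\<^sub>F principal B) (fst :: real \<times> 'b \<Rightarrow> real)"
proof
  show "((fst :: real \<times> 'b \<Rightarrow> real) \<longlongrightarrow> 0) (at_right 0 \<times>\<^sub>F principal B)"
  proof (rule tendstoI)
    fix e :: real assume "0 < e"
    then have "\<forall>\<^sub>F x in at_right 0. dist x (0::real) < e"
      using tendstoD[OF tendsto_ident_at, of e "0::real" "{0<..}"] by simp
    then show "\<forall>\<^sub>F x in at_right 0 \<times>\<^sub>F principal B. dist (fst x) (0::real) < e"
      unfolding eventually_prod_principal_iff by (rule eventually_mono) simp
  qed
qed

lemma continuous_on_dirsum_compose: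
  assumes "C_on m V g" "continuous_on S y" "y ` S \<subseteq> V"
  shows "continuous_on S (\<lambda>u. dirsum u m g (y u))"
proof -
  have "continuous_on S (\<lambda>u. (u, y u))" using assms(2) by (intro continuous_on_Pair continuous_on_id)
  moreover have "(\<lambda>u. (u, y u)) ` S \<subseteq> UNIV \<times> V" using assms(3) by auto
  ultimately show ?thesis using continuous_on_compose2[OF continuous_on_dirsum[OF assms(1)]] by force
qed

text \<open>The highest derivative in the remainder is evaluated at an intermediate point. Uniform
  continuity on a compact set of pairs of direction and point replaces it by its value at
  \<open>t\<close>, with an error that is small uniformly in \<open>u\<close>; a derivative of order
  \<open>j + m + 1\<close> would exceed the smoothness of \<open>f\<close>.\<close>

lemma uniform_taylor:
  fixes g :: "real ^ 'n::finite \<Rightarrow> real"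
  assumes V: "open V" and g: "C_on (j + m) V g" and m: "0 < m" and \<delta>: "0 < \<delta>" "cball t \<delta> \<subseteq> V" and \<rho>: "0 < \<rho>"
  shows "(\<lambda>p. dirsum (snd p) j g (t + fst p *\<^sub>R snd p) - (\<Sum>k\<le>m. dirsum (snd p) (j + k) g t / fact k * fst p ^ k))
    \<in> o[at_right 0 \<times>\<^sub>F principal (cball 0 \<rho>)](\<lambda>p. fst p ^ m)"
proof (rule landau_o.smallI)
  fix \<eta> :: real assume \<eta>: "0 < \<eta>"
  let ?S = "cball 0 \<rho> \<times> cball t \<delta> :: ((real ^ 'n) \<times> (real ^ 'n)) set"
  have "continuous_on ?S (\<lambda>(u, x). dirsum u (j + m) g x)"
    using \<delta> by (intro continuous_on_subset[OF continuous_on_dirsum[OF g]]) auto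
  then have "uniformly_continuous_on ?S (\<lambda>(u, x). dirsum u (j + m) g x)"
    by (intro compact_uniformly_continuous compact_Times) auto
  then obtain d where d: "d > 0" "\<And>p q. p \<in> ?S \<Longrightarrow> q \<in> ?S \<Longrightarrow> dist q p < d \<Longrightarrow>
     dist (dirsum (fst q) (j + m) g (snd q)) (dirsum (fst p) (j + m) g (snd p)) < \<eta>"
    unfolding uniformly_continuous_on_def split_def using \<eta> by metis
  have "\<forall>\<^sub>F y in at_right (0::real). y < min d \<delta> / \<rho>"
    using d(1) \<delta>(1) \<rho> by (intro eventually_at_right_real[THEN eventually_mono, of 0 "min d \<delta> / \<rho>"]) auto
  then have "\<forall>\<^sub>F y in at_right 0. \<forall>u\<in>cball 0 \<rho>. norm (dirsum u j g (t + y *\<^sub>R u) - (\<Sum>k\<le>m. dirsum u (j + k) g t / fact k * y ^ k)) \<le> \<eta> * norm (y ^ m)"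
    using eventually_at_right_less[of 0]
  proof eventually_elim
    case (elim y)
    show ?case
    proof
      fix u :: "real ^ 'n" assume u: "u \<in> cball 0 \<rho>"
      have near: "norm (s *\<^sub>R u) < min d \<delta>" if "0 \<le> s" "s \<le> y" for s
      proof -
        have "norm (s *\<^sub>R u) \<le> y * \<rho>" using that u elim by (auto intro!: mult_mono)
        also have "\<dots> < min d \<delta>" using elim(1) \<rho> by (simp add: pos_less_divide_eq)
        finally show ?thesis .
      qed
      have "t + s *\<^sub>R u \<in> V" if "0 \<le> s" "s \<le> y" for s
        using near[OF that] \<delta>(2) by (intro subsetD[OF \<delta>(2)]) (simp add: dist_norm)
      from taylor_line[OF V g m elim(2) this] obtain \<theta> where \<theta>: "0 < \<theta>" "\<theta> < y"
        "dirsum u j g (t + y *\<^sub>R u) = (\<Sum>k<m. dirsum u (j + k) g t / fact k * y ^ k) + dirsum u (j + m) g (t + \<theta> *\<^sub>R u) / fact m * y ^ m"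
        by blast
      have "dist (dirsum u (j + m) g (t + \<theta> *\<^sub>R u)) (dirsum u (j + m) g t) < \<eta>"
        using d(2)[of "(u, t)" "(u, t + \<theta> *\<^sub>R u)"] near[of \<theta>] \<theta> u \<delta> by (simp add: dist_norm dist_prod_def)
      then have D: "\<bar>dirsum u (j + m) g (t + \<theta> *\<^sub>R u) - dirsum u (j + m) g t\<bar> \<le> \<eta>" by (simp add: dist_real_def)
      have "dirsum u j g (t + y *\<^sub>R u) - (\<Sum>k\<le>m. dirsum u (j + k) g t / fact k * y ^ k)
        = (dirsum u (j + m) g (t + \<theta> *\<^sub>R u) - dirsum u (j + m) g t) / fact m * y ^ m"
        unfolding \<theta>(3) lessThan_Suc_atMost[symmetric] sum.lessThan_Suc by (simp add: algebra_simps diff_divide_distrib)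
      also have "norm \<dots> \<le> \<eta> / 1 * norm (y ^ m)"
        using D \<eta> fact_ge_1[of m, where 'a=real] unfolding norm_mult norm_divide
        by (intro mult_right_mono frac_le) auto
      finally show "norm (dirsum u j g (t + y *\<^sub>R u) - (\<Sum>k\<le>m. dirsum u (j + k) g t / fact k * y ^ k)) \<le> \<eta> * norm (y ^ m)"
        by simp
    qed
  qed
  then show "\<forall>\<^sub>F p in at_right 0 \<times>\<^sub>F principal (cball 0 \<rho>).
     norm (dirsum (snd p) j g (t + fst p *\<^sub>R snd p) - (\<Sum>k\<le>m. dirsum (snd p) (j + k) g t / fact k * fst p ^ k)) \<le> \<eta> * norm (fst p ^ m)"
    unfolding eventually_prod_principal_iff by simp
qed

subsection \<open>The bias of the ideal estimator\<close>

text \<open>The clipping function is represented by its consequences for \<open>\<alpha>\<close>,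
  with \<open>s1\<close> the threshold \<open>t0 * c\<^sup>2\<close> above which
  \<open>\<alpha>\<close> is the square root. The gap between \<open>s1\<close> and \<open>r\<close>
  leaves room for a pilot value slightly below \<open>f x\<close> near \<open>t\<close>.\<close>

locale pilot = smooth_kernel \<Phi> \<Phi>1 \<Phi>2 T \<kappa> d K
  for \<Phi> \<Phi>1 \<Phi>2 :: "real \<Rightarrow> real" and T \<kappa> :: real and d :: nat and K :: "real ^ 'n::finite \<Rightarrow> real" +
  fixes f :: "real ^ 'n \<Rightarrow> real" and \<alpha> :: "real \<Rightarrow> real" and C c s1 r \<delta>0 :: real and t :: "real ^ 'n"
  assumes f_smooth: "f \<in> smooth_densities C 4"
    and c_pos: "0 < c" and s1_pos: "0 < s1" and s1_r: "s1 < r"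
    and \<alpha>_meas [measurable]: "\<alpha> \<in> borel_measurable borel"
    and \<alpha>_ge: "\<And>s. c \<le> \<alpha> s" and \<alpha>_sqrt: "\<And>s. s1 \<le> s \<Longrightarrow> \<alpha> s = sqrt s"
    and \<alpha>_le: "\<And>s. 0 \<le> s \<Longrightarrow> \<alpha> s \<le> sqrt (s1 + s)"
    and \<delta>0_pos: "0 < \<delta>0" and near_t: "\<And>x. norm (x - t) \<le> \<delta>0 \<Longrightarrow> r \<le> f x"
begin

lemma r_pos: "0 < r" using s1_pos s1_r by simp

lemma d_pos: "0 < d" by (simp add: d_eq)

lemma f_nonneg: "0 \<le> f x" and f_bochner: "has_bochner_integral lborel f 1"
  using f_smooth by (auto simp: smooth_densities_def)

lemma f_partials_le: "length is \<le> 4 \<Longrightarrow> \<bar>partial_derivs is f x\<bar> \<le> C"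
  using f_smooth by (auto simp: smooth_densities_def)

lemma f_le: "f x \<le> C"
  using f_partials_le[of "[]" x] by (simp add: partial_derivs_def)

lemma C_pos: "0 < C"
  using f_le[of t] near_t[of t] \<delta>0_pos r_pos by simp

lemma f_C: "C_on 4 UNIV f" using f_smooth by (rule smooth_densities_C_on)

lemma f_cont: "continuous_on UNIV f" using f_C by (rule C_on_continuous)

lemma f_measurable [measurable]: "f \<in> borel_measurable borel"
  by (intro borel_measurable_continuous_onI f_cont)

definition V where "V = {x. 0 < f x}"
definition \<gamma> where "\<gamma> = (\<lambda>x. 1 / f x)"
text \<open>As \<open>\<alpha>\<close> is at least \<open>c\<close>, the kernel
  \<open>K (\<alpha> s *\<^sub>R u)\<close> vanishes for \<open>norm u > \<rho>\<close> whatever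
  \<open>s\<close> is: sample points farther than \<open>\<rho> * h\<close> from \<open>t\<close>
  contribute nothing.\<close>

definition \<rho> where "\<rho> = sqrt T / c"

lemma \<rho>_pos: "0 < \<rho>" using T_pos c_pos by (simp add: \<rho>_def)

lemma open_V: "open V"
  unfolding V_def by (intro open_Collect_less f_cont continuous_intros)

lemma \<gamma>_C: "C_on 4 V \<gamma>"
proof -
  have "UNIV \<inter> V = V" by simp
  have "C_on k W g \<Longrightarrow> W' \<subseteq> W \<Longrightarrow> C_on k W' g" for k W W' and g :: "real ^ 'n \<Rightarrow> real"
    by (induction k arbitrary: g) (auto intro: continuous_on_subset)
  then have "C_on 4 V f" using f_C by blast
  then show ?thesis unfolding \<gamma>_def by (intro C_on_inverse open_V) (auto simp: V_def)
qed

lemma near_V: "cball t \<delta>0 \<subseteq> V"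
  using near_t r_pos unfolding V_def by (force simp: dist_norm norm_minus_commute)

lemma scaled_near: "0 \<le> \<epsilon> \<Longrightarrow> \<epsilon> \<le> \<delta>0 / \<rho> \<Longrightarrow> norm u \<le> \<rho> \<Longrightarrow> r \<le> f (t + \<epsilon> *\<^sub>R u)"
  using \<rho>_pos \<delta>0_pos mult_mono[of \<epsilon> "\<delta>0 / \<rho>" "norm u" \<rho>] by (intro near_t) auto

lemma outside_zero: "\<rho> < norm u \<Longrightarrow> T < (norm (\<alpha> s *\<^sub>R u))\<^sup>2"
proof -
  assume "\<rho> < norm u"
  then have "sqrt T < c * norm u" using c_pos by (simp add: \<rho>_def divide_less_eq mult.commute)
  also have "\<dots> \<le> norm (\<alpha> s *\<^sub>R u)" using \<alpha>_ge[of s] c_pos by (simp add: mult_right_mono)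
  finally show ?thesis using T_pos power_strict_mono[of "sqrt T" "norm (\<alpha> s *\<^sub>R u)" 2] by simp
qed

lemma K_outside: "\<rho> < norm u \<Longrightarrow> K (\<alpha> s *\<^sub>R u) = 0"
  by (rule K_zero[OF outside_zero])

lemma L_outside: "\<rho> < norm u \<Longrightarrow> kernel_L K (\<alpha> s *\<^sub>R u) = 0"
  unfolding kernel_L_eq by (rule l_zero[OF outside_zero])

text \<open>The derivative of \<open>l * sqrt (f (t + \<epsilon> *\<^sub>R l *\<^sub>R v))\<close>
  in \<open>l\<close>, taken at \<open>u = l *\<^sub>R v\<close>; that is, the radial factor of the
  Jacobian of the substitution.\<close>

definition Jac where
  "Jac \<epsilon> u = sqrt (f (t + \<epsilon> *\<^sub>R u)) + \<epsilon> * dirsum u 1 f (t + \<epsilon> *\<^sub>R u) / (2 * sqrt (f (t + \<epsilon> *\<^sub>R u)))"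

text \<open>The first bound keeps \<open>t + \<epsilon> *\<^sub>R u\<close> within
  \<open>\<delta>0\<close> of \<open>t\<close>; the second limits \<open>\<epsilon>\<close> times
  the directional derivative of \<open>f\<close> to \<open>r\<close>, so that at least half of the
  leading term of \<open>Jac\<close> survives.\<close>

definition \<epsilon>1 where "\<epsilon>1 = min (\<delta>0 / \<rho>) (r / (real d * C * \<rho>))"

lemma \<epsilon>1_pos: "0 < \<epsilon>1"
  using \<delta>0_pos \<rho>_pos r_pos C_pos d_pos by (simp add: \<epsilon>1_def)

lemma dirsum_f_le: "m \<le> 4 \<Longrightarrow> \<bar>dirsum u m f x\<bar> \<le> real d ^ m * C * norm u ^ m"
  unfolding d_eq by (rule dirsum_bound) (simp add: f_partials_le)

lemma Jac_ge:
  assumes "0 \<le> \<epsilon>" "\<epsilon> \<le> \<epsilon>1" "norm u \<le> \<rho>"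
  shows "sqrt r / 2 \<le> Jac \<epsilon> u"
proof -
  let ?x = "t + \<epsilon> *\<^sub>R u"
  have fr: "r \<le> f ?x" using assms by (intro scaled_near) (auto simp: \<epsilon>1_def)
  have "\<bar>\<epsilon> * dirsum u 1 f ?x\<bar> \<le> \<epsilon> * (real d * C * norm u)"
    using dirsum_f_le[of 1 u ?x] assms by (simp add: abs_mult mult_left_mono)
  also have "\<dots> \<le> \<epsilon>1 * (real d * C * \<rho>)"
    using assms C_pos by (intro mult_mono) auto
  also have "\<dots> \<le> r / (real d * C * \<rho>) * (real d * C * \<rho>)"
    using C_pos \<rho>_pos by (intro mult_right_mono) (auto simp: \<epsilon>1_def)
  also have "\<dots> = r" using C_pos \<rho>_pos d_pos by simp
  finally have "- f ?x \<le> \<epsilon> * dirsum u 1 f ?x" using fr by linarith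
  then have "- f ?x / (2 * sqrt (f ?x)) \<le> \<epsilon> * dirsum u 1 f ?x / (2 * sqrt (f ?x))"
    using fr r_pos by (intro divide_right_mono) auto
  moreover have "f ?x / (2 * sqrt (f ?x)) = sqrt (f ?x) / 2"
    using fr r_pos by (simp add: real_div_sqrt field_simps)
  ultimately have "sqrt (f ?x) / 2 \<le> Jac \<epsilon> u" unfolding Jac_def by linarith
  moreover have "sqrt r \<le> sqrt (f ?x)" using fr by simp
  ultimately show ?thesis by linarith
qed

lemma Jac_nonneg: "0 \<le> \<epsilon> \<Longrightarrow> \<epsilon> \<le> \<epsilon>1 \<Longrightarrow> norm u \<le> \<rho> \<Longrightarrow> 0 \<le> Jac \<epsilon> u"
  using Jac_ge[of \<epsilon> u] real_sqrt_gt_zero[OF r_pos] by linarith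

lemma f_line_continuous: "continuous_on UNIV (\<lambda>u. f (t + \<epsilon> *\<^sub>R u))"
  by (rule continuous_on_compose2[OF f_cont]) (auto intro!: continuous_intros)

lemma dirsum_f_continuous: "continuous_on UNIV (\<lambda>u. dirsum u 1 f (t + \<epsilon> *\<^sub>R u))"
  by (rule continuous_on_dirsum_compose[OF C_on_mono[OF _ f_C]]) (auto intro!: continuous_intros)

lemma Jac_measurable [measurable]: "Jac \<epsilon> \<in> borel_measurable borel"
proof -
  have [measurable]: "(\<lambda>u. dirsum u 1 f (t + \<epsilon> *\<^sub>R u)) \<in> borel_measurable borel"
    by (intro borel_measurable_continuous_onI dirsum_f_continuous)
  show ?thesis unfolding Jac_def[abs_def] by measurable
qed

text \<open>The support condition on \<open>g\<close> fits the radius of the ball, since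
  \<open>c * \<rho>\<close> is \<open>sqrt T\<close>.\<close>

lemma radial_substitution:
  assumes e: "0 \<le> \<epsilon>" "\<epsilon> \<le> \<epsilon>1"
    and g: "g \<in> borel_measurable borel" "integrable lborel g" "\<And>w. T < (norm w)\<^sup>2 \<Longrightarrow> g w = 0"
  shows "has_bochner_integral lborel
    (\<lambda>u. if norm u \<le> \<rho> then g (sqrt (f (t + \<epsilon> *\<^sub>R u)) *\<^sub>R u) * (sqrt (f (t + \<epsilon> *\<^sub>R u)) ^ (d - 1) * Jac \<epsilon> u) else 0)
    (LINT w|lborel. g w)"
  unfolding d_eq
proof (rule has_bochner_integral_radial_substitution[OF g(1) _ Jac_measurable g(2) _ \<rho>_pos c_pos])
  have e': "\<epsilon> \<le> \<delta>0 / \<rho>" using e by (simp add: \<epsilon>1_def)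
  show "(\<lambda>u. sqrt (f (t + \<epsilon> *\<^sub>R u))) \<in> borel_measurable borel" by measurable
  show "g w = 0" if "c * \<rho> < norm w" for w
    using that c_pos T_pos power_strict_mono[of "sqrt T" "norm w" 2] by (intro g(3)) (simp add: \<rho>_def)
  show "c \<le> sqrt (f (t + \<epsilon> *\<^sub>R u))" if "norm u \<le> \<rho>" for u
    using scaled_near[OF e(1) e' that] s1_r \<alpha>_ge[of "f (t + \<epsilon> *\<^sub>R u)"] \<alpha>_sqrt[of "f (t + \<epsilon> *\<^sub>R u)"] by simp
  show "0 \<le> Jac \<epsilon> u" if "norm u \<le> \<rho>" for u
    by (rule Jac_nonneg[OF e that])
  show "continuous_on (cball 0 \<rho>) (Jac \<epsilon>)"
  proof -
    have "f (t + \<epsilon> *\<^sub>R u) \<noteq> 0" if "u \<in> cball 0 \<rho>" for u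
      using scaled_near[OF e(1) e', of u] that r_pos by auto
    then show ?thesis unfolding Jac_def[abs_def]
      by (intro continuous_intros continuous_on_subset[OF f_line_continuous] continuous_on_subset[OF dirsum_f_continuous]) auto
  qed
  fix v :: "real ^ 'n" and l :: real
  assume l: "0 \<le> l" "norm (l *\<^sub>R v) \<le> \<rho>"
  let ?x = "t + \<epsilon> *\<^sub>R (l *\<^sub>R v)"
  have fx: "0 < f ?x" using scaled_near[OF e(1) e' l(2)] r_pos by linarith
  have "((\<lambda>s. f (t + s *\<^sub>R (\<epsilon> *\<^sub>R v))) has_real_derivative dirsum (\<epsilon> *\<^sub>R v) 1 f (t + l *\<^sub>R (\<epsilon> *\<^sub>R v))) (at l)"
    using C1_line_derivative[of UNIV f t l "\<epsilon> *\<^sub>R v"] C_on_mono[OF _ f_C, of "Suc 0"] by (simp add: dirsum_1)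
  then have D: "((\<lambda>s. f (t + \<epsilon> *\<^sub>R (s *\<^sub>R v))) has_real_derivative \<epsilon> * dirsum v 1 f ?x) (at l)"
    using dirsum_scale[of \<epsilon> v 1 f] by (simp add: mult.commute)
  have "((\<lambda>s. s * sqrt (f (t + \<epsilon> *\<^sub>R (s *\<^sub>R v)))) has_real_derivative
     1 * sqrt (f ?x) + (inverse (sqrt (f ?x)) / 2 * (\<epsilon> * dirsum v 1 f ?x)) * l) (at l)"
    by (rule DERIV_mult[OF DERIV_ident DERIV_chain2[OF DERIV_real_sqrt[OF fx] D]])
  moreover have "1 * sqrt (f ?x) + (inverse (sqrt (f ?x)) / 2 * (\<epsilon> * dirsum v 1 f ?x)) * l = Jac \<epsilon> (l *\<^sub>R v)"
    unfolding Jac_def using dirsum_scale[of l v 1 f ?x] by (simp add: field_simps)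
  ultimately show "((\<lambda>l. l * sqrt (f (t + \<epsilon> *\<^sub>R l *\<^sub>R v))) has_real_derivative Jac \<epsilon> (l *\<^sub>R v)) (at l)"
    by simp
qed

lemma dirsum_1_\<gamma>:
  assumes "x \<in> V"
  shows "dirsum u 1 \<gamma> x = - dirsum u 1 f x / (f x)\<^sup>2"
proof -
  have "partial_deriv i \<gamma> x = - partial_deriv i f x / (f x)\<^sup>2" for i
    unfolding \<gamma>_def using assms
    by (intro partial_deriv_I)
      (auto intro!: derivative_eq_intros partial_deriv_D[OF C_on_mono[OF _ f_C, of "Suc 0"]] simp: V_def power2_eq_square)
  then show ?thesis by (simp add: dirsum_1 sum_negf sum_divide_distrib)
qed

text \<open>The coefficients of \<open>quot \<epsilon> u\<close> in powers of \<open>\<epsilon>\<close> once it is expressed through the substituted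
  variable \<open>w = sqrt (f (t + \<epsilon> *\<^sub>R u)) *\<^sub>R u\<close>; the quadratic one vanishes.\<close>

definition c1 where "c1 w = - f t * f t * dirsum w 1 \<gamma> t / (2 * sqrt (f t))"
definition c3 where "c3 w = f t / sqrt (f t) ^ 3 * ((dirsum w 1 \<gamma> t * f t) ^ 3 / 16
  - (dirsum w 1 \<gamma> t * f t) * (dirsum w 2 \<gamma> t * f t / 2) / 4 + (dirsum w 3 \<gamma> t * f t / 6) / 2)"
definition c4 where "c4 w = dirsum w 4 \<gamma> t / 24"

text \<open>What multiplies \<open>K\<close> and the Jacobian in the integrand of the mean,
  expressed through \<open>\<gamma>\<close>. In this form the square roots have cancelled; see
  \<open>quot_eq\<close> and \<open>ideal_integrand\<close>.\<close>

definition quot where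
  "quot \<epsilon> u = 1 / (\<gamma> (t + \<epsilon> *\<^sub>R u) - \<epsilon> / 2 * dirsum u 1 \<gamma> (t + \<epsilon> *\<^sub>R u))"

lemma quot_eq:
  assumes "0 \<le> \<epsilon>" "\<epsilon> \<le> \<epsilon>1" "norm u \<le> \<rho>"
  shows "quot \<epsilon> u * Jac \<epsilon> u = f (t + \<epsilon> *\<^sub>R u) * sqrt (f (t + \<epsilon> *\<^sub>R u))"
proof -
  let ?x = "t + \<epsilon> *\<^sub>R u"
  have fx: "0 < f ?x" using scaled_near[of \<epsilon> u] assms r_pos by (simp add: \<epsilon>1_def)
  then have x: "?x \<in> V" by (simp add: V_def)
  obtain b where b: "0 < b" "f ?x = b * b" "sqrt (f ?x) = b"
    using fx by (metis real_sqrt_gt_zero real_sqrt_mult_self abs_of_pos)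
  have J: "Jac \<epsilon> u \<noteq> 0" using Jac_ge[OF assms] real_sqrt_gt_zero[OF r_pos] by linarith
  have "\<gamma> ?x - \<epsilon> / 2 * dirsum u 1 \<gamma> ?x = Jac \<epsilon> u / (b * b * b)"
    unfolding dirsum_1_\<gamma>[OF x] unfolding Jac_def \<gamma>_def b(3) using b by (simp add: b(2) field_simps power2_eq_square)
  then show ?thesis unfolding quot_def b(3) using J b by (simp add: b(2))
qed

lemma quot_expansion:
  assumes "0 < \<eta>"
  shows "\<forall>\<^sub>F \<epsilon> in at_right 0. \<forall>u\<in>cball 0 \<rho>.
    \<bar>quot \<epsilon> u - (let w = sqrt (f (t + \<epsilon> *\<^sub>R u)) *\<^sub>R u in f t + \<epsilon> * c1 w + \<epsilon> ^ 3 * c3 w + \<epsilon> ^ 4 * c4 w)\<bar> \<le> \<eta> * \<epsilon> ^ 4"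
proof -
  let ?F = "at_right 0 \<times>\<^sub>F principal (cball 0 \<rho>) :: (real \<times> (real ^ 'n)) filter"
  interpret small_param ?F fst by (rule small_param_fst)
  have ft: "0 < f t" using near_t[of t] \<delta>0_pos r_pos by simp
  \<comment> \<open>Taylor coefficients of \<open>\<gamma>\<close> at \<open>t\<close> divided by
    its value \<open>1 / f t\<close>, to meet the normalisation in
    \<open>inverse_expansion\<close>.\<close>
  define a where "a k p = dirsum (snd p) k \<gamma> t * f t / fact k" for k and p :: "real \<times> (real ^ 'n)"
  have bdd: "BO 0 (a k)" if "k \<le> 4" for k
  proof -
    have "continuous_on (cball 0 \<rho>) (\<lambda>u. dirsum u k \<gamma> t * f t / fact k)"
    proof -
      have "continuous_on (cball 0 \<rho>) (\<lambda>u. dirsum u k \<gamma> t)"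
        using ft by (intro continuous_on_dirsum_compose[OF C_on_mono[OF that \<gamma>_C]]) (auto simp: V_def)
      then show ?thesis by (intro continuous_intros) auto
    qed
    then have "bounded ((\<lambda>u. dirsum u k \<gamma> t * f t / fact k) ` cball 0 \<rho>)"
      by (intro compact_imp_bounded compact_continuous_image) auto
    then have "\<exists>B. \<forall>u\<in>cball 0 \<rho>. \<bar>dirsum u k \<gamma> t * f t / fact k\<bar> \<le> B"
      unfolding bounded_iff by auto
    then obtain B where B: "\<And>u. u \<in> cball 0 \<rho> \<Longrightarrow> \<bar>dirsum u k \<gamma> t * f t / fact k\<bar> \<le> B"
      by blast
    show ?thesis unfolding BO_def
      by (rule bigoI[where c=B]) (use B in \<open>auto simp: eventually_prod_principal_iff a_def\<close>)
  qed
  \<comment> \<open>The factor between \<open>u\<close> and \<open>w\<close> is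
    \<open>sqrt (f t)\<close> times this, and homogeneity of \<open>dirsum\<close> moves the powers
    of \<open>\<omega>\<close> into the argument.\<close>
  define \<omega> where "\<omega> p = sqrt (f (t + fst p *\<^sub>R snd p) / f t)" for p :: "real \<times> (real ^ 'n)"
  define b1 where "b1 p = - a 1 p / 2" for p
  define b3 where "b3 p = a 1 p ^ 3 / 16 - a 1 p * a 2 p / 4 + a 3 p / 2" for p
  define \<gamma>h where "\<gamma>h p = \<gamma> (t + fst p *\<^sub>R snd p) * f t" for p :: "real \<times> (real ^ 'n)"
  define \<delta>h where "\<delta>h p = (\<gamma> (t + fst p *\<^sub>R snd p) - fst p / 2 * dirsum (snd p) 1 \<gamma> (t + fst p *\<^sub>R snd p)) * f t" for p :: "real \<times> (real ^ 'n)"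
  have a0: "a 0 p = 1" for p using ft by (simp add: a_def dirsum_0 \<gamma>_def)
  have tay0: "(\<lambda>p. \<gamma>h p - (1 + a 1 p * fst p + a 2 p * fst p ^ 2 + a 3 p * fst p ^ 3 + a 4 p * fst p ^ 4)) \<in> o[?F](\<lambda>p. fst p ^ 4)"
  proof -
    have "(\<lambda>p. (dirsum (snd p) 0 \<gamma> (t + fst p *\<^sub>R snd p) - (\<Sum>k\<le>4. dirsum (snd p) (0 + k) \<gamma> t / fact k * fst p ^ k)) * f t) \<in> o[?F](\<lambda>p. fst p ^ 4)"
      using uniform_taylor[OF open_V _ _ \<delta>0_pos near_V \<rho>_pos, of 0 4 \<gamma>] \<gamma>_C ft by simp
    then show ?thesis
      by (rule landau_o.small.in_cong[THEN iffD1, rotated])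
        (use ft a0 in \<open>auto simp: \<gamma>h_def a_def dirsum_0 \<gamma>_def eval_nat_numeral field_simps intro!: always_eventually\<close>)
  qed
  \<comment> \<open>Order three is enough here, because this derivative enters with a factor
    \<open>\<epsilon>\<close>.\<close>
  have tay1: "(\<lambda>p. dirsum (snd p) 1 \<gamma> (t + fst p *\<^sub>R snd p) * f t - (a 1 p + 2 * a 2 p * fst p + 3 * a 3 p * fst p ^ 2 + 4 * a 4 p * fst p ^ 3)) \<in> o[?F](\<lambda>p. fst p ^ 3)"
  proof -
    have "(\<lambda>p. (dirsum (snd p) 1 \<gamma> (t + fst p *\<^sub>R snd p) - (\<Sum>k\<le>3. dirsum (snd p) (1 + k) \<gamma> t / fact k * fst p ^ k)) * f t) \<in> o[?F](\<lambda>p. fst p ^ 3)"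
      using uniform_taylor[OF open_V _ _ \<delta>0_pos near_V \<rho>_pos, of 1 3 \<gamma>] \<gamma>_C ft by simp
    then show ?thesis
      by (rule landau_o.small.in_cong[THEN iffD1, rotated])
        (auto simp: a_def eval_nat_numeral field_simps intro!: always_eventually)
  qed
  have "(\<lambda>p. 1 / \<delta>h p - (1 + b1 p * (fst p * \<omega> p) + b3 p * (fst p * \<omega> p) ^ 3 + a 4 p * (fst p * \<omega> p) ^ 4)) \<in> o[?F](\<lambda>p. fst p ^ 4)"
  proof (rule inverse_expansion[where ?a1.0="a 1" and ?a2.0="a 2" and ?a3.0="a 3" and \<gamma>=\<gamma>h])
    have "BO 4 (\<lambda>p. (\<gamma>h p - (1 + a 1 p * fst p + a 2 p * fst p ^ 2 + a 3 p * fst p ^ 3 + a 4 p * fst p ^ 4)) + fst p ^ 4 * a 4 p)"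
      by (intro BO_add smallo_BO[OF tay0] BO_e_times bdd) simp
    then show "BO 4 (\<lambda>p. \<gamma>h p - (1 + a 1 p * fst p + a 2 p * fst p ^ 2 + a 3 p * fst p ^ 3))"
      by (rule BO_eq) (simp add: algebra_simps)
    have "(\<lambda>p. fst p * (dirsum (snd p) 1 \<gamma> (t + fst p *\<^sub>R snd p) * f t - (a 1 p + 2 * a 2 p * fst p + 3 * a 3 p * fst p ^ 2 + 4 * a 4 p * fst p ^ 3))) \<in> o[?F](\<lambda>p. fst p * fst p ^ 3)"
      using tay1 by (intro landau_o.big_small_mult) auto
    then have "(\<lambda>p. (\<gamma>h p - (1 + a 1 p * fst p + a 2 p * fst p ^ 2 + a 3 p * fst p ^ 3 + a 4 p * fst p ^ 4))
       - (fst p * (dirsum (snd p) 1 \<gamma> (t + fst p *\<^sub>R snd p) * f t - (a 1 p + 2 * a 2 p * fst p + 3 * a 3 p * fst p ^ 2 + 4 * a 4 p * fst p ^ 3))) / 2) \<in> o[?F](\<lambda>p. fst p ^ 4)"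
      by (intro sum_in_smallo(2) tay0) (simp add: eval_nat_numeral)
    then show "(\<lambda>p. \<delta>h p - (1 + a 1 p / 2 * fst p - a 3 p / 2 * fst p ^ 3 - a 4 p * fst p ^ 4)) \<in> o[?F](\<lambda>p. fst p ^ 4)"
      by (rule landau_o.small.in_cong[THEN iffD1, rotated])
        (auto simp: \<delta>h_def \<gamma>h_def eval_nat_numeral field_simps intro!: always_eventually)
    show "0 \<le> \<omega> p" for p using f_nonneg ft by (simp add: \<omega>_def)
    have "\<forall>\<^sub>F \<epsilon> in at_right 0. \<epsilon> < \<delta>0 / \<rho>"
      using \<delta>0_pos \<rho>_pos by (intro eventually_at_right_real[THEN eventually_mono, of 0 "\<delta>0 / \<rho>"]) auto
    then show "\<forall>\<^sub>F p in ?F. (\<omega> p)\<^sup>2 * \<gamma>h p = 1"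
      unfolding eventually_prod_principal_iff using eventually_at_right_less[of 0]
    proof eventually_elim
      case (elim \<epsilon>)
      show ?case
      proof
        fix u :: "real ^ 'n" assume "u \<in> cball 0 \<rho>"
        then have "0 < f (t + \<epsilon> *\<^sub>R u)" using scaled_near[of \<epsilon> u] elim r_pos by auto
        then show "(\<omega> (\<epsilon>, u))\<^sup>2 * \<gamma>h (\<epsilon>, u) = 1" using ft by (simp add: \<omega>_def \<gamma>h_def \<gamma>_def)
      qed
    qed
  qed (auto simp: b1_def b3_def intro: bdd)
  then have "(\<lambda>p. (1 / \<delta>h p - (1 + b1 p * (fst p * \<omega> p) + b3 p * (fst p * \<omega> p) ^ 3 + a 4 p * (fst p * \<omega> p) ^ 4)) * f t) \<in> o[?F](\<lambda>p. fst p ^ 4)"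
    using ft by simp
  from landau_o.smallD[OF this assms]
  have ev: "\<forall>\<^sub>F \<epsilon> in at_right 0. \<forall>u\<in>cball 0 \<rho>. norm ((1 / \<delta>h (\<epsilon>, u) - (1 + b1 (\<epsilon>, u) * (\<epsilon> * \<omega> (\<epsilon>, u)) + b3 (\<epsilon>, u) * (\<epsilon> * \<omega> (\<epsilon>, u)) ^ 3 + a 4 (\<epsilon>, u) * (\<epsilon> * \<omega> (\<epsilon>, u)) ^ 4)) * f t) \<le> \<eta> * norm (\<epsilon> ^ 4)"
    unfolding eventually_prod_principal_iff by simp
  have eq: "(1 / \<delta>h (\<epsilon>, u) - (1 + b1 (\<epsilon>, u) * (\<epsilon> * \<omega> (\<epsilon>, u)) + b3 (\<epsilon>, u) * (\<epsilon> * \<omega> (\<epsilon>, u)) ^ 3 + a 4 (\<epsilon>, u) * (\<epsilon> * \<omega> (\<epsilon>, u)) ^ 4)) * f t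
     = quot \<epsilon> u - (let w = sqrt (f (t + \<epsilon> *\<^sub>R u)) *\<^sub>R u in f t + \<epsilon> * c1 w + \<epsilon> ^ 3 * c3 w + \<epsilon> ^ 4 * c4 w)" for \<epsilon> u
  proof -
    define b where "b = sqrt (f (t + \<epsilon> *\<^sub>R u))"
    obtain q where q: "0 < q" "f t = q * q" "sqrt (f t) = q"
      using ft by (metis real_sqrt_gt_zero real_sqrt_mult_self abs_of_pos)
    have w: "\<omega> (\<epsilon>, u) = b / q" by (simp add: \<omega>_def b_def real_sqrt_divide q(3))
    have fac: "fact 2 = (2::real)" "fact 3 = (6::real)" "fact 4 = (24::real)" by (simp_all add: eval_nat_numeral)
    have 1: "1 / \<delta>h (\<epsilon>, u) * f t = quot \<epsilon> u" using q(1) by (simp add: \<delta>h_def quot_def q(2))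
    have 2: "b1 (\<epsilon>, u) * (\<epsilon> * \<omega> (\<epsilon>, u)) * f t = \<epsilon> * c1 (b *\<^sub>R u)"
      unfolding b1_def a_def c1_def dirsum_scale w q(3) using q(1) by (simp add: q(2) field_simps)
    have 3: "b3 (\<epsilon>, u) * (\<epsilon> * \<omega> (\<epsilon>, u)) ^ 3 * f t = \<epsilon> ^ 3 * c3 (b *\<^sub>R u)"
      unfolding b3_def a_def c3_def dirsum_scale w q(3) fac using q(1) by (simp add: q(2) power3_eq_cube power2_eq_square field_simps)
    have 4: "a 4 (\<epsilon>, u) * (\<epsilon> * \<omega> (\<epsilon>, u)) ^ 4 * f t = \<epsilon> ^ 4 * c4 (b *\<^sub>R u)"
      unfolding a_def c4_def dirsum_scale w q(3) fac using q(1) by (simp add: q(2) eval_nat_numeral field_simps)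
    have gen: "(A - (1 + B + G + D)) * y = A * y - (y + B * y + G * y + D * y)" for A B G D y :: real
      by (simp add: algebra_simps)
    show ?thesis unfolding Let_def b_def[symmetric] gen 1 2 3 4 by (rule refl)
  qed
  show ?thesis using ev unfolding eq by simp
qed

lemma integrable_continuous_support:
  fixes h :: "real ^ 'n \<Rightarrow> real"
  assumes h: "continuous_on UNIV h" and z: "\<And>x. T < (norm x)\<^sup>2 \<Longrightarrow> h x = 0"
  shows "integrable lborel h"
proof -
  have "bounded (h ` cball 0 (sqrt T))"
    by (intro compact_imp_bounded compact_continuous_image continuous_on_subset[OF h]) auto
  then have "\<exists>B. \<forall>x\<in>cball 0 (sqrt T). \<bar>h x\<bar> \<le> B"
    unfolding bounded_iff by auto
  then obtain B where B: "\<And>x. x \<in> cball 0 (sqrt T) \<Longrightarrow> \<bar>h x\<bar> \<le> B" by blast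
  show ?thesis
  proof (rule integrable_bounded_support[where R="sqrt T" and B=B])
    show "h x = 0" if "sqrt T < norm x" for x
      using that T_pos power_strict_mono[of "sqrt T" "norm x" 2] by (intro z) auto
  qed (use B in auto, rule borel_measurable_continuous_onI[OF h])
qed

lemma K_times_integrable: "continuous_on UNIV g \<Longrightarrow> integrable lborel (\<lambda>w. K w * g w)"
  by (rule integrable_continuous_support) (auto intro!: continuous_intros K_cont simp: K_zero)

lemma L_times_integrable: "continuous_on UNIV g \<Longrightarrow> integrable lborel (\<lambda>w. kernel_L K w * g w)"
  by (rule integrable_continuous_support, intro continuous_intros kernel_L_cont) (simp_all add: kernel_L_eq l_zero)

lemma t_in_V: "t \<in> V" using near_V \<delta>0_pos by auto

lemma ft_pos: "0 < f t" using t_in_V by (simp add: V_def)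

lemma dirsum_\<gamma>_cont: "m \<le> 4 \<Longrightarrow> continuous_on UNIV (\<lambda>w. dirsum w m \<gamma> t)"
  using t_in_V by (intro continuous_on_dirsum_compose[OF C_on_mono[OF _ \<gamma>_C]]) auto

lemma c_cont: "continuous_on UNIV c1" "continuous_on UNIV c3" "continuous_on UNIV c4"
  unfolding c1_def[abs_def] c3_def[abs_def] c4_def[abs_def]
  using ft_pos by (auto intro!: continuous_intros dirsum_\<gamma>_cont)

lemma dirsum_minus: "dirsum (- w) m g x = (-1) ^ m * dirsum w m g x"
  using dirsum_scale[of "-1" w m g x] by simp

lemma c_odd: "c1 (- w) = - c1 w" "c3 (- w) = - c3 w"
  unfolding c1_def c3_def dirsum_minus by (simp_all add: power3_eq_cube algebra_simps)

lemma ideal_integrand: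
  assumes "0 \<le> \<epsilon>" "\<epsilon> \<le> \<epsilon>1"
  shows "K (\<alpha> (f (t + \<epsilon> *\<^sub>R u)) *\<^sub>R u) * \<alpha> (f (t + \<epsilon> *\<^sub>R u)) ^ d * f (t + \<epsilon> *\<^sub>R u)
    = (if norm u \<le> \<rho> then K (sqrt (f (t + \<epsilon> *\<^sub>R u)) *\<^sub>R u) * (sqrt (f (t + \<epsilon> *\<^sub>R u)) ^ (d - 1) * Jac \<epsilon> u) * quot \<epsilon> u else 0)"
proof (cases "norm u \<le> \<rho>")
  case True
  let ?x = "t + \<epsilon> *\<^sub>R u"
  have "\<alpha> (f ?x) = sqrt (f ?x)"
    using scaled_near[of \<epsilon> u] assms True s1_r by (intro \<alpha>_sqrt) (auto simp: \<epsilon>1_def)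
  moreover have "sqrt (f ?x) ^ d = sqrt (f ?x) ^ (d - 1) * sqrt (f ?x)"
    using d_pos by (simp flip: power_Suc2)
  moreover note quot_eq[OF assms True]
  ultimately show ?thesis using True by (simp add: mult_ac)
qed (simp add: K_outside)

text \<open>The mean of one summand with the pilot replaced by \<open>f\<close>, after
  \<open>x = t + \<epsilon> *\<^sub>R u\<close>; see \<open>summand_integral\<close>.\<close>

definition ideal_mean where
  "ideal_mean \<epsilon> = (LINT u|lborel. K (\<alpha> (f (t + \<epsilon> *\<^sub>R u)) *\<^sub>R u) * \<alpha> (f (t + \<epsilon> *\<^sub>R u)) ^ d * f (t + \<epsilon> *\<^sub>R u))"

text \<open>The pointwise error of \<open>quot_expansion\<close> is multiplied by \<open>?H\<close>,
  which integrates to 1 by the same substitution. A uniform \<open>\<eta> * \<epsilon> ^ 4\<close>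
  therefore remains \<open>\<eta> * \<epsilon> ^ 4\<close> after integration.\<close>

lemma ideal_mean_expansion:
  "((\<lambda>\<epsilon>. (ideal_mean \<epsilon> - f t) / \<epsilon> ^ 4) \<longlongrightarrow> (LINT w|lborel. K w * c4 w)) (at_right 0)"
proof (rule tendstoI)
  fix e :: real assume e: "0 < e"
  define \<eta> where "\<eta> = e / 2"
  have \<eta>: "0 < \<eta>" using e by (simp add: \<eta>_def)
  have "\<forall>\<^sub>F \<epsilon> in at_right (0::real). \<epsilon> < \<epsilon>1"
    using \<epsilon>1_pos by (intro eventually_at_right_real[THEN eventually_mono, of 0 \<epsilon>1]) auto
  then show "\<forall>\<^sub>F \<epsilon> in at_right 0. dist ((ideal_mean \<epsilon> - f t) / \<epsilon> ^ 4) (LINT w|lborel. K w * c4 w) < e"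
    using quot_expansion[OF \<eta>] eventually_at_right_less[of 0]
  proof eventually_elim
    case (elim \<epsilon>)
    define P where "P w = f t + \<epsilon> * c1 w + \<epsilon> ^ 3 * c3 w + \<epsilon> ^ 4 * c4 w" for w
    let ?b = "\<lambda>u. sqrt (f (t + \<epsilon> *\<^sub>R u))"
    let ?j = "\<lambda>u. ?b u ^ (d - 1) * Jac \<epsilon> u"
    let ?I = "\<lambda>u. K (\<alpha> (f (t + \<epsilon> *\<^sub>R u)) *\<^sub>R u) * \<alpha> (f (t + \<epsilon> *\<^sub>R u)) ^ d * f (t + \<epsilon> *\<^sub>R u)"
    let ?G = "\<lambda>u. if norm u \<le> \<rho> then K (?b u *\<^sub>R u) * P (?b u *\<^sub>R u) * ?j u else 0"
    let ?H = "\<lambda>u. if norm u \<le> \<rho> then K (?b u *\<^sub>R u) * ?j u else 0"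
    have e1: "0 \<le> \<epsilon>" "\<epsilon> \<le> \<epsilon>1" using elim by auto
    have P_cont: "continuous_on UNIV P" unfolding P_def by (intro continuous_intros c_cont)
    have [measurable]: "P \<in> borel_measurable borel" by (intro borel_measurable_continuous_onI P_cont)
    have G: "has_bochner_integral lborel ?G (LINT w|lborel. K w * P w)"
      by (rule radial_substitution[OF e1, of "\<lambda>w. K w * P w"]) (auto intro!: K_times_integrable P_cont simp: K_zero)
    have H: "has_bochner_integral lborel ?H 1"
      using radial_substitution[OF e1 K_measurable K_integrable K_zero] by (simp add: K_integral)
    have bound: "\<bar>?I u - ?G u\<bar> \<le> \<eta> * \<epsilon> ^ 4 * ?H u" for u
    proof (cases "norm u \<le> \<rho>")
      case True
      have j: "0 \<le> ?j u"
        using Jac_nonneg[OF e1 True] f_nonneg by (intro mult_nonneg_nonneg) auto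
      have "\<bar>quot \<epsilon> u - P (?b u *\<^sub>R u)\<bar> \<le> \<eta> * \<epsilon> ^ 4"
        using elim(2) True unfolding P_def Let_def by auto
      then have "\<bar>(K (?b u *\<^sub>R u) * ?j u) * (quot \<epsilon> u - P (?b u *\<^sub>R u))\<bar> \<le> (K (?b u *\<^sub>R u) * ?j u) * (\<eta> * \<epsilon> ^ 4)"
        using K_nonneg j by (subst abs_mult) (intro mult_mono, auto)
      then show ?thesis unfolding ideal_integrand[OF e1] using True by (simp add: algebra_simps)
    qed (simp add: K_outside)
    have Im[measurable]: "?I \<in> borel_measurable borel" by measurable
    have Gm: "?G \<in> borel_measurable borel" by measurable
    have IGm: "(\<lambda>u. ?I u - ?G u) \<in> borel_measurable lborel"
      using borel_measurable_diff[OF Im Gm] by simp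
    have int: "integrable lborel (\<lambda>u. ?I u - ?G u)"
    proof (rule Bochner_Integration.integrable_bound)
      show "integrable lborel (\<lambda>u. \<eta> * \<epsilon> ^ 4 * ?H u)" using H by (intro integrable_mult_right) (simp add: has_bochner_integral_iff)
      show "AE u in lborel. norm (?I u - ?G u) \<le> norm (\<eta> * \<epsilon> ^ 4 * ?H u)"
        using order_trans[OF bound abs_ge_self] by (intro AE_I2) (simp only: real_norm_def)
    qed (rule IGm)
    have KP: "(LINT w|lborel. K w * P w) = f t + \<epsilon> ^ 4 * (LINT w|lborel. K w * c4 w)"
    proof -
      have odd: "(LINT w|lborel. K w * c1 w) = 0" "(LINT w|lborel. K w * c3 w) = 0"
        by (auto intro!: lborel_integral_odd borel_measurable_continuous_onI continuous_intros K_cont c_cont simp: K_minus c_odd)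
      have i: "integrable lborel (\<lambda>w. K w * c1 w)" "integrable lborel (\<lambda>w. K w * c3 w)" "integrable lborel (\<lambda>w. K w * c4 w)"
        by (intro K_times_integrable c_cont)+
      have "(LINT w|lborel. K w * P w) = (LINT w|lborel. f t * K w + \<epsilon> * (K w * c1 w) + \<epsilon> ^ 3 * (K w * c3 w) + \<epsilon> ^ 4 * (K w * c4 w))"
        by (intro Bochner_Integration.integral_cong) (auto simp: P_def algebra_simps)
      also have "\<dots> = f t + \<epsilon> ^ 4 * (LINT w|lborel. K w * c4 w)"
        using i K_integrable by (simp add: odd K_integral)
      finally show ?thesis .
    qed
    have "integrable lborel (\<lambda>u. (?I u - ?G u) + ?G u)"
      using int G by (intro Bochner_Integration.integrable_add) (auto simp: has_bochner_integral_iff)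
    then have "integrable lborel ?I" by simp
    then have "ideal_mean \<epsilon> - (LINT w|lborel. K w * P w) = (LINT u|lborel. ?I u - ?G u)"
      unfolding ideal_mean_def has_bochner_integral_integral_eq[OF G, symmetric]
      by (rule Bochner_Integration.integral_diff[symmetric]) (rule integrable.intros[OF G])
    then have "\<bar>ideal_mean \<epsilon> - (LINT w|lborel. K w * P w)\<bar> \<le> (LINT u|lborel. \<bar>?I u - ?G u\<bar>)"
      by (simp only: integral_abs_bound)
    moreover have "(LINT u|lborel. \<bar>?I u - ?G u\<bar>) \<le> (LINT u|lborel. \<eta> * \<epsilon> ^ 4 * ?H u)"
      by (rule integral_mono[OF integrable_abs[OF int] integrable_mult_right[OF integrable.intros[OF H]] bound])
    moreover have "(LINT u|lborel. \<eta> * \<epsilon> ^ 4 * ?H u) = \<eta> * \<epsilon> ^ 4"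
      unfolding integral_mult_right_zero has_bochner_integral_integral_eq[OF H] by simp
    ultimately have fin: "\<bar>(ideal_mean \<epsilon> - f t) - \<epsilon> ^ 4 * (LINT w|lborel. K w * c4 w)\<bar> \<le> \<eta> * \<epsilon> ^ 4"
      unfolding KP diff_diff_eq by linarith
    have e4: "0 < \<epsilon> ^ 4" using elim by simp
    have "(ideal_mean \<epsilon> - f t) / \<epsilon> ^ 4 - (LINT w|lborel. K w * c4 w) = ((ideal_mean \<epsilon> - f t) - \<epsilon> ^ 4 * (LINT w|lborel. K w * c4 w)) / \<epsilon> ^ 4"
      using e4 by (simp add: diff_divide_distrib)
    then have "\<bar>(ideal_mean \<epsilon> - f t) / \<epsilon> ^ 4 - (LINT w|lborel. K w * c4 w)\<bar> = \<bar>(ideal_mean \<epsilon> - f t) - \<epsilon> ^ 4 * (LINT w|lborel. K w * c4 w)\<bar> / \<epsilon> ^ 4"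
      by (simp only: abs_divide abs_of_pos[OF e4])
    also have "\<dots> \<le> \<eta>" using fin e4 by (simp add: divide_le_eq)
    also have "\<dots> < e" using e by (simp add: \<eta>_def)
    finally show ?case by (simp add: dist_real_def)
  qed
qed

lemma asymptotic_bias_eq:
  "asymptotic_bias K c2 f t = c2 powr ((real d + 8) / 2) * (LINT w|lborel. K w * c4 w)"
proof -
  have c: "continuous_on UNIV (\<lambda>w :: real ^ 'n. multi_power w v)" for v
    unfolding multi_power_def by (intro continuous_intros)
  have "(LINT w|lborel. K w * c4 w) = (LINT w|lborel. (\<Sum>v | multi_abs v = 4. multi_deriv v \<gamma> t / multi_fact v * (K w * multi_power w v)))"
  proof (intro Bochner_Integration.integral_cong refl)
    fix w
    \<comment> \<open>The 24 in \<open>c4\<close> is the \<open>fact 4\<close> of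
      \<open>dirsum_multi_index\<close>.\<close>
    have "c4 w = (\<Sum>v | multi_abs v = 4. multi_power w v * multi_deriv v \<gamma> t / multi_fact v)"
      unfolding c4_def dirsum_multi_index[OF open_V \<gamma>_C t_in_V] by (simp add: fact_numeral)
    then show "K w * c4 w = (\<Sum>v | multi_abs v = 4. multi_deriv v \<gamma> t / multi_fact v * (K w * multi_power w v))"
      by (simp add: sum_distrib_left mult_ac)
  qed
  also have "\<dots> = (\<Sum>v | multi_abs v = 4. multi_deriv v \<gamma> t / multi_fact v * (LINT w|lborel. K w * multi_power w v))"
    by (subst Bochner_Integration.integral_sum) (auto intro!: K_times_integrable c)
  finally show ?thesis
    unfolding asymptotic_bias_def kernel_moment_def d_eq \<gamma>_def by (simp add: mult_ac)
qed

end

subsection \<open>Taylor expansion in the pilot density\<close>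

context pilot
begin

definition kern where "kern u s = K (\<alpha> s *\<^sub>R u) * \<alpha> s ^ d"

text \<open>The derivative of \<open>kern u\<close> in \<open>s\<close> under
  \<open>\<alpha> s = sqrt s\<close>. Differentiating
  \<open>K (\<beta> *\<^sub>R u) * \<beta> ^ d\<close> in the scale \<open>\<beta>\<close> gives
  \<open>\<beta> ^ (d - 1)\<close> times \<open>L\<close> at \<open>\<beta> *\<^sub>R u\<close>,
  which is where \<open>L\<close> enters; then \<open>\<beta> = sqrt s\<close>.\<close>

definition Dkern where "Dkern u s = sqrt s ^ d * kernel_L K (sqrt s *\<^sub>R u) / (2 * s)"

definition L_bound where "L_bound = real d * \<kappa> + 2 * T * \<kappa>"

lemma L_bound_nonneg: "0 \<le> L_bound"
  using T_pos \<kappa>_pos by (simp add: L_bound_def)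

lemma l_le: "0 \<le> s \<Longrightarrow> \<bar>l s\<bar> \<le> L_bound"
proof (cases "T < s")
  case False
  assume s: "0 \<le> s"
  have "\<bar>l s\<bar> \<le> \<bar>real d * \<Phi> s\<bar> + \<bar>2 * s * \<Phi>1 s\<bar>" unfolding l_def by (rule abs_triangle_ineq)
  also have "\<dots> \<le> real d * \<kappa> + 2 * T * \<kappa>"
    using False s \<Phi>_le[OF s] \<Phi>1_le[OF s] by (intro add_mono) (auto simp: abs_mult mult_left_mono intro!: mult_mono)
  finally show ?thesis by (simp add: L_bound_def)
qed (use L_bound_nonneg in \<open>simp add: l_zero\<close>)

lemma L_le: "\<bar>kernel_L K x\<bar> \<le> L_bound"
  unfolding kernel_L_eq by (rule l_le) simp

lemma sqrt_power_deriv: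
  "0 < s \<Longrightarrow> ((\<lambda>s. sqrt s ^ m) has_real_derivative real m / (2 * s) * sqrt s ^ m) (at s)"
proof (cases m)
  case (Suc k)
  assume s: "0 < s"
  have "sqrt s * sqrt s = s" using s by simp
  then have "inverse (sqrt s) = sqrt s / s" using s by (simp add: field_simps)
  then have "real m * (inverse (sqrt s) / 2 * sqrt s ^ (m - Suc 0)) = real m / (2 * s) * sqrt s ^ m"
    using s Suc by simp
  then show ?thesis using DERIV_power[OF DERIV_real_sqrt[OF s], of m] by (simp add: mult.commute)
qed auto

lemma scale_arg_deriv:
  assumes "\<And>s. 0 \<le> s \<Longrightarrow> (g has_real_derivative g' s) (at s within {0..})" "0 \<le> a" "0 < s"
  shows "((\<lambda>s. g (s * a)) has_real_derivative g' (s * a) * a) (at s)"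
proof -
  have "((\<lambda>s. s * a) has_real_derivative a) (at s within {0<..})"
    by (auto intro!: derivative_eq_intros)
  moreover have "(g has_real_derivative g' (s * a)) (at (s * a) within (\<lambda>s. s * a) ` {0<..})"
    by (rule has_field_derivative_subset[OF assms(1)]) (use assms in auto)
  ultimately have "(g \<circ> (\<lambda>s. s * a) has_real_derivative g' (s * a) * a) (at s within {0<..})"
    by (intro DERIV_image_chain)
  moreover have "at s within {0<..} = at s" using assms(3) by (intro at_within_open) auto
  ultimately show ?thesis by (simp add: o_def)
qed

text \<open>Bounds the bracket of the second derivative \<open>?E\<close> below. That bracket
  depends on \<open>a\<close> only through \<open>s * a\<close> and vanishes for
  \<open>s * a > T\<close>, so the bound is uniform in \<open>a\<close>.\<close>

definition DD_bound where
  "DD_bound = (real d + 1) * L_bound + T * ((real d + 2) * \<kappa> + 2 * T * \<kappa>)"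

text \<open>\<open>a\<close> stands for \<open>(norm u)^2\<close>. The mean value inequality is used
  twice, for the derivative \<open>?D\<close> and then for the function minus its tangent, which
  asks of the second derivative only that it exists and is bounded.\<close>

lemma kern_second_order:
  assumes a: "0 \<le> a" and b: "0 < lo" "lo \<le> s" "s \<le> hi" "lo \<le> \<phi>" "\<phi> \<le> hi"
  shows "\<bar>\<Phi> (s * a) * sqrt s ^ d - \<Phi> (\<phi> * a) * sqrt \<phi> ^ d - sqrt \<phi> ^ d * l (\<phi> * a) / (2 * \<phi>) * (s - \<phi>)\<bar>
    \<le> sqrt hi ^ d / (2 * lo\<^sup>2) * DD_bound * (s - \<phi>)\<^sup>2"
proof -
  define M where "M = sqrt hi ^ d / (2 * lo\<^sup>2) * DD_bound"
  let ?k = "\<lambda>s. \<Phi> (s * a) * sqrt s ^ d" and ?D = "\<lambda>s. sqrt s ^ d * l (s * a) / (2 * s)"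
  let ?l' = "\<lambda>s. (real d + 2) * \<Phi>1 s + 2 * s * \<Phi>2 s"
  let ?E = "\<lambda>s. sqrt s ^ d / (2 * s\<^sup>2) * ((real d / 2 - 1) * l (s * a) + (s * a) * ?l' (s * a))"
  have k: "(?k has_real_derivative ?D s) (at s)" if s: "0 < s" for s
  proof -
    have "(?k has_real_derivative (\<Phi>1 (s * a) * a) * sqrt s ^ d + (real d / (2 * s) * sqrt s ^ d) * \<Phi> (s * a)) (at s)"
      by (rule DERIV_mult[OF scale_arg_deriv[OF \<Phi>_deriv a s] sqrt_power_deriv[OF s]])
    moreover have "(\<Phi>1 (s * a) * a) * sqrt s ^ d + (real d / (2 * s) * sqrt s ^ d) * \<Phi> (s * a) = ?D s"
      using s by (simp add: l_def field_simps)
    ultimately show ?thesis by (simp only:)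
  qed
  have D: "(?D has_real_derivative ?E s) (at s)" if s: "0 < s" for s
  proof -
    have "(?D has_real_derivative (((real d / (2 * s) * sqrt s ^ d) * l (s * a) + (?l' (s * a) * a) * sqrt s ^ d) * (2 * s) - (sqrt s ^ d * l (s * a)) * 2) / ((2 * s) * (2 * s))) (at s)"
      by (rule DERIV_divide[OF DERIV_mult[OF sqrt_power_deriv[OF s] scale_arg_deriv[OF l_deriv a s]]])
        (use s in \<open>auto intro!: derivative_eq_intros\<close>)
    moreover have "(((real d / (2 * s) * sqrt s ^ d) * l (s * a) + (?l' (s * a) * a) * sqrt s ^ d) * (2 * s) - (sqrt s ^ d * l (s * a)) * 2) / ((2 * s) * (2 * s)) = ?E s"
      using s by (simp add: field_simps power2_eq_square)
    ultimately show ?thesis by (simp only:)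
  qed
  have E: "\<bar>?E s\<bar> \<le> M" if s: "lo \<le> s" "s \<le> hi" for s
  proof -
    have s0: "0 < s" using b s by simp
    have sa: "0 \<le> s * a" using s0 a by simp
    have 1: "\<bar>(real d / 2 - 1) * l (s * a)\<bar> \<le> (real d + 1) * L_bound"
      unfolding abs_mult by (intro mult_mono l_le sa) (auto simp: abs_le_iff)
    have 2: "\<bar>(s * a) * ?l' (s * a)\<bar> \<le> T * ((real d + 2) * \<kappa> + 2 * T * \<kappa>)"
    proof (cases "T < s * a")
      case True
      then show ?thesis using T_pos \<kappa>_pos by (simp add: \<Phi>1_zero \<Phi>2_zero)
    next
      case False
      have "\<bar>?l' (s * a)\<bar> \<le> \<bar>(real d + 2) * \<Phi>1 (s * a)\<bar> + \<bar>2 * (s * a) * \<Phi>2 (s * a)\<bar>" by (rule abs_triangle_ineq)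
      also have "\<dots> \<le> (real d + 2) * \<kappa> + 2 * T * \<kappa>"
        using False sa \<Phi>1_le[OF sa] \<Phi>2_le[OF sa] unfolding abs_mult by (intro add_mono mult_mono) auto
      finally show ?thesis unfolding abs_mult[of "s * a"] using False sa T_pos by (intro mult_mono) auto
    qed
    have "\<bar>(real d / 2 - 1) * l (s * a) + (s * a) * ?l' (s * a)\<bar> \<le> DD_bound"
      unfolding DD_bound_def using 1 2 by linarith
    moreover have "sqrt s ^ d / (2 * s\<^sup>2) \<le> sqrt hi ^ d / (2 * lo\<^sup>2)"
      using s b by (intro frac_le power_mono mult_left_mono) auto
    ultimately show ?thesis unfolding M_def abs_mult
      using s0 b by (intro mult_mono) auto
  qed
  have seg: "x \<in> {lo..hi}" if "x \<in> closed_segment \<phi> s" for x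
    using that b by (auto simp: closed_segment_eq_real_ivl split: if_splits)
  have Dl: "\<bar>?D x - ?D \<phi>\<bar> \<le> M * \<bar>s - \<phi>\<bar>" if x: "x \<in> closed_segment \<phi> s" for x
  proof -
    have "norm (?D x - ?D \<phi>) \<le> M * norm (x - \<phi>)"
    proof (rule field_differentiable_bound[where S="{lo..hi}" and f'="?E"])
      show "(?D has_field_derivative ?E y) (at y within {lo..hi})" if "y \<in> {lo..hi}" for y
        by (rule has_field_derivative_at_within[OF D]) (use that b in auto)
      show "norm (?E y) \<le> M" if "y \<in> {lo..hi}" for y using E[of y] that by simp
    qed (use seg[OF x] b in auto)
    also have "\<dots> \<le> M * \<bar>s - \<phi>\<bar>"
    proof (rule mult_left_mono)
      show "norm (x - \<phi>) \<le> \<bar>s - \<phi>\<bar>" using x by (auto simp: closed_segment_eq_real_ivl split: if_splits)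
      show "0 \<le> M" using E[of \<phi>] b by linarith
    qed
    finally show ?thesis by simp
  qed
  have "norm ((?k s - s * ?D \<phi>) - (?k \<phi> - \<phi> * ?D \<phi>)) \<le> (M * \<bar>s - \<phi>\<bar>) * norm (s - \<phi>)"
  proof (rule field_differentiable_bound[where S="closed_segment \<phi> s" and f'="\<lambda>x. ?D x - 1 * ?D \<phi>"])
    show "((\<lambda>s. ?k s - s * ?D \<phi>) has_field_derivative ?D x - 1 * ?D \<phi>) (at x within closed_segment \<phi> s)" if "x \<in> closed_segment \<phi> s" for x
    proof (rule has_field_derivative_at_within, rule DERIV_diff)
      show "(?k has_real_derivative ?D x) (at x)" by (rule k) (use seg[OF that] b in auto)
      show "((\<lambda>s. s * ?D \<phi>) has_real_derivative 1 * ?D \<phi>) (at x)" by (rule DERIV_cmult_right[OF DERIV_ident])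
    qed
    show "norm (?D x - 1 * ?D \<phi>) \<le> M * \<bar>s - \<phi>\<bar>" if "x \<in> closed_segment \<phi> s" for x
      using Dl[OF that] by simp
  qed auto
  moreover have "(A - s * D) - (B - \<phi> * D) = A - B - D * (s - \<phi>)" for A B D :: real
    by (simp add: algebra_simps)
  moreover have "(M * \<bar>s - \<phi>\<bar>) * norm (s - \<phi>) = M * (s - \<phi>)\<^sup>2"
    by (simp add: power2_eq_square)
  ultimately show ?thesis unfolding M_def by (simp only: real_norm_def)
qed

lemma K_sqrt: "0 \<le> s \<Longrightarrow> K (sqrt s *\<^sub>R u) = \<Phi> (s * (norm u)\<^sup>2)"
  and L_sqrt: "0 \<le> s \<Longrightarrow> kernel_L K (sqrt s *\<^sub>R u) = l (s * (norm u)\<^sup>2)"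
  by (simp_all add: K_eq kernel_L_eq power_mult_distrib)

text \<open>Trades the polynomial growth of \<open>kern\<close> in the pilot value for exponential
  growth, for which a moment of the pilot is available.\<close>

lemma power_le_exp: "0 \<le> x \<Longrightarrow> x ^ d \<le> real d ^ d * exp (x :: real)"
proof -
  assume x: "0 \<le> x"
  have "x / real d \<le> exp (x / real d)" using exp_ge_add_one_self[of "x / real d"] by linarith
  then have "(x / real d) ^ d \<le> exp (x / real d) ^ d" using x by (intro power_mono) auto
  also have "\<dots> = exp x" using d_pos by (simp flip: exp_of_nat_mult)
  finally show ?thesis using d_pos by (simp add: power_divide divide_le_eq mult.commute)
qed

lemma kern_abs_le: "0 \<le> s \<Longrightarrow> \<bar>kern u s\<bar> \<le> \<kappa> * sqrt (s1 + s) ^ d"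
  using K_le K_nonneg \<alpha>_le[of s] \<alpha>_ge[of s] c_pos \<kappa>_pos unfolding kern_def abs_mult
  by (intro mult_mono) (auto simp: abs_mult intro!: power_mono)

lemma Dkern_abs_le:
  assumes "r \<le> \<phi>" "\<phi> \<le> C"
  shows "\<bar>Dkern u \<phi>\<bar> \<le> sqrt C ^ d * L_bound / (2 * r)"
proof -
  have p: "0 < \<phi>" using assms r_pos by simp
  have "\<bar>Dkern u \<phi>\<bar> = sqrt \<phi> ^ d * \<bar>kernel_L K (sqrt \<phi> *\<^sub>R u)\<bar> / (2 * \<phi>)"
    unfolding Dkern_def using p by (simp add: abs_mult)
  also have "\<dots> \<le> sqrt C ^ d * L_bound / (2 * r)"
    using assms p r_pos L_le L_bound_nonneg by (intro frac_le mult_mono power_mono) auto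
  finally show ?thesis .
qed

lemma kern_outside: "\<rho> < norm u \<Longrightarrow> kern u s = 0"
  by (simp add: kern_def K_outside)

lemma Dkern_outside: "\<rho> < norm u \<Longrightarrow> r \<le> s \<Longrightarrow> Dkern u s = 0"
  using L_outside[of u s] \<alpha>_sqrt[of s] s1_r by (simp add: Dkern_def)

text \<open>Three regimes. For \<open>\<bar>s - \<phi>\<bar> \<le> r - s1\<close> both values are at
  least \<open>s1\<close>, and the second-order expansion applies. Otherwise the squared difference
  is at least \<open>(r - s1)^2\<close> and absorbs the bound valid for \<open>s < S0\<close>; for
  larger \<open>s\<close> the exponential takes over. The threshold \<open>S0\<close> is still
  arbitrary here.\<close>

lemma kern_taylor:
  obtains C1 where "0 \<le> C1" "\<And>u s \<phi>. r \<le> \<phi> \<Longrightarrow> \<phi> \<le> C \<Longrightarrow> 0 \<le> s \<Longrightarrow>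
    \<bar>kern u s - kern u \<phi> - Dkern u \<phi> * (s - \<phi>)\<bar> \<le> C1 * (if norm u \<le> \<rho> then (s - \<phi>)\<^sup>2 + (if S0 \<le> s then exp s else 0) else 0)"
proof -
  define \<delta> where "\<delta> = r - s1"
  have \<delta>: "0 < \<delta>" using s1_r by (simp add: \<delta>_def)
  define M where "M = sqrt (C + \<delta>) ^ d / (2 * s1\<^sup>2) * DD_bound"
  \<comment> \<open>One summand for each of the three terms on the left, all measured against
    \<open>exp s\<close>.\<close>
  define C' where "C' = \<kappa> * (real d ^ d * exp (1 + s1)) + \<kappa> * sqrt (s1 + C) ^ d + sqrt C ^ d * L_bound / (2 * r) * (1 + C)"
  have DD: "0 \<le> DD_bound" using T_pos \<kappa>_pos L_bound_nonneg by (simp add: DD_bound_def)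
  have M0: "0 \<le> M" unfolding M_def using C_pos \<delta> DD by (intro mult_nonneg_nonneg divide_nonneg_nonneg) auto
  have C'0: "0 \<le> C'" unfolding C'_def using \<kappa>_pos s1_pos C_pos L_bound_nonneg r_pos
    by (intro add_nonneg_nonneg mult_nonneg_nonneg divide_nonneg_nonneg) auto
  define C1 where "C1 = M + C' + C' * exp S0 / \<delta>\<^sup>2"
  have *: "\<bar>kern u s - kern u \<phi> - Dkern u \<phi> * (s - \<phi>)\<bar> \<le> C1 * (if norm u \<le> \<rho> then (s - \<phi>)\<^sup>2 + (if S0 \<le> s then exp s else 0) else 0)"
    if \<phi>: "r \<le> \<phi>" "\<phi> \<le> C" and s: "0 \<le> s" for u s \<phi>
  proof (cases "norm u \<le> \<rho>")
    case False
    then show ?thesis using \<phi> by (simp add: kern_outside Dkern_outside)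
  next
    case True
    have \<phi>0: "s1 \<le> \<phi>" "0 \<le> \<phi>" using \<phi> s1_r s1_pos by auto
    define R where "R = \<bar>kern u s - kern u \<phi> - Dkern u \<phi> * (s - \<phi>)\<bar>"
    have "R \<le> C1 * ((s - \<phi>)\<^sup>2 + (if S0 \<le> s then exp s else 0))"
    proof (cases "\<bar>s - \<phi>\<bar> \<le> \<delta>")
      case True
      then have s': "s1 \<le> s" "s \<le> C + \<delta>" using \<phi> by (auto simp: \<delta>_def)
      have "R \<le> M * (s - \<phi>)\<^sup>2"
        using kern_second_order[of "(norm u)\<^sup>2" s1 s "C + \<delta>" \<phi>] s' \<phi>0 \<phi> s1_pos \<delta> s
        by (simp add: R_def kern_def Dkern_def \<alpha>_sqrt K_sqrt L_sqrt M_def)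
      also have "\<dots> \<le> C1 * ((s - \<phi>)\<^sup>2 + (if S0 \<le> s then exp s else 0))"
        using M0 C'0 by (intro mult_mono) (auto simp: C1_def)
      finally show ?thesis .
    next
      case False
      have "sqrt (s1 + s) \<le> 1 + s1 + s"
        using s s1_pos by (intro real_le_lsqrt) (auto simp: power2_eq_square algebra_simps)
      then have "sqrt (s1 + s) ^ d \<le> (1 + s1 + s) ^ d"
        using s s1_pos by (intro power_mono) auto
      also have "\<dots> \<le> real d ^ d * exp (1 + s1 + s)"
        using s s1_pos by (intro power_le_exp) auto
      finally have fin: "sqrt (s1 + s) ^ d \<le> real d ^ d * exp (1 + s1 + s)" .
      have 1: "\<bar>kern u s\<bar> \<le> \<kappa> * (real d ^ d * exp (1 + s1)) * exp s"
      proof -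
        have "\<bar>kern u s\<bar> \<le> \<kappa> * (real d ^ d * exp (1 + s1 + s))"
          using order_trans[OF kern_abs_le[OF s] mult_left_mono[OF fin]] \<kappa>_pos by simp
        then show ?thesis by (simp only: exp_add mult.assoc)
      qed
      have e1: "1 \<le> exp s" "s \<le> exp s" using s exp_ge_add_one_self[of s] by (simp, linarith)
      have "\<bar>kern u \<phi>\<bar> \<le> \<kappa> * sqrt (s1 + C) ^ d * 1"
        using kern_abs_le[OF \<phi>0(2), of u] \<kappa>_pos \<phi> \<phi>0 s1_pos
        by (intro order_trans[OF kern_abs_le[OF \<phi>0(2)]]) (auto intro!: mult_left_mono power_mono)
      also have "\<dots> \<le> \<kappa> * sqrt (s1 + C) ^ d * exp s"
        using e1 \<kappa>_pos s1_pos C_pos by (intro mult_left_mono) auto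
      finally have 2: "\<bar>kern u \<phi>\<bar> \<le> \<kappa> * sqrt (s1 + C) ^ d * exp s" .
      have "C * 1 \<le> C * exp s" using e1 C_pos by (intro mult_left_mono) auto
      then have "\<bar>s - \<phi>\<bar> \<le> (1 + C) * exp s" using s \<phi> \<phi>0 e1 by (simp add: algebra_simps)
      then have 3: "\<bar>Dkern u \<phi> * (s - \<phi>)\<bar> \<le> sqrt C ^ d * L_bound / (2 * r) * ((1 + C) * exp s)"
        unfolding abs_mult using Dkern_abs_le[OF \<phi>, of u] by (intro mult_mono) auto
      have R1: "R \<le> C' * exp s"
        unfolding R_def C'_def using 1 2 3 by (simp add: algebra_simps)
      have bd: "R \<le> C' * exp S0 / \<delta>\<^sup>2 * (s - \<phi>)\<^sup>2" if "s < S0"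
      proof -
        have "\<delta>\<^sup>2 \<le> (s - \<phi>)\<^sup>2" using False \<delta> by (intro abs_le_square_iff[THEN iffD1]) auto
        then have "1 \<le> (s - \<phi>)\<^sup>2 / \<delta>\<^sup>2" using \<delta> by simp
        have "R \<le> C' * exp S0 * 1" using R1 C'0 that by (intro order_trans[OF R1]) (auto intro!: mult_left_mono)
        also have "\<dots> \<le> C' * exp S0 * ((s - \<phi>)\<^sup>2 / \<delta>\<^sup>2)"
          using \<open>1 \<le> (s - \<phi>)\<^sup>2 / \<delta>\<^sup>2\<close> C'0 by (intro mult_left_mono) auto
        finally show ?thesis by (simp add: mult_ac)
      qed
      have C1: "C' \<le> C1" "C' * exp S0 / \<delta>\<^sup>2 \<le> C1" "0 \<le> C1" using M0 C'0 by (auto simp: C1_def)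
      show ?thesis
      proof (cases "S0 \<le> s")
        case True
        have "C' * exp s \<le> C1 * ((s - \<phi>)\<^sup>2 + exp s)" using C1 C'0 by (intro mult_mono) auto
        then show ?thesis using R1 True by simp
      next
        case False
        have "C' * exp S0 / \<delta>\<^sup>2 * (s - \<phi>)\<^sup>2 \<le> C1 * (s - \<phi>)\<^sup>2" using C1 by (intro mult_right_mono) auto
        then show ?thesis using bd False by simp
      qed
    qed
    then show ?thesis using True by (simp add: R_def)
  qed
  show ?thesis
    by (rule that[OF _ *]) (use M0 C'0 in \<open>simp add: C1_def\<close>)
qed

subsection \<open>Moments of the pilot estimator\<close>

definition Q where "Q = density lborel (\<lambda>x. ennreal (f x))"

lemma prob_space_Q: "prob_space Q"
proof (rule prob_spaceI)
  have "(\<integral>\<^sup>+x. ennreal (f x) \<partial>lborel) = ennreal 1"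
    using f_bochner f_nonneg by (subst nn_integral_eq_integral) (auto simp: has_bochner_integral_iff)
  then show "emeasure Q (space Q) = 1"
    unfolding Q_def by (simp add: emeasure_density space_density)
qed

lemma space_Q [simp]: "space Q = UNIV" and sets_Q [measurable_cong, simp]: "sets Q = sets borel"
  by (simp_all add: Q_def)

lemma measurable_Q [simp]: "measurable Q N = measurable borel N"
  by (rule measurable_cong_sets) simp_all

lemma Q_integral: "g \<in> borel_measurable borel \<Longrightarrow> (LINT x|Q. g x) = (LINT x|lborel. f x * g x)"
  for g :: "real ^ 'n \<Rightarrow> real"
  unfolding Q_def by (subst integral_density) (auto simp: f_nonneg)

lemma Q_integral_le:
  assumes g: "integrable lborel g" "\<And>x. 0 \<le> g x"
  shows "(LINT x|Q. g x) \<le> C * (LINT x|lborel. g x)"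
proof -
  have m[measurable]: "g \<in> borel_measurable borel" using g(1) by (auto dest: borel_measurable_integrable)
  have b: "f x * g x \<le> C * g x" "0 \<le> f x * g x" for x using f_le[of x] f_nonneg[of x] g(2)[of x] by (auto intro: mult_right_mono)
  have "integrable lborel (\<lambda>x. f x * g x)"
    by (rule Bochner_Integration.integrable_bound[OF integrable_mult_right[OF g(1), of C]])
      (auto intro!: AE_I2 order_trans[OF b(1) abs_ge_self] simp: abs_of_nonneg[OF b(2)])
  then have "(LINT x|lborel. f x * g x) \<le> (LINT x|lborel. C * g x)"
    using g(1) b(1) by (intro integral_mono) auto
  then show ?thesis by (simp add: Q_integral)
qed

text \<open>The mean of the pilot at \<open>y\<close> apart from the self-contribution; a
  convolution because \<open>K\<close> is even.\<close>

definition conv where "conv b y = (LINT w|lborel. K w * f (y + b *\<^sub>R w))"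

lemma kernel_expectation:
  assumes "0 < b"
  shows "(LINT x|Q. K ((1 / b) *\<^sub>R (y - x))) = b ^ d * conv b y"
proof -
  have "(LINT x|Q. K ((1 / b) *\<^sub>R (y - x))) = (LINT x|lborel. f x * K ((1 / b) *\<^sub>R (y - x)))"
    by (rule Q_integral) simp
  also have "\<dots> = \<bar>b\<bar> ^ CARD('n) * (LINT w|lborel. f (y + b *\<^sub>R w) * K ((1 / b) *\<^sub>R (y - (y + b *\<^sub>R w))))"
    by (rule lborel_integral_scale) (use assms in auto)
  also have "\<dots> = b ^ d * conv b y"
    using assms by (simp add: conv_def d_eq K_minus mult.commute)
  finally show ?thesis .
qed

lemma conv_integrable: "integrable lborel (\<lambda>w. K w * f (y + b *\<^sub>R w))"
  by (rule K_times_integrable) (auto intro!: continuous_on_compose2[OF f_cont] continuous_intros)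

lemma conv_nonneg: "0 \<le> conv b y" and conv_le: "conv b y \<le> C"
proof -
  show "0 \<le> conv b y" unfolding conv_def by (intro Bochner_Integration.integral_nonneg mult_nonneg_nonneg K_nonneg f_nonneg)
  have "conv b y \<le> (LINT w|lborel. K w * C)"
    unfolding conv_def by (intro integral_mono conv_integrable mult_left_mono f_le K_nonneg) (use K_integrable in auto)
  then show "conv b y \<le> C" by (simp add: K_integral)
qed

text \<open>Averaging over \<open>w\<close> and \<open>- w\<close> writes the bias of the pilot as a
  mean of these symmetric differences, in which first-order terms cancel pointwise. Linearity in
  \<open>g\<close> lets the same bound serve the derivatives of \<open>f\<close>.\<close>

definition sdiff :: "real ^ 'n \<Rightarrow> (real ^ 'n \<Rightarrow> real) \<Rightarrow> real ^ 'n \<Rightarrow> real" where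
  "sdiff v g x = g (x + v) + g (x - v) - 2 * g x"

lemma sdiff_bound:
  assumes g: "C_on 2 UNIV g" and B: "\<And>is x. length is = 2 \<Longrightarrow> \<bar>partial_derivs is g x\<bar> \<le> B"
  shows "\<bar>sdiff v g x\<bar> \<le> real d ^ 2 * B * (norm v)\<^sup>2"
proof -
  obtain \<theta> where 1: "g (x + v) = g x + dirsum v 1 g x + dirsum v 2 g (x + \<theta> *\<^sub>R v) / 2"
    using taylor_line[of UNIV 0 2 g 1 x v] g by (auto simp: eval_nat_numeral dirsum_0)
  obtain \<theta>' where 2: "g (x - v) = g x + dirsum (- v) 1 g x + dirsum (- v) 2 g (x + \<theta>' *\<^sub>R (- v)) / 2"
    using taylor_line[of UNIV 0 2 g 1 x "- v"] g by (auto simp: eval_nat_numeral dirsum_0)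
  have "sdiff v g x = dirsum v 2 g (x + \<theta> *\<^sub>R v) / 2 + dirsum (- v) 2 g (x + \<theta>' *\<^sub>R (- v)) / 2"
    unfolding sdiff_def 1 2 using dirsum_minus[of v 1 g x] by simp
  moreover have "\<bar>dirsum v 2 g (x + \<theta> *\<^sub>R v)\<bar> \<le> real d ^ 2 * B * (norm v)\<^sup>2"
    unfolding d_eq by (rule dirsum_bound[OF B])
  moreover have "\<bar>dirsum (- v) 2 g (x + \<theta>' *\<^sub>R (- v))\<bar> \<le> real d ^ 2 * B * (norm v)\<^sup>2"
    using dirsum_bound[OF B, of _ "- v" "x + \<theta>' *\<^sub>R (- v)"] unfolding d_eq by simp
  ultimately show ?thesis by linarith
qed

lemma conv_diff_eq: "conv b y - f y = (LINT w|lborel. K w * (sdiff (b *\<^sub>R w) f y / 2))"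
proof -
  have m: "(\<lambda>w. K w * f (y + b *\<^sub>R w)) \<in> borel_measurable borel" by measurable
  have r: "conv b y = (LINT w|lborel. K w * f (y - b *\<^sub>R w))"
    using lborel_integral_scale[OF m, of "-1" 0] by (simp add: conv_def K_minus)
  have i: "integrable lborel (\<lambda>w. K w * f (y - b *\<^sub>R w))"
    using lborel_integrable_scale[OF conv_integrable[where b=b and y=y], of "-1" 0] by (simp add: K_minus)
  have "(LINT w|lborel. K w * (sdiff (b *\<^sub>R w) f y / 2)) = (LINT w|lborel. (K w * f (y + b *\<^sub>R w)) / 2 + (K w * f (y - b *\<^sub>R w)) / 2 - f y * K w)"
    by (intro Bochner_Integration.integral_cong) (auto simp: sdiff_def algebra_simps add_divide_distrib diff_divide_distrib)
  also have "\<dots> = conv b y / 2 + conv b y / 2 - f y"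
    using conv_integrable i K_integrable by (simp add: K_integral r[symmetric] conv_def[symmetric])
  finally show ?thesis by simp
qed

lemma K_sdiff_integral_bound:
  assumes g: "C_on 2 UNIV g" and B: "\<And>is x. length is = 2 \<Longrightarrow> \<bar>partial_derivs is g x\<bar> \<le> B"
  shows "integrable lborel (\<lambda>w. K w * (sdiff (b *\<^sub>R w) g x / 2))"
    "\<bar>LINT w|lborel. K w * (sdiff (b *\<^sub>R w) g x / 2)\<bar> \<le> real d ^ 2 * B * T * b\<^sup>2"
proof -
  \<comment> \<open>Any index list of length two witnesses that \<open>B\<close> is
    non-negative.\<close>
  have B0: "0 \<le> B" using B[of "[undefined, undefined]" x] by (simp add: order_trans[OF abs_ge_zero])
  have gc: "continuous_on UNIV g" using g by (rule C_on_continuous)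
  show i: "integrable lborel (\<lambda>w. K w * (sdiff (b *\<^sub>R w) g x / 2))"
    unfolding sdiff_def by (rule K_times_integrable) (auto intro!: continuous_intros continuous_on_compose2[OF gc])
  have "\<bar>LINT w|lborel. K w * (sdiff (b *\<^sub>R w) g x / 2)\<bar> \<le> (LINT w|lborel. \<bar>K w * (sdiff (b *\<^sub>R w) g x / 2)\<bar>)"
    by (rule integral_abs_bound)
  also have "\<dots> \<le> (LINT w|lborel. K w * (real d ^ 2 * B * T * b\<^sup>2))"
  proof (rule integral_mono)
    fix w
    show "\<bar>K w * (sdiff (b *\<^sub>R w) g x / 2)\<bar> \<le> K w * (real d ^ 2 * B * T * b\<^sup>2)"
    proof (cases "T < (norm w)\<^sup>2")
      case False
      have "\<bar>sdiff (b *\<^sub>R w) g x\<bar> \<le> real d ^ 2 * B * (b\<^sup>2 * (norm w)\<^sup>2)"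
        using sdiff_bound[OF g B, of "b *\<^sub>R w" x] by (simp add: power_mult_distrib)
      also have "\<dots> \<le> real d ^ 2 * B * (b\<^sup>2 * T)" using False B0 by (intro mult_left_mono) auto
      finally have "\<bar>sdiff (b *\<^sub>R w) g x / 2\<bar> \<le> real d ^ 2 * B * T * b\<^sup>2" by (simp add: mult_ac)
      then show ?thesis unfolding abs_mult abs_of_nonneg[OF K_nonneg] by (intro mult_left_mono K_nonneg)
    qed (simp add: K_zero)
  qed (rule integrable_abs[OF i], use K_integrable in simp)
  also have "\<dots> = real d ^ 2 * B * T * b\<^sup>2" by (simp add: K_integral)
  finally show "\<bar>LINT w|lborel. K w * (sdiff (b *\<^sub>R w) g x / 2)\<bar> \<le> real d ^ 2 * B * T * b\<^sup>2" .
qed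

lemma conv_diff_le: "\<bar>conv b y - f y\<bar> \<le> real d ^ 2 * C * T * b\<^sup>2"
  unfolding conv_diff_eq
  by (rule K_sdiff_integral_bound(2)[OF C_on_mono[OF _ f_C]]) (auto intro: f_partials_le)

end

section \<open>Moment bounds and the Hoeffding decomposition\<close>

lemma abs_le_four:
  fixes a b c d x :: real
  assumes "x = a + b - c + d" "\<bar>a\<bar> \<le> A" "\<bar>b\<bar> \<le> B" "\<bar>c\<bar> \<le> C" "\<bar>d\<bar> \<le> D"
  shows "\<bar>x\<bar> \<le> A + B + C + D"
  using assms by linarith

lemma abs_integral_Q_le:
  fixes F :: "'a \<Rightarrow> real"
  assumes Q: "prob_space Q" and m: "F \<in> borel_measurable Q" and B: "\<And>x. x \<in> space Q \<Longrightarrow> \<bar>F x\<bar> \<le> B"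
  shows "\<bar>LINT x|Q. F x\<bar> \<le> B"
proof -
  interpret Q: prob_space Q by fact
  have "\<bar>LINT x|Q. F x\<bar> \<le> (LINT x|Q. \<bar>F x\<bar>)" by (rule integral_abs_bound)
  also have "\<dots> \<le> (LINT x|Q. B)"
    using B by (intro integral_mono integrable_abs integrable_bounded[OF Q m B]) auto
  finally show ?thesis by (simp add: Q.prob_space)
qed

lemma abs_integral_le_sqrt:
  fixes F :: "'a \<Rightarrow> real"
  assumes Q: "prob_space Q" and m: "F \<in> borel_measurable Q" and B: "\<And>x. x \<in> space Q \<Longrightarrow> \<bar>F x\<bar> \<le> B"
    and V: "(LINT x|Q. (F x)\<^sup>2) \<le> V"
  shows "(LINT x|Q. \<bar>F x\<bar>) \<le> sqrt V"
proof -
  have "(LINT x|Q. \<bar>F x\<bar>)\<^sup>2 \<le> (LINT x|Q. \<bar>F x\<bar>\<^sup>2)"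
    using m B by (intro square_integral_le[OF Q, of _ B]) auto
  also have "\<dots> \<le> V" using V by simp
  finally show ?thesis by (rule real_le_rsqrt)
qed

lemma integral_abs_sum_le:
  fixes F :: "nat \<Rightarrow> 'a \<Rightarrow> real"
  assumes "\<And>i. i < n \<Longrightarrow> integrable P (F i)" "\<And>i. i < n \<Longrightarrow> (LINT x|P. \<bar>F i x\<bar>) \<le> B" "0 < n"
  shows "integrable P (\<lambda>x. (\<Sum>i<n. F i x) / real n)" "(LINT x|P. \<bar>(\<Sum>i<n. F i x) / real n\<bar>) \<le> B"
proof -
  show int: "integrable P (\<lambda>x. (\<Sum>i<n. F i x) / real n)"
    using assms(1) by (intro integrable_divide_zero Bochner_Integration.integrable_sum) auto
  have "(LINT x|P. \<bar>(\<Sum>i<n. F i x) / real n\<bar>) \<le> (LINT x|P. (\<Sum>i<n. \<bar>F i x\<bar>) / real n)"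
  proof (rule integral_mono[OF integrable_abs[OF int]])
    show "integrable P (\<lambda>x. (\<Sum>i<n. \<bar>F i x\<bar>) / real n)"
      using assms(1) by (intro integrable_divide_zero Bochner_Integration.integrable_sum) auto
    show "\<bar>(\<Sum>i<n. F i x) / real n\<bar> \<le> (\<Sum>i<n. \<bar>F i x\<bar>) / real n" for x
      unfolding abs_divide by (simp add: divide_right_mono sum_abs)
  qed
  also have "\<dots> = (\<Sum>i<n. LINT x|P. \<bar>F i x\<bar>) / real n"
    using assms(1) by (subst integral_divide_zero, subst Bochner_Integration.integral_sum) auto
  also have "\<dots> \<le> (\<Sum>i<n. B) / real n" using assms(2) by (intro divide_right_mono sum_mono) auto
  finally show "(LINT x|P. \<bar>(\<Sum>i<n. F i x) / real n\<bar>) \<le> B" using assms(3) by simp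
qed

text \<open>Subtracting both projections makes the kernel degenerate, so
  \<open>degenerate_U_second_moment\<close> applies with its factor 2. The other 16 is crude: the
  square of four terms is at most four times the sum of squares, and each projection has second
  moment at most that of \<open>H\<close>.\<close>

lemma hoeffding_second_moment:
  fixes H :: "'a \<Rightarrow> 'a \<Rightarrow> real"
  assumes Q: "prob_space Q" and J: "finite J"
    and m[measurable]: "case_prod H \<in> borel_measurable (Q \<Otimes>\<^sub>M Q)"
    and B: "\<And>x y. x \<in> space Q \<Longrightarrow> y \<in> space Q \<Longrightarrow> \<bar>H x y\<bar> \<le> B"
  defines "H1 \<equiv> \<lambda>x. LINT y|Q. H x y" and "H2 \<equiv> \<lambda>y. LINT x|Q. H x y"
    and "\<theta> \<equiv> LINT x|Q. LINT y|Q. H x y"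
  shows "(LINT x|PiM J (\<lambda>_. Q). (\<Sum>i\<in>J. \<Sum>j\<in>J - {i}. H (x i) (x j) - H1 (x i) - H2 (x j) + \<theta>)\<^sup>2)
     \<le> 32 * (real (card J))\<^sup>2 * (LINT x|Q. LINT y|Q. (H x y)\<^sup>2)"
proof -
  interpret Q: prob_space Q by fact
  interpret QQ: pair_prob_space Q Q ..
  have m1[measurable]: "H1 \<in> borel_measurable Q" unfolding H1_def by measurable
  have m2[measurable]: "H2 \<in> borel_measurable Q" unfolding H2_def by measurable
  have mx: "H x \<in> borel_measurable Q" if "x \<in> space Q" for x using that by measurable
  have my: "(\<lambda>x. H x y) \<in> borel_measurable Q" if "y \<in> space Q" for y using that by measurable
  have b1: "\<bar>H1 x\<bar> \<le> B" if "x \<in> space Q" for x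
    unfolding H1_def using that B by (intro abs_integral_Q_le[OF Q mx]) auto
  have b2: "\<bar>H2 y\<bar> \<le> B" if "y \<in> space Q" for y
    unfolding H2_def using that B by (intro abs_integral_Q_le[OF Q my]) auto
  have \<theta>1: "\<theta> = (LINT x|Q. H1 x)" by (simp add: \<theta>_def H1_def)
  have iH: "integrable (Q \<Otimes>\<^sub>M Q) (case_prod H)"
    by (rule integrable_bounded[OF QQ.prob_space_axioms, of _ B]) (auto simp: space_pair_measure B)
  have \<theta>2: "\<theta> = (LINT y|Q. H2 y)"
    unfolding \<theta>_def H2_def using QQ.Fubini_integral[of H] iH by simp
  have b\<theta>: "\<bar>\<theta>\<bar> \<le> B" unfolding \<theta>1 using b1 by (rule abs_integral_Q_le[OF Q m1])
  define G where "G x y = H x y - H1 x - H2 y + \<theta>" for x y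
  have mG[measurable]: "case_prod G \<in> borel_measurable (Q \<Otimes>\<^sub>M Q)" unfolding G_def by measurable
  have i1: "integrable Q H1" and i2: "integrable Q H2"
    using integrable_bounded[OF Q m1 b1] integrable_bounded[OF Q m2 b2] by auto
  have ix: "integrable Q (H x)" if "x \<in> space Q" for x by (rule integrable_bounded[OF Q mx[OF that] B[OF that]])
  have iy: "integrable Q (\<lambda>x. H x y)" if "y \<in> space Q" for y by (rule integrable_bounded[OF Q my[OF that] B[OF _ that]])
  have bG: "\<bar>G x y\<bar> \<le> 4 * B" if "x \<in> space Q" "y \<in> space Q" for x y
    using B[OF that] b1[OF that(1)] b2[OF that(2)] b\<theta> unfolding G_def by linarith
  have sqB: "a\<^sup>2 \<le> b\<^sup>2" if "\<bar>a\<bar> \<le> b" for a b :: real using power_mono[OF that, of 2] by simp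
  have "(LINT x|PiM J (\<lambda>_. Q). (\<Sum>i\<in>J. \<Sum>j\<in>J - {i}. G (x i) (x j))\<^sup>2)
     \<le> 2 * (real (card J))\<^sup>2 * (LINT x|Q. LINT y|Q. (G x y)\<^sup>2)"
  proof (rule degenerate_U_second_moment[OF Q J mG bG])
    show "(LINT y|Q. G x y) = 0" if "x \<in> space Q" for x
      unfolding G_def using ix[OF that] i2 by (simp add: Q.prob_space \<theta>2[symmetric]) (simp add: H1_def)
    show "(LINT x|Q. G x y) = 0" if "y \<in> space Q" for y
      unfolding G_def using iy[OF that] i1 by (simp add: Q.prob_space \<theta>1[symmetric]) (simp add: H2_def)
  qed
  also have "(LINT x|Q. LINT y|Q. (G x y)\<^sup>2) \<le> 16 * (LINT x|Q. LINT y|Q. (H x y)\<^sup>2)"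
  proof -
    define V where "V = (LINT x|Q. LINT y|Q. (H x y)\<^sup>2)"
    have iH2: "integrable (Q \<Otimes>\<^sub>M Q) (\<lambda>(x, y). (H x y)\<^sup>2)"
      using sqB[OF B] by (intro integrable_bounded[OF QQ.prob_space_axioms, of _ "B\<^sup>2"]) (auto simp: space_pair_measure)
    have iG2: "integrable (Q \<Otimes>\<^sub>M Q) (\<lambda>(x, y). (G x y)\<^sup>2)"
      using sqB[OF bG] by (intro integrable_bounded[OF QQ.prob_space_axioms, of _ "(4 * B)\<^sup>2"]) (auto simp: space_pair_measure)
    have iS: "integrable (Q \<Otimes>\<^sub>M Q) (\<lambda>(x, y). 4 * ((H x y)\<^sup>2 + (H1 x)\<^sup>2 + (H2 y)\<^sup>2 + \<theta>\<^sup>2))"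
    proof (rule integrable_bounded[OF QQ.prob_space_axioms, of _ "16 * B\<^sup>2"])
      fix z assume "z \<in> space (Q \<Otimes>\<^sub>M Q)"
      then obtain x y where z: "z = (x, y)" "x \<in> space Q" "y \<in> space Q" by (auto simp: space_pair_measure)
      show "\<bar>case z of (x, y) \<Rightarrow> 4 * ((H x y)\<^sup>2 + (H1 x)\<^sup>2 + (H2 y)\<^sup>2 + \<theta>\<^sup>2)\<bar> \<le> 16 * B\<^sup>2"
        using sqB[OF B[OF z(2,3)]] sqB[OF b1[OF z(2)]] sqB[OF b2[OF z(3)]] sqB[OF b\<theta>] by (simp add: z(1))
    qed measurable
    have b1s: "(H1 x)\<^sup>2 \<le> B\<^sup>2" "(H2 x)\<^sup>2 \<le> B\<^sup>2" if "x \<in> space Q" for x using that b1 b2 sqB by auto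
    have i1s: "integrable Q (\<lambda>x. (H1 x)\<^sup>2)" "integrable Q (\<lambda>x. (H2 x)\<^sup>2)"
      using b1s by (auto intro!: integrable_bounded[OF Q, of _ "B\<^sup>2"])
    have iVx: "integrable Q (\<lambda>x. LINT y|Q. (H x y)\<^sup>2)"
      using QQ.integrable_fst[OF iH2] by simp
    have iVy: "integrable Q (\<lambda>y. LINT x|Q. (H x y)\<^sup>2)"
      using QQ.integrable_snd[of "\<lambda>x y. (H x y)\<^sup>2"] iH2 by simp
    have V1: "(LINT x|Q. (H1 x)\<^sup>2) \<le> V"
      unfolding V_def using i1s iVx
      by (intro integral_mono) (auto simp: H1_def intro!: square_integral_le[OF Q mx] B)
    have "(LINT y|Q. (H2 y)\<^sup>2) \<le> (LINT y|Q. LINT x|Q. (H x y)\<^sup>2)"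
      using i1s iVy by (intro integral_mono) (auto simp: H2_def intro!: square_integral_le[OF Q my] B)
    also have "\<dots> = V" unfolding V_def using QQ.Fubini_integral[of "\<lambda>x y. (H x y)\<^sup>2"] iH2 by simp
    finally have V2: "(LINT y|Q. (H2 y)\<^sup>2) \<le> V" .
    have V3: "\<theta>\<^sup>2 \<le> V" unfolding \<theta>1 using square_integral_le[OF Q m1 b1] V1 by simp
    \<comment> \<open>Lagrange's identity: the defect in the Cauchy-Schwarz inequality is a sum of
      six squares.\<close>
    have pt: "(G x y)\<^sup>2 \<le> 4 * ((H x y)\<^sup>2 + (H1 x)\<^sup>2 + (H2 y)\<^sup>2 + \<theta>\<^sup>2)" for x y
    proof -
      have "4 * (a\<^sup>2 + b\<^sup>2 + c\<^sup>2 + e\<^sup>2) - (a - b - c + e)\<^sup>2 = (a + b)\<^sup>2 + (a + c)\<^sup>2 + (a - e)\<^sup>2 + (b - c)\<^sup>2 + (b + e)\<^sup>2 + (c + e)\<^sup>2" for a b c e :: real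
        by (simp add: power2_eq_square algebra_simps)
      from this[of "H x y" "H1 x" "H2 y" \<theta>] show ?thesis unfolding G_def
        by (smt (verit) zero_le_power2)
    qed
    have "(LINT x|Q. LINT y|Q. (G x y)\<^sup>2) = (LINT z|(Q \<Otimes>\<^sub>M Q). (case z of (x, y) \<Rightarrow> (G x y)\<^sup>2))"
      using QQ.integral_fst'[OF iG2] by simp
    also have "\<dots> \<le> (LINT z|(Q \<Otimes>\<^sub>M Q). (case z of (x, y) \<Rightarrow> 4 * ((H x y)\<^sup>2 + (H1 x)\<^sup>2 + (H2 y)\<^sup>2 + \<theta>\<^sup>2)))"
      using iG2 iS pt by (intro integral_mono) auto
    also have "\<dots> = (LINT x|Q. LINT y|Q. 4 * ((H x y)\<^sup>2 + (H1 x)\<^sup>2 + (H2 y)\<^sup>2 + \<theta>\<^sup>2))"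
      using QQ.integral_fst'[OF iS] by simp
    also have "\<dots> = (LINT x|Q. 4 * ((LINT y|Q. (H x y)\<^sup>2) + (H1 x)\<^sup>2 + (LINT y|Q. (H2 y)\<^sup>2) + \<theta>\<^sup>2))"
    proof (rule Bochner_Integration.integral_cong[OF refl])
      fix x assume x: "x \<in> space Q"
      have "integrable Q (\<lambda>y. (H x y)\<^sup>2)"
        using mx[OF x] sqB[OF B[OF x]] by (intro integrable_bounded[OF Q, of _ "B\<^sup>2"]) auto
      then show "(LINT y|Q. 4 * ((H x y)\<^sup>2 + (H1 x)\<^sup>2 + (H2 y)\<^sup>2 + \<theta>\<^sup>2)) = 4 * ((LINT y|Q. (H x y)\<^sup>2) + (H1 x)\<^sup>2 + (LINT y|Q. (H2 y)\<^sup>2) + \<theta>\<^sup>2)"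
        using i1s by (simp add: Q.prob_space)
    qed
    also have "\<dots> = 4 * (V + (LINT x|Q. (H1 x)\<^sup>2) + (LINT y|Q. (H2 y)\<^sup>2) + \<theta>\<^sup>2)"
      using iVx i1s by (simp add: Q.prob_space V_def)
    also have "\<dots> \<le> 4 * (V + V + V + V)" by (intro mult_left_mono add_mono V1 V2 V3 order_refl) simp
    also have "\<dots> = 16 * V" by simp
    finally show ?thesis unfolding V_def .
  qed
  finally show ?thesis unfolding G_def by (simp add: mult_left_mono mult.assoc)
qed

context pilot
begin

lemma measure_Q [simp]: "measure Q UNIV = 1"
  using prob_space.prob_space[OF prob_space_Q] by simp

text \<open>The pilot estimate at a sample point \<open>y\<close>, which itself contributes \<open>K 0\<close>; the other sample points
  are indexed by \<open>J\<close>.\<close>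

definition pilot_est :: "nat \<Rightarrow> real \<Rightarrow> nat set \<Rightarrow> real ^ 'n \<Rightarrow> (nat \<Rightarrow> real ^ 'n) \<Rightarrow> real" where
  "pilot_est n b J y x = (K 0 + (\<Sum>j\<in>J. K ((1 / b) *\<^sub>R (y - x j)))) / (real n * b ^ d)"

lemma pilot_est_measurable [measurable]: "pilot_est n b J y \<in> borel_measurable (PiM J (\<lambda>_. Q))"
  unfolding pilot_est_def[abs_def] by measurable

lemma pilot_est_bounds:
  assumes "finite J" "Suc (card J) = n" "0 < b"
  shows "0 \<le> pilot_est n b J y x" "pilot_est n b J y x \<le> \<kappa> / b ^ d"
proof -
  have s: "(\<Sum>j\<in>J. K ((1 / b) *\<^sub>R (y - x j))) \<le> real (card J) * \<kappa>"
    using sum_mono[of J "\<lambda>j. K ((1 / b) *\<^sub>R (y - x j))" "\<lambda>_. \<kappa>"] K_le by simp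
  show "0 \<le> pilot_est n b J y x"
    unfolding pilot_est_def using assms by (auto intro!: divide_nonneg_nonneg add_nonneg_nonneg sum_nonneg K_nonneg)
  have "pilot_est n b J y x \<le> (real n * \<kappa>) / (real n * b ^ d)"
    unfolding pilot_est_def using s K_le[of 0] assms by (intro divide_right_mono) (auto simp: algebra_simps)
  also have "\<dots> = \<kappa> / b ^ d" using assms by auto
  finally show "pilot_est n b J y x \<le> \<kappa> / b ^ d" .
qed

definition C2 where "C2 = 2 * \<kappa> * C + 4 * (\<kappa> + C)\<^sup>2 + 4 * (real d ^ 2 * C * T)\<^sup>2"

text \<open>The error is a centred sum plus a deterministic \<open>B\<close>, which collects the
  self-contribution, the factor \<open>(n - 1) / n\<close> and the smoothing bias. Because
  \<open>K^2 \<le> \<kappa> K\<close>, the variance of a kernel term is again of order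
  \<open>b ^ d\<close>, which gives \<open>1 / N\<close>; squares of \<open>1 / N\<close> are
  absorbed by \<open>1 \<le> N\<close>.\<close>

lemma pilot_second_moment:
  assumes J: "finite J" "Suc (card J) = n" and b: "0 < b" "b \<le> 1" and N: "1 \<le> real n * b ^ d"
  shows "(LINT x|PiM J (\<lambda>_. Q). (pilot_est n b J y x - f y)\<^sup>2) \<le> C2 * (1 / (real n * b ^ d) + b ^ 4)"
proof -
  let ?P = "PiM J (\<lambda>_. Q)"
  interpret Q: prob_space Q by (rule prob_space_Q)
  interpret P: prob_space ?P by (rule prob_space_PiM) (rule prob_space_Q)
  define N where "N = real n * b ^ d"
  define \<psi> where "\<psi> z = K ((1 / b) *\<^sub>R (y - z)) - b ^ d * conv b y" for z
  define B where "B = K 0 / N + real (card J) / real n * conv b y - f y"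
  have N0: "0 < N" "1 \<le> N" using N by (auto simp: N_def)
  have [measurable]: "\<psi> \<in> borel_measurable borel" unfolding \<psi>_def by measurable
  have bd: "b ^ d \<le> 1" using b by (simp add: power_le_one)
  have bc: "0 \<le> b ^ d * conv b y" "b ^ d * conv b y \<le> C"
    using conv_nonneg[of b y] conv_le[of b y] bd b C_pos mult_mono[of "b ^ d" 1 "conv b y" C] by auto
  have \<psi>b: "\<bar>\<psi> z\<bar> \<le> \<kappa> + C" for z
    using bc K_le[of "(1 / b) *\<^sub>R (y - z)"] K_nonneg[of "(1 / b) *\<^sub>R (y - z)"] unfolding \<psi>_def by linarith
  have iK: "integrable Q (\<lambda>z. K ((1 / b) *\<^sub>R (y - z)))"
    by (rule integrable_bounded[OF prob_space_Q, of _ \<kappa>]) (auto simp: K_nonneg K_le)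
  have iK2: "integrable Q (\<lambda>z. (K ((1 / b) *\<^sub>R (y - z)))\<^sup>2)"
    by (rule integrable_bounded[OF prob_space_Q, of _ "\<kappa>\<^sup>2"]) (auto simp: K_nonneg K_le intro!: power_mono)
  have z: "(LINT z|Q. \<psi> z) = 0"
    unfolding \<psi>_def using iK kernel_expectation[OF b(1), of y] by (simp add: Q.prob_space)
  have "(LINT z|Q. (\<psi> z)\<^sup>2) = (LINT z|Q. (K ((1 / b) *\<^sub>R (y - z)))\<^sup>2) - (b ^ d * conv b y)\<^sup>2"
    using Q.variance_eq[OF iK iK2] kernel_expectation[OF b(1), of y] unfolding \<psi>_def by simp
  also have "\<dots> \<le> (LINT z|Q. (K ((1 / b) *\<^sub>R (y - z)))\<^sup>2)" by simp
  also have "\<dots> \<le> (LINT z|Q. \<kappa> * K ((1 / b) *\<^sub>R (y - z)))"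
    using iK iK2 by (intro integral_mono) (auto simp: power2_eq_square K_le K_nonneg mult_right_mono)
  also have "\<dots> = \<kappa> * (b ^ d * conv b y)" by (simp add: kernel_expectation[OF b(1)])
  also have "\<dots> \<le> \<kappa> * (b ^ d * C)" using \<kappa>_pos b by (intro mult_left_mono conv_le) auto
  finally have v: "(LINT z|Q. (\<psi> z)\<^sup>2) \<le> \<kappa> * (b ^ d * C)" .
  have S: "(LINT x|?P. (\<Sum>j\<in>J. \<psi> (x j))\<^sup>2) \<le> \<kappa> * C * N"
  proof -
    have "(LINT x|?P. (\<Sum>j\<in>J. \<psi> (x j))\<^sup>2) = real (card J) * (LINT z|Q. (\<psi> z)\<^sup>2)"
      by (rule PiM_sum_second_moment[OF prob_space_Q J(1) _ \<psi>b z]) simp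
    also have "\<dots> \<le> real n * (\<kappa> * (b ^ d * C))" using v J by (intro mult_mono) auto
    finally show ?thesis by (simp add: N_def mult_ac)
  qed
  have eq: "pilot_est n b J y x - f y = (\<Sum>j\<in>J. \<psi> (x j)) / N + B" for x
  proof -
    have "real n > 0" "b ^ d > 0" using J b by auto
    moreover have "(\<Sum>j\<in>J. \<psi> (x j)) = (\<Sum>j\<in>J. K ((1 / b) *\<^sub>R (y - x j))) - real (card J) * (b ^ d * conv b y)"
      by (simp add: \<psi>_def sum_subtractf)
    ultimately show ?thesis unfolding pilot_est_def B_def N_def
      using b(1) by (simp add: add_divide_distrib diff_divide_distrib)
  qed
  have B_le: "\<bar>B\<bar> \<le> (\<kappa> + C) / N + real d ^ 2 * C * T * b\<^sup>2"
  proof -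
    have cn: "real (card J) / real n = 1 - 1 / real n" using J by (auto simp: field_simps)
    have "B = K 0 / N - conv b y / real n + (conv b y - f y)" unfolding B_def cn by (simp add: left_diff_distrib)
    moreover have "\<bar>K 0 / N\<bar> \<le> \<kappa> / N" using K_le[of 0] K_nonneg[of 0] N0 by (simp add: divide_right_mono)
    moreover have "\<bar>conv b y / real n\<bar> \<le> C / N"
    proof -
      have "N \<le> real n" using bd by (simp add: N_def mult_left_le)
      then show ?thesis using conv_nonneg[of b y] conv_le[of b y] N0 C_pos by (simp add: frac_le)
    qed
    moreover note conv_diff_le[of b y]
    ultimately show ?thesis unfolding add_divide_distrib by linarith
  qed
  have "B\<^sup>2 \<le> ((\<kappa> + C) / N + real d ^ 2 * C * T * b\<^sup>2)\<^sup>2" using power_mono[OF B_le, of 2] by simp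
  also have "\<dots> \<le> 2 * ((\<kappa> + C) / N)\<^sup>2 + 2 * (real d ^ 2 * C * T * b\<^sup>2)\<^sup>2"
    using sum_squares_bound[of "(\<kappa> + C) / N" "real d ^ 2 * C * T * b\<^sup>2"] by (simp add: power2_sum)
  also have "((\<kappa> + C) / N)\<^sup>2 \<le> (\<kappa> + C)\<^sup>2 / N"
  proof -
    have "(\<kappa> + C)\<^sup>2 / N\<^sup>2 \<le> (\<kappa> + C)\<^sup>2 / N" using N0 by (intro divide_left_mono) (auto simp: power2_eq_square)
    then show ?thesis by (simp add: power_divide)
  qed
  finally have B2: "B\<^sup>2 \<le> 2 * ((\<kappa> + C)\<^sup>2 / N) + 2 * ((real d ^ 2 * C * T)\<^sup>2 * b ^ 4)"
    by (simp add: power_mult_distrib)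
  have iS: "integrable ?P (\<lambda>x. (\<Sum>j\<in>J. \<psi> (x j))\<^sup>2)"
  proof (rule integrable_bounded[OF P.prob_space_axioms, of _ "(real (card J) * (\<kappa> + C))\<^sup>2"])
    fix x
    have "\<bar>\<Sum>j\<in>J. \<psi> (x j)\<bar> \<le> real (card J) * (\<kappa> + C)"
      by (rule order_trans[OF sum_abs]) (use sum_mono[of J "\<lambda>j. \<bar>\<psi> (x j)\<bar>" "\<lambda>_. \<kappa> + C"] \<psi>b in simp)
    from power_mono[OF this, of 2] show "\<bar>(\<Sum>j\<in>J. \<psi> (x j))\<^sup>2\<bar> \<le> (real (card J) * (\<kappa> + C))\<^sup>2" by simp
  qed measurable
  have i: "integrable ?P (\<lambda>x. 2 / N\<^sup>2 * (\<Sum>j\<in>J. \<psi> (x j))\<^sup>2 + 2 * B\<^sup>2)"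
    using iS by (intro Bochner_Integration.integrable_add integrable_mult_right) auto
  have pt: "(pilot_est n b J y x - f y)\<^sup>2 \<le> 2 / N\<^sup>2 * (\<Sum>j\<in>J. \<psi> (x j))\<^sup>2 + 2 * B\<^sup>2" for x
    unfolding eq using sum_squares_bound[of "(\<Sum>j\<in>J. \<psi> (x j)) / N" B] by (simp add: power2_sum power_divide)
  have "(LINT x|?P. (pilot_est n b J y x - f y)\<^sup>2) \<le> (LINT x|?P. 2 / N\<^sup>2 * (\<Sum>j\<in>J. \<psi> (x j))\<^sup>2 + 2 * B\<^sup>2)"
    by (rule integral_mono[OF Bochner_Integration.integrable_bound[OF i] i pt])
      (use pt in \<open>auto intro!: AE_I2 order_trans[OF _ abs_ge_self]\<close>)
  also have "\<dots> = 2 / N\<^sup>2 * (LINT x|?P. (\<Sum>j\<in>J. \<psi> (x j))\<^sup>2) + 2 * B\<^sup>2"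
    using iS by (simp add: P.prob_space)
  also have "\<dots> \<le> 2 / N\<^sup>2 * (\<kappa> * C * N) + 2 * (2 * ((\<kappa> + C)\<^sup>2 / N) + 2 * ((real d ^ 2 * C * T)\<^sup>2 * b ^ 4))"
    using S B2 by (intro add_mono mult_left_mono) auto
  also have "\<dots> = (2 * \<kappa> * C + 4 * (\<kappa> + C)\<^sup>2) / N + 4 * (real d ^ 2 * C * T)\<^sup>2 * b ^ 4"
    using N0 by (simp add: power2_eq_square field_simps)
  also have "\<dots> \<le> C2 * (1 / N) + C2 * b ^ 4"
  proof (rule add_mono)
    show "(2 * \<kappa> * C + 4 * (\<kappa> + C)\<^sup>2) / N \<le> C2 * (1 / N)"
      using N0 by (simp add: C2_def divide_right_mono)
    show "4 * (real d ^ 2 * C * T)\<^sup>2 * b ^ 4 \<le> C2 * b ^ 4"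
      unfolding C2_def using \<kappa>_pos C_pos by (intro mult_right_mono) auto
  qed
  finally show ?thesis by (simp add: N_def distrib_left)
qed

text \<open>With \<open>N = n * b ^ d\<close>, the mean of \<open>exp (N * pilot_est n b J y x)\<close> is at most
  \<open>exp (\<kappa> + exp \<kappa> * C * N)\<close>; hence values above \<open>exp \<kappa> * C\<close> are exponentially unlikely.\<close>

definition S0 where "S0 = exp \<kappa> * C + 1"

lemma pilot_exp_moment:
  assumes J: "finite J" "Suc (card J) = n" and b: "0 < b" "b \<le> 1" and N: "1 \<le> real n * b ^ d"
  shows "(LINT x|PiM J (\<lambda>_. Q). (if S0 \<le> pilot_est n b J y x then exp (pilot_est n b J y x) else 0)) \<le> exp (\<kappa> + S0) / (real n * b ^ d)"
proof -
  let ?P = "PiM J (\<lambda>_. Q)"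
  interpret Q: prob_space Q by (rule prob_space_Q)
  interpret P: prob_space ?P by (rule prob_space_PiM) (rule prob_space_Q)
  interpret product_sigma_finite "\<lambda>_::nat. Q" ..
  define N where "N = real n * b ^ d"
  have N0: "0 < N" "1 \<le> N" using N by (auto simp: N_def)
  let ?p = "pilot_est n b J y"
  let ?e = "\<lambda>z. exp (K ((1 / b) *\<^sub>R (y - z)))"
  have Np: "N * ?p x = K 0 + (\<Sum>j\<in>J. K ((1 / b) *\<^sub>R (y - x j)))" for x
    using N0(1) by (simp add: pilot_est_def N_def[symmetric])
  have ie: "integrable Q ?e"
    by (rule integrable_bounded[OF prob_space_Q, of _ "exp \<kappa>"]) (auto simp: K_le)
  have iK: "integrable Q (\<lambda>z. K ((1 / b) *\<^sub>R (y - z)))"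
    by (rule integrable_bounded[OF prob_space_Q, of _ \<kappa>]) (auto simp: K_nonneg K_le)
  have ee: "(LINT z|Q. ?e z) \<le> exp (exp \<kappa> * C * b ^ d)"
  proof -
    have pt: "?e z \<le> 1 + exp \<kappa> * K ((1 / b) *\<^sub>R (y - z))" for z
    proof -
      define k where "k = K ((1 / b) *\<^sub>R (y - z))"
      have k: "0 \<le> k" "k \<le> \<kappa>" using K_nonneg K_le by (auto simp: k_def)
      have "1 - k \<le> exp (- k)" using exp_ge_add_one_self[of "- k"] by simp
      then have "exp k * (1 - k) \<le> exp k * exp (- k)" by (intro mult_left_mono) auto
      then have "exp k \<le> 1 + exp k * k" by (simp add: algebra_simps exp_minus_inverse)
      also have "exp k * k \<le> exp \<kappa> * k" using k by (intro mult_right_mono) auto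
      finally show ?thesis by (simp add: k_def)
    qed
    have "(LINT z|Q. ?e z) \<le> (LINT z|Q. 1 + exp \<kappa> * K ((1 / b) *\<^sub>R (y - z)))"
      using pt iK by (intro integral_mono ie) auto
    also have "\<dots> = 1 + exp \<kappa> * (b ^ d * conv b y)"
      using iK by (simp add: Q.prob_space kernel_expectation[OF b(1)])
    also have "\<dots> \<le> 1 + exp \<kappa> * (b ^ d * C)" using b conv_le by (intro add_left_mono mult_left_mono) auto
    also have "\<dots> \<le> exp (exp \<kappa> * C * b ^ d)" using exp_ge_add_one_self[of "exp \<kappa> * C * b ^ d"] by (simp add: mult_ac)
    finally show ?thesis .
  qed
  have e0: "0 \<le> (LINT z|Q. ?e z)" by (intro Bochner_Integration.integral_nonneg) auto
  have bN: "\<bar>?p x\<bar> \<le> \<kappa> / b ^ d" for x using pilot_est_bounds[OF J b(1), of y x] by simp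
  have "(LINT x|?P. exp (N * ?p x)) = (LINT x|?P. exp (K 0) * (\<Prod>j\<in>J. ?e (x j)))"
    unfolding Np using J by (simp add: exp_add exp_sum)
  also have "\<dots> = exp (K 0) * (\<Prod>j\<in>J. (LINT z|Q. ?e z))"
    using product_integral_prod[of J "\<lambda>_. ?e"] J ie by simp
  also have "\<dots> \<le> exp \<kappa> * (\<Prod>j\<in>J. exp (exp \<kappa> * C * b ^ d))"
    using K_le ee e0 by (intro mult_mono prod_mono) (auto intro!: prod_nonneg)
  also have "\<dots> = exp \<kappa> * exp (real (card J) * (exp \<kappa> * C * b ^ d))"
    by (simp add: exp_of_nat_mult)
  also have "\<dots> \<le> exp \<kappa> * exp (exp \<kappa> * C * N)"
    using J b C_pos unfolding N_def by (auto simp: mult_ac intro!: mult_left_mono)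
  finally have E: "(LINT x|?P. exp (N * ?p x)) \<le> exp \<kappa> * exp (exp \<kappa> * C * N)" .
  have iE: "integrable ?P (\<lambda>x. exp (N * ?p x))"
  proof (rule integrable_bounded[OF P.prob_space_axioms, of _ "exp (N * (\<kappa> / b ^ d))"])
    fix x show "\<bar>exp (N * ?p x)\<bar> \<le> exp (N * (\<kappa> / b ^ d))"
      using mult_left_mono[OF abs_le_D1[OF bN[of x]], of N] N0 by simp
  qed measurable
  \<comment> \<open>On the event, \<open>?p x\<close> is at most
    \<open>N * ?p x - (N - 1) * S0\<close>: an exponential Markov inequality that pays for the event
    and for the integrand at once.\<close>
  have pt: "(if S0 \<le> ?p x then exp (?p x) else 0) \<le> exp (- (N - 1) * S0) * exp (N * ?p x)" for x
  proof (cases "S0 \<le> ?p x")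
    case True
    have "(N - 1) * S0 \<le> (N - 1) * ?p x" using True N0 by (intro mult_left_mono) auto
    then show ?thesis using True unfolding exp_add[symmetric] by (simp add: algebra_simps)
  qed simp
  have i: "integrable ?P (\<lambda>x. exp (- (N - 1) * S0) * exp (N * ?p x))" using iE by simp
  have "(LINT x|?P. (if S0 \<le> ?p x then exp (?p x) else 0)) \<le> (LINT x|?P. exp (- (N - 1) * S0) * exp (N * ?p x))"
    by (rule integral_mono[OF Bochner_Integration.integrable_bound[OF i] i pt]) (use pt in \<open>auto intro!: AE_I2\<close>)
  also have "\<dots> = exp (- (N - 1) * S0) * (LINT x|?P. exp (N * ?p x))" by simp
  also have "\<dots> \<le> exp (- (N - 1) * S0) * (exp \<kappa> * exp (exp \<kappa> * C * N))" by (intro mult_left_mono E) simp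
  \<comment> \<open>The summand 1 in \<open>S0\<close> is what leaves \<open>- N\<close> in the
    exponent after the growth \<open>exp \<kappa> * C * N\<close> has been cancelled.\<close>
  also have "\<dots> = exp (\<kappa> + S0) * exp (- N)"
    unfolding exp_add[symmetric] by (simp add: S0_def algebra_simps)
  also have "\<dots> \<le> exp (\<kappa> + S0) * (1 / N)"
  proof (rule mult_left_mono)
    have "N \<le> exp N" using exp_ge_add_one_self[of N] by linarith
    then show "exp (- N) \<le> 1 / N" using N0 by (simp add: exp_minus inverse_eq_divide frac_le)
  qed simp
  finally show ?thesis by (simp add: N_def)
qed

text \<open>The second term is needed because \<open>\<alpha>\<close> is unbounded, so that the remainder in
  \<open>kern_taylor\<close> is not bounded by a multiple of the square for large \<open>s\<close>.\<close>

definition pilot_err where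
  "pilot_err n b J y x = (pilot_est n b J y x - f y)\<^sup>2 + (if S0 \<le> pilot_est n b J y x then exp (pilot_est n b J y x) else 0)"

definition C3 where "C3 = C2 + exp (\<kappa> + S0)"

lemma pilot_err_nonneg: "0 \<le> pilot_err n b J y x"
  by (simp add: pilot_err_def)

lemma pilot_err_le:
  assumes "finite J" "Suc (card J) = n" "0 < b"
  shows "pilot_err n b J y x \<le> (\<kappa> / b ^ d + C)\<^sup>2 + exp (\<kappa> / b ^ d)"
proof -
  note p = pilot_est_bounds[OF assms, of y x]
  have "\<bar>pilot_est n b J y x - f y\<bar> \<le> \<kappa> / b ^ d + C"
    using p f_nonneg[of y] f_le[of y] by linarith
  from power_mono[OF this, of 2] have "(pilot_est n b J y x - f y)\<^sup>2 \<le> (\<kappa> / b ^ d + C)\<^sup>2" by simp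
  moreover have "(if S0 \<le> pilot_est n b J y x then exp (pilot_est n b J y x) else 0) \<le> exp (\<kappa> / b ^ d)"
    using p by simp
  ultimately show ?thesis unfolding pilot_err_def by linarith
qed

lemma pilot_err_moment:
  assumes J: "finite J" "Suc (card J) = n" and b: "0 < b" "b \<le> 1" and N: "1 \<le> real n * b ^ d"
  shows "integrable (PiM J (\<lambda>_. Q)) (pilot_err n b J y)"
    "(LINT x|PiM J (\<lambda>_. Q). pilot_err n b J y x) \<le> C3 * (1 / (real n * b ^ d) + b ^ 4)"
proof -
  let ?P = "PiM J (\<lambda>_. Q)"
  interpret P: prob_space ?P by (rule prob_space_PiM) (rule prob_space_Q)
  note p = pilot_est_bounds[OF J b(1), of y]
  have i1: "integrable ?P (\<lambda>x. (pilot_est n b J y x - f y)\<^sup>2)"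
  proof (rule integrable_bounded[OF P.prob_space_axioms, of _ "(\<kappa> / b ^ d + C)\<^sup>2"])
    fix x
    have "\<bar>pilot_est n b J y x - f y\<bar> \<le> \<kappa> / b ^ d + C"
      using p[of x] f_nonneg[of y] f_le[of y] by linarith
    from power_mono[OF this, of 2] show "\<bar>(pilot_est n b J y x - f y)\<^sup>2\<bar> \<le> (\<kappa> / b ^ d + C)\<^sup>2" by simp
  qed measurable
  have i2: "integrable ?P (\<lambda>x. if S0 \<le> pilot_est n b J y x then exp (pilot_est n b J y x) else 0)"
    by (rule integrable_bounded[OF P.prob_space_axioms, of _ "exp (\<kappa> / b ^ d)"]) (use p in auto)
  show "integrable ?P (pilot_err n b J y)" unfolding pilot_err_def[abs_def] using i1 i2 by simp
  have "(LINT x|?P. pilot_err n b J y x) \<le> C2 * (1 / (real n * b ^ d) + b ^ 4) + exp (\<kappa> + S0) / (real n * b ^ d)"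
    unfolding pilot_err_def Bochner_Integration.integral_add[OF i1 i2]
    by (intro add_mono pilot_second_moment[OF assms] pilot_exp_moment[OF assms])
  also have "\<dots> \<le> C3 * (1 / (real n * b ^ d) + b ^ 4)"
    unfolding C3_def by (simp add: algebra_simps)
  finally show "(LINT x|?P. pilot_err n b J y x) \<le> C3 * (1 / (real n * b ^ d) + b ^ 4)" .
qed

lemma C3_nonneg: "0 \<le> C3"
  using \<kappa>_pos C_pos by (simp add: C3_def C2_def)

subsection \<open>Localisation at the evaluation point\<close>

definition ball_volume where "ball_volume = measure lborel (cball (0 :: real ^ 'n) \<rho>)"

lemma ball_volume_nonneg: "0 \<le> ball_volume" by (simp add: ball_volume_def)

lemma ball_integral:
  assumes h: "0 < h"
  shows "integrable lborel (\<lambda>x. if norm (x - t) \<le> \<rho> * h then 1 else (0::real))"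
    "(LINT x|lborel. (if norm (x - t) \<le> \<rho> * h then 1 else (0::real))) = h ^ d * ball_volume"
proof -
  have e: "emeasure lborel (cball t (\<rho> * h)) < \<infinity>" by (rule emeasure_bounded_finite) simp
  have ind: "(\<lambda>x. if norm (x - t) \<le> \<rho> * h then 1 else (0::real)) = indicator (cball t (\<rho> * h))"
    by (auto simp: fun_eq_iff indicator_def dist_norm norm_minus_commute)
  show "integrable lborel (\<lambda>x. if norm (x - t) \<le> \<rho> * h then 1 else (0::real))"
    unfolding ind using e by (simp add: integrable_real_indicator)
  have "(LINT x|lborel. (if norm (x - t) \<le> \<rho> * h then 1 else (0::real)))
    = \<bar>h\<bar> ^ CARD('n) * (LINT u|lborel. (if norm (t + h *\<^sub>R u - t) \<le> \<rho> * h then 1 else (0::real)))"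
    by (rule lborel_integral_scale) (use h in auto)
  also have "(\<lambda>u. if norm (t + h *\<^sub>R u - t) \<le> \<rho> * h then 1 else (0::real)) = indicator (cball 0 \<rho>)"
    using h by (auto simp: fun_eq_iff indicator_def mult.commute)
  finally show "(LINT x|lborel. (if norm (x - t) \<le> \<rho> * h then 1 else (0::real))) = h ^ d * ball_volume"
    using h by (simp add: ball_volume_def d_eq)
qed

lemma ball_Q_integral:
  assumes "0 < h" "0 \<le> a"
  shows "(LINT x|Q. (if norm (x - t) \<le> \<rho> * h then a else 0)) \<le> a * (C * (h ^ d * ball_volume))"
proof -
  have "(\<lambda>x. if norm (x - t) \<le> \<rho> * h then a else 0) = (\<lambda>x. a * (if norm (x - t) \<le> \<rho> * h then 1 else 0))" by auto
  moreover have "(LINT x|Q. (if norm (x - t) \<le> \<rho> * h then 1 else 0)) \<le> C * (h ^ d * ball_volume)"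
    using Q_integral_le[OF ball_integral(1)[OF assms(1)]] ball_integral(2)[OF assms(1)] by simp
  ultimately show ?thesis using assms(2) by (simp add: mult_left_mono)
qed

text \<open>Given the \<open>i\<close>-th point, the others are independent of it, and
  \<open>pilot_err_moment\<close> holds uniformly in its position. What remains is the probability
  of order \<open>h ^ d\<close> that it lies near \<open>t\<close>; this factor later cancels the
  \<open>1 / h ^ d\<close> of the kernel.\<close>

lemma local_pilot_err:
  assumes i: "i < n" and b: "0 < b" "b \<le> 1" and N: "1 \<le> real n * b ^ d" and h: "0 < h"
  defines "F \<equiv> \<lambda>x. if norm (x i - t) \<le> \<rho> * h then pilot_err n b ({..<n} - {i}) (x i) x else 0"
  shows "integrable (PiM {..<n} (\<lambda>_. Q)) F"
    "(LINT x|PiM {..<n} (\<lambda>_. Q). F x) \<le> C * ball_volume * C3 * h ^ d * (1 / (real n * b ^ d) + b ^ 4)"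
proof -
  let ?I = "{..<n}" and ?J = "{..<n} - {i}"
  let ?P = "PiM ?I (\<lambda>_. Q)"
  interpret Q: prob_space Q by (rule prob_space_Q)
  interpret P: prob_space ?P by (rule prob_space_PiM) (rule prob_space_Q)
  have J: "finite ?J" "Suc (card ?J) = n" using i by auto
  define A where "A = C3 * (1 / (real n * b ^ d) + b ^ 4)"
  have A0: "0 \<le> A" unfolding A_def using C3_nonneg b by (intro mult_nonneg_nonneg add_nonneg_nonneg) auto
  have m[measurable]: "F \<in> borel_measurable ?P"
  proof -
    have c: "(\<lambda>x. x j) \<in> borel_measurable ?P" if "j < n" for j
      using measurable_component_singleton[of j ?I "\<lambda>_. Q"] that measurable_cong_sets[OF refl sets_Q, of ?P] by simp
    note c[OF i, measurable]
    have [measurable]: "(\<lambda>x. K ((1 / b) *\<^sub>R (x i - x j))) \<in> borel_measurable ?P" if "j \<in> ?J" for j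
    proof -
      have [measurable]: "(\<lambda>x. x j) \<in> borel_measurable ?P" using that by (intro c) simp
      show ?thesis by measurable
    qed
    have [measurable]: "(\<lambda>x. pilot_est n b ?J (x i) x) \<in> borel_measurable ?P"
      unfolding pilot_est_def by measurable
    show ?thesis unfolding F_def pilot_err_def by measurable
  qed
  have F0: "0 \<le> F x" for x by (simp add: F_def pilot_err_nonneg)
  show iF: "integrable ?P F"
  proof (rule integrable_bounded[OF P.prob_space_axioms m])
    fix x show "\<bar>F x\<bar> \<le> (\<kappa> / b ^ d + C)\<^sup>2 + exp (\<kappa> / b ^ d)"
      using pilot_err_le[OF J b(1), of "x i" x] pilot_err_nonneg[of n b ?J "x i" x] by (simp add: F_def)
  qed
  have upd: "F (x(i := y)) = (if norm (y - t) \<le> \<rho> * h then pilot_err n b ?J y x else 0)" for x y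
  proof -
    have "(\<Sum>j\<in>?J. K ((1 / b) *\<^sub>R (y - (x(i := y)) j))) = (\<Sum>j\<in>?J. K ((1 / b) *\<^sub>R (y - x j)))"
      by (rule sum.cong) auto
    then have "pilot_est n b ?J y (x(i := y)) = pilot_est n b ?J y x" unfolding pilot_est_def by simp
    then show ?thesis by (simp add: F_def pilot_err_def)
  qed
  have mi: "integrable Q (\<lambda>y. if norm (y - t) \<le> \<rho> * h then A else 0)"
    by (rule integrable_bounded[OF prob_space_Q, of _ A]) (use A0 in auto)
  have "ennreal (LINT x|?P. F x) = (\<integral>\<^sup>+x. ennreal (F x) \<partial>?P)"
    using nn_integral_eq_integral[OF iF] F0 by simp
  also have "\<dots> = (\<integral>\<^sup>+y. (\<integral>\<^sup>+x. ennreal (F (x(i := y))) \<partial>PiM ?J (\<lambda>_. Q)) \<partial>Q)"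
    using i by (intro PiM_integral_remove_rev[OF prob_space_Q] F0 m) auto
  also have "\<dots> \<le> (\<integral>\<^sup>+y. ennreal (if norm (y - t) \<le> \<rho> * h then A else 0) \<partial>Q)"
  proof (rule nn_integral_mono)
    fix y
    have "(\<integral>\<^sup>+x. ennreal (pilot_err n b ?J y x) \<partial>PiM ?J (\<lambda>_. Q)) = ennreal (LINT x|PiM ?J (\<lambda>_. Q). pilot_err n b ?J y x)"
      using pilot_err_moment(1)[OF J b N] pilot_err_nonneg by (intro nn_integral_eq_integral) auto
    also have "\<dots> \<le> ennreal A" unfolding A_def by (intro ennreal_leI pilot_err_moment(2)[OF J b N])
    finally show "(\<integral>\<^sup>+x. ennreal (F (x(i := y))) \<partial>PiM ?J (\<lambda>_. Q)) \<le> ennreal (if norm (y - t) \<le> \<rho> * h then A else 0)"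
      unfolding upd by simp
  qed
  also have "\<dots> = ennreal (LINT y|Q. (if norm (y - t) \<le> \<rho> * h then A else 0))"
    using mi A0 by (intro nn_integral_eq_integral) auto
  also have "\<dots> \<le> ennreal (A * (C * (h ^ d * ball_volume)))"
    by (intro ennreal_leI ball_Q_integral h A0)
  finally have "(LINT x|?P. F x) \<le> A * (C * (h ^ d * ball_volume))"
    using A0 C_pos h ball_volume_nonneg by (simp add: ennreal_le_iff)
  also have "\<dots> = C * ball_volume * C3 * h ^ d * (1 / (real n * b ^ d) + b ^ 4)" by (simp add: A_def)
  finally show "(LINT x|?P. F x) \<le> C * ball_volume * C3 * h ^ d * (1 / (real n * b ^ d) + b ^ 4)" .
qed

text \<open>The derivative of the summand in the pilot value, at \<open>f x\<close>. The cut-off is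
  explicit since far from \<open>t\<close> the density may fall below \<open>s1\<close>, where the
  square-root formula in \<open>Dkern\<close> need not be the derivative of \<open>kern\<close>; the
  summand itself vanishes there.\<close>

definition slope where
  "slope h x = (if norm (x - t) \<le> \<rho> * h then Dkern ((1 / h) *\<^sub>R (x - t)) (f x) / h ^ d else 0)"

definition slope_bound where "slope_bound = sqrt C ^ d * L_bound / (2 * r)"

lemma slope_bound_nonneg: "0 \<le> slope_bound"
  using C_pos L_bound_nonneg r_pos by (simp add: slope_bound_def)

lemma slope_measurable [measurable]: "slope h \<in> borel_measurable borel"
  unfolding slope_def[abs_def] Dkern_def by measurable

lemma local_f_ge: "0 < h \<Longrightarrow> h \<le> \<epsilon>1 \<Longrightarrow> norm (x - t) \<le> \<rho> * h \<Longrightarrow> r \<le> f x"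
proof (rule near_t)
  assume h: "0 < h" "h \<le> \<epsilon>1" "norm (x - t) \<le> \<rho> * h"
  have "\<rho> * h \<le> \<rho> * (\<delta>0 / \<rho>)" using h \<rho>_pos by (intro mult_left_mono) (auto simp: \<epsilon>1_def)
  then show "norm (x - t) \<le> \<delta>0" using h \<rho>_pos by simp
qed

lemma slope_le:
  assumes h: "0 < h" "h \<le> \<epsilon>1"
  shows "\<bar>slope h x\<bar> \<le> (if norm (x - t) \<le> \<rho> * h then slope_bound / h ^ d else 0)"
proof (cases "norm (x - t) \<le> \<rho> * h")
  case True
  have "\<bar>Dkern ((1 / h) *\<^sub>R (x - t)) (f x)\<bar> \<le> slope_bound"
    unfolding slope_bound_def by (rule Dkern_abs_le[OF local_f_ge[OF h True] f_le])
  then have "\<bar>Dkern ((1 / h) *\<^sub>R (x - t)) (f x)\<bar> / h ^ d \<le> slope_bound / h ^ d"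
    using h by (intro divide_right_mono) auto
  then show ?thesis using True h by (simp add: slope_def)
qed (simp add: slope_def)

lemma slope_le': "0 < h \<Longrightarrow> h \<le> \<epsilon>1 \<Longrightarrow> \<bar>slope h x\<bar> \<le> slope_bound / h ^ d"
  using slope_le[of h x] slope_bound_nonneg by (auto split: if_splits)

lemma slope_integral:
  assumes h: "0 < h" "h \<le> \<epsilon>1"
  shows "(LINT x|Q. \<bar>slope h x\<bar>) \<le> slope_bound * C * ball_volume" "(LINT x|Q. (slope h x)\<^sup>2) \<le> slope_bound\<^sup>2 * C * ball_volume / h ^ d"
proof -
  have hd: "0 < h ^ d" using h by simp
  have "(LINT x|Q. \<bar>slope h x\<bar>) \<le> (LINT x|Q. (if norm (x - t) \<le> \<rho> * h then slope_bound / h ^ d else 0))"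
    using slope_le[OF h] slope_le'[OF h] slope_bound_nonneg h
    by (intro integral_mono integrable_bounded[OF prob_space_Q, of _ "slope_bound / h ^ d"]) auto
  also have "\<dots> \<le> slope_bound / h ^ d * (C * (h ^ d * ball_volume))"
    using h slope_bound_nonneg by (intro ball_Q_integral) auto
  finally show "(LINT x|Q. \<bar>slope h x\<bar>) \<le> slope_bound * C * ball_volume" using h by simp
  have sq: "(slope h x)\<^sup>2 \<le> (if norm (x - t) \<le> \<rho> * h then (slope_bound / h ^ d)\<^sup>2 else 0)" for x
    using power_mono[OF slope_le[OF h, of x], of 2] by (auto split: if_splits)
  then have sq': "(slope h x)\<^sup>2 \<le> (slope_bound / h ^ d)\<^sup>2" for x
    by (rule order_trans) auto
  have "(LINT x|Q. (slope h x)\<^sup>2) \<le> (LINT x|Q. (if norm (x - t) \<le> \<rho> * h then (slope_bound / h ^ d)\<^sup>2 else 0))"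
    using sq sq' by (intro integral_mono integrable_bounded[OF prob_space_Q, of _ "(slope_bound / h ^ d)\<^sup>2"]) auto
  also have "\<dots> \<le> (slope_bound / h ^ d)\<^sup>2 * (C * (h ^ d * ball_volume))"
    using h by (intro ball_Q_integral) auto
  finally show "(LINT x|Q. (slope h x)\<^sup>2) \<le> slope_bound\<^sup>2 * C * ball_volume / h ^ d"
    using h hd by (simp add: power2_eq_square mult_ac)
qed

subsection \<open>The mean of the linear term\<close>

lemma dirsum_f_lipschitz:
  assumes j: "Suc j \<le> 4" and e: "0 \<le> \<epsilon>"
  shows "\<bar>dirsum u j f (x + \<epsilon> *\<^sub>R u) - dirsum u j f x\<bar> \<le> \<epsilon> * (real d ^ Suc j * C * norm u ^ Suc j)"
proof (cases "\<epsilon> = 0")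
  case False
  then have e0: "0 < \<epsilon>" using e by simp
  obtain \<theta> where "dirsum u j f (x + \<epsilon> *\<^sub>R u) = dirsum u j f x + dirsum u (Suc j) f (x + \<theta> *\<^sub>R u) * \<epsilon>"
    using taylor_line[of UNIV j 1 f \<epsilon> x u] C_on_mono[OF _ f_C, of "j + 1"] j e0 by auto
  then show ?thesis
    using dirsum_f_le[OF j, of u "x + \<theta> *\<^sub>R u"] e0 by (simp add: abs_mult mult.commute[of _ \<epsilon>] mult_left_mono)
qed simp

text \<open>Compares the radial factor of the Jacobian with that of a dilation by a constant; its
  first-order term in \<open>\<epsilon>\<close> is odd in \<open>u\<close>.\<close>

definition ratio where "ratio \<epsilon> u = sqrt (f (t + \<epsilon> *\<^sub>R u)) / Jac \<epsilon> u"

lemma ratio_eq: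
  assumes "0 \<le> \<epsilon>" "\<epsilon> \<le> \<epsilon>1" "norm u \<le> \<rho>"
  shows "ratio \<epsilon> u = 2 * f (t + \<epsilon> *\<^sub>R u) / (2 * f (t + \<epsilon> *\<^sub>R u) + \<epsilon> * dirsum u 1 f (t + \<epsilon> *\<^sub>R u))"
    "r \<le> 2 * f (t + \<epsilon> *\<^sub>R u) + \<epsilon> * dirsum u 1 f (t + \<epsilon> *\<^sub>R u)"
proof -
  let ?x = "t + \<epsilon> *\<^sub>R u"
  have fr: "r \<le> f ?x" using assms by (intro scaled_near) (auto simp: \<epsilon>1_def)
  then have fx: "0 < f ?x" using r_pos by linarith
  obtain b where b: "0 < b" "f ?x = b * b" "sqrt (f ?x) = b"
    using fx by (metis real_sqrt_gt_zero real_sqrt_mult_self abs_of_pos)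
  have J: "Jac \<epsilon> u = (2 * f ?x + \<epsilon> * dirsum u 1 f ?x) / (2 * b)"
    unfolding Jac_def b(3) using b(1) by (simp add: b(2) field_simps)
  have "sqrt r \<le> b" using fr b(3) real_sqrt_le_mono[OF fr] by simp
  have "sqrt r / 2 \<le> Jac \<epsilon> u" by (rule Jac_ge[OF assms])
  then have "sqrt r * b \<le> 2 * f ?x + \<epsilon> * dirsum u 1 f ?x"
    unfolding J using b(1) by (simp add: field_simps)
  moreover have "sqrt r * sqrt r \<le> sqrt r * b" using \<open>sqrt r \<le> b\<close> r_pos by (intro mult_left_mono) auto
  ultimately show "r \<le> 2 * f ?x + \<epsilon> * dirsum u 1 f ?x" using r_pos by simp
  show "ratio \<epsilon> u = 2 * f ?x / (2 * f ?x + \<epsilon> * dirsum u 1 f ?x)"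
    unfolding ratio_def J b(3) by (simp add: b(2))
qed

lemma ratio_expansion:
  obtains C6 where "0 \<le> C6" "\<And>\<epsilon> u. 0 \<le> \<epsilon> \<Longrightarrow> \<epsilon> \<le> \<epsilon>1 \<Longrightarrow> norm u \<le> \<rho> \<Longrightarrow>
    \<bar>ratio \<epsilon> u - (1 - \<epsilon> * (dirsum u 1 f t / (2 * f t)))\<bar> \<le> C6 * \<epsilon>\<^sup>2"
proof -
  define D1 where "D1 = real d * C * \<rho>"
  define D2 where "D2 = real d ^ 2 * C * \<rho>\<^sup>2"
  define C6 where "C6 = (2 * C * D2 + 2 * D1 * D1 + D1 * D1) / (r * (2 * r))"
  have D0: "0 \<le> D1" "0 \<le> D2" using C_pos \<rho>_pos by (auto simp: D1_def D2_def)
  have *: "\<bar>ratio \<epsilon> u - (1 - \<epsilon> * (dirsum u 1 f t / (2 * f t)))\<bar> \<le> C6 * \<epsilon>\<^sup>2"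
    if e: "0 \<le> \<epsilon>" "\<epsilon> \<le> \<epsilon>1" and u: "norm u \<le> \<rho>" for \<epsilon> u
  proof -
    let ?x = "t + \<epsilon> *\<^sub>R u"
    define D where "D = dirsum u 1 f ?x"
    define Dt where "Dt = dirsum u 1 f t"
    define F where "F = f ?x"
    define Ft where "Ft = f t"
    have Db: "\<bar>D\<bar> \<le> D1" "\<bar>Dt\<bar> \<le> D1"
      using dirsum_f_le[of 1 u ?x] dirsum_f_le[of 1 u t] u C_pos unfolding D_def Dt_def D1_def
      by (auto elim!: order_trans intro!: mult_left_mono)
    have "\<bar>D - Dt\<bar> \<le> \<epsilon> * (real d ^ 2 * C * norm u ^ 2)"
      using dirsum_f_lipschitz[of 1 \<epsilon> u t] e by (simp add: D_def Dt_def numeral_2_eq_2)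
    also have "\<dots> \<le> \<epsilon> * D2" unfolding D2_def using e u C_pos by (intro mult_left_mono power_mono) auto
    finally have DD: "\<bar>D - Dt\<bar> \<le> \<epsilon> * D2" .
    have "\<bar>F - Ft\<bar> \<le> \<epsilon> * (real d * C * norm u)"
      using dirsum_f_lipschitz[of 0 \<epsilon> u t] e by (simp add: F_def Ft_def dirsum_0)
    also have "\<dots> \<le> \<epsilon> * D1" unfolding D1_def using e u C_pos by (intro mult_left_mono) auto
    finally have FF: "\<bar>F - Ft\<bar> \<le> \<epsilon> * D1" .
    have den: "r \<le> 2 * F + \<epsilon> * D" using ratio_eq(2)[OF e u] by (simp add: F_def D_def)
    have Ft: "r \<le> Ft" "Ft \<le> C" using near_t[of t] \<delta>0_pos f_le[of t] by (auto simp: Ft_def)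
    have pos: "0 < 2 * F + \<epsilon> * D" "0 < 2 * Ft" using den Ft r_pos by linarith+
    have rt: "ratio \<epsilon> u = 2 * F / (2 * F + \<epsilon> * D)" using ratio_eq(1)[OF e u] by (simp add: F_def D_def)
    have "ratio \<epsilon> u - (1 - \<epsilon> * (Dt / (2 * Ft))) = \<epsilon> * ((\<epsilon> * D * Dt + 2 * Dt * (F - Ft)) - 2 * Ft * (D - Dt)) / ((2 * F + \<epsilon> * D) * (2 * Ft))"
      unfolding rt using pos by (simp add: field_simps)
    also have "\<bar>\<dots>\<bar> = \<epsilon> * \<bar>(\<epsilon> * D * Dt + 2 * Dt * (F - Ft)) - 2 * Ft * (D - Dt)\<bar> / ((2 * F + \<epsilon> * D) * (2 * Ft))"
      using pos e by (simp add: abs_mult)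
    also have "\<dots> \<le> \<epsilon> * (\<epsilon> * (2 * C * D2 + 2 * D1 * D1 + D1 * D1)) / (r * (2 * r))"
    proof (intro frac_le mult_mono)
      have "\<bar>\<epsilon> * D * Dt\<bar> \<le> \<epsilon> * (D1 * D1)"
        unfolding abs_mult using Db e D0 by (simp add: mult.assoc mult_mono mult_left_mono)
      moreover have "\<bar>2 * Dt * (F - Ft)\<bar> \<le> 2 * D1 * (\<epsilon> * D1)"
        unfolding abs_mult using Db FF D0 by (intro mult_mono) auto
      moreover have "\<bar>2 * Ft * (D - Dt)\<bar> \<le> 2 * C * (\<epsilon> * D2)"
        unfolding abs_mult using DD Ft r_pos by (intro mult_mono) auto
      ultimately show "\<bar>(\<epsilon> * D * Dt + 2 * Dt * (F - Ft)) - 2 * Ft * (D - Dt)\<bar> \<le> \<epsilon> * (2 * C * D2 + 2 * D1 * D1 + D1 * D1)"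
        by (simp add: algebra_simps)
    qed (use den Ft r_pos e D0 C_pos in auto)
    also have "\<dots> = C6 * \<epsilon>\<^sup>2" by (simp add: C6_def power2_eq_square)
    finally show ?thesis by (simp add: Dt_def Ft_def)
  qed
  show ?thesis by (rule that[OF _ *]) (use D0 C_pos r_pos in \<open>simp add: C6_def\<close>)
qed

lemma sdiff_dirsum_bound:
  assumes "m \<le> 2"
  shows "\<bar>sdiff v (dirsum u m f) x\<bar> \<le> real d ^ m * (real d ^ 2 * C * (norm v)\<^sup>2) * norm u ^ m"
proof -
  have "sdiff v (dirsum u m f) x = (\<Sum>is | length is = m. (\<Prod>i\<leftarrow>is. u $ i) * sdiff v (partial_derivs is f) x)"
    unfolding sdiff_def dirsum_def sum_distrib_left sum.distrib[symmetric] sum_subtractf[symmetric]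
    by (intro sum.cong refl) (simp add: algebra_simps)
  also have "\<bar>\<dots>\<bar> \<le> real CARD('n) ^ m * (real d ^ 2 * C * (norm v)\<^sup>2) * norm u ^ m"
  proof (rule coeff_sum_bound)
    fix "is" :: "'n list" assume l: "length is = m"
    show "\<bar>sdiff v (partial_derivs is f) x\<bar> \<le> real d ^ 2 * C * (norm v)\<^sup>2"
    proof (rule sdiff_bound)
      show "C_on 2 UNIV (partial_derivs is f)"
        using C_on_mono[OF _ f_C, of "2 + length is"] assms l by (intro C_on_partial_derivs) simp
      show "\<bar>partial_derivs js (partial_derivs is f) z\<bar> \<le> C" if "length js = 2" for js z
        using f_partials_le[of "js @ is" z] that l assms by (simp add: partial_derivs_append)
    qed
  qed
  finally show ?thesis by (simp add: d_eq)
qed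

text \<open>The derivative at \<open>t\<close> in direction \<open>u\<close> of the pilot bias
  \<open>conv b - f\<close>.\<close>

definition conv_dir where "conv_dir b u = (LINT w|lborel. K w * (sdiff (b *\<^sub>R w) (dirsum u 1 f) t / 2))"

lemma sdiff_continuous: "continuous_on UNIV g \<Longrightarrow> continuous_on UNIV (\<lambda>w. sdiff (b *\<^sub>R w) g x / 2)"
  unfolding sdiff_def by (auto intro!: continuous_intros continuous_on_compose2[of UNIV g])

lemma dirsum_f_cont: "m \<le> 4 \<Longrightarrow> continuous_on UNIV (dirsum u m f)"
proof -
  assume m: "m \<le> 4"
  have "continuous_on UNIV (\<lambda>x. (u, x))" by (intro continuous_intros)
  then show ?thesis
    using continuous_on_compose2[OF continuous_on_dirsum[OF C_on_mono[OF m f_C]], of UNIV "\<lambda>x. (u, x)"] by simp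
qed

lemma conv_dir_integrable: "integrable lborel (\<lambda>w. K w * (sdiff (b *\<^sub>R w) (dirsum u 1 f) t / 2))"
  by (intro K_times_integrable sdiff_continuous dirsum_f_cont) simp

lemma conv_dir_scale: "conv_dir b (a *\<^sub>R u) = a * conv_dir b u"
proof -
  have "sdiff v (dirsum (a *\<^sub>R u) 1 f) t = a * sdiff v (dirsum u 1 f) t" for v
    using dirsum_scale[of a u 1 f] by (simp add: sdiff_def algebra_simps)
  then have "(\<lambda>w. K w * (sdiff (b *\<^sub>R w) (dirsum (a *\<^sub>R u) 1 f) t / 2)) = (\<lambda>w. a * (K w * (sdiff (b *\<^sub>R w) (dirsum u 1 f) t / 2)))"
    by (simp add: fun_eq_iff)
  then show ?thesis unfolding conv_dir_def by simp
qed

lemma conv_dir_continuous: "continuous_on UNIV (conv_dir b)"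
proof -
  have c: "continuous_on UNIV (partial_deriv i f)" for i
    using C_on_continuous[OF C_on_partial, of 3 UNIV f i] f_C by (simp add: eval_nat_numeral)
  have "conv_dir b u = (\<Sum>i\<in>UNIV. u $ i * (LINT w|lborel. K w * (sdiff (b *\<^sub>R w) (partial_deriv i f) t / 2)))" for u
  proof -
    have "sdiff v (dirsum u 1 f) t = (\<Sum>i\<in>UNIV. u $ i * sdiff v (partial_deriv i f) t)" for v
      by (simp add: sdiff_def dirsum_1 sum.distrib sum_subtractf sum_distrib_left algebra_simps)
    then have "conv_dir b u = (LINT w|lborel. (\<Sum>i\<in>UNIV. u $ i * (K w * (sdiff (b *\<^sub>R w) (partial_deriv i f) t / 2))))"
      unfolding conv_dir_def by (intro Bochner_Integration.integral_cong refl) (simp add: sum_distrib_left sum_divide_distrib mult_ac)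
    also have "\<dots> = (\<Sum>i\<in>UNIV. u $ i * (LINT w|lborel. K w * (sdiff (b *\<^sub>R w) (partial_deriv i f) t / 2)))"
      by (subst Bochner_Integration.integral_sum)
        (auto intro!: integrable_mult_right K_times_integrable sdiff_continuous c simp del: times_divide_eq_right)
    finally show ?thesis .
  qed
  then show ?thesis by (simp add: continuous_on_sum continuous_intros fun_eq_iff[symmetric] cong: continuous_on_cong)
qed

lemma K_weighted_bound:
  assumes "integrable lborel (\<lambda>w. K w * g w)" "\<And>w. (norm w)\<^sup>2 \<le> T \<Longrightarrow> \<bar>g w\<bar> \<le> B" "0 \<le> B"
  shows "\<bar>LINT w|lborel. K w * g w\<bar> \<le> B"
proof -
  have "\<bar>LINT w|lborel. K w * g w\<bar> \<le> (LINT w|lborel. \<bar>K w * g w\<bar>)" by (rule integral_abs_bound)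
  also have "\<dots> \<le> (LINT w|lborel. K w * B)"
  proof (rule integral_mono[OF integrable_abs[OF assms(1)]])
    show "integrable lborel (\<lambda>w. K w * B)" using K_integrable by simp
    show "\<bar>K w * g w\<bar> \<le> K w * B" for w
      using assms(2)[of w] K_nonneg[of w] by (cases "T < (norm w)\<^sup>2") (auto simp: K_zero abs_mult intro!: mult_left_mono)
  qed
  also have "\<dots> = B" by (simp add: K_integral)
  finally show ?thesis .
qed

lemma conv_dir_bound: "\<bar>conv_dir b u\<bar> \<le> real d * (real d ^ 2 * C * T) * norm u * b\<^sup>2"
  unfolding conv_dir_def
proof (rule K_weighted_bound[OF conv_dir_integrable])
  fix w :: "real ^ 'n" assume w: "(norm w)\<^sup>2 \<le> T"
  have "\<bar>sdiff (b *\<^sub>R w) (dirsum u 1 f) t\<bar> \<le> real d * (real d ^ 2 * C * (b\<^sup>2 * (norm w)\<^sup>2)) * norm u"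
    using sdiff_dirsum_bound[of 1 "b *\<^sub>R w" u t] by (simp add: power_mult_distrib)
  also have "\<dots> \<le> real d * (real d ^ 2 * C * (b\<^sup>2 * T)) * norm u"
    using w C_pos by (intro mult_right_mono mult_left_mono) auto
  finally show "\<bar>sdiff (b *\<^sub>R w) (dirsum u 1 f) t / 2\<bar> \<le> real d * (real d ^ 2 * C * T) * norm u * b\<^sup>2"
    by (simp add: mult_ac)
qed (use C_pos T_pos in auto)

text \<open>Four derivatives of \<open>f\<close> are spent: two on the symmetric difference, which
  gives \<open>b^2\<close>, and two on the shift along \<open>u\<close>, which gives
  \<open>\<epsilon>^2\<close>.\<close>

lemma conv_expansion:
  assumes e: "0 < \<epsilon>"
  shows "\<bar>(conv b (t + \<epsilon> *\<^sub>R u) - f (t + \<epsilon> *\<^sub>R u)) - ((conv b t - f t) + \<epsilon> * conv_dir b u)\<bar>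
     \<le> real d ^ 2 * (real d ^ 2 * C * T) * (norm u)\<^sup>2 * b\<^sup>2 * \<epsilon>\<^sup>2"
proof -
  let ?g = "\<lambda>w. sdiff (b *\<^sub>R w) f (t + \<epsilon> *\<^sub>R u) / 2 - sdiff (b *\<^sub>R w) f t / 2 - \<epsilon> * (sdiff (b *\<^sub>R w) (dirsum u 1 f) t / 2)"
  have i: "integrable lborel (\<lambda>w. K w * (sdiff (b *\<^sub>R w) f x / 2))" for x
    by (intro K_times_integrable sdiff_continuous f_cont)
  have eq: "(\<lambda>w. K w * ?g w) = (\<lambda>w. K w * (sdiff (b *\<^sub>R w) f (t + \<epsilon> *\<^sub>R u) / 2) - K w * (sdiff (b *\<^sub>R w) f t / 2) - \<epsilon> * (K w * (sdiff (b *\<^sub>R w) (dirsum u 1 f) t / 2)))"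
    by (simp add: fun_eq_iff algebra_simps)
  have ig: "integrable lborel (\<lambda>w. K w * ?g w)"
    unfolding eq by (intro Bochner_Integration.integrable_diff i integrable_mult_right conv_dir_integrable)
  have "(conv b (t + \<epsilon> *\<^sub>R u) - f (t + \<epsilon> *\<^sub>R u)) - ((conv b t - f t) + \<epsilon> * conv_dir b u) = (LINT w|lborel. K w * ?g w)"
    unfolding eq Bochner_Integration.integral_diff[OF Bochner_Integration.integrable_diff[OF i i] integrable_mult_right[OF conv_dir_integrable]]
      Bochner_Integration.integral_diff[OF i i] integral_mult_right_zero conv_diff_eq conv_dir_def by (simp only: diff_diff_eq)
  also have "\<bar>\<dots>\<bar> \<le> real d ^ 2 * (real d ^ 2 * C * T) * (norm u)\<^sup>2 * b\<^sup>2 * \<epsilon>\<^sup>2"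
  proof (rule K_weighted_bound[OF ig])
    fix w :: "real ^ 'n" assume w: "(norm w)\<^sup>2 \<le> T"
    define v where "v = b *\<^sub>R w"
    let ?D = "\<lambda>m y. sdiff v (dirsum u m f) (t + y *\<^sub>R u)"
    have "\<forall>m y. m < 2 \<and> 0 \<le> y \<and> y \<le> \<epsilon> \<longrightarrow> (?D m has_real_derivative ?D (Suc m) y) (at y)"
    proof (intro allI impI)
      fix m :: nat and y :: real assume m: "m < 2 \<and> 0 \<le> y \<and> y \<le> \<epsilon>"
      have "((\<lambda>s. dirsum u m f (z + s *\<^sub>R u)) has_real_derivative dirsum u (Suc m) f (z + y *\<^sub>R u)) (at y)" for z
        using m by (intro dirsum_derivative[of UNIV] C_on_mono[OF _ f_C]) auto
      from this[of "t + v"] this[of "t - v"] this[of t]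
      show "(?D m has_real_derivative ?D (Suc m) y) (at y)"
        unfolding sdiff_def by (intro DERIV_diff DERIV_add DERIV_cmult) (simp_all add: algebra_simps)
    qed
    from Maclaurin[of \<epsilon> 2 ?D "?D 0", OF e _ refl this]
    obtain \<theta> where \<theta>: "?D 0 \<epsilon> = (\<Sum>m<2. ?D m 0 / fact m * \<epsilon> ^ m) + ?D 2 \<theta> / fact 2 * \<epsilon> ^ 2" by auto
    have d0: "dirsum u 0 f = f" by (simp add: fun_eq_iff dirsum_0)
    have gD: "?g w = ?D 2 \<theta> / 4 * \<epsilon>\<^sup>2"
    proof -
      have "sdiff v f (t + \<epsilon> *\<^sub>R u) = sdiff v f t + sdiff v (dirsum u 1 f) t * \<epsilon> + ?D 2 \<theta> / 2 * \<epsilon>\<^sup>2"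
        using \<theta> by (simp add: d0 numeral_2_eq_2)
      then show ?thesis unfolding v_def[symmetric] by (simp add: field_simps)
    qed
    have "\<bar>?D 2 \<theta>\<bar> \<le> real d ^ 2 * (real d ^ 2 * C * (norm v)\<^sup>2) * (norm u)\<^sup>2"
      by (rule sdiff_dirsum_bound) simp
    also have "real d ^ 2 * (real d ^ 2 * C * (norm v)\<^sup>2) * (norm u)\<^sup>2 \<le> real d ^ 2 * (real d ^ 2 * C * (b\<^sup>2 * T)) * (norm u)\<^sup>2"
      using w C_pos by (intro mult_right_mono mult_left_mono) (auto simp: v_def power_mult_distrib intro!: mult_left_mono)
    finally have "\<bar>?D 2 \<theta>\<bar> / 4 * \<epsilon>\<^sup>2 \<le> (real d ^ 2 * (real d ^ 2 * C * (b\<^sup>2 * T)) * (norm u)\<^sup>2) / 4 * \<epsilon>\<^sup>2"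
      by (intro mult_right_mono divide_right_mono) auto
    then have "\<bar>?g w\<bar> \<le> (real d ^ 2 * (real d ^ 2 * C * (b\<^sup>2 * T)) * (norm u)\<^sup>2) / 4 * \<epsilon>\<^sup>2"
      unfolding gD abs_mult by simp
    also have "\<dots> \<le> (real d ^ 2 * (real d ^ 2 * C * (b\<^sup>2 * T)) * (norm u)\<^sup>2) * \<epsilon>\<^sup>2"
      using C_pos T_pos by (intro mult_right_mono) auto
    finally show "\<bar>?g w\<bar> \<le> real d ^ 2 * (real d ^ 2 * C * T) * (norm u)\<^sup>2 * b\<^sup>2 * \<epsilon>\<^sup>2"
      by (simp add: mult_ac)
  qed (use C_pos T_pos in auto)
  finally show ?thesis .
qed

text \<open>The part of the pilot's smoothing bias that the linear term passes on to the mean of the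
  estimator.\<close>

definition theta where "theta b h = (LINT x|Q. slope h x * (conv b x - f x))"

lemma conv_measurable [measurable]: "conv b \<in> borel_measurable borel"
  unfolding conv_def[abs_def] by measurable

text \<open>A bound by \<open>b^2\<close> alone would only be \<open>o(h^2)\<close>, whereas
  \<open>o(h^4)\<close> is required. The missing \<open>h^2\<close> comes from two cancellations:
  after the substitution the zeroth-order term in \<open>h\<close> is a constant times
  \<open>L\<close>, with integral zero, and the first-order term is \<open>L\<close> times an odd
  function.\<close>

lemma theta_bound:
  obtains C5 where "\<And>b h. 0 < h \<Longrightarrow> h \<le> \<epsilon>1 \<Longrightarrow> \<bar>theta b h\<bar> \<le> C5 * (h\<^sup>2 * b\<^sup>2)"
proof -
  obtain C6 where C6: "0 \<le> C6" "\<And>\<epsilon> u. 0 \<le> \<epsilon> \<Longrightarrow> \<epsilon> \<le> \<epsilon>1 \<Longrightarrow> norm u \<le> \<rho> \<Longrightarrow>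
    \<bar>ratio \<epsilon> u - (1 - \<epsilon> * (dirsum u 1 f t / (2 * f t)))\<bar> \<le> C6 * \<epsilon>\<^sup>2"
    by (rule ratio_expansion) blast
  define A1 where "A1 = real d ^ 2 * C * T"
  define A2 where "A2 = real d * A1 * \<rho>"
  define A3 where "A3 = real d ^ 2 * A1 * \<rho>\<^sup>2"
  define E1 where "E1 = real d * C * \<rho> / (2 * r)"
  define M where "M = 2 * C / r * A3 + C6 * (A1 + \<epsilon>1 * A2) + E1 * A2 + (A2 + A1 * E1) * (real d * C * \<rho> / r)"
  define C5 where "C5 = M * (LINT w|lborel. \<bar>kernel_L K w\<bar>)"
  have A0: "0 \<le> A1" "0 \<le> A2" "0 \<le> A3" "0 \<le> E1"
    using C_pos T_pos \<rho>_pos r_pos by (auto simp: A1_def A2_def A3_def E1_def)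
  have ft: "r \<le> f t" using near_t[of t] \<delta>0_pos by simp
  have "\<bar>theta b h\<bar> \<le> C5 * (h\<^sup>2 * b\<^sup>2)" if h: "0 < h" "h \<le> \<epsilon>1" for b h
  proof -
    define P0 where "P0 = conv b t - f t"
    define e1 where "e1 u = dirsum u 1 f t / (2 * f t)" for u
    define \<Lambda> where "\<Lambda> u = conv_dir b u - P0 * e1 u" for u
    let ?b = "\<lambda>u. sqrt (f (t + h *\<^sub>R u))"
    let ?j = "\<lambda>u. ?b u ^ (d - 1) * Jac h u"
    define F where "F u = conv b (t + h *\<^sub>R u) - f (t + h *\<^sub>R u)" for u
    let ?I = "\<lambda>u. if norm u \<le> \<rho> then kernel_L K (?b u *\<^sub>R u) * ?j u * (ratio h u * F u) else 0"
    \<comment> \<open>The first-order term has to be a function of the substituted variable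
      \<open>w\<close>; using \<open>sqrt (f t)\<close> in place of
      \<open>sqrt (f (t + h *\<^sub>R u))\<close> for the conversion costs one more factor
      \<open>h\<close>.\<close>
    define g where "g w = kernel_L K w * (P0 + h / sqrt (f t) * \<Lambda> w)" for w
    let ?G = "\<lambda>u. if norm u \<le> \<rho> then g (?b u *\<^sub>R u) * ?j u else 0"
    let ?H = "\<lambda>u. if norm u \<le> \<rho> then \<bar>kernel_L K (?b u *\<^sub>R u)\<bar> * ?j u else 0"
    have h0: "0 \<le> h" using h by simp
    have \<Lambda>_scale: "\<Lambda> (a *\<^sub>R u) = a * \<Lambda> u" for a u
      using dirsum_scale[of a u 1 f t] by (simp add: \<Lambda>_def conv_dir_scale e1_def algebra_simps)
    have \<Lambda>_cont: "continuous_on UNIV \<Lambda>"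
      unfolding \<Lambda>_def e1_def
      by (intro continuous_intros conv_dir_continuous continuous_on_dirsum_compose[OF C_on_mono[OF _ f_C]]) (use ft r_pos in auto)
    have g_cont: "continuous_on UNIV g"
      unfolding g_def by (intro continuous_intros kernel_L_cont \<Lambda>_cont)
    have g_int: "integrable lborel g"
      unfolding g_def by (intro L_times_integrable continuous_intros \<Lambda>_cont)
    have L\<Lambda>: "(LINT w|lborel. kernel_L K w * \<Lambda> w) = 0"
    proof (rule lborel_integral_odd)
      show "(\<lambda>w. kernel_L K w * \<Lambda> w) \<in> borel_measurable borel"
        by (intro borel_measurable_continuous_onI continuous_intros kernel_L_cont \<Lambda>_cont)
      show "kernel_L K (- w) * \<Lambda> (- w) = - (kernel_L K w * \<Lambda> w)" for w
        using \<Lambda>_scale[of "-1" w] by (simp add: kernel_L_eq)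
    qed
    have "(LINT w|lborel. g w) = (LINT w|lborel. P0 * kernel_L K w + h / sqrt (f t) * (kernel_L K w * \<Lambda> w))"
      unfolding g_def by (intro Bochner_Integration.integral_cong refl) (simp add: algebra_simps)
    also have "\<dots> = 0"
      using L_times_integrable[OF \<Lambda>_cont] kernel_L_integrable by (simp add: L\<Lambda> kernel_L_integral)
    finally have g0: "(LINT w|lborel. g w) = 0" .
    have gm: "g \<in> borel_measurable borel" by (intro borel_measurable_continuous_onI g_cont)
    have G: "has_bochner_integral lborel ?G 0"
      using radial_substitution[OF h0 h(2) gm g_int] unfolding g0 by (simp add: g_def kernel_L_eq l_zero)
    have H: "has_bochner_integral lborel ?H (LINT w|lborel. \<bar>kernel_L K w\<bar>)"
      by (rule radial_substitution[OF h0 h(2), of "\<lambda>w. \<bar>kernel_L K w\<bar>"])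
        (measurable, rule integrable_abs[OF kernel_L_integrable], simp add: kernel_L_eq l_zero)
    have core: "\<bar>ratio h u * F u - (P0 + h / sqrt (f t) * \<Lambda> (?b u *\<^sub>R u))\<bar> \<le> M * (h\<^sup>2 * b\<^sup>2)" if u: "norm u \<le> \<rho>" for u
    proof -
      define R where "R = F u - (P0 + h * conv_dir b u)"
      define r1 where "r1 = ratio h u - (1 - h * e1 u)"
      have P0b: "\<bar>P0\<bar> \<le> A1 * b\<^sup>2" using conv_diff_le[of b t] by (simp add: P0_def A1_def)
      have P1b: "\<bar>conv_dir b u\<bar> \<le> A2 * b\<^sup>2"
      proof -
        have "\<bar>conv_dir b u\<bar> \<le> real d * A1 * norm u * b\<^sup>2" using conv_dir_bound[of b u] by (simp add: A1_def)
        also have "\<dots> \<le> real d * A1 * \<rho> * b\<^sup>2" using u A0 by (intro mult_right_mono mult_left_mono) auto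
        finally show ?thesis by (simp add: A2_def)
      qed
      have Rb: "\<bar>R\<bar> \<le> A3 * b\<^sup>2 * h\<^sup>2"
      proof -
        have "\<bar>R\<bar> \<le> real d ^ 2 * A1 * (norm u)\<^sup>2 * b\<^sup>2 * h\<^sup>2"
          using conv_expansion[OF h(1), of b u] by (simp add: R_def F_def P0_def A1_def)
        also have "\<dots> \<le> real d ^ 2 * A1 * \<rho>\<^sup>2 * b\<^sup>2 * h\<^sup>2"
          using u A0 by (intro mult_right_mono mult_left_mono power_mono) auto
        finally show ?thesis by (simp add: A3_def)
      qed
      have e1b: "\<bar>e1 u\<bar> \<le> E1"
      proof -
        have "\<bar>dirsum u 1 f t\<bar> \<le> real d * C * \<rho>"
          using dirsum_f_le[of 1 u t] u C_pos by (auto elim!: order_trans intro!: mult_left_mono)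
        then show ?thesis unfolding e1_def E1_def using ft r_pos
          by (simp add: abs_divide frac_le)
      qed
      have r1b: "\<bar>r1\<bar> \<le> C6 * h\<^sup>2" using C6(2)[OF h0 h(2) u] by (simp add: r1_def e1_def)
      have \<Lambda>b: "\<bar>\<Lambda> u\<bar> \<le> (A2 + A1 * E1) * b\<^sup>2"
      proof -
        have "\<bar>P0 * e1 u\<bar> \<le> (A1 * b\<^sup>2) * E1" unfolding abs_mult using P0b e1b A0 by (intro mult_mono) auto
        then show ?thesis using P1b unfolding \<Lambda>_def by (simp add: algebra_simps)
      qed
      have fu: "r \<le> f (t + h *\<^sub>R u)" using h u by (intro scaled_near) (auto simp: \<epsilon>1_def)
      have ratb: "\<bar>ratio h u\<bar> \<le> 2 * C / r"
        unfolding ratio_eq(1)[OF h0 h(2) u] abs_divide using ratio_eq(2)[OF h0 h(2) u] fu f_le r_pos C_pos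
        by (intro frac_le) auto
      have sq: "\<bar>1 - ?b u / sqrt (f t)\<bar> \<le> h * (real d * C * \<rho> / r)"
      proof -
        have pos: "0 < sqrt (f t)" "0 < ?b u" "sqrt r \<le> sqrt (f t)" "0 < sqrt r" using ft fu r_pos by auto
        have "(sqrt (f t) - ?b u) * (sqrt (f t) + ?b u) = f t - f (t + h *\<^sub>R u)"
          using ft fu r_pos by (simp add: algebra_simps)
        then have "\<bar>sqrt (f t) - ?b u\<bar> * (sqrt (f t) + ?b u) = \<bar>f t - f (t + h *\<^sub>R u)\<bar>"
          using pos by (metis abs_mult abs_of_pos add_pos_pos)
        moreover have "\<bar>f t - f (t + h *\<^sub>R u)\<bar> \<le> h * (real d * C * \<rho>)"
          using dirsum_f_lipschitz[of 0 h u t] h u C_pos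
          by (auto simp: dirsum_0 abs_minus_commute elim!: order_trans intro!: mult_left_mono)
        moreover have "\<bar>sqrt (f t) - ?b u\<bar> * sqrt r \<le> \<bar>sqrt (f t) - ?b u\<bar> * (sqrt (f t) + ?b u)"
          by (intro mult_left_mono) (use pos in linarith, simp)
        ultimately have "\<bar>sqrt (f t) - ?b u\<bar> * sqrt r \<le> h * (real d * C * \<rho>)" by linarith
        then have 1: "\<bar>sqrt (f t) - ?b u\<bar> \<le> h * (real d * C * \<rho>) / sqrt r" using pos by (simp add: le_divide_eq)
        have "1 - ?b u / sqrt (f t) = (sqrt (f t) - ?b u) / sqrt (f t)" using pos by (simp add: diff_divide_distrib)
        then have "\<bar>1 - ?b u / sqrt (f t)\<bar> = \<bar>sqrt (f t) - ?b u\<bar> / sqrt (f t)" using pos by simp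
        also have "\<dots> \<le> (h * (real d * C * \<rho>) / sqrt r) / sqrt r"
          using 1 pos h C_pos \<rho>_pos by (intro frac_le) auto
        finally show ?thesis using r_pos by simp
      qed
      \<comment> \<open>The product of the expansions \<open>1 - h e1 + r1\<close> and
        \<open>P0 + h conv_dir + R\<close>, sorted so that every term on the right is of second
        order in \<open>h\<close>.\<close>
      have "ratio h u * F u - (P0 + h / sqrt (f t) * \<Lambda> (?b u *\<^sub>R u))
        = ratio h u * R + r1 * (P0 + h * conv_dir b u) - h\<^sup>2 * (e1 u * conv_dir b u) + h * (\<Lambda> u * (1 - ?b u / sqrt (f t)))"
        unfolding \<Lambda>_scale by (simp add: R_def r1_def \<Lambda>_def power2_eq_square algebra_simps diff_divide_distrib)
      moreover have "\<bar>ratio h u * R\<bar> \<le> 2 * C / r * (A3 * b\<^sup>2 * h\<^sup>2)"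
        unfolding abs_mult using ratb Rb by (intro mult_mono) auto
      moreover have "\<bar>r1 * (P0 + h * conv_dir b u)\<bar> \<le> (C6 * h\<^sup>2) * ((A1 + \<epsilon>1 * A2) * b\<^sup>2)"
      proof -
        have "\<bar>h * conv_dir b u\<bar> \<le> \<epsilon>1 * (A2 * b\<^sup>2)" unfolding abs_mult using h P1b by (intro mult_mono) auto
        then have "\<bar>P0 + h * conv_dir b u\<bar> \<le> (A1 + \<epsilon>1 * A2) * b\<^sup>2" using P0b by (simp add: algebra_simps)
        then show ?thesis unfolding abs_mult[of r1] using r1b by (intro mult_mono) auto
      qed
      moreover have "\<bar>h\<^sup>2 * (e1 u * conv_dir b u)\<bar> \<le> h\<^sup>2 * (E1 * (A2 * b\<^sup>2))"
        unfolding abs_mult using e1b P1b A0 by (intro mult_mono) auto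
      moreover have "\<bar>h * (\<Lambda> u * (1 - ?b u / sqrt (f t)))\<bar> \<le> h * (((A2 + A1 * E1) * b\<^sup>2) * (h * (real d * C * \<rho> / r)))"
        unfolding abs_mult abs_of_pos[OF h(1)] using \<Lambda>b sq h0 A0 by (intro mult_left_mono mult_mono) auto
      ultimately have "\<bar>ratio h u * F u - (P0 + h / sqrt (f t) * \<Lambda> (?b u *\<^sub>R u))\<bar>
         \<le> 2 * C / r * (A3 * b\<^sup>2 * h\<^sup>2) + (C6 * h\<^sup>2) * ((A1 + \<epsilon>1 * A2) * b\<^sup>2) + h\<^sup>2 * (E1 * (A2 * b\<^sup>2))
           + h * (((A2 + A1 * E1) * b\<^sup>2) * (h * (real d * C * \<rho> / r)))"
        by (rule abs_le_four)
      also have "\<dots> = M * (h\<^sup>2 * b\<^sup>2)" unfolding M_def by (simp add: power2_eq_square algebra_simps add_divide_distrib)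
      finally show ?thesis .
    qed
    have bound: "\<bar>?I u - ?G u\<bar> \<le> M * (h\<^sup>2 * b\<^sup>2) * ?H u" for u
    proof (cases "norm u \<le> \<rho>")
      case True
      have j: "0 \<le> ?j u" using Jac_nonneg[OF h0 h(2) True] f_nonneg by (intro mult_nonneg_nonneg) auto
      have "?I u - ?G u = kernel_L K (?b u *\<^sub>R u) * ?j u * (ratio h u * F u - (P0 + h / sqrt (f t) * \<Lambda> (?b u *\<^sub>R u)))"
        using True by (simp add: g_def algebra_simps)
      then have "\<bar>?I u - ?G u\<bar> = ?H u * \<bar>ratio h u * F u - (P0 + h / sqrt (f t) * \<Lambda> (?b u *\<^sub>R u))\<bar>"
        using True by (simp only: abs_mult[of "_ * ?j u"] abs_mult[of _ "?j u"] abs_of_nonneg[OF j] if_True)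
      also have "\<dots> \<le> ?H u * (M * (h\<^sup>2 * b\<^sup>2))" using core[OF True] j by (intro mult_left_mono) auto
      finally show ?thesis by (simp add: mult_ac)
    qed simp
    \<comment> \<open>The density cancels the \<open>1 / s\<close> in \<open>Dkern\<close>, which
      leaves the factor one half.\<close>
    have thI: "theta b h = (LINT u|lborel. ?I u) / 2"
    proof -
      have "theta b h = (LINT x|lborel. f x * (slope h x * (conv b x - f x)))"
        unfolding theta_def by (rule Q_integral) measurable
      also have "\<dots> = \<bar>h\<bar> ^ CARD('n) * (LINT u|lborel. f (t + h *\<^sub>R u) * (slope h (t + h *\<^sub>R u) * (conv b (t + h *\<^sub>R u) - f (t + h *\<^sub>R u))))"
        by (rule lborel_integral_scale) (use h in auto)
      also have "\<dots> = (LINT u|lborel. h ^ d * (f (t + h *\<^sub>R u) * (slope h (t + h *\<^sub>R u) * F u)))"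
        using h by (simp add: d_eq F_def)
      also have "\<dots> = (LINT u|lborel. ?I u / 2)"
      proof (intro Bochner_Integration.integral_cong refl)
        fix u
        show "h ^ d * (f (t + h *\<^sub>R u) * (slope h (t + h *\<^sub>R u) * F u)) = ?I u / 2"
        proof (cases "norm u \<le> \<rho>")
          case True
          have fu: "0 < f (t + h *\<^sub>R u)" using h True scaled_near[of h u] r_pos by (auto simp: \<epsilon>1_def)
          have J: "Jac h u \<noteq> 0" using Jac_ge[OF h0 h(2) True] real_sqrt_gt_zero[OF r_pos] by linarith
          have p: "?b u ^ d = ?b u ^ (d - 1) * ?b u" using d_pos by (simp flip: power_Suc2)
          have "slope h (t + h *\<^sub>R u) = Dkern u (f (t + h *\<^sub>R u)) / h ^ d"
            using True h by (simp add: slope_def mult.commute)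
          then show ?thesis using True h fu J unfolding Dkern_def p ratio_def by (simp add: field_simps)
        next
          case False
          then show ?thesis using h by (simp add: slope_def mult.commute)
        qed
      qed
      finally show ?thesis by simp
    qed
    have Im: "?I \<in> borel_measurable lborel" unfolding ratio_def F_def by measurable
    have int: "integrable lborel (\<lambda>u. ?I u - ?G u)"
    proof (rule Bochner_Integration.integrable_bound)
      show "integrable lborel (\<lambda>u. M * (h\<^sup>2 * b\<^sup>2) * ?H u)" by (rule integrable_mult_right[OF integrable.intros[OF H]])
      show "AE u in lborel. norm (?I u - ?G u) \<le> norm (M * (h\<^sup>2 * b\<^sup>2) * ?H u)"
        using order_trans[OF bound abs_ge_self] by (intro AE_I2) (simp only: real_norm_def)
      show "(\<lambda>u. ?I u - ?G u) \<in> borel_measurable lborel"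
        by (rule borel_measurable_diff[OF Im borel_measurable_integrable[OF integrable.intros[OF G]]])
    qed
    have "integrable lborel (\<lambda>u. (?I u - ?G u) + ?G u)"
      by (rule Bochner_Integration.integrable_add[OF int integrable.intros[OF G]])
    then have iI: "integrable lborel ?I" by simp
    have "(LINT u|lborel. ?I u) = (LINT u|lborel. ?I u - ?G u)"
      using Bochner_Integration.integral_diff[OF iI integrable.intros[OF G]] has_bochner_integral_integral_eq[OF G] by simp
    then have "\<bar>LINT u|lborel. ?I u\<bar> \<le> (LINT u|lborel. \<bar>?I u - ?G u\<bar>)"
      by (simp only: integral_abs_bound)
    moreover have "(LINT u|lborel. \<bar>?I u - ?G u\<bar>) \<le> (LINT u|lborel. M * (h\<^sup>2 * b\<^sup>2) * ?H u)"
      by (rule integral_mono[OF integrable_abs[OF int] integrable_mult_right[OF integrable.intros[OF H]] bound])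
    moreover have "(LINT u|lborel. M * (h\<^sup>2 * b\<^sup>2) * ?H u) = C5 * (h\<^sup>2 * b\<^sup>2)"
      unfolding integral_mult_right_zero has_bochner_integral_integral_eq[OF H] by (simp add: C5_def)
    moreover have "\<bar>theta b h\<bar> \<le> \<bar>LINT u|lborel. ?I u\<bar>" unfolding thI by simp
    ultimately show ?thesis by linarith
  qed
  then show ?thesis by (rule that)
qed

end

section \<open>Limit tools: dominated convergence, weak limits and off-diagonal sums\<close>

lemma dominated_convergence_eventually:
  fixes g :: "nat \<Rightarrow> 'a \<Rightarrow> real"
  assumes m: "\<And>n. g n \<in> borel_measurable M" "g' \<in> borel_measurable M" and w: "integrable M w"
    and lim: "\<And>x. (\<lambda>n. g n x) \<longlonglongrightarrow> g' x" and b: "\<forall>\<^sub>F n in sequentially. \<forall>x. \<bar>g n x\<bar> \<le> w x"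
  shows "(\<lambda>n. LINT x|M. g n x) \<longlonglongrightarrow> (LINT x|M. g' x)"
proof -
  obtain N where N: "\<And>n x. N \<le> n \<Longrightarrow> \<bar>g n x\<bar> \<le> w x" using b unfolding eventually_sequentially by blast
  have "(\<lambda>n. LINT x|M. g (n + N) x) \<longlonglongrightarrow> (LINT x|M. g' x)"
  proof (rule integral_dominated_convergence[where w=w])
    show "AE x in M. (\<lambda>n. g (n + N) x) \<longlonglongrightarrow> g' x"
      using LIMSEQ_ignore_initial_segment[OF lim] by (intro AE_I2)
    show "AE x in M. norm (g (n + N) x) \<le> w x" for n using N by (intro AE_I2) simp
  qed (use m w in auto)
  then show ?thesis by (rule LIMSEQ_offset)
qed

lemma weak_conv_m_eventually_eq:
  assumes "\<forall>\<^sub>F n in sequentially. A n = B n" "weak_conv_m A L"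
  shows "weak_conv_m B L"
proof -
  have "(\<lambda>n. cdf (B n) x) \<longlonglongrightarrow> cdf L x" if "isCont (cdf L) x" for x
  proof -
    have "(\<lambda>n. cdf (A n) x) \<longlonglongrightarrow> cdf L x" using assms(2) that by (auto simp: weak_conv_m_def weak_conv_def)
    moreover have "\<forall>\<^sub>F n in sequentially. cdf (A n) x = cdf (B n) x" using assms(1) by eventually_elim simp
    ultimately show ?thesis by (rule Lim_transform_eventually)
  qed
  then show ?thesis by (auto simp: weak_conv_m_def weak_conv_def)
qed

lemma sum_off_diagonal:
  fixes g :: "nat \<Rightarrow> real"
  shows "(\<Sum>i<n. \<Sum>j\<in>{..<n} - {i}. g j) = (real n - 1) * (\<Sum>j<n. g j)"
    "(\<Sum>i<n. \<Sum>j\<in>{..<n} - {i}. g i) = (real n - 1) * (\<Sum>i<n. g i)"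
proof -
  have "(\<Sum>i<n. \<Sum>j\<in>{..<n} - {i}. g j) = (\<Sum>i<n. (\<Sum>j<n. g j) - g i)"
    by (intro sum.cong refl) (simp add: sum_diff1)
  then show "(\<Sum>i<n. \<Sum>j\<in>{..<n} - {i}. g j) = (real n - 1) * (\<Sum>j<n. g j)"
    by (simp add: sum_subtractf algebra_simps)
  have "(\<Sum>i<n. \<Sum>j\<in>{..<n} - {i}. g i) = (\<Sum>i<n. (real n - 1) * g i)"
    by (intro sum.cong refl) (auto simp: of_nat_diff)
  then show "(\<Sum>i<n. \<Sum>j\<in>{..<n} - {i}. g i) = (real n - 1) * (\<Sum>i<n. g i)"
    by (simp add: sum_distrib_left)
qed

context pilot
begin

subsection \<open>The limit variance\<close>

definition summand where "summand h x s = kern ((1 / h) *\<^sub>R (t - x)) s / h ^ d"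

text \<open>Up to the constant \<open>slope_mean\<close>, the projection of the linear term on the
  second variable: the mean effect of a sample point \<open>y\<close> on the summand of another
  point through the pilot value there.\<close>

definition slope_conv where "slope_conv b h y = (LINT x|Q. slope h x * (K ((1 / b) *\<^sub>R (x - y)) / b ^ d))"

text \<open>A point acts once through its own summand and once through the pilots of the other
  \<open>n - 1\<close> points, in each of which it has weight \<open>1 / n\<close>.\<close>

definition influence where "influence n b h y = summand h y (f y) + (real n - 1) / real n * slope_conv b h y"

text \<open>The limit of \<open>h ^ d\<close> times the influence at
  \<open>t + h *\<^sub>R u\<close>. As \<open>b / h\<close> tends to zero, smoothing at scale
  \<open>b\<close> acts on \<open>slope * f\<close>, which varies at scale \<open>h\<close>, like
  the identity.\<close>

definition limit_influence where "limit_influence u = kern u (f t) + f t * Dkern u (f t)"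

lemma kern_minus: "kern (- u) s = kern u s"
  by (simp add: kern_def K_minus)

lemma Dkern_minus: "Dkern (- u) s = Dkern u s"
  by (simp add: Dkern_def kernel_L_eq)

lemma summand_measurable [measurable]: "(\<lambda>y. summand h y (f y)) \<in> borel_measurable borel"
  unfolding summand_def kern_def by measurable

lemma slope_conv_eq:
  assumes "0 < b"
  shows "slope_conv b h y = (LINT w|lborel. K w * (slope h (y + b *\<^sub>R w) * f (y + b *\<^sub>R w)))"
proof -
  have "slope_conv b h y = (LINT x|lborel. f x * (slope h x * (K ((1 / b) *\<^sub>R (x - y)) / b ^ d)))"
    unfolding slope_conv_def by (rule Q_integral) measurable
  also have "\<dots> = \<bar>b\<bar> ^ CARD('n) * (LINT w|lborel. f (y + b *\<^sub>R w) * (slope h (y + b *\<^sub>R w) * (K ((1 / b) *\<^sub>R (y + b *\<^sub>R w - y)) / b ^ d)))"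
    by (rule lborel_integral_scale) (use assms in auto)
  also have "\<dots> = (LINT w|lborel. b ^ d * (f (y + b *\<^sub>R w) * (slope h (y + b *\<^sub>R w) * (K ((1 / b) *\<^sub>R (y + b *\<^sub>R w - y)) / b ^ d))))"
    using assms by (simp add: d_eq)
  also have "\<dots> = (LINT w|lborel. K w * (slope h (y + b *\<^sub>R w) * f (y + b *\<^sub>R w)))"
    using assms by (intro Bochner_Integration.integral_cong) (auto simp: mult_ac)
  finally show ?thesis .
qed

lemma slope_conv_measurable [measurable]: "slope_conv b h \<in> borel_measurable borel"
proof -
  have "slope_conv b h = (\<lambda>y. LINT x|lborel. f x * (slope h x * (K ((1 / b) *\<^sub>R (x - y)) / b ^ d)))"
    unfolding slope_conv_def[abs_def] by (intro ext Q_integral) measurable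
  then show ?thesis by simp
qed

lemma influence_measurable [measurable]: "influence n b h \<in> borel_measurable borel"
  unfolding influence_def[abs_def] by measurable

definition summand_bound where "summand_bound = \<kappa> * sqrt (s1 + C) ^ d"

lemma kern_f_le: "\<bar>kern u (f x)\<bar> \<le> summand_bound"
proof -
  have "\<bar>kern u (f x)\<bar> \<le> \<kappa> * sqrt (s1 + f x) ^ d" by (rule kern_abs_le[OF f_nonneg])
  also have "\<dots> \<le> summand_bound" unfolding summand_bound_def using \<kappa>_pos f_nonneg f_le s1_pos by (intro mult_left_mono power_mono) auto
  finally show ?thesis .
qed

lemma summand_bound_nonneg: "0 \<le> summand_bound" using kern_f_le[of 0 t] by linarith

lemma summand_le:
  assumes "0 < h"
  shows "\<bar>summand h x (f x)\<bar> \<le> (if norm (x - t) \<le> \<rho> * h then summand_bound / h ^ d else 0)"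
proof (cases "norm (x - t) \<le> \<rho> * h")
  case True
  then show ?thesis using kern_f_le assms by (simp add: summand_def divide_right_mono)
next
  case False
  then have "\<rho> < norm ((1 / h) *\<^sub>R (t - x))" using assms by (simp add: norm_minus_commute pos_less_divide_eq)
  then show ?thesis using False by (simp add: summand_def kern_outside)
qed

lemma slope_conv_le:
  assumes b: "0 < b" and h: "0 < h" "h \<le> \<epsilon>1"
  shows "\<bar>slope_conv b h y\<bar> \<le> slope_bound * C / h ^ d"
  unfolding slope_conv_eq[OF b]
proof (rule K_weighted_bound)
  have le: "\<bar>slope h x * f x\<bar> \<le> slope_bound * C / h ^ d" for x
  proof -
    have "\<bar>slope h x\<bar> * \<bar>f x\<bar> \<le> slope_bound / h ^ d * C"
      using slope_le'[OF h, of x] f_nonneg[of x] f_le[of x] slope_bound_nonneg h by (intro mult_mono) auto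
    then show ?thesis by (simp add: abs_mult)
  qed
  then show "\<bar>slope h (y + b *\<^sub>R w) * f (y + b *\<^sub>R w)\<bar> \<le> slope_bound * C / h ^ d" for w .
  show "0 \<le> slope_bound * C / h ^ d" using slope_bound_nonneg C_pos h by simp
  show "integrable lborel (\<lambda>w. K w * (slope h (y + b *\<^sub>R w) * f (y + b *\<^sub>R w)))"
  proof (rule Bochner_Integration.integrable_bound[OF integrable_mult_left[OF K_integrable, of "slope_bound * C / h ^ d"]])
    show "AE w in lborel. norm (K w * (slope h (y + b *\<^sub>R w) * f (y + b *\<^sub>R w))) \<le> norm (K w * (slope_bound * C / h ^ d))"
      using mult_left_mono[OF order_trans[OF le abs_ge_self] K_nonneg]
      by (intro AE_I2) (simp only: real_norm_def abs_mult[of "K _"] abs_of_nonneg[OF K_nonneg])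
  qed measurable
qed

lemma influence_le:
  assumes n: "0 < n" and b: "0 < b" and h: "0 < h" "h \<le> \<epsilon>1"
  shows "\<bar>influence n b h y\<bar> \<le> (summand_bound + slope_bound * C) / h ^ d"
proof -
  have "\<bar>summand h y (f y)\<bar> \<le> summand_bound / h ^ d" using summand_le[OF h(1), of y] summand_bound_nonneg h by (auto split: if_splits)
  moreover have "\<bar>(real n - 1) / real n * slope_conv b h y\<bar> \<le> 1 * (slope_bound * C / h ^ d)"
    unfolding abs_mult using n slope_conv_le[OF b h] by (intro mult_mono) (auto simp: field_simps)
  ultimately show ?thesis unfolding influence_def add_divide_distrib by linarith
qed

lemma f_line_tendsto: "(g \<longlongrightarrow> 0) F \<Longrightarrow> ((\<lambda>x. f (t + g x)) \<longlongrightarrow> f t) F"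
proof -
  assume g: "(g \<longlongrightarrow> 0) F"
  have "((\<lambda>x. t + g x) \<longlongrightarrow> t + 0) F" by (intro tendsto_intros g)
  moreover have "isCont f t" using f_cont by (simp add: continuous_on_eq_continuous_at)
  ultimately show ?thesis using isCont_tendsto_compose[of t f] by simp
qed

lemma ft_gt: "s1 < f t" "r \<le> f t" using near_t[of t] \<delta>0_pos s1_r by auto

lemma kern_tendsto:
  assumes g: "(g \<longlongrightarrow> 0) F"
  shows "((\<lambda>x. kern u (f (t + g x))) \<longlongrightarrow> kern u (f t)) F"
proof -
  note ft = f_line_tendsto[OF g]
  have "\<forall>\<^sub>F x in F. s1 < f (t + g x)" using ft ft_gt(1) by (rule order_tendstoD(1))
  then have ev: "\<forall>\<^sub>F x in F. K (sqrt (f (t + g x)) *\<^sub>R u) * sqrt (f (t + g x)) ^ d = kern u (f (t + g x))"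
    by eventually_elim (simp add: kern_def \<alpha>_sqrt)
  have "isCont K x" for x using K_cont by (simp add: continuous_on_eq_continuous_at)
  then have "((\<lambda>x. K (sqrt (f (t + g x)) *\<^sub>R u) * sqrt (f (t + g x)) ^ d) \<longlongrightarrow> K (sqrt (f t) *\<^sub>R u) * sqrt (f t) ^ d) F"
    by (intro tendsto_intros isCont_tendsto_compose[of _ K] ft)
  then have "((\<lambda>x. kern u (f (t + g x))) \<longlongrightarrow> K (sqrt (f t) *\<^sub>R u) * sqrt (f t) ^ d) F"
    using ev by (rule Lim_transform_eventually)
  then show ?thesis using ft_gt by (simp add: kern_def \<alpha>_sqrt)
qed

lemma Dkern_tendsto:
  assumes g: "(g \<longlongrightarrow> 0) F" and v: "(v \<longlongrightarrow> u) F"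
  shows "((\<lambda>x. Dkern (v x) (f (t + g x))) \<longlongrightarrow> Dkern u (f t)) F"
proof -
  have "isCont (kernel_L K) x" for x using kernel_L_cont by (simp add: continuous_on_eq_continuous_at)
  then show ?thesis unfolding Dkern_def
    using f_line_tendsto[OF g] ft_pos v by (intro tendsto_intros isCont_tendsto_compose[of _ "kernel_L K"]) auto
qed

text \<open>Dominated convergence is used twice, with \<open>y = t + h *\<^sub>R u\<close>: in the
  variable \<open>w\<close> inside \<open>slope_conv\<close>, for the pointwise limit of the
  influence, and then in \<open>u\<close> for the integral of its square.\<close>

lemma second_moment_limit:
  fixes b h :: "nat \<Rightarrow> real"
  assumes h: "\<forall>\<^sub>F n in sequentially. 0 < h n" "h \<longlonglongrightarrow> 0"
    and b: "\<forall>\<^sub>F n in sequentially. 0 < b n" "(\<lambda>n. b n / h n) \<longlonglongrightarrow> 0"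
  shows "(\<lambda>n. h n ^ d * (LINT y|Q. (influence n (b n) (h n) y)\<^sup>2)) \<longlonglongrightarrow> f t * (LINT u|lborel. (limit_influence u)\<^sup>2)"
proof -
  define \<zeta> where "\<zeta> n u = h n ^ d * influence n (b n) (h n) (t + h n *\<^sub>R u)" for n u
  have good: "\<forall>\<^sub>F n in sequentially. 0 < n \<and> 0 < h n \<and> h n \<le> \<epsilon>1 \<and> 0 < b n \<and> b n \<le> h n"
  proof -
    have "\<forall>\<^sub>F n in sequentially. h n < \<epsilon>1" using h(2) \<epsilon>1_pos by (rule order_tendstoD)
    moreover have "\<forall>\<^sub>F n in sequentially. b n / h n < 1" using b(2) by (rule order_tendstoD) simp
    ultimately show ?thesis using h(1) b(1) eventually_gt_at_top[of 0]
      by eventually_elim (auto simp: divide_less_eq)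
  qed
  define B where "B = summand_bound + slope_bound * C"
  \<comment> \<open>Smoothing with the pilot kernel widens the support by at most
    \<open>b * sqrt T\<close>, hence in units of \<open>h\<close> by at most \<open>sqrt T\<close>,
    as \<open>b n \<le> h n\<close> for good \<open>n\<close>.\<close>
  define R where "R = \<rho> + sqrt T"
  have lim: "(\<lambda>n. \<zeta> n u) \<longlonglongrightarrow> limit_influence u" for u
  proof -
    have hu: "(\<lambda>n. h n *\<^sub>R u) \<longlonglongrightarrow> 0" using tendsto_scaleR[OF h(2) tendsto_const[of u]] by simp
    have L1: "(\<lambda>n. kern u (f (t + h n *\<^sub>R u))) \<longlonglongrightarrow> kern u (f t)" by (rule kern_tendsto[OF hu])
    have L2: "(\<lambda>n. LINT w|lborel. K w * (h n ^ d * slope (h n) (t + h n *\<^sub>R u + b n *\<^sub>R w) * f (t + h n *\<^sub>R u + b n *\<^sub>R w)))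
      \<longlonglongrightarrow> (LINT w|lborel. K w * (Dkern u (f t) * f t))"
    proof (rule dominated_convergence_eventually[where w="\<lambda>w. K w * (slope_bound * C)"])
      show "integrable lborel (\<lambda>w. K w * (slope_bound * C))" using K_integrable by simp
      show "\<forall>\<^sub>F n in sequentially. \<forall>w. \<bar>K w * (h n ^ d * slope (h n) (t + h n *\<^sub>R u + b n *\<^sub>R w) * f (t + h n *\<^sub>R u + b n *\<^sub>R w))\<bar> \<le> K w * (slope_bound * C)"
        using good
      proof eventually_elim
        case (elim n)
        show ?case
        proof
          fix w
          have "\<bar>h n ^ d * slope (h n) x\<bar> * \<bar>f x\<bar> \<le> slope_bound * C" for x
            using slope_le'[of "h n" x] elim f_le[of x] f_nonneg[of x] slope_bound_nonneg
            by (intro mult_mono) (auto simp: abs_mult le_divide_eq mult.commute)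
          then show "\<bar>K w * (h n ^ d * slope (h n) (t + h n *\<^sub>R u + b n *\<^sub>R w) * f (t + h n *\<^sub>R u + b n *\<^sub>R w))\<bar> \<le> K w * (slope_bound * C)"
            unfolding abs_mult[of "K w"] abs_of_nonneg[OF K_nonneg] by (intro mult_left_mono K_nonneg) (simp only: abs_mult)
        qed
      qed
      fix w
      let ?v = "\<lambda>n. u + (b n / h n) *\<^sub>R w"
      have v: "?v \<longlonglongrightarrow> u" using tendsto_add[OF tendsto_const[of u] tendsto_scaleR[OF b(2) tendsto_const[of w]]] by simp
      have hv: "(\<lambda>n. h n *\<^sub>R ?v n) \<longlonglongrightarrow> 0" using tendsto_scaleR[OF h(2) v] by simp
      have "\<forall>\<^sub>F n in sequentially. norm (h n *\<^sub>R ?v n) < \<delta>0" using tendsto_norm_zero[OF hv] \<delta>0_pos by (rule order_tendstoD)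
      then have ev: "\<forall>\<^sub>F n in sequentially. Dkern (?v n) (f (t + h n *\<^sub>R ?v n)) * f (t + h n *\<^sub>R ?v n)
         = h n ^ d * slope (h n) (t + h n *\<^sub>R u + b n *\<^sub>R w) * f (t + h n *\<^sub>R u + b n *\<^sub>R w)"
        using good
      proof eventually_elim
        case (elim n)
        have x: "t + h n *\<^sub>R u + b n *\<^sub>R w = t + h n *\<^sub>R ?v n" using elim by (simp add: scaleR_add_right)
        have fr: "r \<le> f (t + h n *\<^sub>R ?v n)" using elim by (intro near_t) simp
        have "h n ^ d * slope (h n) (t + h n *\<^sub>R ?v n) = Dkern (?v n) (f (t + h n *\<^sub>R ?v n))"
          using elim Dkern_outside[OF _ fr, of "?v n"] by (auto simp: slope_def mult.commute[of \<rho>])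
        then show ?case unfolding x by simp
      qed
      have lv: "(\<lambda>n. Dkern (?v n) (f (t + h n *\<^sub>R ?v n)) * f (t + h n *\<^sub>R ?v n)) \<longlonglongrightarrow> Dkern u (f t) * f t"
        by (intro tendsto_mult Dkern_tendsto[OF hv v] f_line_tendsto[OF hv])
      show "(\<lambda>n. K w * (h n ^ d * slope (h n) (t + h n *\<^sub>R u + b n *\<^sub>R w) * f (t + h n *\<^sub>R u + b n *\<^sub>R w))) \<longlonglongrightarrow> K w * (Dkern u (f t) * f t)"
        by (rule tendsto_mult[OF tendsto_const Lim_transform_eventually[OF lv ev]])
    qed measurable
    have n1: "(\<lambda>n. (real n - 1) / real n) \<longlonglongrightarrow> 1" by real_asymp
    have l: "(\<lambda>n. kern u (f (t + h n *\<^sub>R u)) + (real n - 1) / real n * (LINT w|lborel. K w * (h n ^ d * slope (h n) (t + h n *\<^sub>R u + b n *\<^sub>R w) * f (t + h n *\<^sub>R u + b n *\<^sub>R w))))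
      \<longlonglongrightarrow> kern u (f t) + 1 * (LINT w|lborel. K w * (Dkern u (f t) * f t))"
      by (intro tendsto_add L1 tendsto_mult n1 L2)
    have e: "kern u (f t) + 1 * (LINT w|lborel. K w * (Dkern u (f t) * f t)) = limit_influence u"
      by (simp add: limit_influence_def K_integral)
    have ev: "\<forall>\<^sub>F n in sequentially. kern u (f (t + h n *\<^sub>R u)) + (real n - 1) / real n * (LINT w|lborel. K w * (h n ^ d * slope (h n) (t + h n *\<^sub>R u + b n *\<^sub>R w) * f (t + h n *\<^sub>R u + b n *\<^sub>R w))) = \<zeta> n u"
      using good
    proof eventually_elim
      case (elim n)
      have b0: "0 < b n" using elim by simp
      have "h n ^ d * slope_conv (b n) (h n) (t + h n *\<^sub>R u)
        = (LINT w|lborel. h n ^ d * (K w * (slope (h n) (t + h n *\<^sub>R u + b n *\<^sub>R w) * f (t + h n *\<^sub>R u + b n *\<^sub>R w))))"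
        unfolding slope_conv_eq[OF b0] by (rule integral_mult_right_zero[symmetric])
      also have "\<dots> = (LINT w|lborel. K w * (h n ^ d * slope (h n) (t + h n *\<^sub>R u + b n *\<^sub>R w) * f (t + h n *\<^sub>R u + b n *\<^sub>R w)))"
        by (rule Bochner_Integration.integral_cong[OF refl]) (simp only: mult.left_commute mult.assoc)
      finally have "(LINT w|lborel. K w * (h n ^ d * slope (h n) (t + h n *\<^sub>R u + b n *\<^sub>R w) * f (t + h n *\<^sub>R u + b n *\<^sub>R w))) = h n ^ d * slope_conv (b n) (h n) (t + h n *\<^sub>R u)" ..
      then show ?case using elim by (simp add: \<zeta>_def influence_def summand_def kern_minus distrib_left)
    qed
    show ?thesis using Lim_transform_eventually[OF l ev] unfolding e .
  qed
  have bd: "\<forall>\<^sub>F n in sequentially. \<forall>u. \<bar>(\<zeta> n u)\<^sup>2 * f (t + h n *\<^sub>R u)\<bar> \<le> B\<^sup>2 * C * indicator (cball 0 R) u"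
    using good
  proof eventually_elim
    case (elim n)
    show ?case
    proof
      fix u :: "real ^ 'n"
      show "\<bar>(\<zeta> n u)\<^sup>2 * f (t + h n *\<^sub>R u)\<bar> \<le> B\<^sup>2 * C * indicator (cball 0 R) u"
      proof (cases "norm u \<le> R")
        case True
        have "\<bar>\<zeta> n u\<bar> \<le> B"
          using influence_le[of n "b n" "h n" "t + h n *\<^sub>R u"] elim by (simp add: \<zeta>_def abs_mult B_def le_divide_eq mult.commute)
        from power_mono[OF this, of 2] have "(\<zeta> n u)\<^sup>2 \<le> B\<^sup>2" by simp
        then show ?thesis using True f_le f_nonneg by (auto simp: abs_mult intro!: mult_mono)
      next
        case False
        have "norm (- u) > \<rho>" using False T_pos by (simp add: R_def) (smt (verit) real_sqrt_ge_zero)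
        then have "kern (- u) s = 0" for s by (rule kern_outside)
        then have "summand (h n) (t + h n *\<^sub>R u) s = 0" for s using elim by (simp add: summand_def)
        moreover have "slope_conv (b n) (h n) (t + h n *\<^sub>R u) = 0"
        proof -
          have z: "K w * (slope (h n) (t + h n *\<^sub>R u + b n *\<^sub>R w) * f (t + h n *\<^sub>R u + b n *\<^sub>R w)) = 0" for w
          proof (cases "T < (norm w)\<^sup>2")
            case nT: False
            have "norm w \<le> sqrt T" using nT by (simp add: real_le_rsqrt)
            then have "norm (b n *\<^sub>R w) \<le> h n * sqrt T" using elim by (auto intro!: mult_mono)
            moreover have "h n * (\<rho> + sqrt T) < norm (h n *\<^sub>R u)" using False elim by (simp add: R_def)
            moreover have "norm (h n *\<^sub>R u) \<le> norm (h n *\<^sub>R u + b n *\<^sub>R w) + norm (b n *\<^sub>R w)"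
              using norm_triangle_ineq4[of "h n *\<^sub>R u + b n *\<^sub>R w" "b n *\<^sub>R w"] by simp
            ultimately have "\<rho> * h n < norm (h n *\<^sub>R u + b n *\<^sub>R w)" by (simp add: algebra_simps)
            then show ?thesis by (simp add: slope_def add.assoc)
          qed (simp add: K_zero)
          show ?thesis using elim by (subst slope_conv_eq) (simp_all only: z Bochner_Integration.integral_zero)
        qed
        ultimately show ?thesis using False by (simp add: \<zeta>_def influence_def)
      qed
    qed
  qed
  have "(\<lambda>n. LINT u|lborel. (\<zeta> n u)\<^sup>2 * f (t + h n *\<^sub>R u)) \<longlonglongrightarrow> (LINT u|lborel. (limit_influence u)\<^sup>2 * f t)"
  proof (rule dominated_convergence_eventually[OF _ _ _ _ bd])
    show "(\<lambda>u. (\<zeta> n u)\<^sup>2 * f (t + h n *\<^sub>R u)) \<in> borel_measurable lborel" for n unfolding \<zeta>_def by measurable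
    show "(\<lambda>u. (limit_influence u)\<^sup>2 * f t) \<in> borel_measurable lborel" unfolding limit_influence_def kern_def Dkern_def by measurable
    have "emeasure lborel (cball (0::real ^ 'n) R) < \<infinity>" by (rule emeasure_bounded_finite) simp
    then show "integrable lborel (\<lambda>u. B\<^sup>2 * C * indicator (cball (0::real ^ 'n) R) u)"
      by (intro integrable_mult_right) simp
    show "(\<lambda>n. (\<zeta> n u)\<^sup>2 * f (t + h n *\<^sub>R u)) \<longlonglongrightarrow> (limit_influence u)\<^sup>2 * f t" for u
      using tendsto_scaleR[OF h(2) tendsto_const[of u]] by (intro tendsto_mult tendsto_power lim f_line_tendsto) simp
  qed
  moreover have "\<forall>\<^sub>F n in sequentially. (LINT u|lborel. (\<zeta> n u)\<^sup>2 * f (t + h n *\<^sub>R u)) = h n ^ d * (LINT y|Q. (influence n (b n) (h n) y)\<^sup>2)"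
    using good
  proof eventually_elim
    case (elim n)
    have "(LINT y|Q. (influence n (b n) (h n) y)\<^sup>2) = (LINT y|lborel. f y * (influence n (b n) (h n) y)\<^sup>2)"
      by (rule Q_integral) measurable
    also have "\<dots> = \<bar>h n\<bar> ^ CARD('n) * (LINT u|lborel. f (t + h n *\<^sub>R u) * (influence n (b n) (h n) (t + h n *\<^sub>R u))\<^sup>2)"
      by (rule lborel_integral_scale) (use elim in auto)
    finally have "h n ^ d * (LINT y|Q. (influence n (b n) (h n) y)\<^sup>2) = (h n ^ d)\<^sup>2 * (LINT u|lborel. f (t + h n *\<^sub>R u) * (influence n (b n) (h n) (t + h n *\<^sub>R u))\<^sup>2)"
      using elim by (simp add: d_eq power2_eq_square)
    also have "\<dots> = (LINT u|lborel. (h n ^ d)\<^sup>2 * (f (t + h n *\<^sub>R u) * (influence n (b n) (h n) (t + h n *\<^sub>R u))\<^sup>2))" by simp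
    also have "\<dots> = (LINT u|lborel. (\<zeta> n u)\<^sup>2 * f (t + h n *\<^sub>R u))"
      by (intro Bochner_Integration.integral_cong) (auto simp: \<zeta>_def power_mult_distrib mult_ac)
    finally show ?case by simp
  qed
  ultimately have "(\<lambda>n. h n ^ d * (LINT y|Q. (influence n (b n) (h n) y)\<^sup>2)) \<longlonglongrightarrow> (LINT u|lborel. (limit_influence u)\<^sup>2 * f t)"
    by (rule Lim_transform_eventually)
  then show ?thesis by (simp add: mult.commute)
qed

text \<open>At \<open>f t\<close> the scale is the square root \<open>q\<close>, so the derivative
  of \<open>\<alpha> ^ d\<close> is \<open>d / (2 y) * q ^ d\<close> and the limit influence is
  \<open>q ^ d\<close> times \<open>K + L / 2\<close> at \<open>q *\<^sub>R u\<close>. Squaring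
  gives the three terms of the variance; the cross term is evaluated by
  \<open>K_kernel_L_integral\<close>.\<close>

lemma asymptotic_variance_eq:
  "asymptotic_variance K \<alpha> f t = f t * (LINT u|lborel. (limit_influence u)\<^sup>2)" "0 < asymptotic_variance K \<alpha> f t"
proof -
  define y where "y = f t"
  define q where "q = sqrt y"
  have y: "0 < y" "s1 < y" using ft_pos ft_gt by (auto simp: y_def)
  have q: "0 < q" "q * q = y" using y by (auto simp: q_def)
  define l2 where "l2 = (LINT z|lborel. (kernel_L K z)\<^sup>2)"
  have \<alpha>y: "\<alpha> y = q" using y by (simp add: \<alpha>_sqrt q_def)
  have dv: "deriv (\<lambda>s. \<alpha> s ^ d) y = real d / (2 * y) * q ^ d"
  proof (rule DERIV_imp_deriv)
    have "\<forall>\<^sub>F s in nhds y. s \<in> {s1<..}" using y by (intro eventually_nhds_in_open) auto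
    then have "\<forall>\<^sub>F s in nhds y. \<alpha> s ^ d = sqrt s ^ d" by eventually_elim (simp add: \<alpha>_sqrt)
    then show "((\<lambda>s. \<alpha> s ^ d) has_real_derivative real d / (2 * y) * q ^ d) (at y)"
      using sqrt_power_deriv[OF y(1), of d] DERIV_cong_ev[of y y "\<lambda>s. \<alpha> s ^ d" "\<lambda>s. sqrt s ^ d"] by (simp add: q_def)
  qed
  have z: "limit_influence u = q ^ d * (K (q *\<^sub>R u) + kernel_L K (q *\<^sub>R u) / 2)" for u
    using y unfolding limit_influence_def y_def[symmetric] kern_def \<alpha>y Dkern_def q_def[symmetric] by (simp add: algebra_simps)
  have iKK: "integrable lborel (\<lambda>w. (K w)\<^sup>2)" "integrable lborel (\<lambda>w. K w * kernel_L K w)" "integrable lborel (\<lambda>w. (kernel_L K w)\<^sup>2)"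
    using K_times_integrable[OF K_cont] K_times_integrable[OF kernel_L_cont] L_times_integrable[OF kernel_L_cont]
    by (simp_all add: power2_eq_square)
  have m: "(\<lambda>w. (K w + kernel_L K w / 2)\<^sup>2) \<in> borel_measurable borel" by measurable
  have "(LINT w|lborel. (K w + kernel_L K w / 2)\<^sup>2) = (LINT w|lborel. (K w)\<^sup>2 + K w * kernel_L K w + (kernel_L K w)\<^sup>2 / 4)"
    by (intro Bochner_Integration.integral_cong) (auto simp: power2_eq_square algebra_simps)
  also have "\<dots> = kernel_mu0 K + real d / 2 * kernel_mu0 K + l2 / 4"
    using iKK K_kernel_L_integral by (simp add: kernel_mu0_def l2_def)
  finally have S: "(LINT w|lborel. (K w + kernel_L K w / 2)\<^sup>2) = kernel_mu0 K + real d / 2 * kernel_mu0 K + l2 / 4" .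
  have sc: "q ^ d * (LINT u|lborel. (K (q *\<^sub>R u) + kernel_L K (q *\<^sub>R u) / 2)\<^sup>2) = kernel_mu0 K + real d / 2 * kernel_mu0 K + l2 / 4"
    using lborel_integral_scale[OF m, of q 0] q(1) unfolding S by (simp add: d_eq)
  have "(LINT u|lborel. (limit_influence u)\<^sup>2) = q ^ d * (q ^ d * (LINT u|lborel. (K (q *\<^sub>R u) + kernel_L K (q *\<^sub>R u) / 2)\<^sup>2))"
    unfolding z power_mult_distrib by (simp add: power2_eq_square)
  then have I: "(LINT u|lborel. (limit_influence u)\<^sup>2) = q ^ d * (kernel_mu0 K + real d / 2 * kernel_mu0 K + l2 / 4)"
    unfolding sc .
  have d0: "real d \<noteq> 0" using d_pos by simp
  have av: "asymptotic_variance K \<alpha> f t = q ^ d * y * kernel_mu0 K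
        + y ^ 3 * (real d / (2 * y) * q ^ d)\<^sup>2 / ((real d)\<^sup>2 * q ^ d) * l2
        + y\<^sup>2 * (real d / (2 * y) * q ^ d) * kernel_mu0 K"
    unfolding asymptotic_variance_def Let_def y_def[symmetric] d_eq[symmetric] dv \<alpha>y l2_def ..
  have e1: "y ^ 3 * (real d / (2 * y) * q ^ d)\<^sup>2 / ((real d)\<^sup>2 * q ^ d) = y * q ^ d / 4"
    using y q d0 by (simp add: power2_eq_square power3_eq_cube)
  have e2: "y\<^sup>2 * (real d / (2 * y) * q ^ d) = y * q ^ d * (real d / 2)"
    using y by (simp add: power2_eq_square)
  have av2: "asymptotic_variance K \<alpha> f t = y * (q ^ d * (kernel_mu0 K + real d / 2 * kernel_mu0 K + l2 / 4))"
    unfolding av e1 e2 by (simp add: algebra_simps)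
  then show "asymptotic_variance K \<alpha> f t = f t * (LINT u|lborel. (limit_influence u)\<^sup>2)" unfolding I y_def by simp
  have "0 \<le> l2" unfolding l2_def by (intro Bochner_Integration.integral_nonneg) auto
  then show "0 < asymptotic_variance K \<alpha> f t"
    unfolding av2 using y q kernel_mu0_pos by (intro mult_pos_pos add_pos_nonneg) auto
qed

subsection \<open>The decomposition at a fixed sample size\<close>

lemma component_measurable: "i < n \<Longrightarrow> (\<lambda>x. x i) \<in> borel_measurable (PiM {..<n} (\<lambda>_. Q))"
  using measurable_component_singleton[of i "{..<n}" "\<lambda>_. Q"] by simp

text \<open>The share of the point \<open>y\<close> in the linear term at the point
  \<open>x\<close>: the kernel of the U-statistic, in general neither symmetric nor centred.\<close>

definition interaction where "interaction b h x y = slope h x * (K ((1 / b) *\<^sub>R (x - y)) / b ^ d - f x)"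

definition slope_mean where "slope_mean h = (LINT x|Q. slope h x * f x)"

lemma interaction_measurable [measurable]: "case_prod (interaction b h) \<in> borel_measurable (Q \<Otimes>\<^sub>M Q)"
  unfolding interaction_def by measurable

lemma K_shift_bounded: "0 < b \<Longrightarrow> \<bar>K ((1 / b) *\<^sub>R z) / b ^ d\<bar> \<le> \<kappa> / b ^ d"
  using K_nonneg K_le by (simp add: divide_right_mono)

lemma interaction_le:
  assumes b: "0 < b" and h: "0 < h" "h \<le> \<epsilon>1"
  shows "\<bar>interaction b h x y\<bar> \<le> slope_bound / h ^ d * (\<kappa> / b ^ d + C)"
proof -
  have "\<bar>K ((1 / b) *\<^sub>R (x - y)) / b ^ d - f x\<bar> \<le> \<kappa> / b ^ d + C"
    using K_shift_bounded[OF b, of "x - y"] f_nonneg[of x] f_le[of x] by linarith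
  then show ?thesis unfolding interaction_def abs_mult using slope_le'[OF h] slope_bound_nonneg h by (intro mult_mono) auto
qed

lemma K_Q_integrable:
  assumes b: "0 < b"
  shows "integrable Q (\<lambda>y. K ((1 / b) *\<^sub>R (x - y)) / b ^ d)" "integrable Q (\<lambda>x. K ((1 / b) *\<^sub>R (x - y)) / b ^ d)"
  using K_shift_bounded[OF b] by (intro integrable_bounded[OF prob_space_Q, of _ "\<kappa> / b ^ d"]; simp)+

lemma interaction_integral_right:
  assumes b: "0 < b"
  shows "(LINT y|Q. interaction b h x y) = slope h x * (conv b x - f x)"
proof -
  interpret Q: prob_space Q by (rule prob_space_Q)
  have "(LINT y|Q. interaction b h x y) = slope h x * ((LINT y|Q. K ((1 / b) *\<^sub>R (x - y)) / b ^ d) - f x)"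
    unfolding interaction_def using K_Q_integrable(1)[OF b] by (simp add: Q.prob_space[simplified])
  then show ?thesis using kernel_expectation[OF b] b by simp
qed

lemma interaction_integral_left:
  assumes b: "0 < b" and h: "0 < h" "h \<le> \<epsilon>1"
  shows "(LINT x|Q. interaction b h x y) = slope_conv b h y - slope_mean h"
proof -
  have "\<bar>slope h x * (K ((1 / b) *\<^sub>R (x - y)) / b ^ d)\<bar> \<le> slope_bound / h ^ d * (\<kappa> / b ^ d)" for x
    unfolding abs_mult using slope_le'[OF h] K_shift_bounded[OF b, of "x - y"] slope_bound_nonneg h
    by (intro mult_mono) auto
  then have i1: "integrable Q (\<lambda>x. slope h x * (K ((1 / b) *\<^sub>R (x - y)) / b ^ d))"
    by (intro integrable_bounded[OF prob_space_Q]) auto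
  have "\<bar>slope h x * f x\<bar> \<le> slope_bound / h ^ d * C" for x
    unfolding abs_mult using slope_le'[OF h] f_nonneg f_le slope_bound_nonneg h by (intro mult_mono) auto
  then have i2: "integrable Q (\<lambda>x. slope h x * f x)"
    by (intro integrable_bounded[OF prob_space_Q]) auto
  show ?thesis unfolding interaction_def right_diff_distrib slope_conv_def slope_mean_def by (rule Bochner_Integration.integral_diff[OF i1 i2])
qed

lemma interaction_integral:
  assumes b: "0 < b"
  shows "(LINT x|Q. LINT y|Q. interaction b h x y) = theta b h"
  unfolding interaction_integral_right[OF b] theta_def ..

lemma slope_conv_integral:
  assumes b: "0 < b" and h: "0 < h" "h \<le> \<epsilon>1"
  shows "(LINT y|Q. slope_conv b h y) = theta b h + slope_mean h"
proof -
  interpret Q: prob_space Q by (rule prob_space_Q)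
  interpret QQ: pair_prob_space Q Q ..
  have "integrable (Q \<Otimes>\<^sub>M Q) (case_prod (interaction b h))"
    using interaction_le[OF b h] by (intro integrable_bounded[OF QQ.prob_space_axioms interaction_measurable]) auto
  then have "(LINT y|Q. LINT x|Q. interaction b h x y) = theta b h"
    unfolding interaction_integral[OF b, symmetric] by (rule QQ.Fubini_integral)
  moreover have "(LINT y|Q. LINT x|Q. interaction b h x y) = (LINT y|Q. slope_conv b h y) - slope_mean h"
  proof -
    have "integrable Q (slope_conv b h)" using slope_conv_le[OF b h] by (intro integrable_bounded[OF prob_space_Q]) auto
    then show ?thesis unfolding interaction_integral_left[OF b h] by (simp add: Q.prob_space[simplified])
  qed
  ultimately show ?thesis by simp
qed

lemma summand_integral:
  assumes h: "0 < h"
  shows "(LINT x|Q. summand h x (f x)) = ideal_mean h"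
proof -
  have "(LINT x|Q. summand h x (f x)) = (LINT x|lborel. f x * summand h x (f x))"
    by (rule Q_integral) measurable
  also have "\<dots> = \<bar>h\<bar> ^ CARD('n) * (LINT u|lborel. f (t + h *\<^sub>R u) * summand h (t + h *\<^sub>R u) (f (t + h *\<^sub>R u)))"
    by (rule lborel_integral_scale) (use h in auto)
  also have "\<dots> = (LINT u|lborel. h ^ d * (f (t + h *\<^sub>R u) * summand h (t + h *\<^sub>R u) (f (t + h *\<^sub>R u))))"
    using h by (simp add: d_eq)
  also have "\<dots> = ideal_mean h"
    unfolding ideal_mean_def using h
    by (intro Bochner_Integration.integral_cong refl) (simp add: summand_def kern_minus, simp add: kern_def mult_ac)
  finally show ?thesis .
qed

lemma influence_integral:
  assumes n: "0 < n" and b: "0 < b" and h: "0 < h" "h \<le> \<epsilon>1"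
  shows "(LINT y|Q. influence n b h y) = ideal_mean h + (real n - 1) / real n * (theta b h + slope_mean h)"
proof -
  have "integrable Q (slope_conv b h)" using slope_conv_le[OF b h] by (intro integrable_bounded[OF prob_space_Q]) auto
  moreover have "integrable Q (\<lambda>y. summand h y (f y))"
  proof (rule integrable_bounded[OF prob_space_Q])
    show "\<bar>summand h y (f y)\<bar> \<le> summand_bound / h ^ d" for y
      using summand_le[OF h(1), of y] summand_bound_nonneg h by (auto split: if_splits)
  qed simp
  ultimately show ?thesis
    unfolding influence_def using summand_integral[OF h(1)] slope_conv_integral[OF b h] by simp
qed

lemma slope_mean_le:
  assumes h: "0 < h" "h \<le> \<epsilon>1"
  shows "\<bar>slope_mean h\<bar> \<le> slope_bound * C\<^sup>2 * ball_volume"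
proof -
  have i: "integrable Q (\<lambda>x. C * \<bar>slope h x\<bar>)"
    using slope_le'[OF h] by (intro integrable_mult_right integrable_bounded[OF prob_space_Q, of _ "slope_bound / h ^ d"]) auto
  have le: "\<bar>slope h x * f x\<bar> \<le> C * \<bar>slope h x\<bar>" for x
    using mult_right_mono[OF f_le[of x] abs_ge_zero[of "slope h x"]] f_nonneg[of x] by (simp add: abs_mult mult.commute)
  have i2: "integrable Q (\<lambda>x. \<bar>slope h x * f x\<bar>)"
    by (rule Bochner_Integration.integrable_bound[OF i]) (use le in \<open>auto intro!: AE_I2 order_trans[OF le] simp: C_pos[THEN less_imp_le]\<close>)
  have "\<bar>slope_mean h\<bar> \<le> (LINT x|Q. \<bar>slope h x * f x\<bar>)" unfolding slope_mean_def by (rule integral_abs_bound)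
  also have "\<dots> \<le> (LINT x|Q. C * \<bar>slope h x\<bar>)" by (intro integral_mono i i2 le)
  also have "\<dots> \<le> C * (slope_bound * C * ball_volume)" using slope_integral(1)[OF h] C_pos by (simp add: mult_left_mono)
  finally show ?thesis by (simp add: power2_eq_square mult_ac)
qed

text \<open>The mean of the estimator up to the mean of \<open>rest\<close>; see
  \<open>kde_mean\<close>.\<close>

definition centre where "centre n b h = ideal_mean h + (real n - 1) / real n * theta b h"

definition rest where
  "rest n b h x = adaptive_kde K \<alpha> n b h x t - (\<Sum>i<n. influence n b h (x i) - (LINT y|Q. influence n b h y)) / real n - centre n b h"

definition pilot_at where "pilot_at n b i x = pilot_est n b ({..<n} - {i}) (x i) x"

definition taylor_rem where
  "taylor_rem n b h i x = summand h (x i) (pilot_at n b i x) - summand h (x i) (f (x i)) - slope h (x i) * (pilot_at n b i x - f (x i))"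

lemma kde_eq_pe:
  assumes "i < n"
  shows "kde K n b x (x i) = pilot_at n b i x"
proof -
  have "(\<Sum>j<n. K ((1 / b) *\<^sub>R (x i - x j))) = K 0 + (\<Sum>j\<in>{..<n} - {i}. K ((1 / b) *\<^sub>R (x i - x j)))"
    using assms by (subst sum.remove[of "{..<n}" i]) auto
  then show ?thesis unfolding kde_def d_eq[symmetric] pilot_at_def pilot_est_def by simp
qed

lemma adaptive_kde_eq:
  assumes h: "0 < h"
  shows "adaptive_kde K \<alpha> n b h x t = (\<Sum>i<n. summand h (x i) (pilot_at n b i x)) / real n"
proof -
  have "adaptive_kde K \<alpha> n b h x t = 1 / (real n * h ^ d) * (\<Sum>i<n. h ^ d * summand h (x i) (pilot_at n b i x))"
    unfolding adaptive_kde_def d_eq[symmetric] using h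
    by (intro arg_cong[of _ _ "times _"] sum.cong refl) (simp add: kde_eq_pe summand_def kern_def)
  then show ?thesis using h by (simp flip: sum_distrib_left)
qed

text \<open>The four lines are the diagonal of the double sum, its degenerate part, the projection on
  the first variable (small since \<open>conv b - f\<close> is), and the Taylor remainder; the projection on the
  second variable is part of \<open>influence\<close>.\<close>

lemma rest_eq:
  assumes n: "0 < n" and b: "0 < b" and h: "0 < h" "h \<le> \<epsilon>1"
  shows "rest n b h x =
      (\<Sum>i<n. slope h (x i) * (K 0 / (real n * b ^ d) - f (x i) / real n)) / real n
    + (\<Sum>i<n. \<Sum>j\<in>{..<n} - {i}. interaction b h (x i) (x j) - slope h (x i) * (conv b (x i) - f (x i)) - (slope_conv b h (x j) - slope_mean h) + theta b h) / (real n)\<^sup>2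
    + (real n - 1) / real n * ((\<Sum>i<n. slope h (x i) * (conv b (x i) - f (x i)) - theta b h) / real n)
    + (\<Sum>i<n. taylor_rem n b h i x) / real n"
proof -
  let ?\<theta> = "theta b h" and ?n = "real n" and ?\<kappa> = "(real n - 1) / real n"
  let ?H1 = "\<lambda>x. slope h x * (conv b x - f x)" and ?H2 = "\<lambda>y. slope_conv b h y - slope_mean h"
  let ?T1 = "\<lambda>i. slope h (x i) * (K 0 / (real n * b ^ d) - f (x i) / real n)"
  define SH where "SH = (\<Sum>i<n. \<Sum>j\<in>{..<n} - {i}. interaction b h (x i) (x j))"
  define S1 where "S1 = (\<Sum>i<n. ?H1 (x i))"
  define Sm where "Sm = (\<Sum>i<n. slope_conv b h (x i))"
  define SG where "SG = (\<Sum>i<n. summand h (x i) (f (x i)))"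
  define ST where "ST = (\<Sum>i<n. ?T1 i)"
  define SR where "SR = (\<Sum>i<n. taylor_rem n b h i x)"
  have n0: "?n \<noteq> 0" using n by simp
  \<comment> \<open>The pilot at the \<open>i\<close>-th point divides by \<open>n\<close> while
    only \<open>n - 1\<close> other points occur; the self-contribution \<open>K 0\<close> and one
    missing copy of \<open>f\<close> make up \<open>?T1\<close>.\<close>
  have tm: "summand h (x i) (pilot_at n b i x) = summand h (x i) (f (x i)) + ?T1 i + (\<Sum>j\<in>{..<n} - {i}. interaction b h (x i) (x j)) / ?n + taylor_rem n b h i x"
    if i: "i < n" for i
  proof -
    have c: "real (card ({..<n} - {i})) = ?n - 1" using i n by (simp add: of_nat_diff)
    have "(\<Sum>j\<in>{..<n} - {i}. interaction b h (x i) (x j)) = slope h (x i) * ((\<Sum>j\<in>{..<n} - {i}. K ((1 / b) *\<^sub>R (x i - x j))) / b ^ d - (?n - 1) * f (x i))"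
      unfolding interaction_def by (simp only: sum_distrib_left[symmetric] sum_subtractf sum_constant c sum_divide_distrib[symmetric])
    moreover have "pilot_at n b i x - f (x i) = (K 0 / (?n * b ^ d) - f (x i) / ?n) + ((\<Sum>j\<in>{..<n} - {i}. K ((1 / b) *\<^sub>R (x i - x j))) / b ^ d - (?n - 1) * f (x i)) / ?n"
      unfolding pilot_at_def pilot_est_def using n0 b by (simp add: field_simps)
    ultimately have "slope h (x i) * (pilot_at n b i x - f (x i)) = ?T1 i + (\<Sum>j\<in>{..<n} - {i}. interaction b h (x i) (x j)) / ?n"
      by (simp add: distrib_left)
    then show ?thesis unfolding taylor_rem_def by linarith
  qed
  have "(\<Sum>i<n. summand h (x i) (pilot_at n b i x)) = SG + ST + SH / ?n + SR"
    unfolding SG_def ST_def SH_def SR_def using tm by (simp add: sum.distrib sum_divide_distrib)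
  then have A: "adaptive_kde K \<alpha> n b h x t = (SG + ST + SH / ?n + SR) / ?n" unfolding adaptive_kde_eq[OF h(1)] by simp
  have Z: "(\<Sum>i<n. influence n b h (x i) - (LINT y|Q. influence n b h y)) = SG + ?\<kappa> * Sm - ?n * (ideal_mean h + ?\<kappa> * (?\<theta> + slope_mean h))"
    unfolding influence_integral[OF n b h] unfolding influence_def SG_def Sm_def
    by (simp add: sum.distrib sum_subtractf sum_distrib_left)
  have U: "(\<Sum>i<n. \<Sum>j\<in>{..<n} - {i}. interaction b h (x i) (x j) - ?H1 (x i) - ?H2 (x j) + ?\<theta>)
     = SH - (?n - 1) * S1 - (?n - 1) * (Sm - ?n * slope_mean h) + (?n - 1) * (?n * ?\<theta>)"
  proof -
    have "(\<Sum>i<n. \<Sum>j\<in>{..<n} - {i}. interaction b h (x i) (x j) - ?H1 (x i) - ?H2 (x j) + ?\<theta>)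
      = SH - (\<Sum>i<n. \<Sum>j\<in>{..<n} - {i}. ?H1 (x i)) - (\<Sum>i<n. \<Sum>j\<in>{..<n} - {i}. ?H2 (x j)) + (\<Sum>i<n. \<Sum>j\<in>{..<n} - {i}. ?\<theta>)"
      unfolding SH_def by (simp only: sum.distrib sum_subtractf)
    also have "\<dots> = SH - (?n - 1) * S1 - (?n - 1) * (\<Sum>j<n. ?H2 (x j)) + (?n - 1) * (\<Sum>j<n. ?\<theta>)"
      unfolding S1_def sum_off_diagonal(2)[of "\<lambda>i. ?H1 (x i)"] sum_off_diagonal(1)[of "\<lambda>j. ?H2 (x j)"] sum_off_diagonal(1)[of "\<lambda>j. ?\<theta>"] ..
    finally show ?thesis by (simp add: Sm_def sum_subtractf)
  qed
  have V: "(\<Sum>i<n. ?H1 (x i) - ?\<theta>) = S1 - ?n * ?\<theta>" by (simp add: S1_def sum_subtractf)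
  show ?thesis
    unfolding rest_def centre_def A Z U V ST_def[symmetric] SR_def[symmetric]
    using n0 by (simp add: field_simps power2_eq_square)
qed

text \<open>Squaring the two localised factors costs one volume factor each, which leaves the
  product \<open>h ^ d * b ^ d\<close> in the denominator.\<close>

lemma interaction_second_moment:
  assumes b: "0 < b" "b \<le> 1" and h: "0 < h" "h \<le> \<epsilon>1"
  shows "(LINT x|Q. LINT y|Q. (interaction b h x y)\<^sup>2) \<le> (2 * \<kappa> * C + 2 * C\<^sup>2) * (slope_bound\<^sup>2 * C * ball_volume) / (h ^ d * b ^ d)"
proof -
  interpret Q: prob_space Q by (rule prob_space_Q)
  let ?A = "(2 * \<kappa> * C + 2 * C\<^sup>2) / b ^ d"
  have bd: "0 < b ^ d" "b ^ d \<le> 1" using b by (auto intro: power_le_one)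
  have A0: "0 \<le> ?A" using \<kappa>_pos C_pos bd by simp
  have inner: "(LINT y|Q. (interaction b h x y)\<^sup>2) \<le> (slope h x)\<^sup>2 * ?A" for x
  proof -
    let ?k = "\<lambda>y. K ((1 / b) *\<^sub>R (x - y)) / b ^ d"
    have k: "0 \<le> ?k y" "?k y \<le> \<kappa> / b ^ d" for y using K_shift_bounded[OF b(1), of "x - y"] K_nonneg b by auto
    have le: "(?k y - f x)\<^sup>2 \<le> 2 * (\<kappa> / b ^ d) * ?k y + 2 * C\<^sup>2" for y
    proof -
      have "(?k y)\<^sup>2 \<le> \<kappa> / b ^ d * ?k y" unfolding power2_eq_square using k by (intro mult_right_mono)
      moreover have "(f x)\<^sup>2 \<le> C\<^sup>2" using f_nonneg f_le by (intro power_mono)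
      moreover have "(?k y - f x)\<^sup>2 \<le> 2 * (?k y)\<^sup>2 + 2 * (f x)\<^sup>2"
        using zero_le_power2[of "?k y + f x"] by (simp add: power2_eq_square algebra_simps)
      ultimately show ?thesis by linarith
    qed
    have "\<bar>(?k y - f x)\<^sup>2\<bar> \<le> 2 * (\<kappa> / b ^ d) * (\<kappa> / b ^ d) + 2 * C\<^sup>2" for y
      using le[of y] mult_left_mono[OF k(2)[of y], of "2 * (\<kappa> / b ^ d)"] \<kappa>_pos b by (simp add: order_trans)
    then have i1: "integrable Q (\<lambda>y. (?k y - f x)\<^sup>2)"
      by (intro integrable_bounded[OF prob_space_Q]) auto
    have i2: "integrable Q (\<lambda>y. 2 * (\<kappa> / b ^ d) * ?k y)" by (intro integrable_mult_right K_Q_integrable b)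
    have "(LINT y|Q. (interaction b h x y)\<^sup>2) = (slope h x)\<^sup>2 * (LINT y|Q. (?k y - f x)\<^sup>2)"
      unfolding interaction_def power_mult_distrib by simp
    also have "(LINT y|Q. (?k y - f x)\<^sup>2) \<le> (LINT y|Q. 2 * (\<kappa> / b ^ d) * ?k y + 2 * C\<^sup>2)"
      using le by (intro integral_mono i1 Bochner_Integration.integrable_add i2) auto
    also have "\<dots> = 2 * (\<kappa> / b ^ d) * (LINT y|Q. ?k y) + 2 * C\<^sup>2"
      using i2 by (simp add: Q.prob_space[simplified])
    also have "(LINT y|Q. ?k y) = conv b x" using kernel_expectation[OF b(1)] b by simp
    also have "2 * (\<kappa> / b ^ d) * conv b x + 2 * C\<^sup>2 \<le> 2 * (\<kappa> / b ^ d) * C + 2 * C\<^sup>2 / b ^ d"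
      using \<kappa>_pos bd conv_le by (intro add_mono mult_left_mono) (auto simp: le_divide_eq mult_left_le)
    also have "\<dots> = ?A" by (simp add: add_divide_distrib)
    finally show ?thesis by (simp add: mult_left_mono)
  qed
  have g2: "(slope h x)\<^sup>2 \<le> (slope_bound / h ^ d)\<^sup>2" for x using power_mono[OF slope_le'[OF h, of x], of 2] by simp
  have "(LINT x|Q. LINT y|Q. (interaction b h x y)\<^sup>2) \<le> (LINT x|Q. (slope h x)\<^sup>2 * ?A)"
  proof (intro integral_mono inner)
    show i: "integrable Q (\<lambda>x. (slope h x)\<^sup>2 * ?A)"
      using g2 by (intro integrable_mult_left integrable_bounded[OF prob_space_Q, of _ "(slope_bound / h ^ d)\<^sup>2"]) auto
    have nn: "0 \<le> (LINT y|Q. (interaction b h x y)\<^sup>2)" for x by (intro Bochner_Integration.integral_nonneg) simp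
    have "(\<lambda>(x, y). (interaction b h x y)\<^sup>2) \<in> borel_measurable (Q \<Otimes>\<^sub>M Q)" by measurable
    then have "(\<lambda>x. LINT y|Q. (interaction b h x y)\<^sup>2) \<in> borel_measurable Q"
      by (rule Q.borel_measurable_lebesgue_integral)
    then show "integrable Q (\<lambda>x. LINT y|Q. (interaction b h x y)\<^sup>2)"
      by (rule Bochner_Integration.integrable_bound[OF i])
        (intro AE_I2, simp only: real_norm_def abs_of_nonneg[OF nn], rule order_trans[OF inner abs_ge_self])
  qed
  also have "\<dots> = (LINT x|Q. (slope h x)\<^sup>2) * ?A" by simp
  also have "\<dots> \<le> slope_bound\<^sup>2 * C * ball_volume / h ^ d * ?A" by (intro mult_right_mono slope_integral h A0)
  finally show ?thesis by (simp add: mult_ac)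
qed

text \<open>Outside the ball the summand vanishes for every pilot value, so the pilot has to be
  controlled only at sample points near \<open>t\<close>.\<close>

lemma taylor_rem_le:
  obtains C1 where "0 \<le> C1" "\<And>n b h i x. i < n \<Longrightarrow> 0 < b \<Longrightarrow> 0 < h \<Longrightarrow> h \<le> \<epsilon>1 \<Longrightarrow>
    \<bar>taylor_rem n b h i x\<bar> \<le> C1 / h ^ d * (if norm (x i - t) \<le> \<rho> * h then pilot_err n b ({..<n} - {i}) (x i) x else 0)"
proof -
  obtain C1 where C1: "0 \<le> C1" "\<And>u s \<phi>. r \<le> \<phi> \<Longrightarrow> \<phi> \<le> C \<Longrightarrow> 0 \<le> s \<Longrightarrow>
    \<bar>kern u s - kern u \<phi> - Dkern u \<phi> * (s - \<phi>)\<bar> \<le> C1 * (if norm u \<le> \<rho> then (s - \<phi>)\<^sup>2 + (if S0 \<le> s then exp s else 0) else 0)"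
    by (rule kern_taylor) blast
  have "\<bar>taylor_rem n b h i x\<bar> \<le> C1 / h ^ d * (if norm (x i - t) \<le> \<rho> * h then pilot_err n b ({..<n} - {i}) (x i) x else 0)"
    if i: "i < n" and b: "0 < b" and h: "0 < h" "h \<le> \<epsilon>1" for n b h i x
  proof (cases "norm (x i - t) \<le> \<rho> * h")
    case True
    define u where "u = (1 / h) *\<^sub>R (t - x i)"
    have u: "norm u \<le> \<rho>" using True h by (simp add: u_def norm_minus_commute pos_divide_le_eq)
    have mu: "(1 / h) *\<^sub>R (x i - t) = - u" by (simp add: u_def flip: scaleR_minus_right)
    have s0: "0 \<le> pilot_at n b i x" unfolding pilot_at_def using i b by (intro pilot_est_bounds) auto
    have "taylor_rem n b h i x = (kern u (pilot_at n b i x) - kern u (f (x i)) - Dkern u (f (x i)) * (pilot_at n b i x - f (x i))) / h ^ d"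
      unfolding taylor_rem_def summand_def slope_def u_def[symmetric] mu Dkern_minus using True by (simp add: diff_divide_distrib)
    also have "\<bar>\<dots>\<bar> \<le> C1 * pilot_err n b ({..<n} - {i}) (x i) x / h ^ d"
      unfolding abs_divide using C1(2)[OF local_f_ge[OF h True] f_le s0, of u] u h
      by (auto simp: pilot_err_def pilot_at_def intro!: divide_right_mono)
    finally show ?thesis using True by simp
  next
    case False
    then have "\<rho> < norm ((1 / h) *\<^sub>R (t - x i))" using h by (simp add: norm_minus_commute pos_less_divide_eq)
    then show ?thesis using False by (simp add: taylor_rem_def summand_def slope_def kern_outside)
  qed
  with C1(1) show ?thesis by (rule that)
qed

lemma kde_part_measurable:
  assumes "i < n"
  shows "pilot_at n b i \<in> borel_measurable (PiM {..<n} (\<lambda>_. Q))"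
proof -
  note component_measurable[OF assms, measurable]
  have [measurable]: "(\<lambda>x. K ((1 / b) *\<^sub>R (x i - x j))) \<in> borel_measurable (PiM {..<n} (\<lambda>_. Q))" if "j \<in> {..<n} - {i}" for j
  proof -
    have [measurable]: "(\<lambda>x. x j) \<in> borel_measurable (PiM {..<n} (\<lambda>_. Q))" using that by (intro component_measurable) simp
    show ?thesis by measurable
  qed
  show ?thesis unfolding pilot_at_def[abs_def] pilot_est_def by measurable
qed

lemma summand_pair_measurable [measurable]: "case_prod (summand h) \<in> borel_measurable (borel \<Otimes>\<^sub>M borel)"
  unfolding summand_def kern_def by measurable

lemma taylor_rem_measurable:
  assumes i: "i < n"
  shows "taylor_rem n b h i \<in> borel_measurable (PiM {..<n} (\<lambda>_. Q))"
proof -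
  note component_measurable[OF i, measurable] kde_part_measurable[OF i, measurable]
  show ?thesis unfolding taylor_rem_def[abs_def] by measurable
qed

lemma diagonal_moment:
  assumes n: "0 < n" and b: "0 < b" "b \<le> 1" and h: "0 < h" "h \<le> \<epsilon>1"
  defines "F \<equiv> \<lambda>x. (\<Sum>i<n. slope h (x i) * (K 0 / (real n * b ^ d) - f (x i) / real n)) / real n"
  shows "integrable (PiM {..<n} (\<lambda>_. Q)) F"
    "(LINT x|PiM {..<n} (\<lambda>_. Q). \<bar>F x\<bar>) \<le> slope_bound * C * ball_volume * (\<kappa> + C) / (real n * b ^ d)"
proof -
  let ?P = "PiM {..<n} (\<lambda>_. Q)"
  interpret P: prob_space ?P by (rule prob_space_PiM) (rule prob_space_Q)
  define \<psi> where "\<psi> y = slope h y * (K 0 / (real n * b ^ d) - f y / real n)" for y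
  let ?c = "(\<kappa> + C) / (real n * b ^ d)"
  have bd: "0 < b ^ d" "b ^ d \<le> 1" using b by (auto intro: power_le_one)
  have c0: "0 \<le> ?c" using \<kappa>_pos C_pos bd by simp
  have [measurable]: "\<psi> \<in> borel_measurable borel" unfolding \<psi>_def[abs_def] by measurable
  have le: "\<bar>\<psi> y\<bar> \<le> \<bar>slope h y\<bar> * ?c" for y
  proof -
    have "\<bar>K 0 / (real n * b ^ d)\<bar> \<le> \<kappa> / (real n * b ^ d)" using K_nonneg[of 0] K_le[of 0] bd by (simp add: divide_right_mono)
    moreover have "\<bar>f y / real n\<bar> \<le> C / (real n * b ^ d)"
      using f_nonneg[of y] f_le[of y] n bd C_pos by (auto intro!: frac_le simp: mult_left_le)
    ultimately have "\<bar>K 0 / (real n * b ^ d) - f y / real n\<bar> \<le> ?c" unfolding add_divide_distrib by linarith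
    then show ?thesis unfolding \<psi>_def abs_mult by (intro mult_left_mono) auto
  qed
  have bnd: "\<bar>\<psi> y\<bar> \<le> slope_bound / h ^ d * ?c" for y
    using order_trans[OF le mult_right_mono[OF slope_le'[OF h] c0]] .
  have ig: "integrable Q (\<lambda>y. \<bar>slope h y\<bar>)" using slope_le'[OF h] by (intro integrable_bounded[OF prob_space_Q, of _ "slope_bound / h ^ d"]) auto
  have i1: "integrable ?P (\<lambda>x. \<psi> (x i))" if "i < n" for i
  proof -
    note component_measurable[OF that, measurable]
    show ?thesis using bnd by (intro integrable_bounded[OF P.prob_space_axioms]) auto
  qed
  have i2: "(LINT x|?P. \<bar>\<psi> (x i)\<bar>) \<le> slope_bound * C * ball_volume * (\<kappa> + C) / (real n * b ^ d)" if "i < n" for i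
  proof -
    have "(LINT x|?P. \<bar>\<psi> (x i)\<bar>) = (LINT y|Q. \<bar>\<psi> y\<bar>)"
      using that bnd by (intro PiM_integral_component[OF prob_space_Q]) auto
    also have "\<dots> \<le> (LINT y|Q. \<bar>slope h y\<bar> * ?c)"
      using bnd by (intro integral_mono le integrable_mult_left ig integrable_abs integrable_bounded[OF prob_space_Q]) auto
    also have "\<dots> = (LINT y|Q. \<bar>slope h y\<bar>) * ?c" by simp
    also have "\<dots> \<le> slope_bound * C * ball_volume * ?c" by (intro mult_right_mono slope_integral h c0)
    finally show ?thesis by simp
  qed
  show "integrable ?P F" "(LINT x|?P. \<bar>F x\<bar>) \<le> slope_bound * C * ball_volume * (\<kappa> + C) / (real n * b ^ d)"
    unfolding F_def \<psi>_def[symmetric] using integral_abs_sum_le[OF i1 i2 n, unfolded \<psi>_def[symmetric]] by auto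
qed

text \<open>The pilot bias supplies \<open>b^2\<close> in every centred summand, so after
  multiplication by \<open>sqrt (n h^d)\<close> this part is only of order
  \<open>b^2\<close>.\<close>

lemma smoothing_moment:
  assumes n: "0 < n" and b: "0 < b" "b \<le> 1" and h: "0 < h" "h \<le> \<epsilon>1"
  defines "F \<equiv> \<lambda>x. (real n - 1) / real n * ((\<Sum>i<n. slope h (x i) * (conv b (x i) - f (x i)) - theta b h) / real n)"
  shows "integrable (PiM {..<n} (\<lambda>_. Q)) F"
    "(LINT x|PiM {..<n} (\<lambda>_. Q). \<bar>F x\<bar>) \<le> sqrt ((real d ^ 2 * C * T)\<^sup>2 * (slope_bound\<^sup>2 * C * ball_volume) * b ^ 4 / (real n * h ^ d))"
proof -
  let ?P = "PiM {..<n} (\<lambda>_. Q)"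
  interpret Q: prob_space Q by (rule prob_space_Q)
  interpret P: prob_space ?P by (rule prob_space_PiM) (rule prob_space_Q)
  define g where "g y = slope h y * (conv b y - f y)" for y
  define \<psi> where "\<psi> y = g y - theta b h" for y
  let ?A = "real d ^ 2 * C * T" and ?V = "slope_bound\<^sup>2 * C * ball_volume"
  have [measurable]: "g \<in> borel_measurable borel" unfolding g_def[abs_def] by measurable
  have [measurable]: "\<psi> \<in> borel_measurable borel" unfolding \<psi>_def[abs_def] by measurable
  have gle: "\<bar>g y\<bar> \<le> \<bar>slope h y\<bar> * (?A * b\<^sup>2)" for y
    unfolding g_def abs_mult by (intro mult_left_mono conv_diff_le) simp
  have gb: "\<bar>g y\<bar> \<le> slope_bound / h ^ d * (?A * b\<^sup>2)" for y
    using order_trans[OF gle mult_right_mono[OF slope_le'[OF h]]] C_pos T_pos by simp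
  have ig: "integrable Q g" using gb by (intro integrable_bounded[OF prob_space_Q]) auto
  have th: "(LINT y|Q. g y) = theta b h" unfolding g_def theta_def ..
  have z: "(LINT y|Q. \<psi> y) = 0" unfolding \<psi>_def using ig th by (simp add: Q.prob_space[simplified])
  have bnd: "\<bar>\<psi> y\<bar> \<le> slope_bound / h ^ d * (?A * b\<^sup>2) + \<bar>theta b h\<bar>" for y
    unfolding \<psi>_def using gb[of y] by linarith
  have V: "(LINT y|Q. (\<psi> y)\<^sup>2) \<le> ?A\<^sup>2 * ?V * b ^ 4 / h ^ d"
  proof -
    have g2: "(g y)\<^sup>2 \<le> (slope h y)\<^sup>2 * (?A * b\<^sup>2)\<^sup>2" for y
      using power_mono[OF gle[of y], of 2] by (simp add: power_mult_distrib)
    have ig2: "integrable Q (\<lambda>y. (g y)\<^sup>2)"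
      using power_mono[OF gb, where n=2] by (intro integrable_bounded[OF prob_space_Q, of _ "(slope_bound / h ^ d * (?A * b\<^sup>2))\<^sup>2"]) auto
    have igf: "integrable Q (\<lambda>y. (slope h y)\<^sup>2)"
      using power_mono[OF slope_le'[OF h], where n=2] by (intro integrable_bounded[OF prob_space_Q, of _ "(slope_bound / h ^ d)\<^sup>2"]) auto
    have "(LINT y|Q. (\<psi> y)\<^sup>2) = (LINT y|Q. (g y)\<^sup>2) - (theta b h)\<^sup>2"
      using Q.variance_eq[OF ig ig2] by (simp add: \<psi>_def th)
    also have "\<dots> \<le> (LINT y|Q. (g y)\<^sup>2)" by simp
    also have "\<dots> \<le> (LINT y|Q. (slope h y)\<^sup>2 * (?A * b\<^sup>2)\<^sup>2)"
      by (intro integral_mono g2 ig2 integrable_mult_left igf)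
    also have "\<dots> = (LINT y|Q. (slope h y)\<^sup>2) * (?A * b\<^sup>2)\<^sup>2" by simp
    also have "\<dots> \<le> ?V / h ^ d * (?A * b\<^sup>2)\<^sup>2" by (intro mult_right_mono slope_integral h) simp
    finally show ?thesis by (simp add: power_mult_distrib mult_ac flip: power_mult)
  qed
  let ?k = "(real n - 1) / real n"
  have k: "0 \<le> ?k" "?k \<le> 1" using n by (auto simp: field_simps)
  have F_eq: "F x = ?k * ((\<Sum>i<n. \<psi> (x i)) / real n)" for x unfolding F_def \<psi>_def g_def ..
  have [measurable]: "(\<lambda>x. \<psi> (x i)) \<in> borel_measurable ?P" if "i \<in> {..<n}" for i
  proof -
    have [measurable]: "(\<lambda>x. x i) \<in> borel_measurable ?P" using that by (intro component_measurable) simp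
    show ?thesis by measurable
  qed
  have mF: "F \<in> borel_measurable ?P" unfolding F_eq[abs_def] by measurable
  have bF: "\<bar>F x\<bar> \<le> ?k * ((\<Sum>i<n. (slope_bound / h ^ d * (?A * b\<^sup>2) + \<bar>theta b h\<bar>)) / real n)" for x
  proof -
    have "\<bar>(\<Sum>i<n. \<psi> (x i)) / real n\<bar> \<le> (\<Sum>i<n. (slope_bound / h ^ d * (?A * b\<^sup>2) + \<bar>theta b h\<bar>)) / real n"
      unfolding abs_divide abs_of_nat
      by (intro divide_right_mono order_trans[OF sum_abs] sum_mono bnd) simp
    then show ?thesis unfolding F_eq abs_mult[of ?k] abs_of_nonneg[OF k(1)] by (rule mult_left_mono) (rule k)
  qed
  show "integrable ?P F" by (rule integrable_bounded[OF P.prob_space_axioms mF bF])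
  have "(LINT x|?P. (F x)\<^sup>2) = (?k / real n)\<^sup>2 * (LINT x|?P. (\<Sum>i<n. \<psi> (x i))\<^sup>2)"
    unfolding F_eq by (simp add: power_mult_distrib power_divide)
  also have "(LINT x|?P. (\<Sum>i<n. \<psi> (x i))\<^sup>2) = real n * (LINT y|Q. (\<psi> y)\<^sup>2)"
    unfolding card_lessThan[of n, THEN arg_cong[of _ _ real], symmetric]
    by (rule PiM_sum_second_moment[OF prob_space_Q _ _ bnd z]) auto
  also have "(?k / real n)\<^sup>2 * (real n * (LINT y|Q. (\<psi> y)\<^sup>2)) = ?k\<^sup>2 * ((LINT y|Q. (\<psi> y)\<^sup>2) / real n)"
    using n by (simp add: power2_eq_square mult.assoc)
  also have "\<dots> \<le> 1 * ((?A\<^sup>2 * ?V * b ^ 4 / h ^ d) / real n)"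
    using V k n by (intro mult_mono power_le_one divide_right_mono divide_nonneg_nonneg Bochner_Integration.integral_nonneg) auto
  finally have "(LINT x|?P. (F x)\<^sup>2) \<le> ?A\<^sup>2 * ?V * b ^ 4 / (real n * h ^ d)" by (simp add: mult.commute)
  then show "(LINT x|?P. \<bar>F x\<bar>) \<le> sqrt (?A\<^sup>2 * ?V * b ^ 4 / (real n * h ^ d))"
    by (rule abs_integral_le_sqrt[OF P.prob_space_axioms mF bF])
qed

text \<open>Degeneracy gains a full factor \<open>1 / n\<close>: after multiplication by
  \<open>sqrt (n h^d)\<close> the bound becomes a constant over \<open>sqrt (n b^d)\<close>, which
  tends to zero whatever the relation between the two bandwidths.\<close>

lemma U_moment:
  assumes n: "0 < n" and b: "0 < b" "b \<le> 1" and h: "0 < h" "h \<le> \<epsilon>1"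
  defines "F \<equiv> \<lambda>x. (\<Sum>i<n. \<Sum>j\<in>{..<n} - {i}. interaction b h (x i) (x j) - slope h (x i) * (conv b (x i) - f (x i)) - (slope_conv b h (x j) - slope_mean h) + theta b h) / (real n)\<^sup>2"
  shows "integrable (PiM {..<n} (\<lambda>_. Q)) F"
    "(LINT x|PiM {..<n} (\<lambda>_. Q). \<bar>F x\<bar>) \<le> sqrt (32 * ((2 * \<kappa> * C + 2 * C\<^sup>2) * (slope_bound\<^sup>2 * C * ball_volume)) / ((real n)\<^sup>2 * (h ^ d * b ^ d)))"
proof -
  let ?P = "PiM {..<n} (\<lambda>_. Q)"
  interpret P: prob_space ?P by (rule prob_space_PiM) (rule prob_space_Q)
  let ?V = "(2 * \<kappa> * C + 2 * C\<^sup>2) * (slope_bound\<^sup>2 * C * ball_volume)"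
  define \<psi> where "\<psi> x y = interaction b h x y - slope h x * (conv b x - f x) - (slope_conv b h y - slope_mean h) + theta b h" for x y
  define B where "B = slope_bound / h ^ d * (\<kappa> / b ^ d + C)"
  have bH: "\<bar>interaction b h x y\<bar> \<le> B" for x y unfolding B_def by (rule interaction_le[OF b(1) h])
  have b1: "\<bar>slope h x * (conv b x - f x)\<bar> \<le> B" for x
    unfolding interaction_integral_right[OF b(1), symmetric] using bH by (intro abs_integral_Q_le[OF prob_space_Q]) auto
  have b2: "\<bar>slope_conv b h y - slope_mean h\<bar> \<le> B" for y
    unfolding interaction_integral_left[OF b(1) h, symmetric] using bH by (intro abs_integral_Q_le[OF prob_space_Q]) auto
  have bnd: "\<bar>\<psi> x y\<bar> \<le> 3 * B + \<bar>theta b h\<bar>" for x y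
    unfolding \<psi>_def using bH[of x y] b1[of x] b2[of y] by linarith
  have m\<psi>[measurable]: "case_prod \<psi> \<in> borel_measurable (borel \<Otimes>\<^sub>M borel)"
  proof -
    have [measurable]: "case_prod (interaction b h) \<in> borel_measurable (borel \<Otimes>\<^sub>M borel)" unfolding interaction_def by measurable
    show ?thesis unfolding \<psi>_def[abs_def] by measurable
  qed
  have F_eq: "F x = (\<Sum>i<n. \<Sum>j\<in>{..<n} - {i}. \<psi> (x i) (x j)) / (real n)\<^sup>2" for x unfolding F_def \<psi>_def ..
  have m: "(\<lambda>x. \<psi> (x i) (x j)) \<in> borel_measurable ?P" if "i < n" "j < n" for i j
  proof -
    note component_measurable[OF that(1), measurable] component_measurable[OF that(2), measurable]
    show ?thesis by measurable
  qed
  have mF: "F \<in> borel_measurable ?P" unfolding F_eq[abs_def]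
    by (intro borel_measurable_divide borel_measurable_sum borel_measurable_const m) auto
  have bF: "\<bar>F x\<bar> \<le> (\<Sum>i<n. \<Sum>j\<in>{..<n} - {i}. 3 * B + \<bar>theta b h\<bar>) / (real n)\<^sup>2" for x
    unfolding F_eq abs_divide
    by (auto intro!: divide_right_mono order_trans[OF sum_abs] sum_mono bnd simp del: sum_constant)
  show "integrable ?P F" by (rule integrable_bounded[OF P.prob_space_axioms mF bF])
  have "(LINT x|?P. (\<Sum>i<n. \<Sum>j\<in>{..<n} - {i}. \<psi> (x i) (x j))\<^sup>2) \<le> 32 * (real n)\<^sup>2 * (LINT x|Q. LINT y|Q. (interaction b h x y)\<^sup>2)"
    using hoeffding_second_moment[OF prob_space_Q, of "{..<n}" "interaction b h" B] bH interaction_measurable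
    unfolding interaction_integral_right[OF b(1)] interaction_integral_left[OF b(1) h] theta_def[symmetric] \<psi>_def[symmetric] by simp
  also have "\<dots> \<le> 32 * (real n)\<^sup>2 * (?V / (h ^ d * b ^ d))"
    by (intro mult_left_mono interaction_second_moment b h) auto
  finally have "(LINT x|?P. (F x)\<^sup>2) \<le> 32 * (real n)\<^sup>2 * (?V / (h ^ d * b ^ d)) / ((real n)\<^sup>2)\<^sup>2"
    unfolding F_eq power_divide integral_divide_zero by (rule divide_right_mono) simp
  also have "\<dots> = 32 * ?V / ((real n)\<^sup>2 * (h ^ d * b ^ d))"
  proof -
    have gen: "32 * N * (V / D) / N\<^sup>2 = 32 * V / (N * D)" if "N \<noteq> 0" for N V D :: real
      using that by (simp add: power2_eq_square)
    show ?thesis by (rule gen) (use n in simp)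
  qed
  finally show "(LINT x|?P. \<bar>F x\<bar>) \<le> sqrt (32 * ?V / ((real n)\<^sup>2 * (h ^ d * b ^ d)))"
    by (rule abs_integral_le_sqrt[OF P.prob_space_axioms mF bF])
qed

text \<open>In the Taylor part the factor \<open>h ^ d\<close> of \<open>local_pilot_err\<close>
  cancels the \<open>1 / h ^ d\<close> of \<open>taylor_rem_le\<close>, which leaves the mean error
  of the pilot. The two square roots belong to the degenerate part and to the first
  projection.\<close>

lemma rest_moment:
  obtains C7 where "0 \<le> C7" "\<And>n b h. 0 < n \<Longrightarrow> 0 < b \<Longrightarrow> b \<le> 1 \<Longrightarrow> 1 \<le> real n * b ^ d \<Longrightarrow> 0 < h \<Longrightarrow> h \<le> \<epsilon>1 \<Longrightarrow>
    integrable (PiM {..<n} (\<lambda>_. Q)) (rest n b h) \<and>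
    (LINT x|PiM {..<n} (\<lambda>_. Q). \<bar>rest n b h x\<bar>) \<le> C7 * (1 / (real n * b ^ d) + b ^ 4)
      + sqrt (C7 / ((real n)\<^sup>2 * (h ^ d * b ^ d))) + sqrt (C7 * b ^ 4 / (real n * h ^ d))"
proof -
  obtain C1 where C1: "0 \<le> C1" "\<And>n b h i x. i < n \<Longrightarrow> 0 < b \<Longrightarrow> 0 < h \<Longrightarrow> h \<le> \<epsilon>1 \<Longrightarrow>
    \<bar>taylor_rem n b h i x\<bar> \<le> C1 / h ^ d * (if norm (x i - t) \<le> \<rho> * h then pilot_err n b ({..<n} - {i}) (x i) x else 0)"
    by (rule taylor_rem_le) blast
  define A1 where "A1 = slope_bound * C * ball_volume * (\<kappa> + C)"
  define A2 where "A2 = 32 * ((2 * \<kappa> * C + 2 * C\<^sup>2) * (slope_bound\<^sup>2 * C * ball_volume))"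
  define A3 where "A3 = (real d ^ 2 * C * T)\<^sup>2 * (slope_bound\<^sup>2 * C * ball_volume)"
  define A4 where "A4 = C1 * (C * ball_volume * C3)"
  define C7 where "C7 = A1 + A2 + A3 + A4"
  have A: "0 \<le> A1" "0 \<le> A2" "0 \<le> A3" "0 \<le> A4"
    using slope_bound_nonneg C_pos ball_volume_nonneg \<kappa>_pos T_pos C1(1) C3_nonneg by (auto simp: A1_def A2_def A3_def A4_def)
  have C7: "0 \<le> C7" "A1 + A4 \<le> C7" "A2 \<le> C7" "A3 \<le> C7" using A by (auto simp: C7_def)
  have "integrable (PiM {..<n} (\<lambda>_. Q)) (rest n b h) \<and>
    (LINT x|PiM {..<n} (\<lambda>_. Q). \<bar>rest n b h x\<bar>) \<le> C7 * (1 / (real n * b ^ d) + b ^ 4)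
      + sqrt (C7 / ((real n)\<^sup>2 * (h ^ d * b ^ d))) + sqrt (C7 * b ^ 4 / (real n * h ^ d))"
    if n: "0 < n" and b: "0 < b" "b \<le> 1" and N: "1 \<le> real n * b ^ d" and h: "0 < h" "h \<le> \<epsilon>1" for n b h
  proof -
    let ?P = "PiM {..<n} (\<lambda>_. Q)"
    define q where "q = 1 / (real n * b ^ d) + b ^ 4"
    have hd: "0 < h ^ d" using h by simp
    have R: "integrable ?P (\<lambda>x. taylor_rem n b h i x)" "(LINT x|?P. \<bar>taylor_rem n b h i x\<bar>) \<le> A4 * q" if i: "i < n" for i
    proof -
      let ?F = "\<lambda>x. if norm (x i - t) \<le> \<rho> * h then pilot_err n b ({..<n} - {i}) (x i) x else 0"
      note l = local_pilot_err[OF i b N h(1)]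
      have iF: "integrable ?P (\<lambda>x. C1 / h ^ d * ?F x)" by (intro integrable_mult_right l(1))
      show iR: "integrable ?P (\<lambda>x. taylor_rem n b h i x)"
      proof (rule Bochner_Integration.integrable_bound[OF iF taylor_rem_measurable[OF i]])
        show "AE x in ?P. norm (taylor_rem n b h i x) \<le> norm (C1 / h ^ d * ?F x)"
          using order_trans[OF C1(2)[OF i b(1) h] abs_ge_self] by (intro AE_I2) (simp only: real_norm_def)
      qed
      have "(LINT x|?P. \<bar>taylor_rem n b h i x\<bar>) \<le> (LINT x|?P. C1 / h ^ d * ?F x)"
        by (intro integral_mono integrable_abs iR iF C1(2)[OF i b(1) h])
      also have "\<dots> = C1 / h ^ d * (LINT x|?P. ?F x)" by (rule integral_mult_right_zero)
      also have "\<dots> \<le> C1 / h ^ d * (C * ball_volume * C3 * h ^ d * q)"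
        unfolding q_def using C1(1) hd by (intro mult_left_mono l(2)) auto
      also have "\<dots> = A4 * q" using hd h by (simp add: A4_def)
      finally show "(LINT x|?P. \<bar>taylor_rem n b h i x\<bar>) \<le> A4 * q" .
    qed
    note d1 = diagonal_moment[OF n b h, folded A1_def] and d2 = U_moment[OF n b h, folded A2_def]
      and d3 = smoothing_moment[OF n b h, folded A3_def]
    define T1 where "T1 x = (\<Sum>i<n. slope h (x i) * (K 0 / (real n * b ^ d) - f (x i) / real n)) / real n" for x
    define T2 where "T2 x = (\<Sum>i<n. \<Sum>j\<in>{..<n} - {i}. interaction b h (x i) (x j) - slope h (x i) * (conv b (x i) - f (x i)) - (slope_conv b h (x j) - slope_mean h) + theta b h) / (real n)\<^sup>2" for x
    define T3 where "T3 x = (real n - 1) / real n * ((\<Sum>i<n. slope h (x i) * (conv b (x i) - f (x i)) - theta b h) / real n)" for x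
    define T4 where "T4 x = (\<Sum>i<n. taylor_rem n b h i x) / real n" for x
    note D = d1[folded T1_def] d2[folded T2_def] d3[folded T3_def]
    have eq: "rest n b h x = T1 x + T2 x + T3 x + T4 x" for x
      unfolding T1_def T2_def T3_def T4_def by (rule rest_eq[OF n b(1) h])
    have D4: "integrable ?P T4" "(LINT x|?P. \<bar>T4 x\<bar>) \<le> A4 * q"
      unfolding T4_def using integral_abs_sum_le[of n ?P "taylor_rem n b h" "A4 * q"] R n by auto
    have i: "integrable ?P T1" "integrable ?P T2" "integrable ?P T3" "integrable ?P T4" by (rule D(1) D(3) D(5) D4)+
    have ir: "integrable ?P (rest n b h)" unfolding eq[abs_def] by (intro Bochner_Integration.integrable_add i)
    have "(LINT x|?P. \<bar>rest n b h x\<bar>) \<le> (LINT x|?P. \<bar>T1 x\<bar> + \<bar>T2 x\<bar> + \<bar>T3 x\<bar> + \<bar>T4 x\<bar>)"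
      by (intro integral_mono integrable_abs ir Bochner_Integration.integrable_add i) (simp add: eq)
    also have "\<dots> = (LINT x|?P. \<bar>T1 x\<bar>) + (LINT x|?P. \<bar>T2 x\<bar>) + (LINT x|?P. \<bar>T3 x\<bar>) + (LINT x|?P. \<bar>T4 x\<bar>)"
      using i by simp
    also have "\<dots> \<le> A1 / (real n * b ^ d) + sqrt (A2 / ((real n)\<^sup>2 * (h ^ d * b ^ d))) + sqrt (A3 * b ^ 4 / (real n * h ^ d)) + A4 * q"
      by (intro add_mono D D4)
    also have "A1 / (real n * b ^ d) \<le> A1 * q" unfolding q_def using A b by (simp add: distrib_left)
    also have "sqrt (A2 / ((real n)\<^sup>2 * (h ^ d * b ^ d))) \<le> sqrt (C7 / ((real n)\<^sup>2 * (h ^ d * b ^ d)))"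
      using C7 hd b by (intro real_sqrt_le_mono divide_right_mono) auto
    also have "sqrt (A3 * b ^ 4 / (real n * h ^ d)) \<le> sqrt (C7 * b ^ 4 / (real n * h ^ d))"
      using C7 hd b by (intro real_sqrt_le_mono divide_right_mono mult_right_mono) auto
    finally have "(LINT x|?P. \<bar>rest n b h x\<bar>) \<le> (A1 + A4) * q + sqrt (C7 / ((real n)\<^sup>2 * (h ^ d * b ^ d))) + sqrt (C7 * b ^ 4 / (real n * h ^ d))"
      by (simp add: distrib_right)
    moreover have "(A1 + A4) * q \<le> C7 * q" unfolding q_def using C7 b by (intro mult_right_mono) auto
    ultimately show ?thesis using ir unfolding q_def by linarith
  qed
  with C7(1) show ?thesis by (rule that)
qed

text \<open>The mean of the influence stays bounded while its second moment is of order
  \<open>1 / h ^ d\<close>, so centring does not affect the limit variance.\<close>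

lemma influence_integral_le:
  obtains C8 where "\<And>n b h. 0 < n \<Longrightarrow> 0 < b \<Longrightarrow> b \<le> 1 \<Longrightarrow> 0 < h \<Longrightarrow> h \<le> \<epsilon>1 \<Longrightarrow> \<bar>LINT y|Q. influence n b h y\<bar> \<le> C8"
proof -
  obtain C5 where C5: "\<And>b h. 0 < h \<Longrightarrow> h \<le> \<epsilon>1 \<Longrightarrow> \<bar>theta b h\<bar> \<le> C5 * (h\<^sup>2 * b\<^sup>2)"
    by (rule theta_bound) blast
  define C8 where "C8 = summand_bound * C * ball_volume + (\<bar>C5\<bar> * \<epsilon>1\<^sup>2 + slope_bound * C\<^sup>2 * ball_volume)"
  have "\<bar>LINT y|Q. influence n b h y\<bar> \<le> C8" if n: "0 < n" and b: "0 < b" "b \<le> 1" and h: "0 < h" "h \<le> \<epsilon>1" for n b h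
  proof -
    have iG: "integrable Q (\<lambda>x. summand h x (f x))"
    proof (rule integrable_bounded[OF prob_space_Q])
      show "\<bar>summand h y (f y)\<bar> \<le> summand_bound / h ^ d" for y
        using summand_le[OF h(1), of y] summand_bound_nonneg h by (auto split: if_splits)
    qed simp
    have "\<bar>ideal_mean h\<bar> \<le> (LINT x|Q. \<bar>summand h x (f x)\<bar>)"
      unfolding summand_integral[OF h(1), symmetric] by (rule integral_abs_bound)
    also have "\<dots> \<le> (LINT x|Q. (if norm (x - t) \<le> \<rho> * h then summand_bound / h ^ d else 0))"
      using summand_bound_nonneg h
      by (intro integral_mono integrable_abs iG summand_le integrable_bounded[OF prob_space_Q, of _ "summand_bound / h ^ d"]) auto
    also have "\<dots> \<le> summand_bound / h ^ d * (C * (h ^ d * ball_volume))" using h summand_bound_nonneg by (intro ball_Q_integral) auto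
    also have "\<dots> = summand_bound * C * ball_volume" using h by simp
    finally have 1: "\<bar>ideal_mean h\<bar> \<le> summand_bound * C * ball_volume" .
    have "C5 * (h\<^sup>2 * b\<^sup>2) \<le> \<bar>C5\<bar> * (\<epsilon>1\<^sup>2 * 1)"
      using b h by (intro mult_mono power_mono power_le_one) auto
    then have 2: "\<bar>theta b h\<bar> \<le> \<bar>C5\<bar> * \<epsilon>1\<^sup>2" using C5[OF h, of b] by simp
    have 3: "\<bar>(real n - 1) / real n * (theta b h + slope_mean h)\<bar> \<le> 1 * (\<bar>C5\<bar> * \<epsilon>1\<^sup>2 + slope_bound * C\<^sup>2 * ball_volume)"
      unfolding abs_mult using n 2 slope_mean_le[OF h] by (intro mult_mono) (auto simp: field_simps)
    show ?thesis unfolding influence_integral[OF n b(1) h] C8_def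
      using order_trans[OF abs_triangle_ineq add_mono[OF 1 3]] by simp
  qed
  then show ?thesis by (rule that)
qed

lemma kde_measurable:
  assumes h: "0 < h"
  shows "(\<lambda>x. adaptive_kde K \<alpha> n b h x t) \<in> borel_measurable (PiM {..<n} (\<lambda>_. Q))"
proof -
  have m: "(\<lambda>x. summand h (x i) (pilot_at n b i x)) \<in> borel_measurable (PiM {..<n} (\<lambda>_. Q))" if "i < n" for i
  proof -
    note component_measurable[OF that, measurable] kde_part_measurable[OF that, measurable]
    show ?thesis by measurable
  qed
  show ?thesis unfolding adaptive_kde_eq[OF h] by (intro borel_measurable_divide borel_measurable_sum borel_measurable_const m) auto
qed

end

subsection \<open>Bandwidth sequences\<close>

text \<open>\<open>b\<close> is the pilot bandwidth \<open>h1\<close> and \<open>h\<close> the main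
  bandwidth \<open>h2\<close>.\<close>

locale pilot_bandwidths = pilot \<Phi> \<Phi>1 \<Phi>2 T \<kappa> d K f \<alpha> C c s1 r \<delta>0 t
  for \<Phi> \<Phi>1 \<Phi>2 :: "real \<Rightarrow> real" and T \<kappa> :: real and d :: nat and K :: "real ^ 'n::finite \<Rightarrow> real"
    and f :: "real ^ 'n \<Rightarrow> real" and \<alpha> :: "real \<Rightarrow> real" and C c s1 r \<delta>0 :: real and t :: "real ^ 'n" +
  fixes b h :: "nat \<Rightarrow> real" and c2 :: real
  assumes c2_pos: "0 < c2" and h_eq: "\<And>n. h n = c2 * real n powr (- 1 / (8 + real d))"
    and b_pos: "\<And>n. 1 \<le> n \<Longrightarrow> 0 < b n" and b_tendsto: "b \<longlonglongrightarrow> 0"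
    and N_tendsto: "filterlim (\<lambda>n. real n * b n ^ d) at_top sequentially"
    and rate: "(\<lambda>n. U_rate d n (b n)) \<in> o(\<lambda>n. (h n)\<^sup>2)"
begin

definition scale where "scale n = sqrt (real n * h n ^ d)"

lemma h_pos: "1 \<le> n \<Longrightarrow> 0 < h n"
  using c2_pos by (simp add: h_eq)

lemma h_tendsto: "h \<longlonglongrightarrow> 0"
proof -
  have "(\<lambda>n. c2 * real n powr (- 1 / (8 + real d))) \<longlonglongrightarrow> c2 * 0"
    by (intro tendsto_mult tendsto_const tendsto_neg_powr filterlim_real_sequentially) (simp add: divide_neg_pos)
  then show ?thesis by (simp add: h_eq[abs_def])
qed

text \<open>The bandwidth makes \<open>n * h ^ (d + 8)\<close> constant. A quantity of order
  \<open>h ^ 4\<close> therefore keeps a finite limit after scaling, with the constant of the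
  asymptotic bias, and anything of smaller order disappears.\<close>

lemma scale_h4: "1 \<le> n \<Longrightarrow> scale n * h n ^ 4 = c2 powr ((real d + 8) / 2)"
proof -
  assume n: "1 \<le> n"
  have "h n ^ (d + 8) = c2 powr (real d + 8) * (real n powr (- 1 / (8 + real d))) powr (real d + 8)"
    using n c2_pos powr_realpow[OF h_pos[OF n], of "d + 8"] by (simp add: h_eq powr_mult)
  also have "\<dots> = c2 powr (real d + 8) / real n"
  proof -
    have "- 1 / (8 + real d) * (real d + 8) = - 1" by (simp add: field_simps)
    then show ?thesis using n by (simp only: powr_powr) (simp add: powr_minus_divide)
  qed
  finally have "real n * h n ^ (d + 8) = c2 powr (real d + 8)" using n by simp
  moreover have "scale n * h n ^ 4 = sqrt (real n * h n ^ (d + 8))"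
  proof -
    have "sqrt (h n ^ 8) = h n ^ 4" using h_pos[OF n] by (intro real_sqrt_unique) (auto simp flip: power_mult)
    then show ?thesis unfolding scale_def power_add by (simp add: real_sqrt_mult)
  qed
  ultimately have "scale n * h n ^ 4 = sqrt (c2 powr (real d + 8))" by simp
  then show ?thesis using c2_pos by (simp add: powr_half_sqrt[symmetric] powr_powr)
qed

lemma scale_pos: "1 \<le> n \<Longrightarrow> 0 < scale n"
  using h_pos[of n] by (simp add: scale_def)

lemma scale_tendsto: "filterlim scale at_top sequentially"
proof -
  have h4: "filterlim (\<lambda>n. h n ^ 4) (at_right 0) sequentially"
  proof (rule tendsto_imp_filterlim_at_right)
    show "(\<lambda>n. h n ^ 4) \<longlonglongrightarrow> 0" using tendsto_power[OF h_tendsto, of 4] by simp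
    show "\<forall>\<^sub>F n in sequentially. 0 < h n ^ 4"
      using eventually_ge_at_top[of 1] by eventually_elim (rule zero_less_power[OF h_pos])
  qed
  have lim: "filterlim (\<lambda>n. c2 powr ((real d + 8) / 2) * inverse (h n ^ 4)) at_top sequentially"
    by (rule filterlim_tendsto_pos_mult_at_top[OF tendsto_const]) (use c2_pos in simp, rule filterlim_compose[OF filterlim_inverse_at_top_right h4])
  have ev: "\<forall>\<^sub>F n in sequentially. c2 powr ((real d + 8) / 2) * inverse (h n ^ 4) = scale n"
    using eventually_ge_at_top[of 1]
  proof eventually_elim
    case (elim n)
    then show ?case using scale_h4[OF elim] h_pos[OF elim] by (simp add: field_simps)
  qed
  show ?thesis using lim filterlim_cong[OF refl refl ev] by simp
qed

lemma U_ratio: "(\<lambda>n. U_rate d n (b n) / (h n)\<^sup>2) \<longlonglongrightarrow> 0"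
  by (rule smalloD_tendsto[OF rate])

text \<open>For \<open>b < exp (- 1)\<close> the logarithm in \<open>U_rate\<close> is at least 1,
  so both the bias \<open>b^2\<close> and the root of \<open>1 / (n b^d)\<close> are dominated by
  \<open>U_rate\<close>. This turns the rate condition into bounds on the two errors of the
  pilot.\<close>

lemma U_bounds:
  "\<forall>\<^sub>F n in sequentially. (b n)\<^sup>2 \<le> U_rate d n (b n) \<and> 1 / (real n * b n ^ d) \<le> (U_rate d n (b n))\<^sup>2"
proof -
  have "\<forall>\<^sub>F n in sequentially. b n < exp (- 1)" using b_tendsto by (rule order_tendstoD) simp
  then show ?thesis using eventually_ge_at_top[of 1]
  proof eventually_elim
    case (elim n)
    have b: "0 < b n" using elim b_pos by simp
    have "ln (b n) \<le> ln (exp (- 1))" using elim b by (subst ln_le_cancel_iff) auto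
    then have l: "1 \<le> ln (1 / b n)" using b by (simp add: ln_div)
    have N: "0 < real n * b n ^ d" using b elim by simp
    define w where "w = ln (1 / b n) / (real n * b n ^ d)"
    have w: "1 / (real n * b n ^ d) \<le> w" "0 \<le> w" using l N by (auto simp: w_def divide_right_mono)
    have "w = (sqrt w)\<^sup>2" using w by simp
    also have "\<dots> \<le> (sqrt w + (b n)\<^sup>2)\<^sup>2" using w by (intro power_mono) auto
    finally show ?case using w by (auto simp: U_rate_def w_def[symmetric])
  qed
qed

lemma ratio_tendsto: "(\<lambda>n. (b n)\<^sup>2 / (h n)\<^sup>2) \<longlonglongrightarrow> 0"
proof (rule tendsto_sandwich[OF _ _ tendsto_const U_ratio])
  show "\<forall>\<^sub>F n in sequentially. 0 \<le> (b n)\<^sup>2 / (h n)\<^sup>2" by simp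
  show "\<forall>\<^sub>F n in sequentially. (b n)\<^sup>2 / (h n)\<^sup>2 \<le> U_rate d n (b n) / (h n)\<^sup>2"
    using U_bounds by eventually_elim (simp add: divide_right_mono)
qed

lemma b_over_h: "(\<lambda>n. b n / h n) \<longlonglongrightarrow> 0"
proof -
  have "(\<lambda>n. sqrt ((b n)\<^sup>2 / (h n)\<^sup>2)) \<longlonglongrightarrow> sqrt 0" by (rule tendsto_real_sqrt[OF ratio_tendsto])
  then have "(\<lambda>n. \<bar>b n / h n\<bar>) \<longlonglongrightarrow> 0" by (simp add: real_sqrt_divide abs_divide)
  then show ?thesis by (rule tendsto_rabs_zero_cancel)
qed

lemma scale_times_small:
  assumes "(\<lambda>n. g n / h n ^ 4) \<longlonglongrightarrow> L"
  shows "(\<lambda>n. scale n * g n) \<longlonglongrightarrow> c2 powr ((real d + 8) / 2) * L"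
proof -
  have "\<forall>\<^sub>F n in sequentially. c2 powr ((real d + 8) / 2) * (g n / h n ^ 4) = scale n * g n"
    using eventually_ge_at_top[of 1]
  proof eventually_elim
    case (elim n)
    show ?case unfolding scale_h4[OF elim, symmetric] using h_pos[OF elim] by simp
  qed
  then show ?thesis by (rule Lim_transform_eventually[OF tendsto_mult[OF tendsto_const assms]])
qed

text \<open>The variance of the pilot is at most the square of a quantity of order
  \<open>o(h^2)\<close>, hence \<open>o(h^4)\<close>.\<close>

lemma scale_N: "(\<lambda>n. scale n * (1 / (real n * b n ^ d))) \<longlonglongrightarrow> 0"
proof -
  have "(\<lambda>n. 1 / (real n * b n ^ d) / h n ^ 4) \<longlonglongrightarrow> 0"
  proof (rule tendsto_sandwich[OF _ _ tendsto_const])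
    show "(\<lambda>n. (U_rate d n (b n) / (h n)\<^sup>2)\<^sup>2) \<longlonglongrightarrow> 0" using tendsto_power[OF U_ratio, of 2] by simp
    show "\<forall>\<^sub>F n in sequentially. 0 \<le> 1 / (real n * b n ^ d) / h n ^ 4"
      using eventually_ge_at_top[of 1] by eventually_elim (use b_pos h_pos in \<open>simp add: less_imp_le\<close>)
    show "\<forall>\<^sub>F n in sequentially. 1 / (real n * b n ^ d) / h n ^ 4 \<le> (U_rate d n (b n) / (h n)\<^sup>2)\<^sup>2"
      using U_bounds
    proof eventually_elim
      case (elim n)
      have "((h n)\<^sup>2)\<^sup>2 = h n ^ 4" by (simp flip: power_mult)
      then show ?case unfolding power_divide using elim by (auto intro!: divide_right_mono simp del: divide_divide_eq_left)
    qed
  qed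
  from scale_times_small[OF this] show ?thesis by simp
qed

lemma scale_b4: "(\<lambda>n. scale n * b n ^ 4) \<longlonglongrightarrow> 0"
proof -
  have "(\<lambda>n. b n ^ 4 / h n ^ 4) \<longlonglongrightarrow> 0" using tendsto_power[OF b_over_h, of 4] by (simp add: power_divide)
  from scale_times_small[OF this] show ?thesis by simp
qed

lemma ideal_mean_scaled: "(\<lambda>n. scale n * (ideal_mean (h n) - f t)) \<longlonglongrightarrow> asymptotic_bias K c2 f t"
proof -
  have "filterlim h (at_right 0) sequentially"
    by (rule tendsto_imp_filterlim_at_right[OF h_tendsto eventually_mono[OF eventually_ge_at_top[of 1] h_pos]])
  from filterlim_compose[OF ideal_mean_expansion this] show ?thesis
    unfolding asymptotic_bias_eq by (rule scale_times_small)
qed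

definition good where
  "good n \<longleftrightarrow> 0 < n \<and> 0 < b n \<and> b n \<le> 1 \<and> 1 \<le> real n * b n ^ d \<and> 0 < h n \<and> h n \<le> \<epsilon>1"

lemma eventually_good: "\<forall>\<^sub>F n in sequentially. good n"
proof -
  have "\<forall>\<^sub>F n in sequentially. b n < 1" using b_tendsto by (rule order_tendstoD) simp
  moreover have "\<forall>\<^sub>F n in sequentially. h n < \<epsilon>1" using h_tendsto \<epsilon>1_pos by (rule order_tendstoD)
  moreover have "\<forall>\<^sub>F n in sequentially. 1 \<le> real n * b n ^ d"
    using N_tendsto by (simp add: filterlim_at_top)
  ultimately show ?thesis using eventually_ge_at_top[of 1]
    by eventually_elim (use b_pos h_pos in \<open>auto simp: good_def\<close>)
qed

text \<open>The contribution of \<open>theta\<close> is of order \<open>h^2 b^2\<close>, which is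
  \<open>o(h^4)\<close> as \<open>b / h\<close> tends to zero; only the bias of the ideal mean
  survives.\<close>

lemma centre_scaled: "(\<lambda>n. scale n * (centre n (b n) (h n) - f t)) \<longlonglongrightarrow> asymptotic_bias K c2 f t"
proof -
  obtain C5 where C5: "\<And>b h. 0 < h \<Longrightarrow> h \<le> \<epsilon>1 \<Longrightarrow> \<bar>theta b h\<bar> \<le> C5 * (h\<^sup>2 * b\<^sup>2)"
    by (rule theta_bound) blast
  have "(\<lambda>n. scale n * ((real n - 1) / real n * theta (b n) (h n))) \<longlonglongrightarrow> 0"
  proof (rule Lim_null_comparison)
    have "(\<lambda>n. C5 * (h n)\<^sup>2 * (b n)\<^sup>2 / h n ^ 4) \<longlonglongrightarrow> 0"
    proof -
      have "(\<lambda>n. C5 * ((b n)\<^sup>2 / (h n)\<^sup>2)) \<longlonglongrightarrow> C5 * 0" by (intro tendsto_intros ratio_tendsto)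
      moreover have "C5 * (h n)\<^sup>2 * (b n)\<^sup>2 / h n ^ 4 = C5 * ((b n)\<^sup>2 / (h n)\<^sup>2)" for n
      proof -
        have "h n ^ 4 = (h n)\<^sup>2 * (h n)\<^sup>2" by (simp flip: power_add)
        then have "C5 * (h n)\<^sup>2 * (b n)\<^sup>2 / h n ^ 4 = (C5 * (b n)\<^sup>2 * (h n)\<^sup>2) / ((h n)\<^sup>2 * (h n)\<^sup>2)" by (simp only: mult_ac)
        also have "\<dots> = C5 * (b n)\<^sup>2 / (h n)\<^sup>2" by (cases "h n = 0") (simp_all only: mult_divide_mult_cancel_right power_not_zero not_False_eq_True, simp_all)
        finally show ?thesis by simp
      qed
      ultimately show ?thesis by simp
    qed
    from scale_times_small[OF this] show "(\<lambda>n. scale n * (C5 * (h n)\<^sup>2 * (b n)\<^sup>2)) \<longlonglongrightarrow> 0" by simp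
    show "\<forall>\<^sub>F n in sequentially. norm (scale n * ((real n - 1) / real n * theta (b n) (h n))) \<le> scale n * (C5 * (h n)\<^sup>2 * (b n)\<^sup>2)"
      using eventually_good
    proof eventually_elim
      case (elim n)
      have s: "0 \<le> scale n" using scale_pos[of n] elim by (simp add: good_def)
      have "\<bar>(real n - 1) / real n * theta (b n) (h n)\<bar> \<le> 1 * (C5 * ((h n)\<^sup>2 * (b n)\<^sup>2))"
        unfolding abs_mult using elim C5[of "h n" "b n"] by (intro mult_mono) (auto simp: good_def field_simps)
      then show ?case unfolding real_norm_def abs_mult[of "scale n"] abs_of_nonneg[OF s]
        by (intro mult_left_mono s) (simp add: mult.assoc)
    qed
  qed
  from tendsto_add[OF ideal_mean_scaled this] show ?thesis
    by (simp add: centre_def algebra_simps)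
qed

lemma rest_scaled:
  "good n \<Longrightarrow> integrable (PiM {..<n} (\<lambda>_. Q)) (rest n (b n) (h n))"
  "(\<lambda>n. scale n * (LINT x|PiM {..<n} (\<lambda>_. Q). \<bar>rest n (b n) (h n) x\<bar>)) \<longlonglongrightarrow> 0"
proof -
  obtain C7 where C7: "0 \<le> C7" "\<And>n b h. 0 < n \<Longrightarrow> 0 < b \<Longrightarrow> b \<le> 1 \<Longrightarrow> 1 \<le> real n * b ^ d \<Longrightarrow> 0 < h \<Longrightarrow> h \<le> \<epsilon>1 \<Longrightarrow>
    integrable (PiM {..<n} (\<lambda>_. Q)) (rest n b h) \<and>
    (LINT x|PiM {..<n} (\<lambda>_. Q). \<bar>rest n b h x\<bar>) \<le> C7 * (1 / (real n * b ^ d) + b ^ 4)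
      + sqrt (C7 / ((real n)\<^sup>2 * (h ^ d * b ^ d))) + sqrt (C7 * b ^ 4 / (real n * h ^ d))"
    by (rule rest_moment) blast
  show "good n \<Longrightarrow> integrable (PiM {..<n} (\<lambda>_. Q)) (rest n (b n) (h n))"
    using C7(2)[of n "b n" "h n"] by (simp add: good_def)
  show "(\<lambda>n. scale n * (LINT x|PiM {..<n} (\<lambda>_. Q). \<bar>rest n (b n) (h n) x\<bar>)) \<longlonglongrightarrow> 0"
  proof (rule Lim_null_comparison)
    have "(\<lambda>n. C7 / (real n * b n ^ d)) \<longlonglongrightarrow> 0" by (rule real_tendsto_divide_at_top[OF tendsto_const N_tendsto])
    from tendsto_real_sqrt[OF this] have 1: "(\<lambda>n. sqrt (C7 / (real n * b n ^ d))) \<longlonglongrightarrow> 0" by simp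
    have "(\<lambda>n. sqrt (C7 * b n ^ 4)) \<longlonglongrightarrow> sqrt (C7 * 0 ^ 4)" by (intro tendsto_intros b_tendsto)
    then have 2: "(\<lambda>n. sqrt (C7 * b n ^ 4)) \<longlonglongrightarrow> 0" by simp
    have "(\<lambda>n. C7 * (scale n * (1 / (real n * b n ^ d)) + scale n * b n ^ 4) + sqrt (C7 / (real n * b n ^ d)) + sqrt (C7 * b n ^ 4))
      \<longlonglongrightarrow> C7 * (0 + 0) + 0 + 0"
      by (intro tendsto_add tendsto_mult tendsto_const scale_N scale_b4 1 2)
    then show "(\<lambda>n. C7 * (scale n * (1 / (real n * b n ^ d)) + scale n * b n ^ 4) + sqrt (C7 / (real n * b n ^ d)) + sqrt (C7 * b n ^ 4)) \<longlonglongrightarrow> 0"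
      by simp
    show "\<forall>\<^sub>F n in sequentially. norm (scale n * (LINT x|PiM {..<n} (\<lambda>_. Q). \<bar>rest n (b n) (h n) x\<bar>))
      \<le> C7 * (scale n * (1 / (real n * b n ^ d)) + scale n * b n ^ 4) + sqrt (C7 / (real n * b n ^ d)) + sqrt (C7 * b n ^ 4)"
      using eventually_good
    proof eventually_elim
      case (elim n)
      have g: "0 < n" "0 < b n" "0 < h n" "0 < h n ^ d" "0 < b n ^ d" using elim by (auto simp: good_def)
      have s: "0 \<le> scale n" using scale_pos[of n] g by simp
      let ?I = "LINT x|PiM {..<n} (\<lambda>_. Q). \<bar>rest n (b n) (h n) x\<bar>"
      have "?I \<le> C7 * (1 / (real n * b n ^ d) + b n ^ 4)
         + sqrt (C7 / ((real n)\<^sup>2 * (h n ^ d * b n ^ d))) + sqrt (C7 * b n ^ 4 / (real n * h n ^ d))"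
        using C7(2)[of n "b n" "h n"] elim by (simp add: good_def)
      from mult_left_mono[OF this s] have "scale n * ?I \<le> C7 * (scale n * (1 / (real n * b n ^ d)) + scale n * b n ^ 4)
         + scale n * sqrt (C7 / ((real n)\<^sup>2 * (h n ^ d * b n ^ d))) + scale n * sqrt (C7 * b n ^ 4 / (real n * h n ^ d))"
        by (simp add: algebra_simps)
      moreover have "scale n * sqrt (C7 / ((real n)\<^sup>2 * (h n ^ d * b n ^ d))) = sqrt (C7 / (real n * b n ^ d))"
        unfolding scale_def real_sqrt_mult[symmetric] using g by (intro arg_cong[of _ _ sqrt]) (simp add: power2_eq_square)
      moreover have "scale n * sqrt (C7 * b n ^ 4 / (real n * h n ^ d)) = sqrt (C7 * b n ^ 4)"
        unfolding scale_def real_sqrt_mult[symmetric] using g by (intro arg_cong[of _ _ sqrt]) simp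
      moreover have "0 \<le> scale n * ?I" using s by (intro mult_nonneg_nonneg Bochner_Integration.integral_nonneg) auto
      ultimately show ?case by simp
    qed
  qed
qed

text \<open>The default 0 at the finitely many bad \<open>n\<close> makes measurability, centring
  and boundedness hold for every \<open>n\<close>, as \<open>triangular_array_clt\<close>
  demands.\<close>

definition lin where
  "lin n y = (if good n then scale n / real n * (influence n (b n) (h n) y - (LINT z|Q. influence n (b n) (h n) z)) else 0)"

lemma lin_measurable [measurable]: "lin n \<in> borel_measurable borel"
  unfolding lin_def[abs_def] by measurable

lemma influence_integrable: "good n \<Longrightarrow> integrable Q (influence n (b n) (h n))" "good n \<Longrightarrow> integrable Q (\<lambda>y. (influence n (b n) (h n) y)\<^sup>2)"
proof -
  assume g: "good n"
  have le: "\<bar>influence n (b n) (h n) y\<bar> \<le> (summand_bound + slope_bound * C) / h n ^ d" for y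
    using g by (intro influence_le) (auto simp: good_def)
  then show "integrable Q (influence n (b n) (h n))" by (intro integrable_bounded[OF prob_space_Q]) auto
  show "integrable Q (\<lambda>y. (influence n (b n) (h n) y)\<^sup>2)"
    using power_mono[OF le, where n=2] by (intro integrable_bounded[OF prob_space_Q, of _ "((summand_bound + slope_bound * C) / h n ^ d)\<^sup>2"]) auto
qed

lemma lin_integral: "(LINT y|Q. lin n y) = 0"
proof -
  interpret Q: prob_space Q by (rule prob_space_Q)
  show ?thesis unfolding lin_def using influence_integrable(1)[of n] by (cases "good n") (simp_all add: Q.prob_space[simplified])
qed

definition lin_bound where "lin_bound n = (if good n then 2 * (summand_bound + slope_bound * C) / scale n else 0)"

lemma lin_le: "\<bar>lin n y\<bar> \<le> lin_bound n"
proof (cases "good n")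
  case True
  let ?B = "(summand_bound + slope_bound * C) / h n ^ d"
  have g: "0 < n" "0 < h n" "0 < h n ^ d" using True by (auto simp: good_def)
  have s: "0 < scale n" using scale_pos[of n] g by simp
  have le: "\<bar>influence n (b n) (h n) y\<bar> \<le> ?B" for y
    using True by (intro influence_le) (auto simp: good_def)
  have "\<bar>LINT z|Q. influence n (b n) (h n) z\<bar> \<le> ?B" using le by (intro abs_integral_Q_le[OF prob_space_Q]) auto
  then have "\<bar>influence n (b n) (h n) y - (LINT z|Q. influence n (b n) (h n) z)\<bar> \<le> 2 * ?B" using le[of y] by linarith
  then have "\<bar>lin n y\<bar> \<le> scale n / real n * (2 * ?B)"
    using True s by (simp add: lin_def abs_mult mult_left_mono del: times_divide_eq_right times_divide_eq_left)
  also have "\<dots> = 2 * (summand_bound + slope_bound * C) * (scale n / (real n * h n ^ d))" by simp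
  also have "scale n / (real n * h n ^ d) = 1 / scale n"
  proof -
    have "real n * h n ^ d = scale n * scale n" unfolding scale_def using g by simp
    then show ?thesis using s by simp
  qed
  finally show ?thesis using True by (simp add: lin_bound_def)
qed (simp add: lin_def lin_bound_def)

lemma lin_bound_tendsto: "lin_bound \<longlonglongrightarrow> 0"
proof -
  have "(\<lambda>n. 2 * (summand_bound + slope_bound * C) / scale n) \<longlonglongrightarrow> 0" by (rule real_tendsto_divide_at_top[OF tendsto_const scale_tendsto])
  moreover have "\<forall>\<^sub>F n in sequentially. 2 * (summand_bound + slope_bound * C) / scale n = lin_bound n"
    using eventually_good by eventually_elim (simp add: lin_bound_def)
  ultimately show ?thesis by (rule Lim_transform_eventually)
qed

text \<open>\<open>scale^2 / n\<close> is \<open>h ^ d\<close>, hence the total variance is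
  \<open>h ^ d\<close> times the variance of the influence, and the squared mean drops out by
  \<open>influence_integral_le\<close>.\<close>

lemma lin_variance: "(\<lambda>n. real n * (LINT y|Q. (lin n y)\<^sup>2)) \<longlonglongrightarrow> asymptotic_variance K \<alpha> f t"
proof -
  interpret Q: prob_space Q by (rule prob_space_Q)
  obtain C8 where C8: "\<And>n b h. 0 < n \<Longrightarrow> 0 < b \<Longrightarrow> b \<le> 1 \<Longrightarrow> 0 < h \<Longrightarrow> h \<le> \<epsilon>1 \<Longrightarrow> \<bar>LINT y|Q. influence n b h y\<bar> \<le> C8"
    by (rule influence_integral_le) blast
  have ev1: "\<forall>\<^sub>F n in sequentially. 0 < h n" "\<forall>\<^sub>F n in sequentially. 0 < b n"
    using eventually_good by (auto simp: good_def elim: eventually_mono)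
  have V: "(\<lambda>n. h n ^ d * (LINT y|Q. (influence n (b n) (h n) y)\<^sup>2)) \<longlonglongrightarrow> asymptotic_variance K \<alpha> f t"
    unfolding asymptotic_variance_eq(1) by (rule second_moment_limit[OF ev1(1) h_tendsto ev1(2) b_over_h])
  have W: "(\<lambda>n. h n ^ d * (LINT y|Q. influence n (b n) (h n) y)\<^sup>2) \<longlonglongrightarrow> 0"
  proof (rule Lim_null_comparison)
    have "(\<lambda>n. h n ^ d * C8\<^sup>2) \<longlonglongrightarrow> 0 ^ d * C8\<^sup>2" by (intro tendsto_intros h_tendsto)
    then show "(\<lambda>n. h n ^ d * C8\<^sup>2) \<longlonglongrightarrow> 0" using d_pos by (simp add: zero_power)
    show "\<forall>\<^sub>F n in sequentially. norm (h n ^ d * (LINT y|Q. influence n (b n) (h n) y)\<^sup>2) \<le> h n ^ d * C8\<^sup>2"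
      using eventually_good
    proof eventually_elim
      case (elim n)
      have "\<bar>LINT y|Q. influence n (b n) (h n) y\<bar> \<le> C8" using elim by (intro C8) (auto simp: good_def)
      from power_mono[OF this, of 2] show ?case using elim by (simp add: good_def abs_mult)
    qed
  qed
  have "\<forall>\<^sub>F n in sequentially. h n ^ d * (LINT y|Q. (influence n (b n) (h n) y)\<^sup>2) - h n ^ d * (LINT y|Q. influence n (b n) (h n) y)\<^sup>2 = real n * (LINT y|Q. (lin n y)\<^sup>2)"
    using eventually_good
  proof eventually_elim
    case (elim n)
    let ?e = "LINT y|Q. influence n (b n) (h n) y"
    have g: "0 < n" "0 < h n" using elim by (auto simp: good_def)
    have "real n * (LINT y|Q. (lin n y)\<^sup>2) = real n * ((scale n / real n)\<^sup>2 * (LINT y|Q. (influence n (b n) (h n) y - ?e)\<^sup>2))"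
    proof -
      have "(lin n y)\<^sup>2 = (scale n / real n)\<^sup>2 * (influence n (b n) (h n) y - ?e)\<^sup>2" for y
        using elim by (simp add: lin_def power_mult_distrib power_divide)
      then show ?thesis by (simp only: integral_mult_right_zero)
    qed
    also have "(LINT y|Q. (influence n (b n) (h n) y - ?e)\<^sup>2) = (LINT y|Q. (influence n (b n) (h n) y)\<^sup>2) - ?e\<^sup>2"
      by (rule Q.variance_eq) (use influence_integrable elim in auto)
    also have "real n * ((scale n / real n)\<^sup>2 * ((LINT y|Q. (influence n (b n) (h n) y)\<^sup>2) - ?e\<^sup>2)) = h n ^ d * ((LINT y|Q. (influence n (b n) (h n) y)\<^sup>2) - ?e\<^sup>2)"
    proof -
      have "(scale n)\<^sup>2 = real n * h n ^ d" unfolding scale_def using g by simp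
      then have eq: "real n * (scale n / real n)\<^sup>2 = h n ^ d" unfolding power_divide using g by (simp add: power2_eq_square)
      show ?thesis by (simp only: mult.assoc[symmetric] eq)
    qed
    finally show ?case by (simp add: right_diff_distrib)
  qed
  with tendsto_diff[OF V W] show ?thesis by (simp add: Lim_transform_eventually)
qed

lemma kde_decomposition:
  assumes g: "good n"
  shows "scale n * (adaptive_kde K \<alpha> n (b n) (h n) x t - centre n (b n) (h n)) = (\<Sum>i<n. lin n (x i)) + scale n * rest n (b n) (h n) x"
proof -
  have "(\<Sum>i<n. lin n (x i)) = scale n / real n * (\<Sum>i<n. influence n (b n) (h n) (x i) - (LINT y|Q. influence n (b n) (h n) y))"
    using g by (simp only: lin_def if_True sum_distrib_left)
  then show ?thesis by (simp add: rest_def right_diff_distrib)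
qed

text \<open>The linear part has mean zero, so the exact expectation misses \<open>centre\<close> by
  the mean of \<open>rest\<close>, which the bound in mean controls as well.\<close>

lemma kde_mean:
  assumes g: "good n"
  shows "scale n * ((LINT x|PiM {..<n} (\<lambda>_. Q). adaptive_kde K \<alpha> n (b n) (h n) x t) - centre n (b n) (h n))
    = scale n * (LINT x|PiM {..<n} (\<lambda>_. Q). rest n (b n) (h n) x)"
proof -
  let ?P = "PiM {..<n} (\<lambda>_. Q)"
  interpret P: prob_space ?P by (rule prob_space_PiM) (rule prob_space_Q)
  have s: "0 < scale n" using g scale_pos[of n] by (simp add: good_def)
  have i: "integrable ?P (\<lambda>x. lin n (x i))" "(LINT x|?P. lin n (x i)) = 0" if "i < n" for i
  proof -
    note component_measurable[OF that, measurable]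
    show "integrable ?P (\<lambda>x. lin n (x i))" using lin_le by (intro integrable_bounded[OF P.prob_space_axioms]) auto
    show "(LINT x|?P. lin n (x i)) = 0"
      using PiM_integral_component[OF prob_space_Q, of "{..<n}" i "lin n"] that lin_le lin_integral by auto
  qed
  have eq: "adaptive_kde K \<alpha> n (b n) (h n) x t = ((\<Sum>i<n. lin n (x i)) / scale n + rest n (b n) (h n) x) + centre n (b n) (h n)" for x
    using kde_decomposition[OF g, of x] s by (simp add: field_simps)
  have S: "integrable ?P (\<lambda>x. (\<Sum>i<n. lin n (x i)) / scale n)"
    using i by (intro integrable_divide_zero Bochner_Integration.integrable_sum) auto
  have "(LINT x|?P. adaptive_kde K \<alpha> n (b n) (h n) x t) = (LINT x|?P. (\<Sum>i<n. lin n (x i)) / scale n) + (LINT x|?P. rest n (b n) (h n) x) + centre n (b n) (h n)"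
    unfolding eq using S rest_scaled(1)[OF g] by (simp add: P.prob_space[simplified])
  also have "(LINT x|?P. (\<Sum>i<n. lin n (x i)) / scale n) = 0"
    using i by (subst integral_divide_zero, subst Bochner_Integration.integral_sum) auto
  finally show ?thesis by simp
qed

lemma adaptive_kde_clt:
  "weak_conv_m (\<lambda>n. distr (PiM {..<n} (\<lambda>_. Q)) borel (\<lambda>x. scale n *
      (adaptive_kde K \<alpha> n (b n) (h n) x t - (LINT y|PiM {..<n} (\<lambda>_. Q). adaptive_kde K \<alpha> n (b n) (h n) y t))))
    (normal_law 0 (asymptotic_variance K \<alpha> f t))"
  "weak_conv_m (\<lambda>n. distr (PiM {..<n} (\<lambda>_. Q)) borel (\<lambda>x. scale n * (adaptive_kde K \<alpha> n (b n) (h n) x t - f t)))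
    (normal_law (asymptotic_bias K c2 f t) (asymptotic_variance K \<alpha> f t))"
proof -
  let ?P = "\<lambda>n. PiM {..<n} (\<lambda>_. Q)"
  have P: "prob_space (?P n)" for n by (rule prob_space_PiM) (rule prob_space_Q)
  define e where "e n = (LINT x|?P n. rest n (b n) (h n) x)" for n
  \<comment> \<open>For centring at the exact expectation the remainder is \<open>rest\<close> minus
    its mean; for centring at \<open>f t\<close> it is \<open>rest\<close> itself, and
    \<open>centre - f t\<close> becomes the deterministic shift.\<close>
  define \<rho>1 where "\<rho>1 n x = (if good n then scale n * (rest n (b n) (h n) x - e n) else 0)" for n x
  define \<rho>2 where "\<rho>2 n x = (if good n then scale n * rest n (b n) (h n) x else 0)" for n x
  note clt = triangular_array_clt[OF prob_space_Q _ lin_le lin_integral lin_variance lin_bound_tendsto asymptotic_variance_eq(2)]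
  have const: "integrable (?P n) (\<lambda>x. a :: real)" for n a
  proof -
    interpret prob_space "?P n" by (rule P)
    show ?thesis by simp
  qed
  have i1: "integrable (?P n) (\<rho>1 n)" and i2: "integrable (?P n) (\<rho>2 n)" for n
    unfolding \<rho>1_def[abs_def] \<rho>2_def[abs_def] using rest_scaled(1)[of n]
    by (cases "good n"; simp add: const)+
  have z2: "(\<lambda>n. LINT x|?P n. \<bar>\<rho>2 n x\<bar>) \<longlonglongrightarrow> 0"
  proof -
    have "\<forall>\<^sub>F n in sequentially. scale n * (LINT x|?P n. \<bar>rest n (b n) (h n) x\<bar>) = (LINT x|?P n. \<bar>\<rho>2 n x\<bar>)"
      using eventually_good
    proof eventually_elim
      case (elim n)
      have s: "0 < scale n" using elim scale_pos[of n] by (simp add: good_def)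
      show ?case using elim s by (simp add: \<rho>2_def abs_mult)
    qed
    then show ?thesis by (rule Lim_transform_eventually[OF rest_scaled(2)])
  qed
  have z1: "(\<lambda>n. LINT x|?P n. \<bar>\<rho>1 n x\<bar>) \<longlonglongrightarrow> 0"
  proof (rule Lim_null_comparison)
    show "(\<lambda>n. 2 * (scale n * (LINT x|?P n. \<bar>rest n (b n) (h n) x\<bar>))) \<longlonglongrightarrow> 0"
      using tendsto_mult[OF tendsto_const[of 2] rest_scaled(2)] by simp
    show "\<forall>\<^sub>F n in sequentially. norm (LINT x|?P n. \<bar>\<rho>1 n x\<bar>) \<le> 2 * (scale n * (LINT x|?P n. \<bar>rest n (b n) (h n) x\<bar>))"
      using eventually_good
    proof eventually_elim
      case (elim n)
      interpret prob_space "?P n" by (rule P)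
      have s: "0 < scale n" using elim scale_pos[of n] by (simp add: good_def)
      note ir = rest_scaled(1)[OF elim]
      have "(LINT x|?P n. \<bar>\<rho>1 n x\<bar>) \<le> (LINT x|?P n. scale n * (\<bar>rest n (b n) (h n) x\<bar> + \<bar>e n\<bar>))"
      proof (rule integral_mono)
        show "\<bar>\<rho>1 n x\<bar> \<le> scale n * (\<bar>rest n (b n) (h n) x\<bar> + \<bar>e n\<bar>)" for x
          using elim s by (simp add: \<rho>1_def abs_mult abs_triangle_ineq4)
      qed (use i1 ir in auto)
      also have "\<dots> = scale n * ((LINT x|?P n. \<bar>rest n (b n) (h n) x\<bar>) + \<bar>e n\<bar>)"
        using ir by (simp add: prob_space[simplified])
      also have "\<bar>e n\<bar> \<le> (LINT x|?P n. \<bar>rest n (b n) (h n) x\<bar>)" unfolding e_def by (rule integral_abs_bound)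
      finally have "(LINT x|?P n. \<bar>\<rho>1 n x\<bar>) \<le> 2 * (scale n * (LINT x|?P n. \<bar>rest n (b n) (h n) x\<bar>))"
        using s by (simp add: mult_left_mono)
      moreover have "0 \<le> (LINT x|?P n. \<bar>\<rho>1 n x\<bar>)" by (intro Bochner_Integration.integral_nonneg) auto
      ultimately show ?case by simp
    qed
  qed
  have "weak_conv_m (\<lambda>n. distr (?P n) borel (\<lambda>x. (\<Sum>i<n. lin n (x i)) + \<rho>1 n x + 0)) (normal_law 0 (asymptotic_variance K \<alpha> f t))"
    by (rule clt[OF _ i1 z1 tendsto_const]) simp
  moreover have "\<forall>\<^sub>F n in sequentially. distr (?P n) borel (\<lambda>x. (\<Sum>i<n. lin n (x i)) + \<rho>1 n x + 0) = distr (?P n) borel (\<lambda>x. scale n *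
      (adaptive_kde K \<alpha> n (b n) (h n) x t - (LINT y|?P n. adaptive_kde K \<alpha> n (b n) (h n) y t)))"
    using eventually_good
  proof eventually_elim
    case (elim n)
    have "(\<Sum>i<n. lin n (x i)) + \<rho>1 n x + 0 = scale n *
      (adaptive_kde K \<alpha> n (b n) (h n) x t - (LINT y|?P n. adaptive_kde K \<alpha> n (b n) (h n) y t))" for x
      using kde_decomposition[OF elim, of x] kde_mean[OF elim] elim by (simp add: \<rho>1_def e_def right_diff_distrib)
    then show ?case by simp
  qed
  ultimately show "weak_conv_m (\<lambda>n. distr (?P n) borel (\<lambda>x. scale n *
      (adaptive_kde K \<alpha> n (b n) (h n) x t - (LINT y|?P n. adaptive_kde K \<alpha> n (b n) (h n) y t))))
    (normal_law 0 (asymptotic_variance K \<alpha> f t))"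
    by (rule weak_conv_m_eventually_eq[rotated])
  have "weak_conv_m (\<lambda>n. distr (?P n) borel (\<lambda>x. (\<Sum>i<n. lin n (x i)) + \<rho>2 n x + scale n * (centre n (b n) (h n) - f t)))
      (normal_law (asymptotic_bias K c2 f t) (asymptotic_variance K \<alpha> f t))"
    by (rule clt[OF _ i2 z2 centre_scaled]) simp
  moreover have "\<forall>\<^sub>F n in sequentially. distr (?P n) borel (\<lambda>x. (\<Sum>i<n. lin n (x i)) + \<rho>2 n x + scale n * (centre n (b n) (h n) - f t))
     = distr (?P n) borel (\<lambda>x. scale n * (adaptive_kde K \<alpha> n (b n) (h n) x t - f t))"
    using eventually_good
  proof eventually_elim
    case (elim n)
    have "(\<Sum>i<n. lin n (x i)) + \<rho>2 n x + scale n * (centre n (b n) (h n) - f t) = scale n * (adaptive_kde K \<alpha> n (b n) (h n) x t - f t)" for x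
      using kde_decomposition[OF elim, of x] elim by (simp add: \<rho>2_def right_diff_distrib)
    then show ?case by simp
  qed
  ultimately show "weak_conv_m (\<lambda>n. distr (?P n) borel (\<lambda>x. scale n * (adaptive_kde K \<alpha> n (b n) (h n) x t - f t)))
    (normal_law (asymptotic_bias K c2 f t) (asymptotic_variance K \<alpha> f t))"
    by (rule weak_conv_m_eventually_eq[rotated])
qed

end

subsection \<open>Transfer to the given sample\<close>

text \<open>The growth bound comes from monotonicity: \<open>p (s / c\<^sup>2)\<close> is at most
  the value of \<open>p\<close> at \<open>t0 + s / c\<^sup>2\<close>, where \<open>p\<close> is the
  identity. Monotonicity also gives measurability.\<close>

lemma clip_scale_properties:
  assumes p: "clipping_function t0 p" and c: "0 < c"
  shows "clip_scale c p \<in> borel_measurable borel" "c \<le> clip_scale c p s"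
    "t0 * c\<^sup>2 \<le> s \<Longrightarrow> clip_scale c p s = sqrt s" "0 \<le> s \<Longrightarrow> clip_scale c p s \<le> sqrt (t0 * c\<^sup>2 + s)"
proof -
  have c2: "0 < c\<^sup>2" using c by simp
  have mono: "mono p" and ge: "1 \<le> p s" and id: "t0 \<le> s \<Longrightarrow> p s = s" and t0: "1 \<le> t0" for s
    using p by (auto simp: clipping_function_def)
  have [measurable]: "p \<in> borel_measurable borel" using mono by (rule borel_measurable_mono)
  show "clip_scale c p \<in> borel_measurable borel" unfolding clip_scale_def[abs_def] by measurable
  show "c \<le> clip_scale c p s" using c ge by (simp add: clip_scale_def)
  have cs: "c * sqrt x = sqrt (c\<^sup>2 * x)" for x using c by (simp add: real_sqrt_mult)
  show "clip_scale c p s = sqrt s" if "t0 * c\<^sup>2 \<le> s"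
    using id[of "s / c\<^sup>2"] that c2 by (simp add: clip_scale_def cs le_divide_eq)
  show "clip_scale c p s \<le> sqrt (t0 * c\<^sup>2 + s)" if "0 \<le> s"
  proof -
    have "p (s / c\<^sup>2) \<le> p (t0 + s / c\<^sup>2)" using t0 by (intro monoD[OF mono]) simp
    also have "\<dots> = t0 + s / c\<^sup>2" using that c2 by (intro id) simp
    finally have "c\<^sup>2 * p (s / c\<^sup>2) \<le> c\<^sup>2 * (t0 + s / c\<^sup>2)" using c2 by (intro mult_left_mono) auto
    then show ?thesis unfolding clip_scale_def cs using c2 by (simp add: distrib_left mult.commute)
  qed
qed

text \<open>The first \<open>n\<close> variables have the product law, and \<open>F\<close> depends
  on these alone by \<open>local_F\<close>. A positive \<open>n\<close> provides the non-empty index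
  set on which independence is characterised by the joint law.\<close>

lemma distr_sample:
  fixes X :: "nat \<Rightarrow> 'w \<Rightarrow> 'a::second_countable_topology" and F :: "(nat \<Rightarrow> 'a) \<Rightarrow> real"
  assumes M: "prob_space M" and X: "prob_space.indep_vars M (\<lambda>_. borel) X UNIV"
    and Q: "\<And>i. distr M borel (X i) = Q" and n: "0 < n"
    and F: "F \<in> borel_measurable (PiM {..<n} (\<lambda>_. Q))" and local_F: "\<And>x. F (restrict x {..<n}) = F x"
  shows "distr M borel (\<lambda>\<omega>. F (\<lambda>i. X i \<omega>)) = distr (PiM {..<n} (\<lambda>_. Q)) borel F"
    "prob_space.expectation M (\<lambda>\<omega>. F (\<lambda>i. X i \<omega>)) = (LINT x|PiM {..<n} (\<lambda>_. Q). F x)"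
proof -
  interpret prob_space M by fact
  have Xm: "X i \<in> measurable M borel" for i using X by (auto simp: indep_vars_def)
  have "indep_vars (\<lambda>_. borel) X {..<n}" using X by (rule indep_vars_subset) simp
  then have D: "distr M (PiM {..<n} (\<lambda>_. borel)) (\<lambda>\<omega>. \<lambda>i\<in>{..<n}. X i \<omega>) = PiM {..<n} (\<lambda>_. Q)"
    using n Xm by (subst (asm) indep_vars_iff_distr_eq_PiM) (auto simp: Q)
  have sQ: "sets (PiM {..<n} (\<lambda>_. Q)) = sets (PiM {..<n} (\<lambda>_. borel :: 'a measure))"
    using Q[of 0] by (intro sets_PiM_cong) auto
  have F': "F \<in> borel_measurable (PiM {..<n} (\<lambda>_. borel))" using F measurable_cong_sets[OF sQ refl] by blast
  have R: "(\<lambda>\<omega>. \<lambda>i\<in>{..<n}. X i \<omega>) \<in> measurable M (PiM {..<n} (\<lambda>_. borel))"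
    by (rule measurable_restrict) (rule Xm)
  show "distr M borel (\<lambda>\<omega>. F (\<lambda>i. X i \<omega>)) = distr (PiM {..<n} (\<lambda>_. Q)) borel F"
    unfolding D[symmetric] distr_distr[OF F' R] by (simp add: comp_def local_F)
  show "expectation (\<lambda>\<omega>. F (\<lambda>i. X i \<omega>)) = (LINT x|PiM {..<n} (\<lambda>_. Q). F x)"
    unfolding D[symmetric] integral_distr[OF R F'] by (simp add: local_F)
qed

lemma adaptive_kde_restrict: "adaptive_kde K \<alpha> n b h (restrict x {..<n}) t = adaptive_kde K \<alpha> n b h x t"
proof -
  have "kde K n b (restrict x {..<n}) y = kde K n b x y" for y
    unfolding kde_def by (intro arg_cong[of _ _ "times _"] sum.cong) auto
  then show ?thesis
    unfolding adaptive_kde_def by (intro arg_cong[of _ _ "times _"] sum.cong) auto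
qed

theorem theorem5p1:
  fixes M :: "'w measure"
    and X :: "nat \<Rightarrow> 'w \<Rightarrow> real ^ 'n::finite"
    and f K :: "real ^ 'n \<Rightarrow> real"
    and \<Phi> p \<alpha> :: "real \<Rightarrow> real"
    and C T c t0 c2 r :: real
    and h1 h2 :: "nat \<Rightarrow> real"
    and t :: "real ^ 'n"
  assumes "prob_space M"
    and "prob_space.indep_vars M (\<lambda>_. borel) X UNIV"
    and "\<And>i. distributed M lborel (X i) (\<lambda>x. ennreal (f x))"
    and "f \<in> smooth_densities C 4"
    and "radial_kernel \<Phi> T K"
    and "c > 0"
    and "clipping_function t0 p"
    and "\<alpha> = clip_scale c p"
    and "c2 > 0"
    and "\<And>n. h2 n = c2 * real n powr (- 1 / (8 + real CARD('n)))"
    and "\<And>n. n \<ge> 1 \<Longrightarrow> h1 n > 0"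
    and "h1 \<longlonglongrightarrow> 0"
    and "filterlim (\<lambda>n. real n * h1 n ^ CARD('n)) at_top sequentially"
    and "(\<lambda>n. U_rate CARD('n) n (h1 n)) \<in> o(\<lambda>n. (h2 n)\<^sup>2)"
    and "r > 0"
    and "t \<in> good_region f c t0 r"
  shows
    "weak_conv_m
       (\<lambda>n. distr M borel (\<lambda>\<omega>. sqrt (real n * h2 n ^ CARD('n)) *
          (adaptive_kde K \<alpha> n (h1 n) (h2 n) (\<lambda>i. X i \<omega>) t
           - prob_space.expectation M (\<lambda>\<omega>'. adaptive_kde K \<alpha> n (h1 n) (h2 n) (\<lambda>i. X i \<omega>') t))))
       (normal_law 0 (asymptotic_variance K \<alpha> f t))
     \<and>
     weak_conv_m
       (\<lambda>n. distr M borel (\<lambda>\<omega>. sqrt (real n * h2 n ^ CARD('n)) *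
          (adaptive_kde K \<alpha> n (h1 n) (h2 n) (\<lambda>i. X i \<omega>) t - f t)))
       (normal_law (asymptotic_bias K c2 f t) (asymptotic_variance K \<alpha> f t))"
proof -
  note M = assms(1) and X = assms(2) and Xf = assms(3) and f = assms(4) and K = assms(5) and c = assms(6) and p = assms(7)
  have t: "r < f t" "t0 * c\<^sup>2 < r" using assms(16) by (auto simp: good_region_def)
  have t0: "1 \<le> t0" using p by (simp add: clipping_function_def)
  obtain \<Phi>1 \<Phi>2 T' \<kappa> where sk: "smooth_kernel \<Phi> \<Phi>1 \<Phi>2 T' \<kappa> CARD('n) K"
    using K by (rule radial_kernel_imp_smooth_kernel)
  have "uniformly_continuous_on UNIV (partial_derivs [] f)" using f by (auto simp: smooth_densities_def)
  then have fc: "continuous_on UNIV f"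
    by (auto simp: partial_derivs_def dest: uniformly_continuous_imp_continuous)
  \<comment> \<open>\<open>r < f t\<close> is strict, so continuity gives a closed ball on which
    \<open>f\<close> stays above \<open>r\<close>.\<close>
  obtain \<delta>0 where \<delta>0: "0 < \<delta>0" "\<And>x. norm (x - t) \<le> \<delta>0 \<Longrightarrow> r \<le> f x"
  proof -
    have "open {x. r < f x}" by (intro open_Collect_less continuous_intros fc)
    then obtain e where e: "0 < e" "cball t e \<subseteq> {x. r < f x}" using t(1) open_contains_cball by blast
    have "r \<le> f x" if "norm (x - t) \<le> e" for x
      using subsetD[OF e(2), of x] that by (auto simp: dist_norm norm_minus_commute)
    then show ?thesis by (rule that[OF e(1)])
  qed
  note \<alpha> = clip_scale_properties[OF p c, folded assms(8)]
  \<comment> \<open>The threshold \<open>s1\<close> becomes \<open>t0 * c\<^sup>2\<close>, which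
    lies strictly below \<open>r\<close> by \<open>good_region\<close>.\<close>
  interpret pilot_bandwidths \<Phi> \<Phi>1 \<Phi>2 T' \<kappa> "CARD('n)" K f \<alpha> C c "t0 * c\<^sup>2" r \<delta>0 t h1 h2 c2
  proof (intro pilot_bandwidths.intro pilot.intro pilot_axioms.intro pilot_bandwidths_axioms.intro)
    show "0 < t0 * c\<^sup>2" using t0 c by simp
  qed (use sk f c t \<alpha> \<delta>0 assms in auto)
  have XQ: "distr M borel (X i) = Q" for i
  proof -
    have "distr M borel (X i) = distr M lborel (X i)" by (rule distr_cong) auto
    also have "\<dots> = Q" unfolding Q_def by (rule distributed_distr_eq_density[OF Xf])
    finally show ?thesis .
  qed
  let ?P = "\<lambda>n. PiM {..<n} (\<lambda>_. Q)"
  have A: "(\<lambda>x. adaptive_kde K \<alpha> n (h1 n) (h2 n) x t) \<in> borel_measurable (?P n)" if "1 \<le> n" for n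
    by (rule kde_measurable[OF h_pos[OF that]])
  \<comment> \<open>The index 0 is left out: there the main bandwidth is zero and the sample is
    empty. Weak convergence ignores finitely many indices.\<close>
  have ev1: "\<forall>\<^sub>F n in sequentially. distr (?P n) borel (\<lambda>x. scale n *
      (adaptive_kde K \<alpha> n (h1 n) (h2 n) x t - (LINT y|?P n. adaptive_kde K \<alpha> n (h1 n) (h2 n) y t)))
    = distr M borel (\<lambda>\<omega>. sqrt (real n * h2 n ^ CARD('n)) *
          (adaptive_kde K \<alpha> n (h1 n) (h2 n) (\<lambda>i. X i \<omega>) t
           - prob_space.expectation M (\<lambda>\<omega>'. adaptive_kde K \<alpha> n (h1 n) (h2 n) (\<lambda>i. X i \<omega>') t)))"
    using eventually_ge_at_top[of 1]
  proof eventually_elim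
    case (elim n)
    have n: "0 < n" using elim by simp
    note [measurable] = A[OF elim]
    show ?case
      unfolding distr_sample(2)[OF M X XQ n A[OF elim] adaptive_kde_restrict] scale_def
      by (rule distr_sample(1)[OF M X XQ n, symmetric]) (measurable, simp add: adaptive_kde_restrict)
  qed
  have ev2: "\<forall>\<^sub>F n in sequentially. distr (?P n) borel (\<lambda>x. scale n * (adaptive_kde K \<alpha> n (h1 n) (h2 n) x t - f t))
    = distr M borel (\<lambda>\<omega>. sqrt (real n * h2 n ^ CARD('n)) * (adaptive_kde K \<alpha> n (h1 n) (h2 n) (\<lambda>i. X i \<omega>) t - f t))"
    using eventually_ge_at_top[of 1]
  proof eventually_elim
    case (elim n)
    have n: "0 < n" using elim by simp
    note [measurable] = A[OF elim]
    show ?case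
      unfolding scale_def
      by (rule distr_sample(1)[OF M X XQ n, symmetric]) (measurable, simp add: adaptive_kde_restrict)
  qed
  show ?thesis
    using weak_conv_m_eventually_eq[OF ev1 adaptive_kde_clt(1)] weak_conv_m_eventually_eq[OF ev2 adaptive_kde_clt(2)]
    by (rule conjI)
qed

end
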